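(* Let $G$ be a finite group. In the ring $\mathbb{Q}[t,t^{-1}][\![p_i(c)]\!]$ we have the equation \[ \sum_{n\geq 1}\sum_{i\in\mathbb{Z}}\mathrm{ch}_{G\wr S_n}(W\!H_i(R_n(G)))\,(-t)^i=\mathrm{Exp}_G\circ(t^{-1}L)\circ(tp_1)-\mathrm{Exp}_G\circ L\circ(tp_1). \]
   Context: Posets. Write $[n]=\{1,\dots,n\}$. $G$ acts on $G\times[n]$ by left multiplication on the first factor, and $G\wr S_n$ denotes the group of permutations of $G\times[n]$ commuting with this action. The Dowling lattice $Q_n(G)$ ($n\ge1$) is the poset of pairs $(J,\pi)$ where $J$ is a $G$-stable subset of $G\times[n]$ and $\pi$ is a set partition of $(G\times[n])\setminus J$ (into nonempty parts; the empty set has one partition, the empty one) whose parts are permuted freely by $G$ (for all $1\neq g\in G$, $K\in\pi$: $K\neq g.K\in\pi$). The order is: $(J,\pi)\le(J',\pi')$ iff $J\subseteq J'$ and every $K\in\pi$ satisfies either $K\subseteq J'$ or $K$ is contained in a single part of $\pi'$. Its minimum $\hat0$ has $J=\emptyset$ and all parts singletons; its maximum is $\hat1=(G\times[n],\emptyset)$. The group $G\wr S_n$ acts on it. $R_n(G)$ is the $(G\wr S_n)$-stable sub-poset of pairs $(J,\pi)$ with $J=\emptyset$ or $J=G\times[n]$; it is pure and Cohen-Macaulay with rank function $\mathrm{rk}(J,\pi)=n-\frac{|\pi|}{|G|}$. Whitney homology. For a pure Cohen-Macaulay poset $P$ with minimum $\hat0$ and $x<y$ in $P$, let $\widetilde H_P(x,y)=\widetilde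 H_{\ell(x,y)-2}((x,y);\mathbb{Q})$, the top-degree reduced homology of (the order complex of) the open interval $(x,y)$, where $\ell(x,y)$ is the length of $[x,y]$ and $\widetilde H_{-1}(\emptyset;\mathbb{Q})=\mathbb{Q}$; let $\widetilde H_P(x,x)=\mathbb{Q}$. Then $W\!H_i(P)=\bigoplus_{x\in P,\ \mathrm{rk}(x)=i}\widetilde H_P(\hat0,x)$ for $i\in\mathbb{Z}$; a group acting on $P$ acts on each $W\!H_i(P)$ by functoriality (trivially on $\widetilde H_{-1}(\emptyset)$ and $\widetilde H_P(\hat0,\hat0)$). Characters. Let $G_*$ be the set of conjugacy classes of $G$, and let $p_i(c)$ ($i\ge1$, $c\in G_*$) be indeterminates of degree $i$; $\mathbb{A}_G=\mathbb{Q}[\![p_i(c)]\!]$ denotes formal power series (completion with respect to this grading). For $G=\{1\}$ write $p_i=p_i(\{1\})$. For a representation $M$ of $G\wr S_n$ over $\mathbb{Q}$, \[ \mathrm{ch}_{G\wr S_n}(M)=\frac{1}{|G|^nn!}\sum_{x\in G\wr S_n}\mathrm{tr}(x,M)\,\Psi(x),\qquad \Psi(x)=\prod_{i,c}p_i(c)^{a_i(c)}, \] where $a_i(c)$ is the number of cycles of length $i$ and type $c$ of $x$: a cycle of the permutation of $[n]$ induced by $x$, of length $i$ and containing $m$, has type the conjugacy class of the $h\in G$ with $x^i.(1,m)=(h,m)$. Plethysm. With coefficients in $\mathbb{Q}[t,t^{-1}]$, for $f$ a power series in the $p_i(c)$ and $g$ a power series in the $p_j$ with zero degree-$0$ term,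 $f\circ g$ is defined by substituting for each $p_i(c)$ in $f$ (leaving coefficients of $f$ unchanged) the series $p_i(c)\circ g$ obtained from $g$ by replacing each $p_j$ by $p_{ij}(c^j)$ and $t$ by $t^i$; here $c^j$ is the class of $j$th powers of elements of $c$. (So $p_i(c)\circ p_j=p_{ij}(c^j)$ and $p_i(c)\circ t=t^i$.) For $G=\{1\}$ this is ordinary plethysm, with $p_i\circ t=t^i$; $\circ$ is associative. Series. $\mathrm{Exp}_G=\exp\bigl(\sum_{i\ge1,c\in G_*}\frac{|c|\,p_i(c)}{|G|\,i}\bigr)$ and $L=\sum_{e\ge1}\frac{\mu(e)}{e}\log(1+p_e)$, with $\mu$ the number-theoretic Möbius function. *)

theory Defs
  imports
    "Jordan_Normal_Form.VS_Connect"
    "HOL-Algebra.Order"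
    "HOL-Library.Poly_Mapping"
    "HOL-Library.Set_Algebras"
    "HOL-Library.Disjoint_Sets"
    "HOL-Computational_Algebra.Formal_Power_Series"
    "HOL-Computational_Algebra.Squarefree"
    "HOL-Combinatorics.Permutations"
    "HOL-Combinatorics.Orbits"
begin

section \<open>Formal power series in many variables\<close>

text \<open>
  A monomial is a finitely supported exponent function. If the variables are graded by positive
  degrees, with finitely many variables in each degree, then every degree has finitely many
  monomials, so the completion of the polynomial ring consists of all functions from monomials
  to coefficients.
\<close>

typedef ('v, 'r) mfps = "UNIV :: (('v \<Rightarrow>\<^sub>0 nat) \<Rightarrow> 'r) set"
  morphisms mcoeff Mfps ..

lemma mcoeff_Mfps [simp]: "mcoeff (Mfps f) = f"
  by (simp add: Mfps_inverse)

lemma mfps_eqI: "(\<And>m. mcoeff f m = mcoeff g m) \<Longrightarrow> f = g"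
  by (metis ext mcoeff_inject)

lemma finite_monomial_divisors:
  fixes m :: "'v \<Rightarrow>\<^sub>0 nat"
  shows "finite {a. \<exists>b. a + b = m}"
proof -
  define N where "N = (\<Union>v\<in>Poly_Mapping.keys m. {..Poly_Mapping.lookup m v})"
  define F where "F = {f :: 'v \<Rightarrow> nat. \<forall>v. (v \<in> Poly_Mapping.keys m \<longrightarrow> f v \<in> N) \<and>
    (v \<notin> Poly_Mapping.keys m \<longrightarrow> f v = 0)}"
  have "finite N"
    by (auto simp: N_def)
  then have "finite F"
    unfolding F_def by (intro finite_set_of_finite_funs) auto
  moreover have "Poly_Mapping.lookup ` {a. \<exists>b. a + b = m} \<subseteq> F"
  proof clarify
    fix a b :: "'v \<Rightarrow>\<^sub>0 nat" assume m: "m = a + b"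
    have "Poly_Mapping.lookup a v \<in> N" if "v \<in> Poly_Mapping.keys (a + b)" for v
      unfolding N_def m using that by (intro UN_I[of v]) (auto simp: lookup_add)
    moreover have "Poly_Mapping.lookup a v = 0" if "v \<notin> Poly_Mapping.keys (a + b)" for v
      using that by (simp add: lookup_add in_keys_iff)
    ultimately show "Poly_Mapping.lookup a \<in> F"
      unfolding F_def m by simp
  qed
  moreover have "inj_on Poly_Mapping.lookup {a. \<exists>b. a + b = m}"
    by (simp add: inj_on_def)
  ultimately show ?thesis
    using inj_on_finite by blast
qed

lemma finite_monomial_splits:
  fixes m :: "'v \<Rightarrow>\<^sub>0 nat"
  shows "finite {(a, b). a + b = m}"
proof (rule finite_subset)
  have "a + b = m \<Longrightarrow> b + a = m" for a b
    by (simp add: add.commute)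
  then show "{(a, b). a + b = m} \<subseteq> {a. \<exists>b. a + b = m} \<times> {a. \<exists>b. a + b = m}"
    by blast
  show "finite ({a. \<exists>b. a + b = m} \<times> {a. \<exists>b. a + b = m})"
    using finite_monomial_divisors by blast
qed

instantiation mfps :: (type, comm_ring_1) comm_ring_1
begin

definition "0 = Mfps (\<lambda>m. 0)"
definition "1 = Mfps (\<lambda>m. if m = 0 then 1 else 0)"
definition "f + g = Mfps (\<lambda>m. mcoeff f m + mcoeff g m)"
definition "f - g = Mfps (\<lambda>m. mcoeff f m - mcoeff g m)"
definition "- f = Mfps (\<lambda>m. - mcoeff f m)"
definition "f * g = Mfps (\<lambda>m. \<Sum>(a, b) \<in> {(a, b). a + b = m}. mcoeff f a * mcoeff g b)"

instance
proof
  fix f g h :: "('a, 'b) mfps"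
  show "f + g + h = f + (g + h)" "f + g = g + f" "0 + f = f" "- f + f = 0" "f - g = f + - g"
    by (simp_all add: plus_mfps_def minus_mfps_def uminus_mfps_def zero_mfps_def
        algebra_simps mcoeff_inverse)
  show "(0 :: ('a, 'b) mfps) \<noteq> 1"
  proof
    assume "(0 :: ('a, 'b) mfps) = 1"
    then have "mcoeff (0 :: ('a, 'b) mfps) 0 = mcoeff 1 0"
      by (rule arg_cong)
    then show False
      by (simp add: zero_mfps_def one_mfps_def)
  qed
  show "f * g = g * f"
  proof (rule mfps_eqI)
    fix m
    show "mcoeff (f * g) m = mcoeff (g * f) m"
      unfolding times_mfps_def mcoeff_Mfps
      by (rule sum.reindex_bij_witness[of _ prod.swap prod.swap]) (auto simp: algebra_simps)
  qed
  show "(f + g) * h = f * h + g * h"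
    by (simp add: plus_mfps_def times_mfps_def algebra_simps sum.distrib case_prod_beta)
  show "1 * f = f"
  proof (rule mfps_eqI)
    fix m
    have "mcoeff (1 * f) m
        = (\<Sum>p\<in>{(a, b). a + b = m}. if p = (0, m) then mcoeff f m else 0)"
      unfolding times_mfps_def one_mfps_def mcoeff_Mfps
      proof (intro sum.cong refl)
      fix p assume "p \<in> {(a, b). a + b = m}"
      then have "snd p = m" if "fst p = 0"
        using that by auto
      then show "(case p of (a, b) \<Rightarrow> (if a = 0 then 1 else 0) * mcoeff f b)
          = (if p = (0, m) then mcoeff f m else 0)"
        by (cases p) auto
    qed
    then show "mcoeff (1 * f) m = mcoeff f m"
      using finite_monomial_splits[of m] by simp
  qed
  show "f * g * h = f * (g * h)"
  proof (rule mfps_eqI)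
    fix m
    define S :: "('a \<Rightarrow>\<^sub>0 nat) \<Rightarrow> _" where "S d = {(a, b). a + b = d}" for d
    have fin: "finite (S d)" for d
      unfolding S_def by (rule finite_monomial_splits)
    have mem: "p \<in> S d \<longleftrightarrow> fst p + snd p = d" for p d
      by (cases p) (simp add: S_def)
    have times: "mcoeff (u * v) d = (\<Sum>p\<in>S d. mcoeff u (fst p) * mcoeff v (snd p))"
      for u v :: "('a, 'b) mfps" and d
      by (simp add: times_mfps_def S_def case_prod_beta)
    let ?t = "\<lambda>a b c. mcoeff f a * mcoeff g b * mcoeff h c"
    have "mcoeff (f * g * h) m = (\<Sum>p\<in>S m. \<Sum>q\<in>S (fst p). ?t (fst q) (snd q) (snd p))"
      by (simp only: times sum_distrib_right)
    also have "\<dots> = (\<Sum>(p, q)\<in>Sigma (S m) (\<lambda>p. S (fst p)). ?t (fst q) (snd q) (snd p))"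
      by (rule sum.Sigma) (simp_all add: fin)
    also have "\<dots> = (\<Sum>(p, q)\<in>Sigma (S m) (\<lambda>p. S (snd p)). ?t (fst p) (fst q) (snd q))"
      by (rule sum.reindex_bij_witness[of _
            "\<lambda>(p, q). ((fst p + fst q, snd q), (fst p, fst q))"
            "\<lambda>(p, q). ((fst q, snd q + snd p), (snd q, snd p))"])
         (auto simp: mem add.assoc[symmetric])
    also have "\<dots> = (\<Sum>p\<in>S m. \<Sum>q\<in>S (snd p). ?t (fst p) (fst q) (snd q))"
      by (rule sum.Sigma[symmetric]) (simp_all add: fin)
    also have "\<dots> = mcoeff (f * (g * h)) m"
      by (simp only: times sum_distrib_left mult.assoc)
    finally show "mcoeff (f * g * h) m = mcoeff (f * (g * h)) m" .
  qed
qed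

end

definition mconst :: "'r \<Rightarrow> ('v, 'r :: comm_ring_1) mfps" where
  "mconst r = Mfps (\<lambda>m. r when m = 0)"

definition mvar :: "'v \<Rightarrow> ('v, 'r :: comm_ring_1) mfps" where
  "mvar v = Mfps (\<lambda>m. 1 when m = Poly_Mapping.single v 1)"

text \<open>
  The sum of a family in which each monomial occurs in only finitely many members
  (where that fails, \<^const>\<open>Sum_any\<close> returns the junk value 0).
\<close>

definition msum :: "('i \<Rightarrow> ('v, 'r :: comm_ring_1) mfps) \<Rightarrow> 'i set \<Rightarrow> ('v, 'r) mfps" where
  "msum F I = Mfps (\<lambda>m. Sum_any (\<lambda>i. mcoeff (F i) m when i \<in> I))"


section \<open>The ring of Laurent-polynomial valued series\<close>

text \<open>
  \<open>\<rat>[t, t\<^sup>-\<^sup>1]\<close> is the group algebra of the integers: \<open>Poly_Mapping.single k r\<close> is \<open>r t\<^sup>k\<close>.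
  The variable \<open>(i, c)\<close> stands for \<open>p\<^sub>i(c)\<close>. Only pairs with \<open>i \<ge> 1\<close> and \<open>c\<close> a conjugacy class
  of \<open>G\<close> ever occur. For the trivial group, \<open>p\<^sub>i\<close> is indexed by \<open>i\<close> alone.
\<close>

type_synonym laurent = "int \<Rightarrow>\<^sub>0 rat"
type_synonym 'v series = "('v, laurent) mfps"

definition rat_const :: "rat \<Rightarrow> 'v series" where
  "rat_const r = mconst (Poly_Mapping.single 0 r)"

definition t_pow :: "int \<Rightarrow> 'v series" where
  "t_pow k = mconst (Poly_Mapping.single k 1)"

definition neg_t_pow :: "int \<Rightarrow> 'v series" where
  "neg_t_pow k = mconst (Poly_Mapping.single k ((-1) powi k))"

definition conj_class :: "('g, 'b) monoid_scheme \<Rightarrow> 'g \<Rightarrow> 'g set" where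
  "conj_class G a = {g \<otimes>\<^bsub>G\<^esub> a \<otimes>\<^bsub>G\<^esub> inv\<^bsub>G\<^esub> g | g. g \<in> carrier G}"

definition conj_classes :: "('g, 'b) monoid_scheme \<Rightarrow> 'g set set" where
  "conj_classes G = conj_class G ` carrier G"

definition class_pow :: "('g, 'b) monoid_scheme \<Rightarrow> 'g set \<Rightarrow> nat \<Rightarrow> 'g set" where
  "class_pow G c j = (\<lambda>x. x [^]\<^bsub>G\<^esub> j) ` c"

text \<open>\<open>t \<mapsto> t\<^sup>i\<close>\<close>
definition laurent_adams :: "nat \<Rightarrow> laurent \<Rightarrow> laurent" where
  "laurent_adams i a = (\<Sum>k\<in>Poly_Mapping.keys a. Poly_Mapping.single (int i * k) (Poly_Mapping.lookup a k))"

text \<open>\<open>p\<^sub>i(c) \<circ> g\<close>: replace each \<open>p\<^sub>j\<close> by \<open>p\<^sub>i\<^sub>j(c\<^sup>j)\<close> and \<open>t\<close> by \<open>t\<^sup>i\<close>\<close>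

definition adams_monomial ::
  "('g, 'b) monoid_scheme \<Rightarrow> nat \<times> 'g set \<Rightarrow> (nat \<Rightarrow>\<^sub>0 nat) \<Rightarrow> (nat \<times> 'g set \<Rightarrow>\<^sub>0 nat)" where
  "adams_monomial G = (\<lambda>(i, c) m.
     \<Sum>j\<in>Poly_Mapping.keys m. Poly_Mapping.single (i * j, class_pow G c j) (Poly_Mapping.lookup m j))"

definition adams ::
  "('g, 'b) monoid_scheme \<Rightarrow> nat \<times> 'g set \<Rightarrow> nat series \<Rightarrow> (nat \<times> 'g set) series" where
  "adams G v g = Mfps (\<lambda>q.
     Sum_any (\<lambda>m. laurent_adams (fst v) (mcoeff g m) when adams_monomial G v m = q))"

definition plethysm ::
  "('g, 'b) monoid_scheme \<Rightarrow> (nat \<times> 'g set) series \<Rightarrow> nat series \<Rightarrow> (nat \<times> 'g set) series" where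
  "plethysm G f g =
     msum (\<lambda>m. mconst (mcoeff f m) * (\<Prod>v\<in>Poly_Mapping.keys m. adams G v g ^ Poly_Mapping.lookup m v)) UNIV"

text \<open>\<open>F(S)\<close> for a univariate power series \<open>F\<close> and a series \<open>S\<close> without constant term\<close>
definition fps_subst :: "rat fps \<Rightarrow> 'v series \<Rightarrow> 'v series" where
  "fps_subst F S = msum (\<lambda>k. rat_const (fps_nth F k) * S ^ k) UNIV"

definition Exp_series :: "('g, 'b) monoid_scheme \<Rightarrow> (nat \<times> 'g set) series" where
  "Exp_series G = fps_subst (fps_exp 1)
     (msum (\<lambda>(i, c). rat_const (of_nat (card c) / (of_nat (Coset.order G) * of_nat i)) * mvar (i, c))
        ({1..} \<times> conj_classes G))"

definition moebius :: "nat \<Rightarrow> int" where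
  "moebius e = (if squarefree e then (-1) ^ card (prime_factors e) else 0)"

text \<open>\<^term>\<open>fps_ln 1\<close> is the expansion of \<open>log(1 + X)\<close> in \<open>X\<close>.\<close>
definition L_series :: "nat series" where
  "L_series = msum (\<lambda>e. rat_const (of_int (moebius e) / of_nat e) * fps_subst (fps_ln 1) (mvar e)) {1..}"


section \<open>Vector spaces over the rationals\<close>

definition vs_trace :: "(rat, 'v) module \<Rightarrow> ('v \<Rightarrow> 'v) \<Rightarrow> rat" where
  "vs_trace V f = (THE r. \<exists>A a. finite A \<and> vectorspace.basis class_ring V A \<and>
     (\<forall>b\<in>A. f b = module.lincomb V (a b) A) \<and> r = (\<Sum>b\<in>A. a b b))"

definition vs_direct_sum :: "'i set \<Rightarrow> ('i \<Rightarrow> (rat, 'v) module) \<Rightarrow> (rat, 'i \<Rightarrow> 'v) module" where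
  "vs_direct_sum I V =
     \<lparr>carrier = {\<phi> \<in> \<Pi>\<^sub>E i\<in>I. carrier (V i). finite {i\<in>I. \<phi> i \<noteq> \<zero>\<^bsub>V i\<^esub>}},
      monoid.mult = undefined, one = undefined,
      zero = (\<lambda>i\<in>I. \<zero>\<^bsub>V i\<^esub>),
      add = (\<lambda>\<phi> \<psi>. \<lambda>i\<in>I. \<phi> i \<oplus>\<^bsub>V i\<^esub> \<psi> i),
      smult = (\<lambda>r \<phi>. \<lambda>i\<in>I. r \<odot>\<^bsub>V i\<^esub> \<phi> i)\<rparr>"


section \<open>Reduced homology of order complexes\<close>

text \<open>
  A \<open>d\<close>-simplex of the order complex of a set \<open>A\<close> of poset elements is written as the strictly
  increasing list of its \<open>d + 1\<close> vertices, which also fixes its orientation. The empty list is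
  the simplex of dimension \<open>-1\<close> of the augmented complex.
\<close>

definition order_simplices :: "'a gorder \<Rightarrow> 'a set \<Rightarrow> 'a list set" where
  "order_simplices P A = {xs. set xs \<subseteq> A \<and> sorted_wrt (lless P) xs}"

definition chains :: "'a gorder \<Rightarrow> 'a set \<Rightarrow> int \<Rightarrow> ('a list \<Rightarrow>\<^sub>0 rat) set" where
  "chains P A d = {z. Poly_Mapping.keys z \<subseteq> {xs \<in> order_simplices P A. int (length xs) = d + 1}}"

definition boundary :: "('a list \<Rightarrow>\<^sub>0 rat) \<Rightarrow> ('a list \<Rightarrow>\<^sub>0 rat)" where
  "boundary z = (\<Sum>xs\<in>Poly_Mapping.keys z. \<Sum>k<length xs.
     Poly_Mapping.single (take k xs @ drop (Suc k) xs) ((-1) ^ k * Poly_Mapping.lookup z xs))"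

definition cycles :: "'a gorder \<Rightarrow> 'a set \<Rightarrow> int \<Rightarrow> ('a list \<Rightarrow>\<^sub>0 rat) set" where
  "cycles P A d = {z \<in> chains P A d. boundary z = 0}"

definition boundaries :: "'a gorder \<Rightarrow> 'a set \<Rightarrow> int \<Rightarrow> ('a list \<Rightarrow>\<^sub>0 rat) set" where
  "boundaries P A d = boundary ` chains P A (d + 1)"

text \<open>Homology classes are cosets of the space of boundaries.\<close>
definition reduced_homology ::
  "'a gorder \<Rightarrow> 'a set \<Rightarrow> int \<Rightarrow> (rat, ('a list \<Rightarrow>\<^sub>0 rat) set) module" where
  "reduced_homology P A d =
     \<lparr>carrier = (\<lambda>z. z +o boundaries P A d) ` cycles P A d,
      monoid.mult = undefined, one = undefined,
      zero = boundaries P A d,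
      add = (+),
      smult = (\<lambda>r C. Poly_Mapping.map ((*) r) ` C + boundaries P A d)\<rparr>"

definition push_chain :: "('a \<Rightarrow> 'b) \<Rightarrow> ('a list \<Rightarrow>\<^sub>0 rat) \<Rightarrow> ('b list \<Rightarrow>\<^sub>0 rat)" where
  "push_chain f z = (\<Sum>xs\<in>Poly_Mapping.keys z. Poly_Mapping.single (map f xs) (Poly_Mapping.lookup z xs))"

text \<open>
  The map \<open>H\<^sub>d(A) \<rightarrow> H\<^sub>d(A')\<close> induced by a strictly order preserving \<open>f\<close> with \<open>f ` A \<subseteq> A'\<close>;
  adding the boundaries turns the image of a coset into a full coset.
\<close>
definition induced_map ::
  "('a \<Rightarrow> 'a) \<Rightarrow> 'a gorder \<Rightarrow> 'a set \<Rightarrow> int \<Rightarrow> ('a list \<Rightarrow>\<^sub>0 rat) set \<Rightarrow> ('a list \<Rightarrow>\<^sub>0 rat) set" where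
  "induced_map f P A' d C = push_chain f ` C + boundaries P A' d"


section \<open>Whitney homology\<close>

definition open_interval :: "'a gorder \<Rightarrow> 'a \<Rightarrow> 'a \<Rightarrow> 'a set" where
  "open_interval P x y = {z \<in> carrier P. x \<sqsubset>\<^bsub>P\<^esub> z \<and> z \<sqsubset>\<^bsub>P\<^esub> y}"

definition interval_length :: "'a gorder \<Rightarrow> 'a \<Rightarrow> 'a \<Rightarrow> int" where
  "interval_length P x y =
     int (Max (length ` order_simplices P (\<lbrace>x..y\<rbrace>\<^bsub>P\<^esub>))) - 1"

text \<open>
  For \<open>x = y\<close> the open interval is empty, and the convention that the Whitney homology of
  \<open>[x, x]\<close> is \<open>\<rat>\<close> with trivial action is obtained by taking the reduced homology of the empty
  complex in degree \<open>-1\<close>.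
\<close>
definition top_degree :: "'a gorder \<Rightarrow> 'a \<Rightarrow> 'a \<Rightarrow> int" where
  "top_degree P x y = (if x = y then -1 else interval_length P x y - 2)"

definition interval_homology ::
  "'a gorder \<Rightarrow> 'a \<Rightarrow> 'a \<Rightarrow> (rat, ('a list \<Rightarrow>\<^sub>0 rat) set) module" where
  "interval_homology P x y = reduced_homology P (open_interval P x y) (top_degree P x y)"

definition rank_level :: "'a gorder \<Rightarrow> ('a \<Rightarrow> rat) \<Rightarrow> int \<Rightarrow> 'a set" where
  "rank_level P rk i = {x \<in> carrier P. rk x = of_int i}"

definition whitney_homology ::
  "'a gorder \<Rightarrow> ('a \<Rightarrow> rat) \<Rightarrow> int \<Rightarrow> (rat, 'a \<Rightarrow> ('a list \<Rightarrow>\<^sub>0 rat) set) module" where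
  "whitney_homology P rk i =
     vs_direct_sum (rank_level P rk i) (interval_homology P (\<bottom>\<^bsub>P\<^esub>))"

text \<open>
  A rank preserving automorphism \<open>f\<close> maps the summand of \<open>x\<close> to that of \<open>f x\<close>, so the component
  of the image at \<open>y\<close> comes from the component at \<open>f\<^sup>-\<^sup>1 y\<close>.
\<close>
definition whitney_action ::
  "'a gorder \<Rightarrow> ('a \<Rightarrow> rat) \<Rightarrow> int \<Rightarrow> ('a \<Rightarrow> 'a) \<Rightarrow>
     ('a \<Rightarrow> ('a list \<Rightarrow>\<^sub>0 rat) set) \<Rightarrow> ('a \<Rightarrow> ('a list \<Rightarrow>\<^sub>0 rat) set)" where
  "whitney_action P rk i f \<phi> = (\<lambda>y\<in>rank_level P rk i.
     induced_map f P (open_interval P (\<bottom>\<^bsub>P\<^esub>) y) (top_degree P (\<bottom>\<^bsub>P\<^esub>) y)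
       (\<phi> (inv_into (carrier P) f y)))"


section \<open>Wreath products and characteristics\<close>

definition points :: "('g, 'b) monoid_scheme \<Rightarrow> nat \<Rightarrow> ('g \<times> nat) set" where
  "points G n = carrier G \<times> {1..n}"

definition left_act :: "('g, 'b) monoid_scheme \<Rightarrow> 'g \<Rightarrow> 'g \<times> nat \<Rightarrow> 'g \<times> nat" where
  "left_act G g = (\<lambda>(h, m). (g \<otimes>\<^bsub>G\<^esub> h, m))"

definition wreath :: "('g, 'b) monoid_scheme \<Rightarrow> nat \<Rightarrow> ('g \<times> nat \<Rightarrow> 'g \<times> nat) set" where
  "wreath G n = {x. x permutes points G n \<and>
     (\<forall>g\<in>carrier G. \<forall>p\<in>points G n. x (left_act G g p) = left_act G g (x p))}"

definition base_perm ::
  "('g, 'b) monoid_scheme \<Rightarrow> ('g \<times> nat \<Rightarrow> 'g \<times> nat) \<Rightarrow> nat \<Rightarrow> nat" where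
  "base_perm G x m = snd (x (\<one>\<^bsub>G\<^esub>, m))"

text \<open>Cycles are identified with their sets of elements, the orbits of the induced permutation.\<close>
definition cycle_count ::
  "('g, 'b) monoid_scheme \<Rightarrow> nat \<Rightarrow> ('g \<times> nat \<Rightarrow> 'g \<times> nat) \<Rightarrow> nat \<Rightarrow> 'g set \<Rightarrow> nat" where
  "cycle_count G n x i c =
     card {C \<in> orbit (base_perm G x) ` {1..n}. card C = i \<and>
       (\<exists>m\<in>C. \<exists>h. (x ^^ i) (\<one>\<^bsub>G\<^esub>, m) = (h, m) \<and> conj_class G h = c)}"

definition cycle_monomial ::
  "('g, 'b) monoid_scheme \<Rightarrow> nat \<Rightarrow> ('g \<times> nat \<Rightarrow> 'g \<times> nat) \<Rightarrow> (nat \<times> 'g set) series" where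
  "cycle_monomial G n x =
     (\<Prod>(i, c)\<in>{1..n} \<times> conj_classes G. mvar (i, c) ^ cycle_count G n x i c)"

definition wreath_ch ::
  "('g, 'b) monoid_scheme \<Rightarrow> nat \<Rightarrow> (rat, 'v) module \<Rightarrow>
     (('g \<times> nat \<Rightarrow> 'g \<times> nat) \<Rightarrow> 'v \<Rightarrow> 'v) \<Rightarrow> (nat \<times> 'g set) series" where
  "wreath_ch G n M \<rho> = rat_const (1 / (of_nat (Coset.order G) ^ n * fact n)) *
     (\<Sum>x\<in>wreath G n. rat_const (vs_trace M (\<rho> x)) * cycle_monomial G n x)"


section \<open>The posets\<close>

type_synonym 'g dowling = "('g \<times> nat) set \<times> ('g \<times> nat) set set"

definition dowling_elements :: "('g, 'b) monoid_scheme \<Rightarrow> nat \<Rightarrow> 'g dowling set" where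
  "dowling_elements G n = {(J, \<pi>).
     J \<subseteq> points G n \<and> (\<forall>g\<in>carrier G. left_act G g ` J = J) \<and>
     partition_on (points G n - J) \<pi> \<and>
     (\<forall>g\<in>carrier G. \<forall>K\<in>\<pi>. left_act G g ` K \<in> \<pi> \<and> (g \<noteq> \<one>\<^bsub>G\<^esub> \<longrightarrow> left_act G g ` K \<noteq> K))}"

definition dowling_le :: "'g dowling \<Rightarrow> 'g dowling \<Rightarrow> bool" where
  "dowling_le = (\<lambda>(J, \<pi>) (J', \<pi>').
     J \<subseteq> J' \<and> (\<forall>K\<in>\<pi>. K \<subseteq> J' \<or> (\<exists>K'\<in>\<pi>'. K \<subseteq> K')))"

definition dowling_lattice :: "('g, 'b) monoid_scheme \<Rightarrow> nat \<Rightarrow> 'g dowling gorder" where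
  "dowling_lattice G n = \<lparr>carrier = dowling_elements G n, eq = (=), le = dowling_le\<rparr>"

definition R_poset :: "('g, 'b) monoid_scheme \<Rightarrow> nat \<Rightarrow> 'g dowling gorder" where
  "R_poset G n = (dowling_lattice G n)
     \<lparr>carrier := {(J, \<pi>) \<in> dowling_elements G n. J = {} \<or> J = points G n}\<rparr>"

definition dowling_rank :: "('g, 'b) monoid_scheme \<Rightarrow> nat \<Rightarrow> 'g dowling \<Rightarrow> rat" where
  "dowling_rank G n = (\<lambda>(J, \<pi>). of_nat n - of_nat (card \<pi>) / of_nat (Coset.order G))"

definition dowling_act :: "('g \<times> nat \<Rightarrow> 'g \<times> nat) \<Rightarrow> 'g dowling \<Rightarrow> 'g dowling" where
  "dowling_act x = (\<lambda>(J, \<pi>). (x ` J, (\<lambda>K. x ` K) ` \<pi>))"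

definition ch_WH_R :: "('g, 'b) monoid_scheme \<Rightarrow> nat \<Rightarrow> int \<Rightarrow> (nat \<times> 'g set) series" where
  "ch_WH_R G n i = wreath_ch G n
     (whitney_homology (R_poset G n) (dowling_rank G n) i)
     (\<lambda>x. whitney_action (R_poset G n) (dowling_rank G n) i (dowling_act x))"

end

theory Submission
  imports Defs
begin

text \<open>
  Let \<open>M\<^sub>u(s)\<close> be the polynomial attached by Moebius inversion to a variable \<open>u = p\<^sub>i(c)\<close>, so that
  \<open>Exp\<^sub>G \<circ> (t\<^sup>a L)\<close> is the product over \<open>u\<close> of the series \<open>(1 + u)\<close> to the power \<open>M\<^sub>u(t\<^sup>a)\<close>; the
  coefficient of a monomial \<open>m\<close> is the product of the binomial coefficients of \<open>M\<^sub>u(t\<^sup>a)\<close> over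
  \<open>m(u)\<close>. On the other side, since open intervals are acyclic below the top degree, the Hopf trace
  formula expresses the trace of \<open>x\<close> on Whitney homology by the Moebius function of the poset of
  \<open>x\<close>-fixed elements, and the coefficient of \<open>m\<close> comes from
  \<open>K\<^sub>m(s) = \<Sum> \<mu>\<^sub>x(\<pi>) s\<close> to the number of \<open>G\<close>-orbits of blocks of \<open>\<pi>\<close>, summed over all \<open>x\<close> of
  cycle type \<open>m\<close> and all \<open>x\<close>-fixed \<open>\<pi>\<close>. If \<open>G\<close> acts freely on a set \<open>B\<close> with \<open>s\<close> elements, Moebius inversion over
  kernels shows that \<open>K\<^sub>m(s)\<close> counts the pairs \<open>(x, \<phi>)\<close> where \<open>\<phi> : G \<times> [n] \<rightarrow> B\<close> is equivariant and
  the functions \<open>\<phi> \<circ> x\<^sup>k\<close> jointly separate points. Such a pair is an equivariant embedding of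
  \<open>G \<times> [n]\<close> onto a shift-stable set of sequences in \<open>B\<close> that are periodic up to \<open>G\<close>. As there are
  \<open>M\<^sub>u(s)\<close> orbits of such sequences of type \<open>u\<close>, one finds that \<open>K\<^sub>m(s)\<close> is \<open>|G|\<^sup>n n!\<close> times the product
  of binomial coefficients of \<open>M\<^sub>u(s)\<close> over \<open>m(u)\<close>, first for all multiples \<open>s\<close> of \<open>|G|\<close> and then
  identically in \<open>s\<close>.
\<close>

section \<open>Coefficients of power series\<close>

text \<open>Both terms on the right have the same source. A partition has rank n minus its number of
  orbits of blocks, so up to normalisation the partitions contribute t^n K_m(1/t). The added top
  element has rank n, and its Moebius value is minus the sum of all the others, so it contributes
  -t^n K_m(1). This explains the exponents -1 and 0 of t in front of L; the factor t^n is the effect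
  of substituting t p_1. The hard point of the topology is the interval below the top element. Two
  covers of an element that lie below one partition always have a join there, but in general two
  balanced partitions may have no balanced upper bound, because their relations together can relate
  a point to a translate of itself. The order of the covers is therefore steered by a chosen coatom,
  given by a map to G, which is replaced along the recursion. Summing over all x of one type is what
  makes the count possible: a separating colouring remembers x as the shift of its sequences, so x
  disappears and a set of orbits of sequences remains.\<close>

lemma mcoeff_zero [simp]: "mcoeff 0 m = 0"
  by (simp add: zero_mfps_def)

lemma mcoeff_add [simp]: "mcoeff (f + g) m = mcoeff f m + mcoeff g m"
  by (simp add: plus_mfps_def)

lemma mcoeff_diff [simp]: "mcoeff (f - g) m = mcoeff f m - mcoeff g m"
  by (simp add: minus_mfps_def)

lemma mcoeff_one: "mcoeff 1 m = (if m = 0 then 1 else 0)"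
  by (simp add: one_mfps_def)

lemma mcoeff_sum [simp]: "mcoeff (sum f A) m = (\<Sum>i\<in>A. mcoeff (f i) m)"
  by (induction A rule: infinite_finite_induct) auto

lemma mcoeff_times:
  "mcoeff (f * g) m = (\<Sum>(a, b)\<in>{(a, b). a + b = m}. mcoeff f a * mcoeff g b)"
  by (simp add: times_mfps_def)

text \<open>Constants, variables and their products are all of this form, which reduces such
  products to addition of exponents.\<close>

definition mmon :: "('v \<Rightarrow>\<^sub>0 nat) \<Rightarrow> 'r \<Rightarrow> ('v, 'r :: comm_ring_1) mfps" where
  "mmon a r = Mfps (\<lambda>m. r when m = a)"

lemma mcoeff_mmon: "mcoeff (mmon a r) m = (r when m = a)"
  by (simp add: mmon_def)

lemma mconst_eq_mmon: "mconst r = mmon 0 r"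
  by (simp add: mconst_def mmon_def)

lemma mvar_eq_mmon: "mvar v = mmon (Poly_Mapping.single v 1) 1"
  by (simp add: mvar_def mmon_def)

lemma mcoeff_mmon_mult_add: "mcoeff (mmon a r * f) (a + b) = r * mcoeff f b"
proof -
  have "mcoeff (mmon a r * f) (a + b)
      = (\<Sum>p\<in>{(a', b'). a' + b' = a + b}. if p = (a, b) then r * mcoeff f b else 0)"
    unfolding mcoeff_times by (intro sum.cong) (auto simp: mcoeff_mmon when_def split: if_splits)
  also have "\<dots> = r * mcoeff f b"
    by (subst sum.delta[OF finite_monomial_splits]) auto
  finally show ?thesis .
qed

lemma mcoeff_mmon_mult_zero:
  "(\<And>b. m \<noteq> a + b) \<Longrightarrow> mcoeff (mmon a r * f) m = 0"
  unfolding mcoeff_times by (intro sum.neutral) (auto simp: mcoeff_mmon when_def)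

lemma mcoeff_mconst_mult [simp]: "mcoeff (mconst r * f) m = r * mcoeff f m"
  using mcoeff_mmon_mult_add[of 0 r f m] by (simp add: mconst_eq_mmon)

lemma mcoeff_mconst_mult' [simp]: "mcoeff (f * mconst r) m = r * mcoeff f m"
  by (subst mult.commute) simp

lemma mmon_mult: "mmon a r * mmon b s = mmon (a + b) (r * s)"
proof (rule mfps_eqI)
  fix m
  show "mcoeff (mmon a r * mmon b s) m = mcoeff (mmon (a + b) (r * s)) m"
  proof (cases "\<exists>c. m = a + c")
    case True
    then obtain c where "m = a + c" by blast
    then show ?thesis by (simp add: mcoeff_mmon_mult_add) (simp add: mcoeff_mmon when_def)
  next
    case False
    then show ?thesis by (auto simp: mcoeff_mmon_mult_zero mcoeff_mmon)
  qed
qed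

lemma one_eq_mmon: "1 = mmon 0 1"
  by (rule mfps_eqI) (simp add: mcoeff_one mcoeff_mmon when_def)

lemma mconst_mult: "mconst r * mconst s = mconst (r * s)"
  by (simp add: mconst_eq_mmon mmon_mult)

lemma mconst_0: "mconst 0 = 0"
  by (rule mfps_eqI) (simp add: mconst_def)

lemma mmon_power: "mmon (Poly_Mapping.single v k) r ^ j = mmon (Poly_Mapping.single v (k * j)) (r ^ j)"
  by (induction j) (auto simp: one_eq_mmon mmon_mult single_add[symmetric])

lemma mvar_power: "mvar v ^ k = mmon (Poly_Mapping.single v k) 1"
  using mmon_power[of v 1 1 k] by (simp add: mvar_eq_mmon)

lemma mmon_prod: "(\<Prod>i\<in>I. mmon (a i) (r i)) = mmon (\<Sum>i\<in>I. a i) (\<Prod>i\<in>I. r i)"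
proof (induction I rule: infinite_finite_induct)
  case (insert x I)
  then show ?case by (simp add: mmon_mult)
qed (simp_all add: one_eq_mmon[symmetric])

lemma sum_single_keys:
  fixes m :: "'v \<Rightarrow>\<^sub>0 nat"
  assumes "finite V" "Poly_Mapping.keys m \<subseteq> V"
  shows "(\<Sum>v\<in>V. Poly_Mapping.single v (Poly_Mapping.lookup m v)) = m"
proof (rule poly_mapping_eqI)
  fix u
  have "Poly_Mapping.lookup (\<Sum>v\<in>V. Poly_Mapping.single v (Poly_Mapping.lookup m v)) u
      = (\<Sum>v\<in>V. if u = v then Poly_Mapping.lookup m v else 0)"
    unfolding lookup_sum by (intro sum.cong) (auto simp: lookup_single when_def)
  also have "\<dots> = Poly_Mapping.lookup m u"
    using assms by (auto simp: in_keys_iff)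
  finally show "Poly_Mapping.lookup (\<Sum>v\<in>V. Poly_Mapping.single v (Poly_Mapping.lookup m v)) u
      = Poly_Mapping.lookup m u" .
qed

section \<open>Formal partial derivatives\<close>

definition pderiv_mfps :: "'v \<Rightarrow> ('v, 'r :: comm_ring_1) mfps \<Rightarrow> ('v, 'r) mfps" where
  "pderiv_mfps u f = Mfps (\<lambda>m. of_nat (Poly_Mapping.lookup m u + 1) * mcoeff f (m + Poly_Mapping.single u 1))"

lemma mcoeff_pderiv:
  "mcoeff (pderiv_mfps u f) m
    = of_nat (Poly_Mapping.lookup m u + 1) * mcoeff f (m + Poly_Mapping.single u 1)"
  by (simp add: pderiv_mfps_def)

text \<open>The core of the Leibniz rule. The factor \<open>lookup a u\<close> removes the
  splittings in which \<open>u\<close> is absent from \<open>a\<close>; the others arise from the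
  splittings of \<open>m\<close> by putting one more \<open>u\<close> into the first part.\<close>

lemma sum_splits_shift:
  fixes h :: "('v \<Rightarrow>\<^sub>0 nat) \<Rightarrow> ('v \<Rightarrow>\<^sub>0 nat) \<Rightarrow> 'r :: comm_ring_1"
  shows "(\<Sum>(a, b)\<in>{(a, b). a + b = m + Poly_Mapping.single u 1}. of_nat (Poly_Mapping.lookup a u) * h a b)
    = (\<Sum>(a, b)\<in>{(a, b). a + b = m}. of_nat (Poly_Mapping.lookup a u + 1) * h (a + Poly_Mapping.single u 1) b)"
    (is "?L = ?R")
proof -
  let ?s = "Poly_Mapping.single u 1 :: 'v \<Rightarrow>\<^sub>0 nat"
  let ?T = "{(a, b). a + b = m + ?s}"
  have "?L = (\<Sum>(a, b)\<in>{(a, b) \<in> ?T. Poly_Mapping.lookup a u \<noteq> 0}. of_nat (Poly_Mapping.lookup a u) * h a b)"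
    by (rule sum.mono_neutral_right[OF finite_monomial_splits]) (auto intro: Nat.gr0I)
  also have "\<dots> = ?R"
  proof (rule sum.reindex_bij_witness[of _ "\<lambda>(a, b). (a + ?s, b)" "\<lambda>(a, b). (a - ?s, b)"])
    have sub: "a - ?s + ?s = a" if "Poly_Mapping.lookup a u \<noteq> 0" for a
      using that by (intro poly_mapping_eqI) (auto simp: lookup_add lookup_minus lookup_single when_def)
    fix p assume p: "p \<in> {(a, b) \<in> ?T. Poly_Mapping.lookup a u \<noteq> 0}"
    obtain a b where ab: "p = (a, b)" by (cases p)
    then have a: "a + b = m + ?s" "a - ?s + ?s = a" using p sub by auto
    then have "(a - ?s) + b + ?s = m + ?s" by (metis add.commute add.left_commute)
    then have m: "a - ?s + b = m" by simp
    show "(case case p of (a, b) \<Rightarrow> (a - ?s, b) of (a, b) \<Rightarrow> (a + ?s, b)) = p"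
      using a ab by auto
    show "(case p of (a, b) \<Rightarrow> (a - ?s, b)) \<in> {(a, b). a + b = m}"
      using m ab by auto
    have "Poly_Mapping.lookup (a - ?s) u + 1 = Poly_Mapping.lookup a u"
      using p ab by (auto simp: lookup_minus lookup_single)
    then show "(case case p of (a, b) \<Rightarrow> (a - ?s, b) of
             (a, b) \<Rightarrow> of_nat (Poly_Mapping.lookup a u + 1) * h (a + ?s) b) =
         (case p of (a, b) \<Rightarrow> of_nat (Poly_Mapping.lookup a u) * h a b)"
      using a(2) ab by (simp only: prod.case)
  next
    fix p assume "p \<in> {(a, b). a + b = m}"
    then show "(case case p of (a, b) \<Rightarrow> (a + ?s, b) of (a, b) \<Rightarrow> (a - ?s, b)) = p"
      "(case p of (a, b) \<Rightarrow> (a + ?s, b)) \<in> {(a, b) \<in> ?T. Poly_Mapping.lookup a u \<noteq> 0}"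
      by (auto simp: lookup_add algebra_simps)
  qed
  finally show ?thesis .
qed

lemma pderiv_mult: "pderiv_mfps u (f * g) = pderiv_mfps u f * g + f * pderiv_mfps u g"
proof (rule mfps_eqI)
  fix m
  let ?s = "Poly_Mapping.single u 1 :: 'a \<Rightarrow>\<^sub>0 nat"
  let ?T = "{(a, b). a + b = m + ?s}"
  have swap: "(\<Sum>(a, b)\<in>{(a, b). a + b = c}. F a b) = (\<Sum>(a, b)\<in>{(a, b). a + b = c}. F b a)"
    for c :: "'a \<Rightarrow>\<^sub>0 nat" and F :: "_ \<Rightarrow> _ \<Rightarrow> 'b"
    by (rule sum.reindex_bij_witness[of _ prod.swap prod.swap]) (auto simp: add.commute)
  have "mcoeff (pderiv_mfps u (f * g)) m
      = (\<Sum>(a, b)\<in>?T. of_nat (Poly_Mapping.lookup (m + ?s) u) * (mcoeff f a * mcoeff g b))"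
    by (simp add: mcoeff_pderiv mcoeff_times sum_distrib_left lookup_add case_prod_beta)
  \<comment> \<open>The exponent of \<open>u\<close> in a product of monomials is the sum of its
    exponents in the two factors.\<close>
  also have "\<dots> = (\<Sum>(a, b)\<in>?T. of_nat (Poly_Mapping.lookup a u) * (mcoeff f a * mcoeff g b)
        + of_nat (Poly_Mapping.lookup b u) * (mcoeff f a * mcoeff g b))"
  proof (intro sum.cong refl)
    fix p assume p: "p \<in> ?T"
    obtain a b where "p = (a, b)" by (cases p)
    with p have "m + ?s = a + b" by auto
    then show "(case p of (a, b) \<Rightarrow> of_nat (Poly_Mapping.lookup (m + ?s) u) * (mcoeff f a * mcoeff g b)) =
      (case p of (a, b) \<Rightarrow> of_nat (Poly_Mapping.lookup a u) * (mcoeff f a * mcoeff g b)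
        + of_nat (Poly_Mapping.lookup b u) * (mcoeff f a * mcoeff g b))"
      using \<open>p = (a, b)\<close> by (simp only: lookup_add of_nat_add) (simp add: algebra_simps)
  qed
  also have "\<dots> = (\<Sum>(a, b)\<in>?T. of_nat (Poly_Mapping.lookup a u) * (mcoeff f a * mcoeff g b))
      + (\<Sum>(a, b)\<in>?T. of_nat (Poly_Mapping.lookup b u) * (mcoeff f a * mcoeff g b))"
    by (simp add: sum.distrib case_prod_beta)
  also have "(\<Sum>(a, b)\<in>?T. of_nat (Poly_Mapping.lookup b u) * (mcoeff f a * mcoeff g b))
      = (\<Sum>(a, b)\<in>?T. of_nat (Poly_Mapping.lookup a u) * (mcoeff f b * mcoeff g a))"
    by (rule swap)
  also have "\<dots> = (\<Sum>(a, b)\<in>{(a, b). a + b = m}. of_nat (Poly_Mapping.lookup a u + 1) * (mcoeff f b * mcoeff g (a + ?s)))"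
    by (rule sum_splits_shift)
  also have "\<dots> = (\<Sum>(a, b)\<in>{(a, b). a + b = m}. of_nat (Poly_Mapping.lookup b u + 1) * (mcoeff f a * mcoeff g (b + ?s)))"
    by (rule swap)
  also have "\<dots> = mcoeff (f * pderiv_mfps u g) m"
    by (simp add: mcoeff_times mcoeff_pderiv algebra_simps)
  also have "(\<Sum>(a, b)\<in>?T. of_nat (Poly_Mapping.lookup a u) * (mcoeff f a * mcoeff g b))
      = mcoeff (pderiv_mfps u f * g) m"
    by (subst sum_splits_shift) (simp only: mcoeff_times mcoeff_pderiv mult.assoc)
  finally show "mcoeff (pderiv_mfps u (f * g)) m = mcoeff (pderiv_mfps u f * g + f * pderiv_mfps u g) m"
    by simp
qed

lemma pderiv_one: "pderiv_mfps u 1 = 0"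
proof (rule mfps_eqI)
  fix m :: "'a \<Rightarrow>\<^sub>0 nat"
  have "Poly_Mapping.lookup (m + Poly_Mapping.single u 1) u \<noteq> Poly_Mapping.lookup 0 u"
    by (simp add: lookup_add)
  then have "m + Poly_Mapping.single u 1 \<noteq> 0" by metis
  then show "mcoeff (pderiv_mfps u 1) m = mcoeff (0 :: ('a, 'b) mfps) m"
    by (simp add: mcoeff_pderiv mcoeff_one)
qed

lemma pderiv_const_mult: "pderiv_mfps u (mconst r * f) = mconst r * pderiv_mfps u f"
  by (rule mfps_eqI) (simp add: mcoeff_pderiv algebra_simps)

lemma pderiv_power: "pderiv_mfps u (f ^ k) = of_nat k * f ^ (k - 1) * pderiv_mfps u f"
proof (induction k)
  case (Suc k)
  then show ?case
    by (cases k) (auto simp: pderiv_mult algebra_simps)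
qed (simp add: pderiv_one)

text \<open>The exponent is lowered inside the full product instead of splitting off the factor of
  \<open>v\<close>, because this is literally the product that belongs to the monomial
  \<open>m - single v 1\<close> in \<open>pterm_pderiv\<close>. If \<open>k v = 0\<close> the
  truncated subtraction does no harm, as the factor \<open>of_nat (k v)\<close> vanishes.\<close>

lemma pderiv_prod_power:
  assumes "finite V"
  shows "pderiv_mfps u (\<Prod>v\<in>V. A v ^ k v)
    = (\<Sum>v\<in>V. of_nat (k v) * pderiv_mfps u (A v) * (\<Prod>w\<in>V. A w ^ (k w - (if w = v then 1 else 0))))"
  using assms
proof (induction V)
  case (insert x V)
  have 1: "(\<Prod>w\<in>V. A w ^ (k w - (if w = x then 1 else 0))) = (\<Prod>w\<in>V. A w ^ k w)"
    using insert.hyps by (intro prod.cong) auto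
  have 2: "(\<Sum>v\<in>V. of_nat (k v) * pderiv_mfps u (A v) * (\<Prod>w\<in>insert x V. A w ^ (k w - (if w = v then 1 else 0))))
    = A x ^ k x * (\<Sum>v\<in>V. of_nat (k v) * pderiv_mfps u (A v) * (\<Prod>w\<in>V. A w ^ (k w - (if w = v then 1 else 0))))"
    unfolding sum_distrib_left
  proof (intro sum.cong refl)
    fix v assume "v \<in> V"
    then have "x \<noteq> v" using insert.hyps by auto
    then show "of_nat (k v) * pderiv_mfps u (A v) * (\<Prod>w\<in>insert x V. A w ^ (k w - (if w = v then 1 else 0))) =
      A x ^ k x * (of_nat (k v) * pderiv_mfps u (A v) * (\<Prod>w\<in>V. A w ^ (k w - (if w = v then 1 else 0))))"
      using insert.hyps by (simp add: algebra_simps)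
  qed
  have 3: "(\<Sum>v\<in>insert x V. of_nat (k v) * pderiv_mfps u (A v) * (\<Prod>w\<in>insert x V. A w ^ (k w - (if w = v then 1 else 0))))
    = of_nat (k x) * pderiv_mfps u (A x) * (A x ^ (k x - 1) * (\<Prod>w\<in>V. A w ^ k w))
      + A x ^ k x * pderiv_mfps u (\<Prod>v\<in>V. A v ^ k v)"
    unfolding sum.insert[OF insert.hyps] unfolding 2 unfolding prod.insert[OF insert.hyps] 1 insert.IH by simp
  show ?case
    unfolding 3 unfolding prod.insert[OF insert.hyps] pderiv_mult pderiv_power
    by (simp add: algebra_simps)
qed (simp add: pderiv_one)

section \<open>Gradings of monomials and orders of vanishing\<close>

definition weight :: "('v \<Rightarrow> nat) \<Rightarrow> ('v \<Rightarrow>\<^sub>0 nat) \<Rightarrow> nat" where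
  "weight w m = (\<Sum>v\<in>Poly_Mapping.keys m. w v * Poly_Mapping.lookup m v)"

lemma weight_superset:
  "finite V \<Longrightarrow> Poly_Mapping.keys m \<subseteq> V \<Longrightarrow> weight w m = (\<Sum>v\<in>V. w v * Poly_Mapping.lookup m v)"
  unfolding weight_def by (intro sum.mono_neutral_left) (auto simp: in_keys_iff)

lemma weight_add: "weight w (a + b) = weight w a + weight w b"
proof -
  let ?V = "Poly_Mapping.keys a \<union> Poly_Mapping.keys b"
  have "Poly_Mapping.keys (a + b) \<subseteq> ?V" by (rule Poly_Mapping.keys_add)
  then show ?thesis
    by (subst (1 2 3) weight_superset[of ?V]) (auto simp: lookup_add algebra_simps sum.distrib)
qed

lemma weight_0 [simp]: "weight w 0 = 0"
  by (simp add: weight_def)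

lemma weight_single [simp]: "weight w (Poly_Mapping.single v k) = w v * k"
  by (simp add: weight_def)

text \<open>The grading in which \<open>p_i(c)\<close> has degree \<open>i\<close>. The constant
  weight 1, used for the exponential series, counts the factors of a monomial.\<close>

abbreviation wt :: "(nat \<times> 'c \<Rightarrow>\<^sub>0 nat) \<Rightarrow> nat" where
  "wt \<equiv> weight fst"

definition order_ge :: "nat \<Rightarrow> (nat \<times> 'c, 'r :: comm_ring_1) mfps \<Rightarrow> bool" where
  "order_ge d f \<longleftrightarrow> (\<forall>m. wt m < d \<longrightarrow> mcoeff f m = 0)"

lemma order_ge_mult:
  fixes f g :: "(nat \<times> 'c, 'r :: comm_ring_1) mfps"
  shows "order_ge d f \<Longrightarrow> order_ge e g \<Longrightarrow> order_ge (d + e) (f * g)"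
  unfolding order_ge_def mcoeff_times
proof (intro allI impI sum.neutral ballI)
  fix m :: "nat \<times> 'c \<Rightarrow>\<^sub>0 nat" and p
  assume "\<forall>m. wt m < d \<longrightarrow> mcoeff f m = 0" "\<forall>m. wt m < e \<longrightarrow> mcoeff g m = 0"
    and m: "wt m < d + e" "p \<in> {(a, b). a + b = m}"
  moreover have "wt (fst p) < d \<or> wt (snd p) < e"
    using m by (auto simp: weight_add)
  ultimately show "(case p of (a, b) \<Rightarrow> mcoeff f a * mcoeff g b) = 0"
    by (auto simp: case_prod_beta)
qed

lemma order_ge_one: "order_ge 0 f"
  by (simp add: order_ge_def)

lemma order_ge_power: "order_ge d f \<Longrightarrow> order_ge (d * k) (f ^ k)"
  by (induction k) (auto simp: order_ge_one intro: order_ge_mult)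

lemma order_ge_prod: "(\<And>i. i \<in> I \<Longrightarrow> order_ge (d i) (f i)) \<Longrightarrow> order_ge (\<Sum>i\<in>I. d i) (\<Prod>i\<in>I. f i)"
  by (induction I rule: infinite_finite_induct) (auto simp: order_ge_one intro: order_ge_mult)

section \<open>The coefficients of the right hand side\<close>

lemma laurent_of_nat: "(of_nat k :: laurent) = Poly_Mapping.single 0 (of_nat k)"
  by (rule single_of_nat[symmetric])

lemma laurent_inv_cancel:
  "k > 0 \<Longrightarrow> Poly_Mapping.single 0 (1 / of_nat k) * (of_nat k * (x :: laurent)) = x"
  by (simp add: laurent_of_nat mult_single mult.assoc[symmetric] del: single_of_nat)

lemma laurent_of_nat_cancel:
  "k > 0 \<Longrightarrow> of_nat k * (x :: laurent) = y \<longleftrightarrow> x = Poly_Mapping.single 0 (1 / of_nat k) * y"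
  by (auto simp: laurent_inv_cancel) (simp add: laurent_of_nat mult_single mult.assoc[symmetric] del: single_of_nat)

lemma mfps_of_nat: "(of_nat k :: ('v, 'r :: comm_ring_1) mfps) = mconst (of_nat k)"
proof (induction k)
  case (Suc k)
  then show ?case
    by (intro mfps_eqI) (simp add: mconst_def mcoeff_one when_def)
qed (simp add: mconst_0)

lemma Sum_any_single:
  assumes "\<And>i. i \<noteq> j \<Longrightarrow> F i = 0"
  shows "Sum_any F = F j"
proof -
  have "Sum_any F = sum F {j}"
    using assms by (intro Sum_any.expand_superset) auto
  then show ?thesis by simp
qed

section \<open>The exponential series and its differential equation\<close>

definition cvars :: "('g, 'b) monoid_scheme \<Rightarrow> (nat \<times> 'g set) set" where
  "cvars G = {1..} \<times> conj_classes G"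

definition cweight :: "('g, 'b) monoid_scheme \<Rightarrow> nat \<times> 'g set \<Rightarrow> rat" where
  "cweight G v = of_nat (card (snd v)) / (of_nat (Coset.order G) * of_nat (fst v))"

definition lin_part :: "('g, 'b) monoid_scheme \<Rightarrow> (nat \<times> 'g set) series" where
  "lin_part G = msum (\<lambda>(i, c). rat_const (of_nat (card c) / (of_nat (Coset.order G) * of_nat i)) * mvar (i, c))
        ({1..} \<times> conj_classes G)"

lemma single_eq_single:
  assumes "k \<noteq> 0" "Poly_Mapping.single v k = Poly_Mapping.single w l"
  shows "v = w \<and> k = l"
proof -
  have "Poly_Mapping.lookup (Poly_Mapping.single v k) v = Poly_Mapping.lookup (Poly_Mapping.single w l) v"
    using assms by simp
  then show ?thesis using assms(1) by (auto simp: lookup_single when_def split: if_splits)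
qed

lemma mcoeff_lin_part_single:
  "mcoeff (lin_part G) (Poly_Mapping.single v 1)
    = (if v \<in> cvars G then Poly_Mapping.single 0 (cweight G v) else 0)"
  unfolding lin_part_def msum_def mcoeff_Mfps
  by (subst Sum_any_single[of v])
    (auto simp: rat_const_def mcoeff_mmon mvar_eq_mmon cvars_def cweight_def when_def
      split: if_splits dest: single_eq_single[rotated])

lemma mcoeff_lin_part_zero:
  assumes "\<And>v. m \<noteq> Poly_Mapping.single v 1"
  shows "mcoeff (lin_part G) m = 0"
  unfolding lin_part_def msum_def mcoeff_Mfps
  using assms by (subst Sum_any_single[of undefined])
    (auto simp: rat_const_def mcoeff_mmon mvar_eq_mmon when_def split: prod.splits)

lemma add_single_eq_single:
  fixes q :: "'v \<Rightarrow>\<^sub>0 nat"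
  assumes "q + Poly_Mapping.single u 1 = Poly_Mapping.single v k"
  shows "v = u \<and> q = Poly_Mapping.single u (k - 1) \<and> k > 0"
proof -
  have "Poly_Mapping.lookup (q + Poly_Mapping.single u 1) u = Poly_Mapping.lookup (Poly_Mapping.single v k) u"
    using assms by simp
  then have vu: "v = u" "k > 0" by (auto simp: lookup_add lookup_single when_def split: if_splits)
  have "q + Poly_Mapping.single u 1 = Poly_Mapping.single u (k - 1) + Poly_Mapping.single u 1"
    using assms vu by (simp add: single_add[symmetric])
  then show ?thesis using vu by (metis add_right_imp_eq)
qed

lemma pderiv_lin_part:
  "pderiv_mfps u (lin_part G) = mconst (if u \<in> cvars G then Poly_Mapping.single 0 (cweight G u) else 0)"
proof (rule mfps_eqI)
  fix m :: "nat \<times> 'a set \<Rightarrow>\<^sub>0 nat"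
  show "mcoeff (pderiv_mfps u (lin_part G)) m
    = mcoeff (mconst (if u \<in> cvars G then Poly_Mapping.single 0 (cweight G u) else 0)) m"
  proof (cases "m = 0")
    case True
    then show ?thesis
      using mcoeff_lin_part_single[of G u] by (simp add: mcoeff_pderiv mconst_def)
  next
    case False
    have "m + Poly_Mapping.single u 1 \<noteq> Poly_Mapping.single v 1" for v
      using False add_single_eq_single[of m u v 1] by auto
    then show ?thesis
      using False mcoeff_lin_part_zero[of "m + Poly_Mapping.single u 1" G] by (simp add: mcoeff_pderiv mconst_def)
  qed
qed

text \<open>The powers of a linear form live on monomials with different numbers of factors. Hence
  only one term of the exponential sum reaches a given monomial, as recorded in
  \<open>mcoeff_Exp\<close>.\<close>

lemma lin_part_power_homogeneous:
  "mcoeff (lin_part G ^ k) m \<noteq> 0 \<Longrightarrow> weight (\<lambda>_. 1) m = k"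
proof (induction k arbitrary: m)
  case 0
  then show ?case by (auto simp: mcoeff_one split: if_splits)
next
  case (Suc k)
  then have "(\<Sum>(a, b)\<in>{(a, b). a + b = m}. mcoeff (lin_part G) a * mcoeff (lin_part G ^ k) b) \<noteq> 0"
    by (simp add: mcoeff_times)
  then obtain p where p: "p \<in> {(a, b). a + b = m}"
    "(case p of (a, b) \<Rightarrow> mcoeff (lin_part G) a * mcoeff (lin_part G ^ k) b) \<noteq> 0"
    by (rule sum.not_neutral_contains_not_neutral)
  obtain a b where ab: "p = (a, b)" by (cases p)
  with p have "mcoeff (lin_part G) a \<noteq> 0" "mcoeff (lin_part G ^ k) b \<noteq> 0" "m = a + b" by auto
  moreover obtain v where "a = Poly_Mapping.single v 1"
    using calculation(1) mcoeff_lin_part_zero by blast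
  ultimately show ?case using Suc.IH[of b] by (simp add: weight_add)
qed

lemma mcoeff_Exp: "mcoeff (Exp_series G) m
    = Poly_Mapping.single 0 (1 / fact (weight (\<lambda>_. 1) m)) * mcoeff (lin_part G ^ weight (\<lambda>_. 1) m) m"
  unfolding Exp_series_def fps_subst_def lin_part_def[symmetric]
  unfolding msum_def mcoeff_Mfps
  using lin_part_power_homogeneous[of G _ m]
  by (subst Sum_any_single[of "weight (\<lambda>_. 1) m"]) (auto simp: rat_const_def)

lemma Exp_0: "mcoeff (Exp_series G) 0 = 1"
  by (simp add: mcoeff_Exp mcoeff_one)

text \<open>Coefficient form of the chain rule for exp: the derivative of the linear form in its
  exponent is a constant.\<close>

lemma Exp_rec:
  "of_nat (Poly_Mapping.lookup m u + 1) * mcoeff (Exp_series G) (m + Poly_Mapping.single u 1)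
    = (if u \<in> cvars G then Poly_Mapping.single 0 (cweight G u) else 0) * mcoeff (Exp_series G) m"
proof -
  let ?k = "weight (\<lambda>_. 1) m"
  let ?c = "if u \<in> cvars G then Poly_Mapping.single 0 (cweight G u) else 0 :: laurent"
  have k: "weight (\<lambda>_. 1) (m + Poly_Mapping.single u 1) = Suc ?k"
    by (simp add: weight_add)
  have "of_nat (Poly_Mapping.lookup m u + 1) * mcoeff (lin_part G ^ Suc ?k) (m + Poly_Mapping.single u 1)
      = mcoeff (pderiv_mfps u (lin_part G ^ Suc ?k)) m"
    by (simp add: mcoeff_pderiv)
  also have "pderiv_mfps u (lin_part G ^ Suc ?k) = mconst (of_nat (Suc ?k) * ?c) * lin_part G ^ ?k"
    unfolding pderiv_power pderiv_lin_part
    by (rule mfps_eqI) (simp add: mfps_of_nat algebra_simps flip: of_nat_Suc)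
  finally have "of_nat (Poly_Mapping.lookup m u + 1) * mcoeff (lin_part G ^ Suc ?k) (m + Poly_Mapping.single u 1)
    = of_nat (Suc ?k) * ?c * mcoeff (lin_part G ^ ?k) m" by simp
  then have "of_nat (Poly_Mapping.lookup m u + 1) * mcoeff (Exp_series G) (m + Poly_Mapping.single u 1)
    = Poly_Mapping.single 0 (1 / fact (Suc ?k)) * (of_nat (Suc ?k) * ?c * mcoeff (lin_part G ^ ?k) m)"
    unfolding mcoeff_Exp k by (subst mult.left_commute) (simp only:)
  also have "\<dots> = (Poly_Mapping.single 0 (1 / fact (Suc ?k)) * of_nat (Suc ?k)) * (?c * mcoeff (lin_part G ^ ?k) m)"
    by (simp only: mult.assoc)
  also have "Poly_Mapping.single 0 (1 / fact (Suc ?k)) * of_nat (Suc ?k) = (Poly_Mapping.single 0 (1 / fact ?k) :: laurent)"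
  proof -
    have "1 / fact (Suc ?k) * of_nat (Suc ?k) = (1 / fact ?k :: rat)"
      by (simp add: fact_Suc del: of_nat_Suc)
    then show ?thesis unfolding laurent_of_nat mult_single by simp
  qed
  finally show ?thesis
    unfolding mcoeff_Exp by (simp only: ac_simps)
qed

text \<open>In \<open>Exp_rec\<close> a variable outside \<open>cvars G\<close> has factor 0, which
  kills every monomial that contains it.\<close>

lemma Exp_zero:
  assumes "\<not> Poly_Mapping.keys m \<subseteq> cvars G"
  shows "mcoeff (Exp_series G) m = 0"
proof -
  obtain u where u: "u \<in> Poly_Mapping.keys m" "u \<notin> cvars G" using assms by blast
  let ?m = "m - Poly_Mapping.single u 1"
  have "m = ?m + Poly_Mapping.single u 1"
    using u by (intro poly_mapping_eqI) (auto simp: lookup_add lookup_minus lookup_single when_def in_keys_iff)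
  then have "of_nat (Poly_Mapping.lookup ?m u + 1) * mcoeff (Exp_series G) m = 0"
    using Exp_rec[of ?m u G] u by simp
  then show ?thesis
    by (subst (asm) laurent_of_nat_cancel) auto
qed

section \<open>The logarithmic series and its images under p_i(c)\<close>

definition log_coeff :: "nat \<Rightarrow> nat \<Rightarrow> rat" where
  "log_coeff e k = of_int (moebius e) / of_nat e * ((-1) ^ (k - 1) / of_nat k)"

lemma mcoeff_fps_subst_mvar:
  "k > 0 \<Longrightarrow> mcoeff (fps_subst F (mvar v)) (Poly_Mapping.single v k) = Poly_Mapping.single 0 (fps_nth F k)"
  unfolding fps_subst_def msum_def mcoeff_Mfps
  by (subst Sum_any_single[of k])
    (auto simp: rat_const_def mvar_power mcoeff_mmon when_def dest: single_eq_single[rotated])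

lemma mcoeff_fps_subst_mvar_zero:
  assumes "fps_nth F 0 = 0" "\<And>k. k > 0 \<Longrightarrow> m \<noteq> Poly_Mapping.single v k"
  shows "mcoeff (fps_subst F (mvar v)) m = 0"
proof -
  have "mcoeff (rat_const (fps_nth F k) * mvar v ^ k) m = 0" for k
    using assms by (cases "k = 0") (auto simp: rat_const_def mvar_power mcoeff_mmon when_def mconst_0)
  then show ?thesis unfolding fps_subst_def msum_def by simp
qed

lemma fps_ln_nth: "fps_nth (fps_ln (1::rat)) k = (if k = 0 then 0 else (-1) ^ (k - 1) / of_nat k)"
  by (cases k) (auto simp: fps_ln_def)

lemma mcoeff_L_single:
  assumes "e > 0" "k > 0"
  shows "mcoeff L_series (Poly_Mapping.single e k) = Poly_Mapping.single 0 (log_coeff e k)"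
proof -
  have "mcoeff (fps_subst (fps_ln 1) (mvar e')) (Poly_Mapping.single e k) = 0" if "e' \<noteq> e" for e'
    using that assms(2) by (intro mcoeff_fps_subst_mvar_zero) (auto simp: fps_ln_nth dest: single_eq_single[rotated])
  then show ?thesis
    unfolding L_series_def msum_def mcoeff_Mfps using assms
    by (subst Sum_any_single[of e])
      (auto simp: rat_const_def mcoeff_fps_subst_mvar mult_single fps_ln_nth log_coeff_def)
qed

lemma mcoeff_L_zero:
  assumes "\<And>e k. e > 0 \<Longrightarrow> k > 0 \<Longrightarrow> m \<noteq> Poly_Mapping.single e k"
  shows "mcoeff L_series m = 0"
proof -
  have "mcoeff (fps_subst (fps_ln 1) (mvar e)) m = 0" if "e \<ge> 1" for e
    using that assms by (intro mcoeff_fps_subst_mvar_zero) (auto simp: fps_ln_nth)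
  then have "(mcoeff (rat_const (of_int (moebius e) / of_nat e) * fps_subst (fps_ln 1) (mvar e)) m when e \<in> {1..}) = 0" for e
    by (simp add: rat_const_def when_def)
  then show ?thesis
    unfolding L_series_def msum_def mcoeff_Mfps by simp
qed

lemma laurent_adams_single: "laurent_adams i (Poly_Mapping.single a r) = Poly_Mapping.single (int i * a) r"
  by (simp add: laurent_adams_def)

lemma laurent_adams_0: "laurent_adams i 0 = 0"
  by (simp add: laurent_adams_def)

lemma adams_monomial_single:
  "k > 0 \<Longrightarrow> adams_monomial G (i, c) (Poly_Mapping.single e k) = Poly_Mapping.single (i * e, class_pow G c e) k"
  by (simp add: adams_monomial_def)

text \<open>\<open>L\<close> involves only powers of single variables, with
  \<open>log_coeff e k\<close> at \<open>p_e^k\<close>. As \<open>i > 0\<close>, the index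
  \<open>i * e\<close> determines \<open>e\<close>, so distinct variables of \<open>L\<close> keep
  distinct images and no two coefficients are added up.\<close>

lemma mcoeff_adams_L_single:
  assumes "i > 0" "e > 0" "k > 0"
  shows "mcoeff (adams G (i, c) (t_pow a * L_series)) (Poly_Mapping.single (i * e, class_pow G c e) k)
    = Poly_Mapping.single (int i * a) (log_coeff e k)"
proof -
  have "(laurent_adams i (mcoeff (t_pow a * L_series) m)
      when adams_monomial G (i, c) m = Poly_Mapping.single (i * e, class_pow G c e) k) = 0"
    if ne: "m \<noteq> Poly_Mapping.single e k" for m
  proof (cases "\<exists>e' k'. e' > 0 \<and> k' > 0 \<and> m = Poly_Mapping.single e' k'")
    case True
    then obtain e' k' where m: "e' > 0" "k' > 0" "m = Poly_Mapping.single e' k'" by blast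
    have "adams_monomial G (i, c) m \<noteq> Poly_Mapping.single (i * e, class_pow G c e) k"
    proof
      assume "adams_monomial G (i, c) m = Poly_Mapping.single (i * e, class_pow G c e) k"
      then have "Poly_Mapping.single (i * e', class_pow G c e') k' = Poly_Mapping.single (i * e, class_pow G c e) k"
        using m by (simp add: adams_monomial_single)
      from single_eq_single[OF _ this] m(2) have "i * e' = i * e" "k' = k" by auto
      then show False using ne m assms by simp
    qed
    then show ?thesis by simp
  next
    case False
    then have "mcoeff L_series m = 0" by (intro mcoeff_L_zero) blast
    then show ?thesis by (simp add: t_pow_def laurent_adams_0)
  qed
  then show ?thesis
    unfolding adams_def mcoeff_Mfps fst_conv using assms
    by (subst Sum_any_single[of "Poly_Mapping.single e k"])
      (auto simp: t_pow_def mcoeff_L_single mult_single laurent_adams_single adams_monomial_single)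
qed

lemma mcoeff_adams_L_zero:
  assumes "\<And>e k. e > 0 \<Longrightarrow> k > 0 \<Longrightarrow> q \<noteq> Poly_Mapping.single (i * e, class_pow G c e) k"
  shows "mcoeff (adams G (i, c) (t_pow a * L_series)) q = 0"
proof -
  have "(laurent_adams i (mcoeff (t_pow a * L_series) m) when adams_monomial G (i, c) m = q) = 0" for m
  proof (cases "\<exists>e' k'. e' > 0 \<and> k' > 0 \<and> m = Poly_Mapping.single e' k'")
    case True
    then obtain e' k' where m: "e' > 0" "k' > 0" "m = Poly_Mapping.single e' k'" by blast
    then have "adams_monomial G (i, c) m \<noteq> q"
      using assms[of e' k'] by (simp add: adams_monomial_single eq_commute[of _ q])
    then show ?thesis by simp
  next
    case False
    then have "mcoeff L_series m = 0" by (intro mcoeff_L_zero) blast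
    then show ?thesis by (simp add: t_pow_def laurent_adams_0)
  qed
  then show ?thesis unfolding adams_def mcoeff_Mfps fst_conv by simp
qed

text \<open>The variables \<open>p_i(c)\<close> such that \<open>p_i(c) \<circ> p_e\<close> is
  \<open>u\<close> for some \<open>e\<close>; only their substituted logarithms can involve
  \<open>u\<close>. Here \<open>e\<close> is the quotient of the degrees, and the class of
  \<open>u\<close> consists of the \<open>e\<close>-th powers of \<open>c\<close>.\<close>

definition root_vars :: "('g, 'b) monoid_scheme \<Rightarrow> nat \<times> 'g set \<Rightarrow> (nat \<times> 'g set) set" where
  "root_vars G u = {v \<in> cvars G. fst u > 0 \<and> fst v dvd fst u \<and> snd u = class_pow G (snd v) (fst u div fst v)}"

definition moeb_coeff :: "nat \<times> 'g set \<Rightarrow> nat \<times> 'g set \<Rightarrow> rat" where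
  "moeb_coeff v u = of_int (moebius (fst u div fst v)) / of_nat (fst u div fst v)"

lemma mcoeff_mvar_mult_pderiv:
  "mcoeff (mvar u * pderiv_mfps u f) q = of_nat (Poly_Mapping.lookup q u) * mcoeff f q"
proof (cases "\<exists>b. q = Poly_Mapping.single u 1 + b")
  case True
  then obtain b where b: "q = Poly_Mapping.single u 1 + b" by blast
  then have "mcoeff (mvar u * pderiv_mfps u f) q = mcoeff (pderiv_mfps u f) b"
    unfolding mvar_eq_mmon by (simp only: mcoeff_mmon_mult_add) simp
  then show ?thesis using b by (simp add: mcoeff_pderiv lookup_add add.commute)
next
  case False
  have "Poly_Mapping.lookup q u = 0"
  proof (rule ccontr)
    assume "Poly_Mapping.lookup q u \<noteq> 0"
    then have "q = Poly_Mapping.single u 1 + (q - Poly_Mapping.single u 1)"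
      by (intro poly_mapping_eqI) (auto simp: lookup_add lookup_minus lookup_single when_def)
    with False show False by blast
  qed
  moreover have "mcoeff (mvar u * pderiv_mfps u f) q = 0"
    unfolding mvar_eq_mmon using False by (intro mcoeff_mmon_mult_zero) blast
  ultimately show ?thesis by simp
qed

text \<open>For a root \<open>v = (i, c)\<close> of \<open>u\<close> the series
  \<open>p_i(c) \<circ> (t^a L)\<close> is \<open>t^(i a) \<mu>(e)/e log(1 + u)\<close> plus terms
  free of \<open>u\<close>; for other \<open>v\<close> it is free of \<open>u\<close>. Multiplying
  the derivative by \<open>1 + u\<close> clears the only denominator and leaves a constant, and this
  is what makes a finite recursion possible.\<close>

lemma pderiv_adams_L:
  assumes v: "v \<in> cvars G"
  shows "(1 + mvar u) * pderiv_mfps u (adams G v (t_pow a * L_series))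
    = mconst (if v \<in> root_vars G u then Poly_Mapping.single (int (fst v) * a) (moeb_coeff v u) else 0)"
    (is "_ = mconst ?\<beta>")
proof (rule mfps_eqI)
  fix q :: "nat \<times> 'a set \<Rightarrow>\<^sub>0 nat"
  obtain i c where ic: "v = (i, c)" by (cases v)
  then have i: "i > 0" using v by (auto simp: cvars_def)
  let ?A = "adams G v (t_pow a * L_series)"
  have lhs: "mcoeff ((1 + mvar u) * pderiv_mfps u ?A) q
    = of_nat (Poly_Mapping.lookup q u + 1) * mcoeff ?A (q + Poly_Mapping.single u 1)
      + of_nat (Poly_Mapping.lookup q u) * mcoeff ?A q"
    unfolding distrib_right mcoeff_add mcoeff_mvar_mult_pderiv by (simp add: mcoeff_pderiv)
  show "mcoeff ((1 + mvar u) * pderiv_mfps u ?A) q = mcoeff (mconst ?\<beta>) q"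
  proof (cases "v \<in> root_vars G u")
    case False
    have z: "mcoeff ?A (p + Poly_Mapping.single u 1) = 0" for p
      unfolding ic
    proof (rule mcoeff_adams_L_zero)
      fix e k :: nat assume "e > 0" "k > 0"
      show "p + Poly_Mapping.single u 1 \<noteq> Poly_Mapping.single (i * e, class_pow G c e) k"
      proof
        assume "p + Poly_Mapping.single u 1 = Poly_Mapping.single (i * e, class_pow G c e) k"
        from add_single_eq_single[OF this] have "u = (i * e, class_pow G c e)" by simp
        with False show False using v i \<open>e > 0\<close> by (auto simp: root_vars_def ic)
      qed
    qed
    have "of_nat (Poly_Mapping.lookup q u) * mcoeff ?A q = 0"
    proof (cases "Poly_Mapping.lookup q u = 0")
      case nz: False
      then have "q = (q - Poly_Mapping.single u 1) + Poly_Mapping.single u 1"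
        by (intro poly_mapping_eqI) (auto simp: lookup_add lookup_minus lookup_single when_def)
      then show ?thesis using z by (metis mult_zero_right)
    qed simp
    then show ?thesis unfolding lhs z using False by (simp add: mconst_0)
  next
    case True
    define e where "e = fst u div i"
    have u: "fst u > 0" "i dvd fst u" "snd u = class_pow G c e"
      using True by (simp_all add: root_vars_def ic e_def)
    have e1: "fst u = i * e"
      using u(2) by (simp add: e_def)
    then have "e > 0" using u(1) by (cases e) auto
    moreover have "u = (i * e, class_pow G c e)"
      using e1 u(3) by (simp add: prod_eq_iff)
    ultimately have e: "e > 0" "u = (i * e, class_pow G c e)" .
    have A: "mcoeff ?A (Poly_Mapping.single u k) = Poly_Mapping.single (int i * a) (log_coeff e k)" if "k > 0" for k
      unfolding ic e(2) using i e(1) that by (rule mcoeff_adams_L_single)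
    have kA: "of_nat k * mcoeff ?A (Poly_Mapping.single u k)
        = Poly_Mapping.single (int i * a) (moeb_coeff v u * (-1) ^ (k - 1))" if "k > 0" for k
      unfolding A[OF that] laurent_of_nat mult_single using that
      by (simp add: log_coeff_def moeb_coeff_def ic e_def)
    show ?thesis
    proof (cases "\<exists>k. q = Poly_Mapping.single u k")
      case qk: True
      then obtain k where k: "q = Poly_Mapping.single u k" by blast
      then have q1: "q + Poly_Mapping.single u 1 = Poly_Mapping.single u (k + 1)"
        by (simp add: single_add[symmetric])
      have "mcoeff ((1 + mvar u) * pderiv_mfps u ?A) q
         = of_nat (k + 1) * mcoeff ?A (Poly_Mapping.single u (k + 1)) + of_nat k * mcoeff ?A (Poly_Mapping.single u k)"
        unfolding lhs q1 by (simp add: k)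
      \<comment> \<open>The coefficients of the logarithm, multiplied by their exponents, differ
        only in sign, so the two neighbouring terms cancel unless \<open>k = 0\<close>, where the
        second one is absent.\<close>
      also have "\<dots> = mcoeff (mconst ?\<beta>) q"
      proof (cases k)
        case 0
        then show ?thesis using kA[of 1] True by (simp add: k mconst_def ic)
      next
        case (Suc j)
        have "Poly_Mapping.single u k \<noteq> 0" 
        proof
          assume "Poly_Mapping.single u k = 0"
          then have "Poly_Mapping.lookup (Poly_Mapping.single u k) u = 0" by (simp only: lookup_zero)
          then show False using Suc by simp
        qed
        then show ?thesis using kA[of k] kA[of "k+1"] Suc
          by (simp add: k mconst_def single_add[symmetric])
      qed
      finally show ?thesis .
    next
      case qk: False
      have z: "mcoeff ?A p = 0" if "\<forall>k. p \<noteq> Poly_Mapping.single u k" "Poly_Mapping.lookup p u > 0" for p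
        unfolding ic
      proof (rule mcoeff_adams_L_zero)
        fix e' k :: nat assume "e' > 0" "k > 0"
        show "p \<noteq> Poly_Mapping.single (i * e', class_pow G c e') k"
          using that by (auto simp: lookup_single when_def split: if_splits)
      qed
      have 1: "\<forall>k. q + Poly_Mapping.single u 1 \<noteq> Poly_Mapping.single u k"
        using qk add_single_eq_single[of q u u] by auto
      have "q \<noteq> 0" using qk by (metis single_zero)
      then show ?thesis
        unfolding lhs using z[OF 1] z[of q] qk by (cases "Poly_Mapping.lookup q u = 0") (auto simp: lookup_add mconst_def)
    qed
  qed
qed

text \<open>The reason why the plethysm converges: monomials of weight above \<open>wt q\<close>
  cannot contribute to the coefficient at \<open>q\<close>.\<close>

lemma order_ge_adams_L:
  assumes "i > 0"
  shows "order_ge i (adams G (i, c) (t_pow a * L_series))"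
  unfolding order_ge_def
proof (intro allI impI)
  fix m :: "nat \<times> 'a set \<Rightarrow>\<^sub>0 nat" assume m: "wt m < i"
  show "mcoeff (adams G (i, c) (t_pow a * L_series)) m = 0"
  proof (rule mcoeff_adams_L_zero)
    fix e k :: nat assume "e > 0" "k > 0"
    then have "i \<le> i * e * k" using assms by simp
    with m show "m \<noteq> Poly_Mapping.single (i * e, class_pow G c e) k" by auto
  qed
qed

definition Mlaur :: "('g, 'b) monoid_scheme \<Rightarrow> int \<Rightarrow> nat \<times> 'g set \<Rightarrow> laurent" where
  "Mlaur G a u = (\<Sum>v\<in>root_vars G u. Poly_Mapping.single (int (fst v) * a) (cweight G v * moeb_coeff v u))"

lemma finite_conj_classes: "finite (carrier G) \<Longrightarrow> finite (conj_classes G)"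
  by (simp add: conj_classes_def)

lemma finite_root_vars:
  assumes "finite (carrier G)"
  shows "finite (root_vars G u)"
proof (rule finite_subset)
  show "root_vars G u \<subseteq> {..fst u} \<times> conj_classes G"
    by (auto simp: root_vars_def cvars_def dvd_imp_le)
qed (simp add: assms finite_conj_classes)

section \<open>The plethysm as solution of a differential equation\<close>

definition monos_upto :: "('g, 'b) monoid_scheme \<Rightarrow> nat \<Rightarrow> (nat \<times> 'g set \<Rightarrow>\<^sub>0 nat) set" where
  "monos_upto G D = {m. Poly_Mapping.keys m \<subseteq> cvars G \<and> wt m \<le> D}"

lemma finite_monos_upto:
  assumes "finite (carrier G)"
  shows "finite (monos_upto G D)"
proof -
  define V where "V = {..D} \<times> conj_classes G"
  have V: "finite V" using assms by (simp add: V_def finite_conj_classes)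
  define F where "F = {f :: nat \<times> 'a set \<Rightarrow> nat. \<forall>v. (v \<in> V \<longrightarrow> f v \<in> {..D}) \<and> (v \<notin> V \<longrightarrow> f v = 0)}"
  have "finite F" unfolding F_def using V by (intro finite_set_of_finite_funs) auto
  moreover have "Poly_Mapping.lookup ` monos_upto G D \<subseteq> F"
  proof clarify
    fix m assume m: "m \<in> monos_upto G D"
    have le: "fst v * Poly_Mapping.lookup m v \<le> D" if "v \<in> Poly_Mapping.keys m" for v
    proof -
      have "fst v * Poly_Mapping.lookup m v \<le> wt m"
        unfolding weight_def using that by (intro member_le_sum) auto
      then show ?thesis using m by (simp add: monos_upto_def)
    qed
    have *: "Poly_Mapping.lookup m v \<le> D \<and> v \<in> V" if "Poly_Mapping.lookup m v \<noteq> 0" for v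
    proof -
      have v: "v \<in> Poly_Mapping.keys m" using that by (simp add: in_keys_iff)
      then have "v \<in> cvars G" using m by (auto simp: monos_upto_def)
      then have "fst v \<ge> 1" "snd v \<in> conj_classes G" by (auto simp: cvars_def)
      moreover have "fst v \<le> D" "Poly_Mapping.lookup m v \<le> D"
        using le[OF v] that \<open>fst v \<ge> 1\<close> by (metis le_trans mult_le_mono1 mult_le_mono2 mult.right_neutral mult_1 Suc_leI gr0I One_nat_def)+
      ultimately show ?thesis by (cases v) (auto simp: V_def)
    qed
    have "Poly_Mapping.lookup m v \<le> D" for v
      using *[of v] by (cases "Poly_Mapping.lookup m v = 0") auto
    moreover have "v \<notin> V \<Longrightarrow> Poly_Mapping.lookup m v = 0" for v
      using *[of v] by blast
    ultimately show "Poly_Mapping.lookup m \<in> F" unfolding F_def by simp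
  qed
  moreover have "inj_on Poly_Mapping.lookup (monos_upto G D)"
    by (simp add: inj_on_def)
  ultimately show ?thesis using inj_on_finite by blast
qed

definition pterm :: "('g, 'b) monoid_scheme \<Rightarrow> int \<Rightarrow> (nat \<times> 'g set \<Rightarrow>\<^sub>0 nat) \<Rightarrow> (nat \<times> 'g set) series" where
  "pterm G a m = mconst (mcoeff (Exp_series G) m) *
     (\<Prod>v\<in>Poly_Mapping.keys m. adams G v (t_pow a * L_series) ^ Poly_Mapping.lookup m v)"

lemma pterm_zero: "\<not> Poly_Mapping.keys m \<subseteq> cvars G \<Longrightarrow> pterm G a m = 0"
  by (simp add: pterm_def Exp_zero mconst_0)

lemma mcoeff_pterm_zero:
  assumes "m \<notin> monos_upto G (wt q)"
  shows "mcoeff (pterm G a m) q = 0"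
proof (cases "Poly_Mapping.keys m \<subseteq> cvars G")
  case True
  then have "wt q < wt m" using assms by (simp add: monos_upto_def)
  have "order_ge (\<Sum>v\<in>Poly_Mapping.keys m. fst v * Poly_Mapping.lookup m v)
     (\<Prod>v\<in>Poly_Mapping.keys m. adams G v (t_pow a * L_series) ^ Poly_Mapping.lookup m v)"
  proof (intro order_ge_prod order_ge_power)
    fix v assume "v \<in> Poly_Mapping.keys m"
    then have "fst v > 0" using True by (auto simp: cvars_def)
    then show "order_ge (fst v) (adams G v (t_pow a * L_series))"
      using order_ge_adams_L[of "fst v" G "snd v" a] by simp
  qed
  then show ?thesis using \<open>wt q < wt m\<close> by (simp add: order_ge_def pterm_def weight_def)
qed (simp add: pterm_zero)

lemma monos_mono: "D \<le> D' \<Longrightarrow> monos_upto G D \<subseteq> monos_upto G D'"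
  by (auto simp: monos_upto_def)

definition Fser :: "('g, 'b) monoid_scheme \<Rightarrow> int \<Rightarrow> (nat \<times> 'g set) series" where
  "Fser G a = plethysm G (Exp_series G) (t_pow a * L_series)"

text \<open>The bound \<open>D\<close> is left free so that coefficients at different monomials can
  be summed over a common index set in \<open>Fser_rec\<close>.\<close>

lemma mcoeff_Fser:
  assumes "finite (carrier G)" "wt q \<le> D"
  shows "mcoeff (Fser G a) q = (\<Sum>m\<in>monos_upto G D. mcoeff (pterm G a m) q)"
proof -
  have "mcoeff (Fser G a) q = Sum_any (\<lambda>m. mcoeff (pterm G a m) q)"
    by (simp add: Fser_def plethysm_def msum_def pterm_def)
  also have "\<dots> = (\<Sum>m\<in>monos_upto G D. mcoeff (pterm G a m) q)"
    using mcoeff_pterm_zero monos_mono[OF assms(2)]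
    by (intro Sum_any.expand_superset finite_monos_upto assms) blast
  finally show ?thesis .
qed

text \<open>The operator \<open>(1 + u) \<partial>/\<partial>u\<close> turns one factor of the
  product into a constant, by \<open>pderiv_adams_L\<close>. What remains is again a summand of the
  plethysm, for the monomial with one factor \<open>v\<close> less, so the family of summands is
  closed under the operator.\<close>

lemma pterm_pderiv:
  assumes m: "Poly_Mapping.keys m \<subseteq> cvars G"
  shows "(1 + mvar u) * pderiv_mfps u (pterm G a m)
    = (\<Sum>v\<in>Poly_Mapping.keys m. mconst (Poly_Mapping.single 0 (cweight G v) *
        (if v \<in> root_vars G u then Poly_Mapping.single (int (fst v) * a) (moeb_coeff v u) else 0))
        * pterm G a (m - Poly_Mapping.single v 1))"
proof -
  let ?K = "Poly_Mapping.keys m" and ?E = "mcoeff (Exp_series G)" and ?A = "\<lambda>v. adams G v (t_pow a * L_series)"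
  let ?\<beta> = "\<lambda>v. if v \<in> root_vars G u then Poly_Mapping.single (int (fst v) * a) (moeb_coeff v u) else 0 :: laurent"
  have "(1 + mvar u) * pderiv_mfps u (pterm G a m)
    = mconst (?E m) * (\<Sum>v\<in>?K. of_nat (Poly_Mapping.lookup m v) * ((1 + mvar u) * pderiv_mfps u (?A v)) *
       (\<Prod>w\<in>?K. ?A w ^ (Poly_Mapping.lookup m w - (if w = v then 1 else 0))))"
    unfolding pterm_def pderiv_const_mult
    by (subst pderiv_prod_power) (simp_all add: sum_distrib_left ac_simps)
  also have "\<dots> = (\<Sum>v\<in>?K. mconst (?E m) * (of_nat (Poly_Mapping.lookup m v) * ((1 + mvar u) * pderiv_mfps u (?A v)) *
       (\<Prod>w\<in>?K. ?A w ^ (Poly_Mapping.lookup m w - (if w = v then 1 else 0)))))"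
    by (rule sum_distrib_left)
  also have "\<dots> = (\<Sum>v\<in>?K. mconst (Poly_Mapping.single 0 (cweight G v) * ?\<beta> v) * pterm G a (m - Poly_Mapping.single v 1))"
  proof (intro sum.cong refl)
    fix v assume v: "v \<in> ?K"
    let ?m = "m - Poly_Mapping.single v 1"
    have vc: "v \<in> cvars G" using v m by blast
    have mm: "?m + Poly_Mapping.single v 1 = m"
      using v by (intro poly_mapping_eqI) (auto simp: lookup_add lookup_minus lookup_single when_def in_keys_iff)
    have l: "Poly_Mapping.lookup ?m v + 1 = Poly_Mapping.lookup m v"
      using v by (simp add: lookup_minus in_keys_iff)
    \<comment> \<open>The exponent brought down by the derivative is exactly what the recursion of
      the exponential series absorbs.\<close>
    have E: "of_nat (Poly_Mapping.lookup m v) * ?E m = Poly_Mapping.single 0 (cweight G v) * ?E ?m"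
      using Exp_rec[of ?m v G] vc unfolding mm l by simp
    have "Poly_Mapping.keys ?m \<subseteq> ?K"
      by (auto simp: in_keys_iff lookup_minus)
    then have "(\<Prod>w\<in>Poly_Mapping.keys ?m. ?A w ^ Poly_Mapping.lookup ?m w) = (\<Prod>w\<in>?K. ?A w ^ Poly_Mapping.lookup ?m w)"
      by (intro prod.mono_neutral_left) (auto simp: in_keys_iff)
    also have "\<dots> = (\<Prod>w\<in>?K. ?A w ^ (Poly_Mapping.lookup m w - (if w = v then 1 else 0)))"
      by (intro prod.cong) (auto simp: lookup_minus lookup_single when_def)
    finally have P: "(\<Prod>w\<in>?K. ?A w ^ (Poly_Mapping.lookup m w - (if w = v then 1 else 0)))
      = (\<Prod>w\<in>Poly_Mapping.keys ?m. ?A w ^ Poly_Mapping.lookup ?m w)" by simp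
    have "mconst (?E m) * (of_nat (Poly_Mapping.lookup m v) * ((1 + mvar u) * pderiv_mfps u (?A v)) * X)
      = mconst (of_nat (Poly_Mapping.lookup m v) * ?E m * ?\<beta> v) * X" for X
      unfolding pderiv_adams_L[OF vc] mfps_of_nat
      by (simp only: mconst_mult[symmetric] mult.assoc) (simp only: ac_simps)
    also have "mconst (of_nat (Poly_Mapping.lookup m v) * ?E m * ?\<beta> v) * X
      = mconst (Poly_Mapping.single 0 (cweight G v) * ?\<beta> v) * (mconst (?E ?m) * X)" for X
      unfolding E by (simp only: mconst_mult[symmetric] mult.assoc) (simp only: ac_simps)
    finally show "mconst (?E m) * (of_nat (Poly_Mapping.lookup m v) * ((1 + mvar u) * pderiv_mfps u (?A v)) *
       (\<Prod>w\<in>?K. ?A w ^ (Poly_Mapping.lookup m w - (if w = v then 1 else 0))))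
      = mconst (Poly_Mapping.single 0 (cweight G v) * ?\<beta> v) * pterm G a ?m"
      unfolding P pterm_def .
  qed
  finally show ?thesis .
qed

text \<open>
  The coefficient form of \<open>(1 + p\<^sub>u) \<partial>F/\<partial>p\<^sub>u = M\<^sub>u F\<close>, which avoids expanding the plethysm.
\<close>
lemma Fser_rec:
  assumes fin: "finite (carrier G)"
  shows "mcoeff (Fser G a) (q + Poly_Mapping.single u 1)
    = Poly_Mapping.single 0 (1 / of_nat (Poly_Mapping.lookup q u + 1))
      * ((Mlaur G a u - of_nat (Poly_Mapping.lookup q u)) * mcoeff (Fser G a) q)"
proof -
  let ?q = "q + Poly_Mapping.single u 1"
  let ?D = "wt ?q"
  let ?c = "\<lambda>v. Poly_Mapping.single (int (fst v) * a) (cweight G v * moeb_coeff v u)"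
  let ?\<beta> = "\<lambda>v. if v \<in> root_vars G u then Poly_Mapping.single (int (fst v) * a) (moeb_coeff v u) else 0 :: laurent"
  have D: "wt q \<le> ?D" by (simp add: weight_add)
  have "of_nat (Poly_Mapping.lookup q u + 1) * mcoeff (Fser G a) ?q + of_nat (Poly_Mapping.lookup q u) * mcoeff (Fser G a) q
    = (\<Sum>m\<in>monos_upto G ?D. of_nat (Poly_Mapping.lookup q u + 1) * mcoeff (pterm G a m) ?q
        + of_nat (Poly_Mapping.lookup q u) * mcoeff (pterm G a m) q)"
    unfolding mcoeff_Fser[OF fin D] mcoeff_Fser[OF fin order.refl[of ?D]]
    by (simp only: sum.distrib sum_distrib_left)
  also have "\<dots> = (\<Sum>m\<in>monos_upto G ?D. mcoeff ((1 + mvar u) * pderiv_mfps u (pterm G a m)) q)"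
    unfolding distrib_right mcoeff_add mcoeff_mvar_mult_pderiv mult_1 mcoeff_pderiv ..
  also have "\<dots> = (\<Sum>m\<in>monos_upto G ?D. \<Sum>v\<in>Poly_Mapping.keys m.
      Poly_Mapping.single 0 (cweight G v) * ?\<beta> v * mcoeff (pterm G a (m - Poly_Mapping.single v 1)) q)"
    by (intro sum.cong refl) (simp add: pterm_pderiv monos_upto_def del: distrib_right)
  also have "\<dots> = (\<Sum>m\<in>monos_upto G ?D. \<Sum>v\<in>root_vars G u.
      if v \<in> Poly_Mapping.keys m then ?c v * mcoeff (pterm G a (m - Poly_Mapping.single v 1)) q else 0)"
  proof (rule sum.cong[OF refl])
    fix m assume "m \<in> monos_upto G ?D"
    show "(\<Sum>v\<in>Poly_Mapping.keys m. Poly_Mapping.single 0 (cweight G v) * ?\<beta> v * mcoeff (pterm G a (m - Poly_Mapping.single v 1)) q)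
      = (\<Sum>v\<in>root_vars G u. if v \<in> Poly_Mapping.keys m then ?c v * mcoeff (pterm G a (m - Poly_Mapping.single v 1)) q else 0)"
      (is "sum ?f _ = sum ?g _")
    proof -
      have "sum ?f (Poly_Mapping.keys m) = sum ?f (Poly_Mapping.keys m \<inter> root_vars G u)"
        by (rule sum.mono_neutral_right) auto
      also have "\<dots> = sum ?g (Poly_Mapping.keys m \<inter> root_vars G u)"
        by (intro sum.cong) (auto simp: mult_single)
      also have "\<dots> = sum ?g (root_vars G u)"
        using finite_root_vars[OF fin] by (intro sum.mono_neutral_left) auto
      finally show ?thesis .
    qed
  qed
  also have "\<dots> = (\<Sum>v\<in>root_vars G u. \<Sum>m\<in>monos_upto G ?D.
      if v \<in> Poly_Mapping.keys m then ?c v * mcoeff (pterm G a (m - Poly_Mapping.single v 1)) q else 0)"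
    by (rule sum.swap)
  also have "\<dots> = (\<Sum>v\<in>root_vars G u. ?c v * mcoeff (Fser G a) q)"
  proof (intro sum.cong refl)
    fix v assume v: "v \<in> root_vars G u"
    then have vc: "v \<in> cvars G" and le: "fst v \<le> fst u" by (auto simp: root_vars_def dvd_imp_le)
    \<comment> \<open>A root of \<open>u\<close> has degree at most that of \<open>u\<close>, so
      after the removal of one factor \<open>v\<close> the range still contains every monomial that
      reaches \<open>q\<close>.\<close>
    have D': "wt q \<le> ?D - fst v" using le by (simp add: weight_add)
    have "(\<Sum>m\<in>monos_upto G ?D. if v \<in> Poly_Mapping.keys m then ?c v * mcoeff (pterm G a (m - Poly_Mapping.single v 1)) q else 0)
      = (\<Sum>m\<in>{m \<in> monos_upto G ?D. v \<in> Poly_Mapping.keys m}. ?c v * mcoeff (pterm G a (m - Poly_Mapping.single v 1)) q)"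
      by (rule sum.inter_filter[symmetric]) (rule finite_monos_upto[OF fin])
    also have "\<dots> = (\<Sum>m\<in>monos_upto G (?D - fst v). ?c v * mcoeff (pterm G a m) q)"
    proof (rule sum.reindex_bij_witness[of _ "\<lambda>m. m + Poly_Mapping.single v 1" "\<lambda>m. m - Poly_Mapping.single v 1"])
      fix m assume m: "m \<in> {m \<in> monos_upto G ?D. v \<in> Poly_Mapping.keys m}"
      show mm: "m - Poly_Mapping.single v 1 + Poly_Mapping.single v 1 = m"
        using m by (intro poly_mapping_eqI) (auto simp: lookup_add lookup_minus lookup_single when_def in_keys_iff)
      have "wt m = wt (m - Poly_Mapping.single v 1) + fst v"
        by (subst mm[symmetric]) (simp only: weight_add weight_single mult_1_right)
      moreover have "Poly_Mapping.keys (m - Poly_Mapping.single v 1) \<subseteq> Poly_Mapping.keys m"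
        by (auto simp: in_keys_iff lookup_minus)
      ultimately show "m - Poly_Mapping.single v 1 \<in> monos_upto G (?D - fst v)"
        using m by (auto simp: monos_upto_def)
    next
      fix m assume m: "m \<in> monos_upto G (?D - fst v)"
      show "m + Poly_Mapping.single v 1 - Poly_Mapping.single v 1 = m"
        by simp
      have "fst v \<le> ?D" using le by (simp add: weight_add)
      moreover have "Poly_Mapping.keys (m + Poly_Mapping.single v 1) \<subseteq> cvars G"
        using m vc Poly_Mapping.keys_add[of m "Poly_Mapping.single v 1"] by (auto simp: monos_upto_def)
      moreover have "v \<in> Poly_Mapping.keys (m + Poly_Mapping.single v 1)"
        by (simp add: in_keys_iff lookup_add)
      ultimately show "m + Poly_Mapping.single v 1 \<in> {m \<in> monos_upto G ?D. v \<in> Poly_Mapping.keys m}"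
        using m by (auto simp: monos_upto_def weight_add)
    qed simp
    also have "\<dots> = ?c v * mcoeff (Fser G a) q"
      unfolding mcoeff_Fser[OF fin D'] by (rule sum_distrib_left[symmetric])
    finally show "(\<Sum>m\<in>monos_upto G ?D. if v \<in> Poly_Mapping.keys m then ?c v * mcoeff (pterm G a (m - Poly_Mapping.single v 1)) q else 0)
      = ?c v * mcoeff (Fser G a) q" .
  qed
  also have "\<dots> = Mlaur G a u * mcoeff (Fser G a) q"
    unfolding Mlaur_def by (rule sum_distrib_right[symmetric])
  finally have "of_nat (Poly_Mapping.lookup q u + 1) * mcoeff (Fser G a) ?q
    = (Mlaur G a u - of_nat (Poly_Mapping.lookup q u)) * mcoeff (Fser G a) q"
    by (simp add: algebra_simps)
  then show ?thesis
    by (subst (asm) laurent_of_nat_cancel) simp_all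
qed

lemma Fser_0:
  assumes fin: "finite (carrier G)"
  shows "mcoeff (Fser G a) 0 = 1"
proof -
  have "monos_upto G 0 = {0}"
  proof (intro subset_antisym subsetI)
    fix m assume m: "m \<in> monos_upto G 0"
    have "Poly_Mapping.keys m = {}"
    proof (rule ccontr)
      assume "Poly_Mapping.keys m \<noteq> {}"
      then obtain v where v: "v \<in> Poly_Mapping.keys m" by blast
      then have "fst v > 0" using m by (auto simp: monos_upto_def cvars_def)
      moreover have "fst v * Poly_Mapping.lookup m v \<le> wt m"
        unfolding weight_def using v by (intro member_le_sum) auto
      ultimately show False using m v by (simp add: monos_upto_def in_keys_iff)
    qed
    then show "m \<in> {0}" by simp
  qed (simp add: monos_upto_def)
  then show ?thesis
    using mcoeff_Fser[OF fin, of 0 0 a] by (simp add: pterm_def Exp_0 mcoeff_one mconst_def)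
qed

section \<open>Polynomials evaluated at powers of t\<close>

definition laurent_subst :: "int \<Rightarrow> rat poly \<Rightarrow> laurent" where
  "laurent_subst a p = poly (map_poly (Poly_Mapping.single 0) p) (Poly_Mapping.single a 1)"

lemma laurent_subst_0 [simp]: "laurent_subst a 0 = 0"
  by (simp add: laurent_subst_def)

lemma laurent_subst_pCons:
  "laurent_subst a (pCons c p) = Poly_Mapping.single 0 c + Poly_Mapping.single a 1 * laurent_subst a p"
  by (simp add: laurent_subst_def map_poly_pCons)

lemma laurent_subst_add: "laurent_subst a (p + q) = laurent_subst a p + laurent_subst a q"
proof (induction p arbitrary: q)
  case (pCons c p)
  show ?case
    by (cases q) (simp only: add_pCons laurent_subst_pCons pCons.IH single_add, simp add: algebra_simps)
qed simp

lemma laurent_subst_smult: "laurent_subst a (Polynomial.smult r p) = Poly_Mapping.single 0 r * laurent_subst a p"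
  by (induction p) (simp_all add: laurent_subst_pCons mult_single algebra_simps)

lemma laurent_subst_mult: "laurent_subst a (p * q) = laurent_subst a p * laurent_subst a q"
  by (induction p) (simp_all add: laurent_subst_pCons laurent_subst_add laurent_subst_smult algebra_simps)

lemma laurent_subst_diff: "laurent_subst a (p - q) = laurent_subst a p - laurent_subst a q"
  using laurent_subst_add[of a "p - q" q] by (simp add: algebra_simps)

lemma laurent_subst_sum: "laurent_subst a (sum f A) = (\<Sum>i\<in>A. laurent_subst a (f i))"
  by (induction A rule: infinite_finite_induct) (simp_all add: laurent_subst_add)

lemma laurent_subst_monom: "laurent_subst a (monom r k) = Poly_Mapping.single (int k * a) r"
  by (induction k) (simp_all add: monom_0 monom_Suc laurent_subst_pCons mult_single algebra_simps)

lemma laurent_subst_const: "laurent_subst a [:r:] = Poly_Mapping.single 0 r"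
  using laurent_subst_monom[of a r 0] by (simp add: monom_0)

lemma laurent_subst_1: "laurent_subst a 1 = 1"
  unfolding one_pCons laurent_subst_const by simp

text \<open>
  The value at \<open>s\<close> is the number of orbits of type \<open>u\<close> of sequences over a free \<open>G\<close>-set with \<open>s\<close>
  elements.
\<close>
definition orbit_poly :: "('g, 'b) monoid_scheme \<Rightarrow> nat \<times> 'g set \<Rightarrow> rat poly" where
  "orbit_poly G u = (\<Sum>v\<in>root_vars G u. monom (cweight G v * moeb_coeff v u) (fst v))"

lemma laurent_subst_orbit_poly: "laurent_subst a (orbit_poly G u) = Mlaur G a u"
  by (simp add: orbit_poly_def Mlaur_def laurent_subst_sum laurent_subst_monom)

text \<open>The inner product is the binomial coefficient of \<open>orbit_poly G u\<close> over
  \<open>lookup m u\<close>. It is kept as a polynomial because it is evaluated at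
  \<open>t^a\<close> for two values of \<open>a\<close> on one side and at integers on the
  other.\<close>

definition choose_poly :: "('g, 'b) monoid_scheme \<Rightarrow> (nat \<times> 'g set \<Rightarrow>\<^sub>0 nat) \<Rightarrow> rat poly" where
  "choose_poly G m = (\<Prod>u\<in>Poly_Mapping.keys m. \<Prod>l<Poly_Mapping.lookup m u.
     Polynomial.smult (1 / of_nat (l + 1)) (orbit_poly G u - [:of_nat l:]))"

lemma choose_poly_superset:
  assumes "finite V" "Poly_Mapping.keys m \<subseteq> V"
  shows "choose_poly G m = (\<Prod>u\<in>V. \<Prod>l<Poly_Mapping.lookup m u.
     Polynomial.smult (1 / of_nat (l + 1)) (orbit_poly G u - [:of_nat l:]))"
  unfolding choose_poly_def using assms by (intro prod.mono_neutral_left) (auto simp: in_keys_iff)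

text \<open>This is the recursion of \<open>Fser_rec\<close>. Together with the value 1 at the
  trivial monomial it identifies the two families in \<open>mcoeff_Fser_choose_poly\<close>.\<close>

lemma choose_poly_add_single:
  "choose_poly G (m + Poly_Mapping.single u 1) = choose_poly G m *
     Polynomial.smult (1 / of_nat (Poly_Mapping.lookup m u + 1)) (orbit_poly G u - [:of_nat (Poly_Mapping.lookup m u):])"
proof -
  let ?f = "\<lambda>u l. Polynomial.smult (1 / of_nat (l + 1)) (orbit_poly G u - [:of_nat l:])"
  let ?V = "insert u (Poly_Mapping.keys m)" and ?W = "Poly_Mapping.keys m - {u}"
  have V: "?V = insert u ?W" by auto
  have k: "Poly_Mapping.keys (m + Poly_Mapping.single u 1) \<subseteq> ?V" "Poly_Mapping.keys m \<subseteq> ?V"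
    using Poly_Mapping.keys_add[of m "Poly_Mapping.single u 1"] by auto
  have "choose_poly G (m + Poly_Mapping.single u 1) = (\<Prod>l<Poly_Mapping.lookup m u + 1. ?f u l)
     * (\<Prod>w\<in>?W. \<Prod>l<Poly_Mapping.lookup (m + Poly_Mapping.single u 1) w. ?f w l)"
    using k by (subst choose_poly_superset[of ?V]) (simp_all add: prod.insert_remove lookup_add)
  also have "(\<Prod>w\<in>?W. \<Prod>l<Poly_Mapping.lookup (m + Poly_Mapping.single u 1) w. ?f w l)
     = (\<Prod>w\<in>?W. \<Prod>l<Poly_Mapping.lookup m w. ?f w l)"
    by (intro prod.cong) (auto simp: lookup_add lookup_single when_def)
  also have "(\<Prod>l<Poly_Mapping.lookup m u + 1. ?f u l)
      = (\<Prod>l<Poly_Mapping.lookup m u. ?f u l) * ?f u (Poly_Mapping.lookup m u)"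
    by (simp only: Suc_eq_plus1[symmetric] prod.lessThan_Suc)
  also have "\<dots> * (\<Prod>w\<in>?W. \<Prod>l<Poly_Mapping.lookup m w. ?f w l)
     = choose_poly G m * ?f u (Poly_Mapping.lookup m u)"
    using k by (subst choose_poly_superset[of ?V m]) (simp_all add: prod.insert_remove ac_simps)
  finally show ?thesis .
qed

lemma monomial_induct [case_names zero step]:
  fixes m :: "'v \<Rightarrow>\<^sub>0 nat"
  assumes "P 0" "\<And>m u. P m \<Longrightarrow> P (m + Poly_Mapping.single u 1)"
  shows "P m"
proof (induction "weight (\<lambda>_. 1) m" arbitrary: m)
  case 0
  have "Poly_Mapping.keys m = {}"
  proof (rule ccontr)
    assume "Poly_Mapping.keys m \<noteq> {}"
    then obtain v where v: "v \<in> Poly_Mapping.keys m" by blast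
    have "1 * Poly_Mapping.lookup m v \<le> weight (\<lambda>_. 1) m"
      unfolding weight_def using v by (intro member_le_sum) auto
    with 0 v show False by (simp add: in_keys_iff)
  qed
  then show ?case using assms(1) by simp
next
  case (Suc k)
  then have "m \<noteq> 0" by auto
  then obtain u where u: "Poly_Mapping.lookup m u \<noteq> 0" by (metis lookup_zero poly_mapping_eqI)
  have m: "m - Poly_Mapping.single u 1 + Poly_Mapping.single u 1 = m"
    using u by (intro poly_mapping_eqI) (auto simp: lookup_add lookup_minus lookup_single when_def)
  have "weight (\<lambda>_. 1) (m - Poly_Mapping.single u 1) + 1 = weight (\<lambda>_. 1) m"
    by (subst (2) m[symmetric]) (simp only: weight_add weight_single mult_1_right)
  then have "P (m - Poly_Mapping.single u 1)" using Suc by simp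
  then show ?case using assms(2) m by metis
qed

lemma mcoeff_Fser_choose_poly:
  assumes fin: "finite (carrier G)"
  shows "mcoeff (Fser G a) m = laurent_subst a (choose_poly G m)"
proof (induction m rule: monomial_induct)
  case zero
  then show ?case by (simp add: Fser_0[OF fin] choose_poly_def laurent_subst_1)
next
  case (step m u)
  show ?case
    unfolding Fser_rec[OF fin] choose_poly_add_single laurent_subst_mult laurent_subst_smult
      laurent_subst_diff laurent_subst_orbit_poly laurent_subst_const laurent_of_nat step.IH
    by (simp only: ac_simps)
qed

lemma poly_choose_poly:
  assumes "\<And>u. u \<in> Poly_Mapping.keys m \<Longrightarrow> poly (orbit_poly G u) s = of_nat (N u)"
  shows "poly (choose_poly G m) s = of_nat (\<Prod>u\<in>Poly_Mapping.keys m. N u choose Poly_Mapping.lookup m u)"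
proof -
  have "(\<Prod>l<k. (of_nat n - of_nat l) / of_nat (l + 1)) = (of_nat (n choose k) :: rat)" for n k
  proof -
    have "(\<Prod>l<k. (of_nat n - of_nat l) / of_nat (l + 1))
      = (\<Prod>l = 0..<k. of_nat n - of_nat l) / (fact k :: rat)"
      by (simp add: prod_dividef fact_prod_Suc lessThan_atLeast0)
    also have "\<dots> = of_nat (n choose k)"
      by (simp add: binomial_gbinomial gbinomial_prod_rev)
    finally show ?thesis .
  qed
  then show ?thesis using assms
    by (simp add: choose_poly_def poly_prod of_nat_prod)
qed

section \<open>Powers of conjugacy classes and the outer substitution\<close>

context group
begin

lemma conj_pow:
  "g \<in> carrier G \<Longrightarrow> a \<in> carrier G \<Longrightarrow> (g \<otimes> a \<otimes> inv g) [^] (e :: nat) = g \<otimes> (a [^] e) \<otimes> inv g"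
proof (induction e)
  case (Suc e)
  have "g \<otimes> a [^] e \<otimes> inv g \<otimes> (g \<otimes> a \<otimes> inv g) = g \<otimes> a [^] e \<otimes> (inv g \<otimes> g) \<otimes> a \<otimes> inv g"
    using Suc.prems by (simp only: m_assoc m_closed inv_closed nat_pow_closed)
  then show ?case using Suc by (simp add: m_assoc)
qed simp

lemma class_pow_conj_class:
  "a \<in> carrier G \<Longrightarrow> class_pow G (conj_class G a) e = conj_class G (a [^] e)"
  unfolding class_pow_def conj_class_def by (force simp: conj_pow image_iff)

lemma class_pow_in_conj_classes:
  "c \<in> conj_classes G \<Longrightarrow> class_pow G c e \<in> conj_classes G"
  by (auto simp: conj_classes_def class_pow_conj_class)

lemma conj_class_subset: "c \<in> conj_classes G \<Longrightarrow> c \<subseteq> carrier G"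
  by (auto simp: conj_classes_def conj_class_def)

lemma class_pow_1: "c \<in> conj_classes G \<Longrightarrow> class_pow G c 1 = c"
proof -
  assume "c \<in> conj_classes G"
  then obtain a where "a \<in> carrier G" "c = conj_class G a" by (auto simp: conj_classes_def)
  then show ?thesis using class_pow_conj_class[of a 1] by simp
qed

lemma root_vars_empty: "u \<notin> cvars G \<Longrightarrow> root_vars G u = {}"
proof (rule ccontr)
  assume u: "u \<notin> cvars G" "root_vars G u \<noteq> {}"
  then obtain v where "fst u > 0" "snd v \<in> conj_classes G" "snd u = class_pow G (snd v) (fst u div fst v)"
    by (auto simp: root_vars_def cvars_def)
  then have "u \<in> {1..} \<times> conj_classes G"
    using class_pow_in_conj_classes by (cases u) simp
  with u show False by (simp add: cvars_def)
qed

text \<open>A variable outside \<open>cvars G\<close> has no roots, so its orbit polynomial is 0 and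
  the factor with \<open>l = 0\<close> vanishes.\<close>

lemma choose_poly_zero:
  assumes "\<not> Poly_Mapping.keys m \<subseteq> cvars G"
  shows "choose_poly G m = 0"
proof -
  obtain u where u: "u \<in> Poly_Mapping.keys m" "u \<notin> cvars G" using assms by blast
  have "(\<Prod>l<Poly_Mapping.lookup m u. Polynomial.smult (1 / of_nat (l + 1)) (orbit_poly G u - [:of_nat l:])) = 0"
  proof (rule prod_zero)
    show "\<exists>l\<in>{..<Poly_Mapping.lookup m u}. Polynomial.smult (1 / of_nat (l + 1)) (orbit_poly G u - [:of_nat l:]) = 0"
      using u by (intro bexI[of _ 0]) (auto simp: orbit_poly_def root_vars_empty in_keys_iff)
  qed simp
  then show ?thesis unfolding choose_poly_def using u by (intro prod_zero) auto
qed

lemma adams_t_p1: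
  assumes "v \<in> cvars G"
  shows "adams G v (t_pow 1 * mvar 1) = mmon (Poly_Mapping.single v 1) (Poly_Mapping.single (int (fst v)) 1)"
proof (rule mfps_eqI)
  fix q
  obtain i c where ic: "v = (i, c)" by (cases v)
  have c: "class_pow G c 1 = c" using assms class_pow_1[of c] by (simp add: ic cvars_def)
  have m: "mcoeff (t_pow 1 * mvar 1) m = (Poly_Mapping.single 1 1 when m = Poly_Mapping.single 1 1)" for m :: "nat \<Rightarrow>\<^sub>0 nat"
    by (simp add: t_pow_def mvar_eq_mmon mcoeff_mmon when_def)
  show "mcoeff (adams G v (t_pow 1 * mvar 1)) q
    = mcoeff (mmon (Poly_Mapping.single v 1) (Poly_Mapping.single (int (fst v)) 1)) q"
    unfolding adams_def mcoeff_Mfps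
    by (subst Sum_any_single[of "Poly_Mapping.single 1 1"])
      (use c in \<open>auto simp: m ic laurent_adams_0 laurent_adams_single adams_monomial_single mcoeff_mmon when_def simp del: One_nat_def\<close>)
qed

text \<open>Every genuine variable is replaced by itself times the power of \<open>t\<close> given
  by its degree, so each monomial is only rescaled. The hypothesis confines \<open>F\<close> to
  these variables, for which first powers of a class give back the class.\<close>

lemma mcoeff_plethysm_t_p1:
  assumes F: "\<And>m. \<not> Poly_Mapping.keys m \<subseteq> cvars G \<Longrightarrow> mcoeff F m = 0"
  shows "mcoeff (plethysm G F (t_pow 1 * mvar 1)) m = Poly_Mapping.single (int (wt m)) 1 * mcoeff F m"
proof -
  let ?P = "\<lambda>m. mconst (mcoeff F m) * (\<Prod>v\<in>Poly_Mapping.keys m. adams G v (t_pow 1 * mvar 1) ^ Poly_Mapping.lookup m v)"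
  have P: "?P m = mmon m (Poly_Mapping.single (int (wt m)) 1 * mcoeff F m)" for m
  proof (cases "Poly_Mapping.keys m \<subseteq> cvars G")
    case True
    have "(\<Prod>v\<in>Poly_Mapping.keys m. adams G v (t_pow 1 * mvar 1) ^ Poly_Mapping.lookup m v)
      = (\<Prod>v\<in>Poly_Mapping.keys m. mmon (Poly_Mapping.single v (Poly_Mapping.lookup m v))
            (Poly_Mapping.single (int (fst v * Poly_Mapping.lookup m v)) 1))"
    proof (rule prod.cong[OF refl])
      fix v assume "v \<in> Poly_Mapping.keys m"
      then have v: "v \<in> cvars G" using True by blast
      have pw: "Poly_Mapping.single a (1::rat) ^ k = Poly_Mapping.single (int k * a) 1" for a k
        by (induction k) (auto simp: mult_single algebra_simps)
      then show "adams G v (t_pow 1 * mvar 1) ^ Poly_Mapping.lookup m v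
        = mmon (Poly_Mapping.single v (Poly_Mapping.lookup m v)) (Poly_Mapping.single (int (fst v * Poly_Mapping.lookup m v)) 1)"
        by (simp only: adams_t_p1[OF v] mmon_power pw mult_1) (simp only: mult.commute of_nat_mult)
    qed
    also have "\<dots> = mmon m (Poly_Mapping.single (int (wt m)) 1)"
    proof -
      have pr: "(\<Prod>v\<in>K. Poly_Mapping.single (int (f v)) (1::rat)) = Poly_Mapping.single (int (\<Sum>v\<in>K. f v)) 1" for K and f :: "nat \<times> 'a set \<Rightarrow> nat"
        by (induction K rule: infinite_finite_induct) (auto simp: mult_single)
      show ?thesis unfolding mmon_prod pr weight_def by (simp only: sum_single_keys finite_keys order.refl)
    qed
    finally show ?thesis by (simp add: mconst_eq_mmon mmon_mult mult.commute)
  next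
    case False
    then show ?thesis by (simp add: F mconst_0) (simp add: mmon_def zero_mfps_def)
  qed
  show ?thesis
    unfolding plethysm_def msum_def mcoeff_Mfps P
    by (subst Sum_any_single[of m]) (auto simp: mcoeff_mmon)
qed

theorem mcoeff_rhs:
  assumes "finite (carrier G)"
  shows "mcoeff (plethysm G (plethysm G (Exp_series G) (t_pow (-1) * L_series)) (t_pow 1 * mvar 1)
    - plethysm G (plethysm G (Exp_series G) L_series) (t_pow 1 * mvar 1)) m
    = Poly_Mapping.single (int (wt m)) 1 * (laurent_subst (-1) (choose_poly G m) - laurent_subst 0 (choose_poly G m))"
proof -
  have "t_pow 0 * L_series = L_series"
    by (rule mfps_eqI) (simp add: t_pow_def)
  then have 0: "plethysm G (Exp_series G) L_series = Fser G 0"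
    by (simp add: Fser_def)
  have "mcoeff (plethysm G (Fser G a) (t_pow 1 * mvar 1)) m
    = Poly_Mapping.single (int (wt m)) 1 * laurent_subst a (choose_poly G m)" for a
    by (subst mcoeff_plethysm_t_p1) (simp_all add: mcoeff_Fser_choose_poly assms choose_poly_zero)
  then show ?thesis
    unfolding 0 Fser_def[symmetric] by (simp add: algebra_simps)
qed

end

section \<open>Traces and acyclic order complexes\<close>

locale trace_space = vector_space
begin

definition basis_trace :: "'b set \<Rightarrow> ('b \<Rightarrow> 'b) \<Rightarrow> 'a" where
  "basis_trace B F = (\<Sum>b\<in>B. representation B (F b) b)"

text \<open>The identity tr(AB) = tr(BA) in coordinates: each \<open>b\<close> is expanded in
  \<open>C\<close>, the sums are exchanged, and the inner sum becomes the expansion of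
  \<open>F c\<close> in \<open>B\<close> read off in \<open>C\<close>.\<close>

lemma basis_trace_unique:
  assumes B: "finite B" "independent B" and C: "finite C" "independent C"
    and eq: "span B = span C" and lin: "Vector_Spaces.linear scale scale F" and F: "\<And>v. v \<in> span B \<Longrightarrow> F v \<in> span B"
  shows "basis_trace B F = basis_trace C F"
proof -
  interpret F: Vector_Spaces.linear scale scale F by (rule lin)
  have mix: "representation X (F x) x = (\<Sum>y\<in>Y. representation Y x y * representation X (F y) x)"
    if X: "independent X" "finite X" and Y: "independent Y" "finite Y" "span X = span Y"
      and FX: "\<And>v. v \<in> span X \<Longrightarrow> F v \<in> span X" and x: "x \<in> span X"
    for X Y x
  proof -
    have mem: "F y \<in> span X" if "y \<in> Y" for y
      using FX[of y] Y(3) that span_base by auto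
    have "x = (\<Sum>y\<in>Y. representation Y x y *s y)"
      using sum_representation_eq[OF Y(1) _ Y(2) order.refl, of x] x Y by simp
    then have "F x = (\<Sum>y\<in>Y. representation Y x y *s F y)"
      by (metis (no_types, lifting) F.scale F.sum sum.cong)
    then have "representation X (F x) = representation X (\<Sum>y\<in>Y. representation Y x y *s F y)"
      by simp
    also have "\<dots> = (\<lambda>b. \<Sum>y\<in>Y. representation X (representation Y x y *s F y) b)"
      using mem by (intro representation_sum X) (auto intro: span_scale)
    also have "\<dots> = (\<lambda>b. \<Sum>y\<in>Y. representation Y x y * representation X (F y) b)"
      using mem X by (simp add: representation_scale)
    finally show ?thesis by simp
  qed
  have "basis_trace B F = (\<Sum>b\<in>B. \<Sum>c\<in>C. representation C b c * representation B (F c) b)"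
    unfolding basis_trace_def using B C eq F span_base by (intro sum.cong refl mix) auto
  also have "\<dots> = (\<Sum>c\<in>C. \<Sum>b\<in>B. representation C b c * representation B (F c) b)"
    by (rule sum.swap)
  also have "\<dots> = (\<Sum>c\<in>C. representation C (F c) c)"
  proof (rule sum.cong[OF refl])
    fix c assume "c \<in> C"
    then have Fc: "F c \<in> span B" using F eq span_base by auto
    have mem: "b \<in> span C" if "b \<in> B" for b using that eq span_base by auto
    have "F c = (\<Sum>b\<in>B. representation B (F c) b *s b)"
      using sum_representation_eq[OF B(2) Fc B(1) order.refl] by simp
    then have "representation C (F c) = representation C (\<Sum>b\<in>B. representation B (F c) b *s b)"
      by simp
    also have "\<dots> = (\<lambda>x. \<Sum>b\<in>B. representation C (representation B (F c) b *s b) x)"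
      using mem by (intro representation_sum C) (auto intro: span_scale)
    also have "\<dots> = (\<lambda>x. \<Sum>b\<in>B. representation B (F c) b * representation C b x)"
      using mem C by (simp add: representation_scale)
    finally show "(\<Sum>b\<in>B. representation C b c * representation B (F c) b) = representation C (F c) c"
      by (simp add: mult.commute)
  qed
  finally show ?thesis unfolding basis_trace_def .
qed

definition span_trace :: "'b set \<Rightarrow> ('b \<Rightarrow> 'b) \<Rightarrow> 'a" where
  "span_trace S F = basis_trace (SOME B. finite B \<and> independent B \<and> span B = S) F"

lemma span_trace_eq:
  assumes "finite B" "independent B" "span B = S" "Vector_Spaces.linear scale scale F" "\<And>v. v \<in> S \<Longrightarrow> F v \<in> S"
  shows "span_trace S F = basis_trace B F"
proof -
  let ?P = "\<lambda>B. finite B \<and> independent B \<and> span B = S"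
  have "?P (SOME B. ?P B)" using assms by (intro someI[of ?P B]) auto
  then show ?thesis
    unfolding span_trace_def using assms by (intro basis_trace_unique) auto
qed

lemma finite_basis_exists:
  assumes "finite T" "S \<subseteq> span T" "subspace S"
  obtains B where "finite B" "independent B" "span B = S"
proof -
  obtain B where B: "B \<subseteq> S" "independent B" "S \<subseteq> span B"
    by (rule maximal_independent_subset_extend[of "{}" S]) (simp_all add: dependent_def)
  moreover have "finite B" using independent_span_bound[of T B] assms B by auto
  moreover have "span B \<subseteq> S" using B assms(3) span_minimal by blast
  ultimately show ?thesis using that by blast
qed

text \<open>Additivity of the trace along the kernel and the image of \<open>g\<close>. A basis
  \<open>K\<close> of the kernel is extended to a basis \<open>B\<close> of \<open>S\<close>; the
  images of \<open>B - K\<close> then form a basis of the image, and the matrix of \<open>F\<close>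
  is block triangular.\<close>

lemma span_trace_kernel_image:
  assumes T: "finite T" "S \<subseteq> span T" and S: "subspace S"
    and F: "Vector_Spaces.linear scale scale F" "\<And>v. v \<in> S \<Longrightarrow> F v \<in> S"
    and F': "Vector_Spaces.linear scale scale F'" and g: "Vector_Spaces.linear scale scale g"
    and comm: "\<And>v. v \<in> S \<Longrightarrow> g (F v) = F' (g v)"
  shows "span_trace S F = span_trace {v \<in> S. g v = 0} F + span_trace (g ` S) F'"
proof -
  interpret F: Vector_Spaces.linear scale scale F by (rule F)
  interpret F': Vector_Spaces.linear scale scale F' by (rule F')
  interpret g: Vector_Spaces.linear scale scale g by (rule g)
  let ?N = "{v \<in> S. g v = 0}"
  have N: "subspace ?N"
    using S by (auto simp: subspace_def g.add g.scale)
  obtain K where K: "finite K" "independent K" "span K = ?N"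
    using finite_basis_exists[of T ?N] T N by auto
  then have "K \<subseteq> S" using span_base by blast
  then obtain B where B: "K \<subseteq> B" "B \<subseteq> S" "independent B" "S \<subseteq> span B"
    by (rule maximal_independent_subset_extend[OF _ K(2)])
  have finB: "finite B" using independent_span_bound[of T B] T B by auto
  have spB: "span B = S" using B S span_minimal by blast
  have FN: "F v \<in> ?N" if "v \<in> ?N" for v
    using that F comm[of v] by (auto simp: F'.zero)
  \<comment> \<open>A vector of \<open>span (B - K)\<close> killed by \<open>g\<close> lies in
    \<open>span K\<close> too, so its coordinates are supported on two disjoint sets.\<close>
  have inj: "inj_on g (span (B - K))"
  proof (subst g.inj_on_iff_eq_0)
    show "subspace (span (B - K))" by simp
    show "\<forall>x\<in>span (B - K). g x = 0 \<longrightarrow> x = 0"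
    proof (intro ballI impI)
      fix x assume x: "x \<in> span (B - K)" "g x = 0"
      have "x \<in> span B" using x span_mono[of "B - K" B] by auto
      then have xK: "x \<in> span K" using x K spB by auto
      have "representation B x b = 0" for b
      proof (rule ccontr)
        assume nz: "representation B x b \<noteq> 0"
        have "representation B x = representation K x" "representation B x = representation (B - K) x"
          using representation_extend[OF B(3) xK B(1)] representation_extend[OF B(3) x(1)] by auto
        then have "b \<in> K" "b \<in> B - K" using nz representation_ne_zero by metis+
        then show False by blast
      qed
      then show "x = 0"
        using sum_nonzero_representation_eq[OF B(3) \<open>x \<in> span B\<close>] by simp
    qed
  qed
  have gK: "g k = 0" if "k \<in> K" for k using that K span_base by blast
  have spg: "span (g ` (B - K)) = g ` S"
  proof
    show "span (g ` (B - K)) \<subseteq> g ` S"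
      unfolding g.span_image using span_mono[of "B - K" B] spB by auto
    show "g ` S \<subseteq> span (g ` (B - K))"
    proof
      fix y assume "y \<in> g ` S"
      then obtain v where v: "v \<in> S" "y = g v" by blast
      have "v = (\<Sum>b\<in>B. representation B v b *s b)"
        using sum_representation_eq[OF B(3) _ finB order.refl, of v] v spB by simp
      then have "y = (\<Sum>b\<in>B. representation B v b *s g b)"
        unfolding v(2) by (metis (no_types, lifting) g.scale g.sum sum.cong)
      also have "\<dots> = (\<Sum>b\<in>B - K. representation B v b *s g b)"
        using finB B(1) gK by (intro sum.mono_neutral_right) auto
      also have "\<dots> \<in> span (g ` (B - K))"
        by (intro span_sum span_scale span_base) auto
      finally show "y \<in> span (g ` (B - K))" .
    qed
  qed
  have indg: "independent (g ` (B - K))"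
    using g.independent_injective_image[OF _ inj] B(3) independent_mono by blast
  have injB: "inj_on g (B - K)" using inj span_superset inj_on_subset by blast
  have F'S: "F' v \<in> g ` S" if v: "v \<in> g ` S" for v
  proof -
    obtain w where w: "w \<in> S" "v = g w" using v by blast
    have "F' v = g (F w)" unfolding w(2) by (rule comm[OF w(1), symmetric])
    then show ?thesis using F(2)[OF w(1)] by blast
  qed
  have "span_trace S F = basis_trace B F"
    using finB B(3) spB F by (intro span_trace_eq) auto
  also have "\<dots> = (\<Sum>b\<in>K. representation B (F b) b) + (\<Sum>b\<in>B - K. representation B (F b) b)"
    unfolding basis_trace_def by (simp add: sum.subset_diff[OF B(1) finB] add.commute)
  also have "(\<Sum>b\<in>K. representation B (F b) b) = basis_trace K F"
    unfolding basis_trace_def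
  proof (rule sum.cong[OF refl])
    fix b assume "b \<in> K"
    then have "F b \<in> span K" using FN K span_base by auto
    then show "representation B (F b) b = representation K (F b) b"
      using representation_extend[OF B(3) _ B(1)] by metis
  qed
  also have "basis_trace K F = span_trace ?N F"
    using K FN F by (intro span_trace_eq[symmetric]) auto
  \<comment> \<open>Applying \<open>g\<close> removes the coordinates along \<open>K\<close>; those
    left are the coordinates of \<open>F' (g b)\<close>.\<close>
  also have "(\<Sum>b\<in>B - K. representation B (F b) b) = basis_trace (g ` (B - K)) F'"
    unfolding basis_trace_def sum.reindex[OF injB] o_def
  proof (rule sum.cong[OF refl])
    fix b assume b: "b \<in> B - K"
    then have bS: "b \<in> S" "F b \<in> S" using B F by auto
    have mem: "g x \<in> span (g ` (B - K))" if "x \<in> B - K" for x using that by (intro span_base) auto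
    have "F b = (\<Sum>x\<in>B. representation B (F b) x *s x)"
      using sum_representation_eq[OF B(3) _ finB order.refl, of "F b"] bS spB by simp
    then have "g (F b) = (\<Sum>x\<in>B. representation B (F b) x *s g x)"
      by (metis (no_types, lifting) g.scale g.sum sum.cong)
    also have "\<dots> = (\<Sum>x\<in>B - K. representation B (F b) x *s g x)"
      using finB B(1) gK by (intro sum.mono_neutral_right) auto
    finally have "F' (g b) = (\<Sum>x\<in>B - K. representation B (F b) x *s g x)"
      using comm bS by simp
    then have "representation (g ` (B - K)) (F' (g b)) (g b)
      = representation (g ` (B - K)) (\<Sum>x\<in>B - K. representation B (F b) x *s g x) (g b)" by simp
    also have "\<dots> = (\<Sum>x\<in>B - K. representation B (F b) x * representation (g ` (B - K)) (g x) (g b))"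
      by (subst representation_sum[OF indg]) (use mem indg in \<open>auto simp: representation_scale intro: span_scale\<close>)
    also have "\<dots> = (\<Sum>x\<in>B - K. if x = b then representation B (F b) b else 0)"
      using indg b injB by (intro sum.cong refl) (auto simp: representation_basis inj_on_eq_iff)
    also have "\<dots> = representation B (F b) b"
      using b finB by simp
    finally show "representation B (F b) b = representation (g ` (B - K)) (F' (g b)) (g b)" by simp
  qed
  also have "\<dots> = span_trace (g ` S) F'"
    using indg spg finB F'S F' by (intro span_trace_eq[symmetric]) auto
  finally show ?thesis .
qed

end

section \<open>Linear extension of maps given on a basis\<close>

definition qscale :: "rat \<Rightarrow> ('k \<Rightarrow>\<^sub>0 rat) \<Rightarrow> ('k \<Rightarrow>\<^sub>0 rat)" where
  "qscale r = Poly_Mapping.map ((*) r)"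

lemma lookup_qscale [simp]: "Poly_Mapping.lookup (qscale r z) k = r * Poly_Mapping.lookup z k"
  by (simp add: qscale_def Poly_Mapping.map.rep_eq when_def)

interpretation Q: trace_space "qscale :: rat \<Rightarrow> ('k \<Rightarrow>\<^sub>0 rat) \<Rightarrow> _"
  by unfold_locales (auto intro!: poly_mapping_eqI simp: lookup_add algebra_simps)

lemma qscale_single [simp]: "qscale r (Poly_Mapping.single k s) = Poly_Mapping.single k (r * s)"
  by (rule poly_mapping_eqI) (simp add: lookup_single when_def)

text \<open>Boundaries, induced maps and homotopies are all written as \<open>lin\<close>, so that
  \<open>lin_lin\<close> and \<open>lin_cong\<close> reduce identities between them to single
  simplices.\<close>

definition lin :: "('a \<Rightarrow> 'b \<Rightarrow>\<^sub>0 rat) \<Rightarrow> ('a \<Rightarrow>\<^sub>0 rat) \<Rightarrow> ('b \<Rightarrow>\<^sub>0 rat)" where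
  "lin F z = (\<Sum>k\<in>Poly_Mapping.keys z. qscale (Poly_Mapping.lookup z k) (F k))"

lemma lin_superset:
  "finite K \<Longrightarrow> Poly_Mapping.keys z \<subseteq> K \<Longrightarrow> lin F z = (\<Sum>k\<in>K. qscale (Poly_Mapping.lookup z k) (F k))"
  unfolding lin_def by (intro sum.mono_neutral_left) (auto simp: in_keys_iff)

lemma lin_0 [simp]: "lin F 0 = 0"
  by (simp add: lin_def)

lemma lin_add: "lin F (z + w) = lin F z + lin F w"
proof -
  let ?K = "Poly_Mapping.keys z \<union> Poly_Mapping.keys w"
  have "Poly_Mapping.keys (z + w) \<subseteq> ?K" by (rule Poly_Mapping.keys_add)
  then show ?thesis
    by (subst (1 2 3) lin_superset[of ?K]) (auto simp: lookup_add Q.scale_left_distrib sum.distrib)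
qed

lemma lin_qscale: "lin F (qscale r z) = qscale r (lin F z)"
  by (subst (1 2) lin_superset[of "Poly_Mapping.keys z"]) (auto simp: in_keys_iff Q.scale_sum_right)

lemma linear_lin: "Vector_Spaces.linear qscale qscale (lin F)"
  by unfold_locales (simp_all add: lin_add lin_qscale)

lemma lin_minus: "lin F (- z) = - lin F z"
  using lin_add[of F z "- z"] by (simp add: eq_neg_iff_add_eq_0 add.commute)

lemma lin_diff: "lin F (z - w) = lin F z - lin F w"
  using lin_add[of F z "- w"] by (simp add: lin_minus)

lemma lin_sum: "lin F (sum z I) = (\<Sum>i\<in>I. lin F (z i))"
  by (induction I rule: infinite_finite_induct) (auto simp: lin_add)

lemma lin_single [simp]: "lin F (Poly_Mapping.single k r) = qscale r (F k)"
  by (simp add: lin_def)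

lemma lin_cong: "(\<And>k. k \<in> Poly_Mapping.keys z \<Longrightarrow> F k = H k) \<Longrightarrow> lin F z = lin H z"
  unfolding lin_def by (intro sum.cong) auto

lemma lin_lin: "lin F (lin H z) = lin (\<lambda>k. lin F (H k)) z"
  unfolding lin_def[of H] lin_def[of "\<lambda>k. lin F (H k)"] by (simp add: lin_sum lin_qscale)

lemma lin_single_1: "lin (\<lambda>k. Poly_Mapping.single k 1) z = z"
proof (rule poly_mapping_eqI)
  fix x
  have "Poly_Mapping.lookup (lin (\<lambda>k. Poly_Mapping.single k 1) z) x
    = (\<Sum>k\<in>Poly_Mapping.keys z. if k = x then Poly_Mapping.lookup z k else 0)"
    unfolding lin_def lookup_sum by (intro sum.cong) (auto simp: lookup_single when_def)
  also have "\<dots> = Poly_Mapping.lookup z x" by (simp add: in_keys_iff)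
  finally show "Poly_Mapping.lookup (lin (\<lambda>k. Poly_Mapping.single k 1) z) x = Poly_Mapping.lookup z x" .
qed

lemma lin_diff_fun: "lin (\<lambda>k. F k - H k) z = lin F z - lin H z"
  by (simp add: lin_def Q.scale_right_diff_distrib sum_subtractf)

lemma lin_zero_fun: "lin (\<lambda>k. 0) z = 0"
  by (simp add: lin_def)

lemma keys_lin: "Poly_Mapping.keys (lin F z) \<subseteq> (\<Union>k\<in>Poly_Mapping.keys z. Poly_Mapping.keys (F k))"
proof
  fix x assume "x \<in> Poly_Mapping.keys (lin F z)"
  then have "(\<Sum>k\<in>Poly_Mapping.keys z. Poly_Mapping.lookup z k * Poly_Mapping.lookup (F k) x) \<noteq> 0"
    by (simp add: in_keys_iff lin_def lookup_sum)
  then obtain k where "k \<in> Poly_Mapping.keys z" "Poly_Mapping.lookup z k * Poly_Mapping.lookup (F k) x \<noteq> 0"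
    by (rule sum.not_neutral_contains_not_neutral)
  then show "x \<in> (\<Union>k\<in>Poly_Mapping.keys z. Poly_Mapping.keys (F k))"
    by (auto simp: in_keys_iff)
qed

section \<open>Simplicial boundary, cones and unions\<close>

definition face_sum :: "'a list \<Rightarrow> ('a list \<Rightarrow>\<^sub>0 rat)" where
  "face_sum xs = (\<Sum>k<length xs. Poly_Mapping.single (take k xs @ drop (Suc k) xs) ((-1) ^ k))"

lemma boundary_eq_lin: "boundary = lin face_sum"
  by (rule ext) (simp add: boundary_def lin_def face_sum_def Q.scale_sum_right mult.commute)

lemma push_chain_eq_lin: "push_chain f = lin (\<lambda>xs. Poly_Mapping.single (map f xs) 1)"
  by (rule ext) (simp add: push_chain_def lin_def)

definition cons_chain :: "'a \<Rightarrow> ('a list \<Rightarrow>\<^sub>0 rat) \<Rightarrow> ('a list \<Rightarrow>\<^sub>0 rat)" where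
  "cons_chain x = lin (\<lambda>ys. Poly_Mapping.single (x # ys) 1)"

lemma face_sum_Nil [simp]: "face_sum [] = 0"
  by (simp add: face_sum_def)

text \<open>The boundary of a cone with apex \<open>x\<close>. With this recursion,
  \<open>boundary_face_sum\<close> and the cone homotopy follow without any computation with
  positions and signs.\<close>

lemma face_sum_Cons: "face_sum (x # xs) = Poly_Mapping.single xs 1 - cons_chain x (face_sum xs)"
proof -
  have "face_sum (x # xs) = Poly_Mapping.single xs 1
    + (\<Sum>k<length xs. Poly_Mapping.single (x # take k xs @ drop (Suc k) xs) (- ((-1) ^ k)))"
    unfolding face_sum_def length_Cons sum.lessThan_Suc_shift by simp
  also have "(\<Sum>k<length xs. Poly_Mapping.single (x # take k xs @ drop (Suc k) xs) (- ((-1) ^ k :: rat)))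
    = - cons_chain x (face_sum xs)"
    by (simp add: face_sum_def cons_chain_def lin_sum single_uminus sum_negf)
  finally show ?thesis by simp
qed

lemma boundary_cons_chain: "boundary (cons_chain x z) = z - cons_chain x (boundary z)"
proof -
  have "boundary (cons_chain x z) = lin (\<lambda>ys. Poly_Mapping.single ys 1 - cons_chain x (face_sum ys)) z"
    by (simp add: boundary_eq_lin cons_chain_def lin_lin face_sum_Cons)
  then show ?thesis by (simp add: lin_diff_fun lin_single_1 boundary_eq_lin lin_lin cons_chain_def)
qed

lemma boundary_diff: "boundary (z - w) = boundary z - boundary w"
  by (simp add: boundary_eq_lin lin_diff)

lemma boundary_add: "boundary (z + w) = boundary z + boundary w"
  by (simp add: boundary_eq_lin lin_add)

lemma boundary_single_1: "boundary (Poly_Mapping.single xs 1) = face_sum xs"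
  by (simp add: boundary_eq_lin)

lemma boundary_face_sum: "boundary (face_sum xs) = 0"
proof (induction xs)
  case (Cons x xs)
  then show ?case
    by (simp add: face_sum_Cons boundary_diff boundary_single_1 boundary_cons_chain) (simp add: cons_chain_def)
qed (simp add: boundary_eq_lin)

lemma boundary_boundary: "boundary (boundary z) = 0"
proof -
  have "boundary (boundary z) = lin (\<lambda>xs. boundary (face_sum xs)) z"
    by (simp add: boundary_eq_lin lin_lin)
  then show ?thesis by (simp add: boundary_face_sum lin_zero_fun)
qed

text \<open>Vanishing of reduced homology in all degrees below \<open>r\<close>. For the interval
  below \<open>y\<close> it is used with \<open>r = rk y - 2\<close>, so that only the top degree
  can survive.\<close>

definition acyclic_below :: "'a gorder \<Rightarrow> 'a set \<Rightarrow> int \<Rightarrow> bool" where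
  "acyclic_below P U r \<longleftrightarrow> (\<forall>d<r. cycles P U d \<subseteq> boundaries P U d)"

lemma sorted_wrt_drop_nth:
  assumes "sorted_wrt R xs" "k < length xs"
  shows "sorted_wrt R (take k xs @ drop (Suc k) xs)"
  using assms(1) by (subst (asm) id_take_nth_drop[OF assms(2)]) (auto simp: sorted_wrt_append)

lemma keys_face_sum: "Poly_Mapping.keys (face_sum xs) \<subseteq> (\<lambda>k. take k xs @ drop (Suc k) xs) ` {..<length xs}"
proof
  fix ys assume "ys \<in> Poly_Mapping.keys (face_sum xs)"
  then have "(\<Sum>k<length xs. Poly_Mapping.lookup (Poly_Mapping.single (take k xs @ drop (Suc k) xs) ((-1) ^ k :: rat)) ys) \<noteq> 0"
    by (simp add: face_sum_def in_keys_iff lookup_sum)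
  then obtain k where "k < length xs" "Poly_Mapping.lookup (Poly_Mapping.single (take k xs @ drop (Suc k) xs) ((-1) ^ k :: rat)) ys \<noteq> 0"
    by (rule sum.not_neutral_contains_not_neutral) simp
  then show "ys \<in> (\<lambda>k. take k xs @ drop (Suc k) xs) ` {..<length xs}"
    by (auto simp: lookup_single when_def split: if_splits)
qed

lemma order_simplices_face:
  "xs \<in> order_simplices P A \<Longrightarrow> k < length xs \<Longrightarrow> take k xs @ drop (Suc k) xs \<in> order_simplices P A"
  using sorted_wrt_drop_nth[of "lless P" xs k] set_take_subset[of k xs] set_drop_subset[of "Suc k" xs]
  by (auto simp: order_simplices_def)

lemma chains_iff: "z \<in> chains P A d \<longleftrightarrow> (\<forall>xs\<in>Poly_Mapping.keys z. xs \<in> order_simplices P A \<and> int (length xs) = d + 1)"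
  by (auto simp: chains_def)

lemma chains_0 [simp]: "0 \<in> chains P A d"
  by (simp add: chains_iff)

lemma chains_add: "z \<in> chains P A d \<Longrightarrow> w \<in> chains P A d \<Longrightarrow> z + w \<in> chains P A d"
  using Poly_Mapping.keys_add[of z w] by (auto simp: chains_iff)

lemma chains_uminus: "z \<in> chains P A d \<Longrightarrow> - z \<in> chains P A d"
  by (simp add: chains_iff)

lemma chains_diff: "z \<in> chains P A d \<Longrightarrow> w \<in> chains P A d \<Longrightarrow> z - w \<in> chains P A d"
  using chains_add[of z P A d "- w"] by (simp add: chains_uminus)

lemma chains_mono: "A \<subseteq> B \<Longrightarrow> z \<in> chains P A d \<Longrightarrow> z \<in> chains P B d"
  by (auto simp: chains_iff order_simplices_def)

lemma chains_lin:
  assumes "\<And>xs. xs \<in> Poly_Mapping.keys z \<Longrightarrow> F xs \<in> chains P A d"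
  shows "lin F z \<in> chains P A d"
  using keys_lin[of F z] assms by (fastforce simp: chains_iff)

lemma chains_face_sum: "xs \<in> order_simplices P A \<Longrightarrow> int (length xs) = d + 1 \<Longrightarrow> face_sum xs \<in> chains P A (d - 1)"
  using keys_face_sum[of xs] order_simplices_face[of xs P A] by (fastforce simp: chains_iff)

lemma chains_boundary: "z \<in> chains P A d \<Longrightarrow> boundary z \<in> chains P A (d - 1)"
  unfolding boundary_eq_lin by (rule chains_lin) (simp add: chains_iff[of z] chains_face_sum)

lemma boundary_0 [simp]: "boundary 0 = 0"
  by (simp add: boundary_eq_lin)

lemma chains_negative: "d < -1 \<Longrightarrow> z \<in> chains P A d \<longleftrightarrow> z = 0"
proof
  assume "d < -1" "z \<in> chains P A d"
  then have "Poly_Mapping.keys z = {}" by (force simp: chains_iff)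
  then show "z = 0" by simp
qed simp

lemma acyclic_below_negative: "r \<le> -1 \<Longrightarrow> acyclic_below P U r"
  unfolding acyclic_below_def cycles_def boundaries_def
  by (auto simp: chains_negative intro!: image_eqI[of _ _ 0])

text \<open>The apex \<open>u\<close> is comparable to everything, so the order complex is
  contractible and there is no restriction on \<open>r\<close>.\<close>

lemma acyclic_below_cone:
  assumes u: "u \<in> U" "\<And>x. x \<in> U \<Longrightarrow> x \<noteq> u \<Longrightarrow> lless P u x" "\<And>x. x \<in> U \<Longrightarrow> \<not> lless P x u"
  shows "acyclic_below P U r"
  unfolding acyclic_below_def
proof (intro allI impI subsetI)
  fix d z assume z: "z \<in> cycles P U d"
  \<comment> \<open>The contracting homotopy puts the apex in front. A simplex through the apex
    begins with it, since nothing lies below it, and is sent to 0.\<close>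
  define h where "h = lin (\<lambda>xs. if u \<in> set xs then 0 else Poly_Mapping.single (u # xs) 1)"
  have base: "boundary (h (Poly_Mapping.single xs 1)) + h (face_sum xs) = Poly_Mapping.single xs 1"
    if xs: "xs \<in> order_simplices P U" for xs
  proof (cases "u \<in> set xs")
    case False
    have "h (face_sum xs) = cons_chain u (face_sum xs)"
      unfolding h_def cons_chain_def
    proof (rule lin_cong)
      fix ys assume "ys \<in> Poly_Mapping.keys (face_sum xs)"
      then obtain k where "ys = take k xs @ drop (Suc k) xs" using keys_face_sum[of xs] by blast
      then have "set ys \<subseteq> set xs"
        using set_take_subset[of k xs] set_drop_subset[of "Suc k" xs] by auto
      then show "(if u \<in> set ys then 0 else Poly_Mapping.single (u # ys) 1) = Poly_Mapping.single (u # ys) 1"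
        using False by auto
    qed
    then show ?thesis using False by (simp add: h_def face_sum_Cons boundary_single_1)
  next
    case True
    have xsP: "set xs \<subseteq> U" "sorted_wrt (lless P) xs" using xs by (auto simp: order_simplices_def)
    obtain ys where ys: "xs = u # ys"
    proof (cases xs)
      case (Cons y ys)
      have "u \<in> set ys \<Longrightarrow> False" using Cons xsP u(3)[of y] by auto
      then show ?thesis using that Cons True by auto
    qed (use True in auto)
    have uys: "u \<notin> set ys" using ys xsP u by auto
    have "h (cons_chain u w) = 0" for w
      by (simp add: h_def cons_chain_def lin_lin lin_zero_fun)
    then have "h (face_sum xs) = h (Poly_Mapping.single ys 1)"
      by (simp add: ys face_sum_Cons) (simp add: h_def lin_diff)
    then show ?thesis using uys by (simp add: h_def ys)
  qed
  have zc: "z \<in> chains P U d" "boundary z = 0" using z by (auto simp: cycles_def)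
  have "boundary (h z) + h (boundary z) = lin (\<lambda>xs. boundary (h (Poly_Mapping.single xs 1)) + h (face_sum xs)) z"
    by (simp add: boundary_eq_lin h_def lin_lin) (simp add: lin_def Q.scale_right_distrib sum.distrib)
  also have "\<dots> = lin (\<lambda>xs. Poly_Mapping.single xs 1) z"
    using zc(1) base by (intro lin_cong) (auto simp: chains_iff)
  finally have "boundary (h z) = z"
    using zc(2) by (simp add: lin_single_1) (simp add: h_def)
  moreover have "h z \<in> chains P U (d + 1)"
    unfolding h_def
  proof (rule chains_lin)
    fix xs assume "xs \<in> Poly_Mapping.keys z"
    then have "xs \<in> order_simplices P U" "int (length xs) = d + 1" using zc(1) by (auto simp: chains_iff)
    then show "(if u \<in> set xs then 0 else Poly_Mapping.single (u # xs) 1) \<in> chains P U (d + 1)"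
      using u by (auto simp: chains_iff order_simplices_def)
  qed
  ultimately show "z \<in> boundaries P U d" unfolding boundaries_def by force
qed

text \<open>The Mayer-Vietoris argument. By \<open>split\<close> every chain of the union lies in
  one of the parts, so the order complex of the union is the union of the two complexes. The
  connecting map lowers the degree, so one degree less is enough for the intersection.\<close>

lemma acyclic_below_union:
  assumes split: "order_simplices P (V \<union> W) \<subseteq> order_simplices P V \<union> order_simplices P W"
    and V: "acyclic_below P V r" and W: "acyclic_below P W r" and VW: "acyclic_below P (V \<inter> W) (r - 1)"
  shows "acyclic_below P (V \<union> W) r"
  unfolding acyclic_below_def
proof (intro allI impI subsetI)
  fix d z assume d: "d < r" and "z \<in> cycles P (V \<union> W) d"
  then have z: "z \<in> chains P (V \<union> W) d" "boundary z = 0" by (auto simp: cycles_def)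
  define zV where "zV = lin (\<lambda>xs. if xs \<in> order_simplices P V then Poly_Mapping.single xs 1 else 0) z"
  define zW where "zW = lin (\<lambda>xs. if xs \<in> order_simplices P V then 0 else Poly_Mapping.single xs 1) z"
  have "zV + zW = lin (\<lambda>xs. Poly_Mapping.single xs 1) z"
    unfolding zV_def zW_def lin_def sum.distrib[symmetric] by (intro sum.cong) auto
  then have sum: "zV + zW = z" by (simp add: lin_single_1)
  have cV: "zV \<in> chains P V d"
    unfolding zV_def using z(1) by (intro chains_lin) (auto simp: chains_iff)
  have cW: "zW \<in> chains P W d"
    unfolding zW_def using z(1) split by (intro chains_lin) (auto simp: chains_iff)
  \<comment> \<open>The boundaries of the two pieces agree up to sign, so they are supported on the
    intersection.\<close>
  have bd: "boundary zV = - boundary zW"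
    using z(2) unfolding sum[symmetric] boundary_add by (simp add: eq_neg_iff_add_eq_0)
  have "boundary zV \<in> chains P V (d - 1)" "boundary zV \<in> chains P W (d - 1)"
    using chains_boundary[OF cV] chains_uminus[OF chains_boundary[OF cW]] by (simp_all add: bd[symmetric])
  then have "boundary zV \<in> chains P (V \<inter> W) (d - 1)"
    by (auto simp: chains_iff order_simplices_def)
  then have "boundary zV \<in> cycles P (V \<inter> W) (d - 1)"
    by (simp add: cycles_def boundary_boundary)
  then have "boundary zV \<in> boundaries P (V \<inter> W) (d - 1)"
    using VW[unfolded acyclic_below_def, rule_format, of "d - 1"] d by auto
  then obtain w where w: "w \<in> chains P (V \<inter> W) d" "boundary w = boundary zV"
    by (auto simp: boundaries_def)
  \<comment> \<open>The chain \<open>w\<close> of the intersection is moved from one piece to the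
    other, which makes both pieces cycles.\<close>
  have "zV - w \<in> cycles P V d" "zW + w \<in> cycles P W d"
    using cV cW w chains_mono[of "V \<inter> W" V w P d] chains_mono[of "V \<inter> W" W w P d]
    by (auto simp: cycles_def boundary_diff boundary_add chains_diff chains_add bd)
  then have "zV - w \<in> boundaries P V d" "zW + w \<in> boundaries P W d"
    using V W d by (auto simp: acyclic_below_def)
  then obtain p q where p: "p \<in> chains P V (d + 1)" "boundary p = zV - w"
    and q: "q \<in> chains P W (d + 1)" "boundary q = zW + w" by (auto simp: boundaries_def)
  have "boundary (p + q) = z" by (simp add: boundary_add p(2) q(2) sum)
  moreover have "p + q \<in> chains P (V \<union> W) (d + 1)"
    using chains_mono[of V "V \<union> W" p] chains_mono[of W "V \<union> W" q] p q by (intro chains_add) auto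
  ultimately show "z \<in> boundaries P (V \<union> W) d" by (force simp: boundaries_def)
qed

section \<open>Graded posets with a least element\<close>

locale graded_poset =
  fixes P :: "'a gorder" and rk :: "'a \<Rightarrow> nat" and bot :: 'a
  assumes fin: "finite (carrier P)" and eq: "eq P = (=)"
    and le_refl: "x \<in> carrier P \<Longrightarrow> le P x x"
    and le_trans: "x \<in> carrier P \<Longrightarrow> y \<in> carrier P \<Longrightarrow> z \<in> carrier P \<Longrightarrow> le P x y \<Longrightarrow> le P y z \<Longrightarrow> le P x z"
    and rk_mono: "x \<in> carrier P \<Longrightarrow> y \<in> carrier P \<Longrightarrow> lless P x y \<Longrightarrow> rk x < rk y"
    and bot: "bot \<in> carrier P" "\<And>x. x \<in> carrier P \<Longrightarrow> le P bot x" "rk bot = 0"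
    and cover: "x \<in> carrier P \<Longrightarrow> y \<in> carrier P \<Longrightarrow> lless P x y \<Longrightarrow>
      \<exists>a\<in>carrier P. lless P x a \<and> rk a = rk x + 1 \<and> le P a y"
begin

lemma lless_iff: "lless P x y \<longleftrightarrow> le P x y \<and> x \<noteq> y"
  by (simp add: lless_def eq)

lemma le_iff: "x \<in> carrier P \<Longrightarrow> le P x y \<longleftrightarrow> x = y \<or> lless P x y"
  by (auto simp: lless_iff le_refl)

lemma lless_irrefl [simp]: "\<not> lless P x x"
  by (simp add: lless_iff)

lemma lless_trans:
  assumes "x \<in> carrier P" "y \<in> carrier P" "z \<in> carrier P" "lless P x y" "lless P y z"
  shows "lless P x z"
  using assms le_trans[of x y z] rk_mono[of x y] rk_mono[of y z] by (auto simp: lless_iff)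

lemma le_lless_trans:
  assumes "x \<in> carrier P" "y \<in> carrier P" "z \<in> carrier P" "le P x y" "lless P y z"
  shows "lless P x z"
  using assms lless_trans[of x y z] by (auto simp: le_iff)

lemma rk_le: "x \<in> carrier P \<Longrightarrow> y \<in> carrier P \<Longrightarrow> le P x y \<Longrightarrow> rk x \<le> rk y"
  using rk_mono[of x y] by (auto simp: le_iff)

lemma le_rk_eq: "x \<in> carrier P \<Longrightarrow> y \<in> carrier P \<Longrightarrow> le P x y \<Longrightarrow> rk x = rk y \<Longrightarrow> x = y"
  using rk_mono[of x y] by (auto simp: le_iff)

lemma antisym: "x \<in> carrier P \<Longrightarrow> y \<in> carrier P \<Longrightarrow> le P x y \<Longrightarrow> le P y x \<Longrightarrow> x = y"
  by (metis le_antisym rk_le le_rk_eq)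

lemma bottom_eq: "\<bottom>\<^bsub>P\<^esub> = bot"
proof -
  have "least P bot (carrier P)" unfolding least_def using bot by auto
  moreover have "x = bot" if "least P x (carrier P)" for x
    using that bot antisym[of x bot] by (auto simp: least_def)
  ultimately show ?thesis unfolding bottom_def by (rule some_equality)
qed

definition filter_above :: "'a set \<Rightarrow> 'a set \<Rightarrow> 'a set" where
  "filter_above M A = {y \<in> M. \<exists>a\<in>A. le P a y}"

text \<open>
  The argument of a recursive atom ordering. Here \<open>good x A\<close> says that \<open>A\<close> is an initial segment of
  an admissible ordering of the covers of \<open>x\<close>. If \<open>a\<close> comes last in \<open>A\<close>, the filter above \<open>A\<close> is
  the union of the filter above \<open>A - {a}\<close> and the cone with apex \<open>a\<close>, and by \<open>join\<close> their
  intersection is the filter generated by covers of \<open>a\<close>.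
\<close>
lemma acyclic_filter:
  assumes M: "M \<subseteq> carrier P"
    and good_cov: "\<And>x A. good x A \<Longrightarrow> x \<in> M \<and> A \<subseteq> {c \<in> M. lless P x c \<and> rk c = rk x + 1}"
    and good_step: "\<And>x A. good x A \<Longrightarrow> rk x + 2 \<le> R \<Longrightarrow> (\<exists>a. A = {a}) \<or>
       (\<exists>a\<in>A. good x (A - {a}) \<and> (rk a + 2 \<le> R \<longrightarrow>
          good a {c \<in> M. lless P a c \<and> rk c = rk a + 1 \<and> (\<exists>b\<in>A - {a}. lless P b c)}))"
    and join: "\<And>x a b y. a \<in> M \<Longrightarrow> b \<in> M \<Longrightarrow> x \<in> M \<Longrightarrow> y \<in> M \<Longrightarrow> lless P x a \<Longrightarrow> lless P x b \<Longrightarrow>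
       rk a = rk x + 1 \<Longrightarrow> rk b = rk x + 1 \<Longrightarrow> a \<noteq> b \<Longrightarrow> le P a y \<Longrightarrow> le P b y \<Longrightarrow>
       \<exists>c\<in>M. lless P a c \<and> lless P b c \<and> rk c = rk a + 1 \<and> le P c y"
    and good: "good x A"
  shows "acyclic_below P (filter_above M A) (int R - int (rk x) - 2)"
  using good
proof (induction "R - rk x" arbitrary: x A rule: less_induct)
  case less
  note outer = less.hyps
  have "A \<subseteq> carrier P" using good_cov[OF less.prems] M by blast
  then have "finite A" using fin by (rule finite_subset)
  then show ?case using less.prems
  proof (induction "card A" arbitrary: A rule: less_induct)
    case (less A)
    note inner = less.hyps
    show ?case
    proof (cases "rk x + 2 \<le> R")
      case False
      then show ?thesis by (intro acyclic_below_negative) auto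
    next
      case True
      have cov: "x \<in> M" "\<And>a. a \<in> A \<Longrightarrow> a \<in> M \<and> lless P x a \<and> rk a = rk x + 1"
        using good_cov[OF less.prems(2)] by auto
      show ?thesis
      proof (cases "\<exists>a. A = {a}")
        case sing: True
        then obtain a where a: "A = {a}" by blast
        then have aM: "a \<in> carrier P" "a \<in> M" using cov(2)[of a] M by auto
        show ?thesis
        proof (rule acyclic_below_cone[of a])
          show "a \<in> filter_above M A" using aM le_refl by (auto simp: filter_above_def a)
          fix y assume y: "y \<in> filter_above M A"
          then have y': "y \<in> carrier P" "le P a y" using M by (auto simp: filter_above_def a)
          then show "y \<noteq> a \<Longrightarrow> lless P a y" by (auto simp: lless_iff)
          show "\<not> lless P y a"
            using y' aM antisym[of a y] by (auto simp: lless_iff)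
        qed
      next
        case nsing: False
        then obtain a where a: "a \<in> A" "good x (A - {a})"
          "rk a + 2 \<le> R \<Longrightarrow> good a {c \<in> M. lless P a c \<and> rk c = rk a + 1 \<and> (\<exists>b\<in>A - {a}. lless P b c)}"
          using good_step[OF less.prems(2) True] by blast
        let ?V = "filter_above M (A - {a})" and ?W = "filter_above M {a}"
        let ?C = "{c \<in> M. lless P a c \<and> rk c = rk a + 1 \<and> (\<exists>b\<in>A - {a}. lless P b c)}"
        have rka: "rk a = rk x + 1" and aM: "a \<in> M" using cov(2)[OF a(1)] by auto
        have aC: "a \<in> carrier P" using aM M by auto
        have U: "filter_above M A = ?V \<union> ?W" using a(1) by (auto simp: filter_above_def)
        have up: "z \<in> filter_above M B" if asm: "y \<in> filter_above M B" "z \<in> M" "lless P y z" "B \<subseteq> A" for y z B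
        proof -
          obtain b where b: "b \<in> B" "le P b y" "y \<in> M" using asm(1) unfolding filter_above_def by blast
          then have "le P b z" using le_trans[of b y z] asm cov(2)[of b] M by (auto simp: lless_iff)
          then show ?thesis using b asm(2) by (auto simp: filter_above_def)
        qed
        have all_up: "xs \<in> order_simplices P (filter_above M B)"
          if xs: "xs \<in> order_simplices P (?V \<union> ?W)" "xs = y # ys" "y \<in> filter_above M B" "B \<subseteq> A" for xs y ys B
        proof -
          have "z \<in> filter_above M B" if "z \<in> set ys" for z
          proof -
            have "lless P y z" "z \<in> M" using xs that by (auto simp: order_simplices_def filter_above_def)
            then show ?thesis using up[OF xs(3) _ _ xs(4)] by blast
          qed
          then show ?thesis using xs by (auto simp: order_simplices_def)
        qed
        \<comment> \<open>Both parts are closed upwards, so a chain lies in any part that contains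
          its least element.\<close>
        have spl: "order_simplices P (?V \<union> ?W) \<subseteq> order_simplices P ?V \<union> order_simplices P ?W"
        proof
          fix xs assume xs: "xs \<in> order_simplices P (?V \<union> ?W)"
          show "xs \<in> order_simplices P ?V \<union> order_simplices P ?W"
          proof (cases xs)
            case Nil
            then show ?thesis by (simp add: order_simplices_def)
          next
            case (Cons y ys)
            then have "y \<in> ?V \<or> y \<in> ?W" using xs by (auto simp: order_simplices_def)
            then show ?thesis using all_up[OF xs Cons, of "A - {a}"] all_up[OF xs Cons, of "{a}"] a(1) by auto
          qed
        qed
        \<comment> \<open>Being above \<open>a\<close> and above some other \<open>b\<close> means
          being above a common cover of both. The intersection is therefore a filter of the same
          kind, based at \<open>a\<close> instead of \<open>x\<close>.\<close>
        have inter: "?V \<inter> ?W = filter_above M ?C"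
        proof (intro subset_antisym subsetI)
          fix y assume y: "y \<in> ?V \<inter> ?W"
          then obtain b where b: "b \<in> A - {a}" "le P b y" "le P a y" "y \<in> M" by (auto simp: filter_above_def)
          have "\<exists>c\<in>M. lless P a c \<and> lless P b c \<and> rk c = rk a + 1 \<and> le P c y"
            using b cov a(1) by (intro join[of a b x y]) auto
          then show "y \<in> filter_above M ?C" using b by (auto simp: filter_above_def)
        next
          fix y assume "y \<in> filter_above M ?C"
          then obtain c b where c: "y \<in> M" "c \<in> M" "lless P a c" "b \<in> A - {a}" "lless P b c" "le P c y"
            by (auto simp: filter_above_def)
          then have "b \<in> carrier P" using cov(2)[of b] M by auto
          then have "le P a y" "le P b y"
            using c le_trans[of a c y] le_trans[of b c y] aC M by (auto simp: lless_iff)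
          then show "y \<in> ?V \<inter> ?W" using c by (auto simp: filter_above_def)
        qed
        have "acyclic_below P ?V (int R - int (rk x) - 2)"
          using a(2) less.prems(1) card_Diff1_less[OF less.prems(1) a(1)] by (intro inner) auto
        moreover have "acyclic_below P ?W (int R - int (rk x) - 2)"
        proof (rule acyclic_below_cone[of a])
          show "a \<in> ?W" using aM aC le_refl by (auto simp: filter_above_def)
          fix y assume y: "y \<in> ?W"
          then have y': "y \<in> carrier P" "le P a y" using M by (auto simp: filter_above_def)
          then show "y \<noteq> a \<Longrightarrow> lless P a y" by (auto simp: lless_iff)
          show "\<not> lless P y a"
            using y' aC antisym[of a y] by (auto simp: lless_iff)
        qed
        \<comment> \<open>The rank of \<open>a\<close> exceeds that of \<open>x\<close> by one,
          which is exactly the degree lost in the union argument.\<close>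
        moreover have "acyclic_below P (?V \<inter> ?W) (int R - int (rk x) - 2 - 1)"
        proof (cases "rk a + 2 \<le> R")
          case aR: True
          have "acyclic_below P (filter_above M ?C) (int R - int (rk a) - 2)"
            using aR rka by (intro outer a(3)) auto
          then show ?thesis unfolding inter by (simp add: rka algebra_simps)
        next
          case False
          then show ?thesis using rka by (intro acyclic_below_negative) auto
        qed
        ultimately show ?thesis unfolding U by (intro acyclic_below_union spl)
      qed
    qed
  qed
qed

lemma chain_exists:
  assumes "y \<in> carrier P" "x \<in> carrier P" "le P x y"
  shows "\<exists>xs. xs \<in> order_simplices P {u \<in> carrier P. le P x u \<and> le P u y} \<and> length xs = rk y - rk x + 1"
  using assms(2,3)
proof (induction "rk y - rk x" arbitrary: x rule: less_induct)
  case less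
  show ?case
  proof (cases "x = y")
    case True
    then show ?thesis using less.prems le_refl by (intro exI[of _ "[x]"]) (auto simp: order_simplices_def)
  next
    case False
    then have "lless P x y" using less.prems by (simp add: lless_iff)
    then obtain a where a: "a \<in> carrier P" "lless P x a" "rk a = rk x + 1" "le P a y"
      using cover less.prems assms(1) by blast
    have "rk a \<le> rk y" using rk_le a assms(1) by blast
    then obtain xs where xs: "xs \<in> order_simplices P {u \<in> carrier P. le P a u \<and> le P u y}" "length xs = rk y - rk a + 1"
      using less.hyps[of a] a by force
    have xa: "le P x a" using a(2) by (simp add: lless_iff)
    have "x # xs \<in> order_simplices P {u \<in> carrier P. le P x u \<and> le P u y}"
    proof -
      have "lless P x z" if "z \<in> set xs" for z
      proof -
        have z: "z \<in> carrier P" "le P a z" using xs that by (auto simp: order_simplices_def)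
        then show ?thesis using a less.prems lless_trans[of x a z] by (auto simp: le_iff)
      qed
      then show ?thesis using xs less.prems le_refl
        by (auto simp: order_simplices_def lless_iff)
    qed
    then show ?thesis using xs(2) a(3) \<open>rk a \<le> rk y\<close> by (intro exI[of _ "x # xs"]) auto
  qed
qed

lemma length_simplex_le:
  assumes "xs \<in> order_simplices P A" "A \<subseteq> carrier P" "\<And>u. u \<in> A \<Longrightarrow> rk u < N"
  shows "length xs \<le> N"
proof -
  have xs: "set xs \<subseteq> A" "sorted_wrt (lless P) xs" using assms by (auto simp: order_simplices_def)
  have "sorted_wrt (\<lambda>x y. rk x < rk y) xs"
    by (rule sorted_wrt_mono_rel[OF _ xs(2)]) (use rk_mono xs assms in blast)
  then have "sorted_wrt (<) (map rk xs)" by (simp add: sorted_wrt_map)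
  then have "distinct (map rk xs)" by (simp add: strict_sorted_iff)
  then have "length xs = card (rk ` set xs)" by (metis distinct_card length_map list.set_map)
  also have "\<dots> \<le> card {..<N}" using xs assms by (intro card_mono) auto
  finally show ?thesis by simp
qed

text \<open>Ranks increase strictly along chains, which bounds the length, and by
  \<open>cover\<close> some chain passes through every rank.\<close>

lemma interval_length_bot:
  assumes "y \<in> carrier P"
  shows "interval_length P bot y = int (rk y)"
proof -
  let ?I = "{u \<in> carrier P. le P bot u \<and> le P u y}"
  have I: "\<lbrace>bot..y\<rbrace>\<^bsub>P\<^esub> = ?I" by (auto simp: at_least_at_most_def)
  have le: "length xs \<le> rk y + 1" if "xs \<in> order_simplices P ?I" for xs
    using that rk_le assms by (intro length_simplex_le[of xs ?I]) (auto simp: less_Suc_eq_le)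
  obtain xs where xs: "xs \<in> order_simplices P ?I" "length xs = rk y + 1"
    using chain_exists[OF assms bot(1)] bot assms by auto
  have "Max (length ` order_simplices P ?I) = rk y + 1"
  proof (rule Max_eqI)
    have "length ` order_simplices P ?I \<subseteq> {..rk y + 1}" using le by auto
    then show "finite (length ` order_simplices P ?I)" by (rule finite_subset) simp
    show "rk y + 1 \<in> length ` order_simplices P ?I" using xs by force
  qed (use le in auto)
  then show ?thesis by (simp add: interval_length_def I)
qed

end

text \<open>
  Carries traces from modules of HOL-Algebra over to the vector spaces of the type-class library.
\<close>
locale embedded_space =
  fixes V :: "(rat, 'v) module" and \<Theta> :: "'v \<Rightarrow> ('k \<Rightarrow>\<^sub>0 rat)"
  assumes zero_closed: "\<zero>\<^bsub>V\<^esub> \<in> carrier V"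
    and add_closed: "x \<in> carrier V \<Longrightarrow> y \<in> carrier V \<Longrightarrow> x \<oplus>\<^bsub>V\<^esub> y \<in> carrier V"
    and scale_closed: "x \<in> carrier V \<Longrightarrow> r \<odot>\<^bsub>V\<^esub> x \<in> carrier V"
    and map_zero: "\<Theta> \<zero>\<^bsub>V\<^esub> = 0"
    and map_add: "x \<in> carrier V \<Longrightarrow> y \<in> carrier V \<Longrightarrow> \<Theta> (x \<oplus>\<^bsub>V\<^esub> y) = \<Theta> x + \<Theta> y"
    and map_scale: "x \<in> carrier V \<Longrightarrow> \<Theta> (r \<odot>\<^bsub>V\<^esub> x) = qscale r (\<Theta> x)"
    and inj: "inj_on \<Theta> (carrier V)"
begin

lemma map_eqD: "\<Theta> x = \<Theta> y \<Longrightarrow> x \<in> carrier V \<Longrightarrow> y \<in> carrier V \<Longrightarrow> x = y"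
  using inj by (auto dest: inj_onD)

lemma vs: "vectorspace class_ring V"
proof (rule vectorspace.intro[OF _ class_field], rule module_criteria)
  show "cring (class_ring :: rat ring)" by (rule domain.axioms(1)[OF field.axioms(1)[OF class_field]])
  show "\<forall>v\<in>carrier V. \<exists>neg_v\<in>carrier V. v \<oplus>\<^bsub>V\<^esub> neg_v = \<zero>\<^bsub>V\<^esub>"
  proof
    fix v assume v: "v \<in> carrier V"
    have "\<Theta> (v \<oplus>\<^bsub>V\<^esub> ((-1) \<odot>\<^bsub>V\<^esub> v)) = \<Theta> \<zero>\<^bsub>V\<^esub>"
      using v by (simp add: map_add map_scale scale_closed map_zero)
    then have "v \<oplus>\<^bsub>V\<^esub> ((-1) \<odot>\<^bsub>V\<^esub> v) = \<zero>\<^bsub>V\<^esub>"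
      by (rule map_eqD) (simp_all add: v add_closed scale_closed zero_closed)
    then show "\<exists>neg_v\<in>carrier V. v \<oplus>\<^bsub>V\<^esub> neg_v = \<zero>\<^bsub>V\<^esub>" using v scale_closed by blast
  qed
qed (auto intro!: map_eqD simp: zero_closed add_closed scale_closed map_zero map_add map_scale
      Q.scale_left_distrib Q.scale_right_distrib algebra_simps)

sublocale vectorspace class_ring V
  by (rule vs)

lemma lincomb_map:
  assumes "finite A" "A \<subseteq> carrier V"
  shows "lincomb a A \<in> carrier V \<and> \<Theta> (lincomb a A) = (\<Sum>x\<in>A. qscale (a x) (\<Theta> x))"
  using assms
proof (induction A)
  case empty
  then show ?case by (simp add: lincomb_def zero_closed map_zero)
next
  case (insert x A)
  have "lincomb a (insert x A) = a x \<odot>\<^bsub>V\<^esub> x \<oplus>\<^bsub>V\<^esub> lincomb a A"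
    unfolding lincomb_def using insert.hyps insert.prems scale_closed
    by (subst finsum_insert) auto
  then show ?case using insert by (simp add: add_closed scale_closed map_add map_scale)
qed

lemma lin_dep_map:
  assumes A: "A \<subseteq> carrier V"
  shows "lin_dep A \<longleftrightarrow> Q.dependent (\<Theta> ` A)"
proof
  assume "lin_dep A"
  then obtain B a v where B: "finite B" "B \<subseteq> A" "lincomb a B = \<zero>\<^bsub>V\<^esub>" "v \<in> B" "a v \<noteq> 0"
    by (auto simp: lin_dep_def)
  then have BC: "B \<subseteq> carrier V" using A by blast
  let ?u = "\<lambda>y. a (inv_into (carrier V) \<Theta> y)"
  have u: "?u (\<Theta> x) = a x" if "x \<in> B" for x
    using that BC inj by (simp add: subset_iff)
  have injB: "inj_on \<Theta> B" using inj BC inj_on_subset by blast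
  have "(\<Sum>y\<in>\<Theta> ` B. qscale (?u y) y) = (\<Sum>x\<in>B. qscale (a x) (\<Theta> x))"
    using injB u by (simp add: sum.reindex)
  also have "\<dots> = 0" using lincomb_map[OF B(1) BC, of a] B(3) map_zero by simp
  finally show "Q.dependent (\<Theta> ` A)"
    unfolding Q.dependent_explicit using B u
    by (intro exI[of _ "\<Theta> ` B"] exI[of _ ?u]) auto
next
  assume "Q.dependent (\<Theta> ` A)"
  then obtain T u y where T: "finite T" "T \<subseteq> \<Theta> ` A" "(\<Sum>v\<in>T. qscale (u v) v) = 0" "y \<in> T" "u y \<noteq> 0"
    by (auto simp: Q.dependent_explicit)
  obtain B where B: "B \<subseteq> A" "T = \<Theta> ` B" "inj_on \<Theta> B"
    using T(2) subset_image_inj by metis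
  have BC: "B \<subseteq> carrier V" using A B by blast
  have fB: "finite B" using B T(1) finite_image_iff by metis
  obtain v where v: "v \<in> B" "y = \<Theta> v" using B T by blast
  have "\<Theta> (lincomb (\<lambda>x. u (\<Theta> x)) B) = 0"
    using lincomb_map[OF fB BC] T(3) B by (simp add: sum.reindex)
  then have "lincomb (\<lambda>x. u (\<Theta> x)) B = \<zero>\<^bsub>V\<^esub>"
    using lincomb_map[OF fB BC] zero_closed map_zero by (intro map_eqD) auto
  then show "lin_dep A"
    unfolding lin_dep_def using fB B v T by (intro exI[of _ B] exI[of _ "\<lambda>x. u (\<Theta> x)"] exI[of _ v]) auto
qed

lemma span_map:
  assumes A: "A \<subseteq> carrier V"
  shows "span A \<subseteq> carrier V" "\<Theta> ` span A = Q.span (\<Theta> ` A)"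
proof -
  show sub: "span A \<subseteq> carrier V"
    using lincomb_map A by (auto simp: span_def)
  show "\<Theta> ` span A = Q.span (\<Theta> ` A)"
  proof
    show "\<Theta> ` span A \<subseteq> Q.span (\<Theta> ` A)"
    proof
      fix y assume "y \<in> \<Theta> ` span A"
      then obtain a B where B: "finite B" "B \<subseteq> A" "y = \<Theta> (lincomb a B)" by (auto simp: span_def)
      then have "y = (\<Sum>x\<in>B. qscale (a x) (\<Theta> x))" using lincomb_map A by auto
      moreover have "qscale (a x) (\<Theta> x) \<in> Q.span (\<Theta> ` A)" if "x \<in> B" for x
        using that B(2) by (intro Q.span_scale Q.span_base) blast
      ultimately show "y \<in> Q.span (\<Theta> ` A)" by (simp add: Q.span_sum)
    qed
    show "Q.span (\<Theta> ` A) \<subseteq> \<Theta> ` span A"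
    proof
      fix y assume "y \<in> Q.span (\<Theta> ` A)"
      then obtain T r where T: "finite T" "T \<subseteq> \<Theta> ` A" "y = (\<Sum>v\<in>T. qscale (r v) v)"
        by (auto simp: Q.span_explicit)
      obtain B where B: "B \<subseteq> A" "T = \<Theta> ` B" "inj_on \<Theta> B"
        using T(2) subset_image_inj by metis
      have BC: "B \<subseteq> carrier V" using A B by blast
      have fB: "finite B" using B T(1) finite_image_iff by metis
      have "y = \<Theta> (lincomb (\<lambda>x. r (\<Theta> x)) B)"
        using lincomb_map[OF fB BC] T(3) B by (simp add: sum.reindex)
      then show "y \<in> \<Theta> ` span A" using B fB by (auto simp: span_def)
    qed
  qed
qed

text \<open>\<open>vs_trace\<close> is a definite description over all finite bases, so existence
  and uniqueness have to be shown. Both are transported through \<open>\<Theta>\<close>: bases of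
  \<open>V\<close> correspond to bases of the image, and \<open>span_trace\<close> does not depend
  on the basis.\<close>

lemma vs_trace_eq_span_trace:
  assumes T: "finite T" "\<Theta> ` carrier V \<subseteq> Q.span T"
    and F: "Vector_Spaces.linear qscale qscale F"
    and f: "\<And>v. v \<in> carrier V \<Longrightarrow> f v \<in> carrier V" "\<And>v. v \<in> carrier V \<Longrightarrow> \<Theta> (f v) = F (\<Theta> v)"
  shows "vs_trace V f = Q.span_trace (\<Theta> ` carrier V) F"
proof -
  let ?S = "\<Theta> ` carrier V"
  let ?P = "\<lambda>r. \<exists>A a. finite A \<and> basis A \<and> (\<forall>b\<in>A. f b = lincomb (a b) A) \<and> r = (\<Sum>b\<in>A. a b b)"
  have FS: "F v \<in> ?S" if "v \<in> ?S" for v using that f by force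
  have uniq: "r = Q.span_trace ?S F" if "?P r" for r
  proof -
    obtain A a where A: "finite A" "basis A" "\<And>b. b \<in> A \<Longrightarrow> f b = lincomb (a b) A" "r = (\<Sum>b\<in>A. a b b)"
      using \<open>?P r\<close> by blast
    have AC: "A \<subseteq> carrier V" and nd: "\<not> lin_dep A" and gen: "span A = carrier V"
      using A(2) by (auto simp: basis_def)
    have ind: "Q.independent (\<Theta> ` A)" using nd lin_dep_map[OF AC] by blast
    have sp: "Q.span (\<Theta> ` A) = ?S" using span_map(2)[OF AC] gen by simp
    have injA: "inj_on \<Theta> A" using inj AC inj_on_subset by blast
    have "Q.span_trace ?S F = Q.basis_trace (\<Theta> ` A) F"
      using A(1) ind sp F FS by (intro Q.span_trace_eq) auto
    also have "\<dots> = (\<Sum>b\<in>A. Q.representation (\<Theta> ` A) (F (\<Theta> b)) (\<Theta> b))"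
      by (simp add: Q.basis_trace_def sum.reindex[OF injA])
    also have "\<dots> = (\<Sum>b\<in>A. a b b)"
    proof (rule sum.cong[OF refl])
      fix b assume b: "b \<in> A"
      have "F (\<Theta> b) = (\<Sum>x\<in>A. qscale (a b x) (\<Theta> x))"
        using f(2)[of b] A(3)[OF b] lincomb_map[OF A(1) AC, of "a b"] b AC by auto
      then have "Q.representation (\<Theta> ` A) (F (\<Theta> b)) (\<Theta> b)
        = Q.representation (\<Theta> ` A) (\<Sum>x\<in>A. qscale (a b x) (\<Theta> x)) (\<Theta> b)" by simp
      also have "\<dots> = (\<Sum>x\<in>A. Q.representation (\<Theta> ` A) (qscale (a b x) (\<Theta> x)) (\<Theta> b))"
        by (subst Q.representation_sum[OF ind]) (auto intro: Q.span_scale Q.span_base)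
      also have "\<dots> = (\<Sum>x\<in>A. if x = b then a b b else 0)"
        using ind b injA by (intro sum.cong refl) (auto simp: Q.representation_scale Q.span_base Q.representation_basis inj_on_eq_iff)
      also have "\<dots> = a b b" using A(1) b by simp
      finally show "Q.representation (\<Theta> ` A) (F (\<Theta> b)) (\<Theta> b) = a b b" .
    qed
    finally show ?thesis using A(4) by simp
  qed
  have subS: "Q.subspace ?S"
    unfolding Q.subspace_def
  proof (intro conjI ballI allI)
    show "0 \<in> ?S" using map_zero zero_closed by (metis imageI)
    fix x y assume "x \<in> ?S" "y \<in> ?S"
    then show "x + y \<in> ?S" using map_add add_closed by (metis (no_types, lifting) image_iff)
  next
    fix r x assume "x \<in> ?S"
    then show "qscale r x \<in> ?S" using map_scale scale_closed by (metis (no_types, lifting) image_iff)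
  qed
  obtain B where B: "finite B" "Q.independent B" "Q.span B = ?S"
    by (rule Q.finite_basis_exists[OF T subS])
  have "B \<subseteq> \<Theta> ` carrier V" using B Q.span_superset by blast
  then obtain A where A: "A \<subseteq> carrier V" "B = \<Theta> ` A" "inj_on \<Theta> A"
    using subset_image_inj by metis
  have fA: "finite A" using A B(1) finite_image_iff by metis
  have bas: "basis A"
  proof -
    have "\<Theta> ` span A = \<Theta> ` carrier V" using span_map[OF A(1)] A(2) B(3) by simp
    then have "span A = carrier V" using inj_on_image_eq_iff[OF inj span_map(1)[OF A(1)]] by simp
    then show ?thesis using lin_dep_map[OF A(1)] B A by (simp add: basis_def)
  qed
  define a where "a b x = Q.representation B (F (\<Theta> b)) (\<Theta> x)" for b x
  have "f b = lincomb (a b) A" if b: "b \<in> A" for b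
  proof (rule map_eqD)
    have bC: "b \<in> carrier V" using b A by blast
    then have "F (\<Theta> b) \<in> Q.span B" using FS B by auto
    then have "F (\<Theta> b) = (\<Sum>x\<in>B. qscale (Q.representation B (F (\<Theta> b)) x) x)"
      using Q.sum_representation_eq[OF B(2) _ B(1) order.refl] by simp
    also have "\<dots> = \<Theta> (lincomb (a b) A)"
      using lincomb_map[OF fA A(1)] A by (simp add: a_def sum.reindex)
    finally show "\<Theta> (f b) = \<Theta> (lincomb (a b) A)" using f(2) bC by simp
    show "f b \<in> carrier V" "lincomb (a b) A \<in> carrier V" using f(1) bC lincomb_map[OF fA A(1)] by auto
  qed
  then have P: "?P (\<Sum>b\<in>A. a b b)" using fA bas by blast
  show ?thesis
    unfolding vs_trace_def
  proof (rule the_equality)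
    show "?P (Q.span_trace ?S F)" using P uniq[OF P] by simp
  qed (rule uniq)
qed

end

lemma lin_sum_fun: "(\<Sum>y\<in>Y. lin (F y) w) = lin (\<lambda>k. \<Sum>y\<in>Y. F y k) w"
proof -
  have "(\<Sum>y\<in>Y. lin (F y) w) = (\<Sum>k\<in>Poly_Mapping.keys w. \<Sum>y\<in>Y. qscale (Poly_Mapping.lookup w k) (F y k))"
    unfolding lin_def by (rule sum.swap)
  then show ?thesis by (simp add: lin_def Q.scale_sum_right)
qed

lemma face_sum_map: "face_sum (map f xs) = push_chain f (face_sum xs)"
  by (simp add: face_sum_def push_chain_eq_lin lin_sum take_map drop_map)

lemma push_chain_single [simp]: "push_chain f (Poly_Mapping.single xs r) = Poly_Mapping.single (map f xs) r"
  by (simp add: push_chain_eq_lin)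

lemma linear_push_chain: "Vector_Spaces.linear qscale qscale (push_chain f)"
  unfolding push_chain_eq_lin by (rule linear_lin)

section \<open>Traces on Whitney homology\<close>

definition free_span :: "'k set \<Rightarrow> ('k \<Rightarrow>\<^sub>0 rat) set" where
  "free_span K = {w. Poly_Mapping.keys w \<subseteq> K}"

lemma inj_single_1: "inj_on (\<lambda>k. Poly_Mapping.single k (1 :: rat)) K"
proof (rule inj_onI)
  fix x y assume "Poly_Mapping.single x (1 :: rat) = Poly_Mapping.single y 1"
  then have "Poly_Mapping.keys (Poly_Mapping.single x (1 :: rat)) = Poly_Mapping.keys (Poly_Mapping.single y (1 :: rat))"
    by simp
  then show "x = y" by simp
qed

lemma single_1_eq_iff: "Poly_Mapping.single x (1 :: rat) = Poly_Mapping.single y 1 \<longleftrightarrow> x = y"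
  using inj_single_1[of UNIV] by (auto dest: injD)

lemma independent_singles: "Q.independent ((\<lambda>k. Poly_Mapping.single k 1) ` K)"
  unfolding Q.independent_explicit_module
proof (intro allI impI)
  fix T u v
  assume T: "finite T" "T \<subseteq> (\<lambda>k. Poly_Mapping.single k (1 :: rat)) ` K" "(\<Sum>x\<in>T. qscale (u x) x) = 0" "v \<in> T"
  obtain k where k: "v = Poly_Mapping.single k 1" using T by blast
  have "Poly_Mapping.lookup (\<Sum>x\<in>T. qscale (u x) x) k = (\<Sum>x\<in>T. if x = v then u v else 0)"
    unfolding lookup_sum
  proof (rule sum.cong[OF refl])
    fix x assume "x \<in> T"
    then obtain l where "x = Poly_Mapping.single l 1" using T(2) by blast
    then show "Poly_Mapping.lookup (qscale (u x) x) k = (if x = v then u v else 0)"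
      using inj_single_1[of UNIV] by (auto simp: k lookup_single when_def inj_on_def)
  qed
  then show "u v = 0" using T by simp
qed

lemma span_singles:
  fixes K :: "'k set"
  shows "Q.span ((\<lambda>k. Poly_Mapping.single k 1) ` K) = free_span K"
proof
  have "Q.subspace (free_span K)"
    unfolding Q.subspace_def free_span_def
  proof (intro conjI ballI allI)
    fix x y :: "'k \<Rightarrow>\<^sub>0 rat" and c :: rat
    assume x: "x \<in> {w. Poly_Mapping.keys w \<subseteq> K}"
    have "Poly_Mapping.keys (qscale c x) \<subseteq> Poly_Mapping.keys x" by (auto simp: in_keys_iff)
    then show "qscale c x \<in> {w. Poly_Mapping.keys w \<subseteq> K}" using x by blast
    assume "y \<in> {w. Poly_Mapping.keys w \<subseteq> K}"
    then show "x + y \<in> {w. Poly_Mapping.keys w \<subseteq> K}" using x Poly_Mapping.keys_add[of x y] by blast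
  qed simp
  then show "Q.span ((\<lambda>k. Poly_Mapping.single k 1) ` K) \<subseteq> free_span K"
    by (rule Q.span_minimal[rotated]) (auto simp: free_span_def)
  show "free_span K \<subseteq> Q.span ((\<lambda>k. Poly_Mapping.single k 1) ` K)"
  proof
    fix w assume w: "w \<in> free_span K"
    have "w = (\<Sum>k\<in>Poly_Mapping.keys w. qscale (Poly_Mapping.lookup w k) (Poly_Mapping.single k 1))"
      using lin_single_1[of w] by (simp add: lin_def)
    also have "\<dots> \<in> Q.span ((\<lambda>k. Poly_Mapping.single k 1) ` K)"
      using w by (intro Q.span_sum Q.span_scale Q.span_base) (auto simp: free_span_def)
    finally show "w \<in> Q.span ((\<lambda>k. Poly_Mapping.single k 1) ` K)" .
  qed
qed

lemma subspace_free_span: "Q.subspace (free_span K)"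
  unfolding span_singles[symmetric] by simp

text \<open>In the basis of single lists each column of the matrix has one entry 1, so the trace
  counts the fixed lists.\<close>

lemma span_trace_free_span:
  assumes K: "finite K" and f: "\<And>xs. xs \<in> K \<Longrightarrow> map f xs \<in> K"
  shows "Q.span_trace (free_span K) (push_chain f) = of_nat (card {xs \<in> K. map f xs = xs})"
proof -
  let ?s = "\<lambda>k. Poly_Mapping.single k (1 :: rat)"
  have mem: "push_chain f v \<in> free_span K" if "v \<in> free_span K" for v
    using that keys_lin[of "\<lambda>xs. ?s (map f xs)" v] f
    by (fastforce simp: free_span_def push_chain_eq_lin)
  have "Q.span_trace (free_span K) (push_chain f) = Q.basis_trace (?s ` K) (push_chain f)"
    using K mem by (intro Q.span_trace_eq independent_singles span_singles linear_push_chain) auto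
  also have "\<dots> = (\<Sum>xs\<in>K. Q.representation (?s ` K) (?s (map f xs)) (?s xs))"
    by (simp add: Q.basis_trace_def sum.reindex[OF inj_single_1])
  also have "\<dots> = (\<Sum>xs\<in>K. if map f xs = xs then 1 else 0)"
    using f by (intro sum.cong refl, subst Q.representation_basis[OF independent_singles])
      (auto simp: single_1_eq_iff)
  also have "\<dots> = of_nat (card {xs \<in> K. map f xs = xs})"
    using K by (simp add: sum.If_cases Collect_conj_eq)
  finally show ?thesis .
qed

section \<open>Marked chains: all intervals of one rank in a single complex\<close>

definition snoc_chain :: "'a \<Rightarrow> ('a list \<Rightarrow>\<^sub>0 rat) \<Rightarrow> ('a list \<Rightarrow>\<^sub>0 rat)" where
  "snoc_chain y = lin (\<lambda>xs. Poly_Mapping.single (xs @ [y]) 1)"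

definition strip_chain :: "'a \<Rightarrow> ('a list \<Rightarrow>\<^sub>0 rat) \<Rightarrow> ('a list \<Rightarrow>\<^sub>0 rat)" where
  "strip_chain y = lin (\<lambda>ys. if ys \<noteq> [] \<and> last ys = y then Poly_Mapping.single (butlast ys) 1 else 0)"

text \<open>The direct sum of the boundary maps of the separate intervals: the last entry marks the
  summand and is never deleted.\<close>

definition inner_boundary :: "('a list \<Rightarrow>\<^sub>0 rat) \<Rightarrow> ('a list \<Rightarrow>\<^sub>0 rat)" where
  "inner_boundary = lin (\<lambda>ys. if ys = [] then 0 else snoc_chain (last ys) (face_sum (butlast ys)))"

lemma strip_snoc: "strip_chain y (snoc_chain y' z) = (if y = y' then z else 0)"
  by (auto simp: strip_chain_def snoc_chain_def lin_lin lin_single_1 lin_zero_fun)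

lemma inner_boundary_snoc: "inner_boundary (snoc_chain y z) = snoc_chain y (boundary z)"
  by (simp add: inner_boundary_def snoc_chain_def lin_lin boundary_eq_lin)

lemma inner_boundary_sum: "inner_boundary (sum z I) = (\<Sum>i\<in>I. inner_boundary (z i))"
  by (simp add: inner_boundary_def lin_sum)

lemma strip_chain_sum: "strip_chain y (sum z I) = (\<Sum>i\<in>I. strip_chain y (z i))"
  by (simp add: strip_chain_def lin_sum)

lemma push_chain_0 [simp]: "push_chain f 0 = 0"
  by (simp add: push_chain_eq_lin)

lemma push_snoc: "push_chain f (snoc_chain y z) = snoc_chain (f y) (push_chain f z)"
  by (simp add: push_chain_eq_lin snoc_chain_def lin_lin)

lemma inner_boundary_push: "inner_boundary (push_chain f w) = push_chain f (inner_boundary w)"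
proof -
  have "inner_boundary (push_chain f w) = lin (\<lambda>ys. inner_boundary (Poly_Mapping.single (map f ys) 1)) w"
    by (simp add: inner_boundary_def push_chain_eq_lin lin_lin)
  also have "\<dots> = lin (\<lambda>ys. push_chain f (inner_boundary (Poly_Mapping.single ys 1))) w"
  proof (rule lin_cong)
    fix ys
    show "inner_boundary (Poly_Mapping.single (map f ys) 1) = push_chain f (inner_boundary (Poly_Mapping.single ys 1))"
    proof (cases "ys = []")
      case True
      then show ?thesis by (simp add: inner_boundary_def push_chain_eq_lin)
    next
      case False
      then show ?thesis
        by (simp add: inner_boundary_def push_snoc last_map map_butlast[symmetric] face_sum_map)
    qed
  qed
  also have "\<dots> = push_chain f (inner_boundary w)"
    by (simp add: inner_boundary_def push_chain_eq_lin lin_lin)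
  finally show ?thesis .
qed

lemma elt_plus_zero: "z +o {0 :: 'b :: comm_monoid_add} = {z}"
  by (auto simp: elt_set_plus_def)

section \<open>The trace of a poset automorphism\<close>

locale poset_automorphism = graded_poset +
  fixes f :: "'a \<Rightarrow> 'a" and rkq :: "'a \<Rightarrow> rat"
  assumes acyc: "y \<in> carrier P \<Longrightarrow> y \<noteq> bot \<Longrightarrow> acyclic_below P (open_interval P bot y) (int (rk y) - 2)"
    and f_bij: "bij_betw f (carrier P) (carrier P)"
    and f_le: "x \<in> carrier P \<Longrightarrow> y \<in> carrier P \<Longrightarrow> le P (f x) (f y) \<longleftrightarrow> le P x y"
    and f_rk: "x \<in> carrier P \<Longrightarrow> rk (f x) = rk x"
    and rkq: "x \<in> carrier P \<Longrightarrow> rkq x = of_nat (rk x)"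
begin

text \<open>
  By P. Hall's theorem this is the Moebius function of the subposet of \<open>f\<close>-fixed elements.
\<close>
definition mob :: "'a \<Rightarrow> rat" where
  "mob y = (if y = bot then 1 else
     \<Sum>xs\<in>{xs \<in> order_simplices P (open_interval P bot y). map f xs = xs}. (-1) ^ (length xs + 1))"

lemma f_carrier: "x \<in> carrier P \<Longrightarrow> f x \<in> carrier P"
  using f_bij by (auto simp: bij_betw_def)

lemma f_inj: "x \<in> carrier P \<Longrightarrow> y \<in> carrier P \<Longrightarrow> f x = f y \<Longrightarrow> x = y"
  using f_bij by (auto simp: bij_betw_def inj_on_def)

lemma f_lless: "x \<in> carrier P \<Longrightarrow> y \<in> carrier P \<Longrightarrow> lless P (f x) (f y) \<longleftrightarrow> lless P x y"
  using f_le f_inj by (auto simp: lless_iff)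

lemma rk_0_iff: "x \<in> carrier P \<Longrightarrow> rk x = 0 \<longleftrightarrow> x = bot"
  using le_rk_eq[of bot x] bot by auto

lemma f_bot: "f bot = bot"
  using rk_0_iff[of "f bot"] f_rk[of bot] bot f_carrier by simp

lemma f_open_interval:
  assumes "y \<in> carrier P" "x \<in> open_interval P bot y"
  shows "f x \<in> open_interval P bot (f y)"
  using assms f_lless[of bot x] f_lless[of x y] bot f_carrier by (auto simp: open_interval_def f_bot)

lemma f_order_simplices:
  assumes "y \<in> carrier P" "xs \<in> order_simplices P (open_interval P bot y)"
  shows "map f xs \<in> order_simplices P (open_interval P bot (f y))"
proof -
  have xs: "set xs \<subseteq> open_interval P bot y" "sorted_wrt (lless P) xs" using assms by (auto simp: order_simplices_def)
  have "sorted_wrt (\<lambda>a b. lless P (f a) (f b)) xs"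
  proof (rule sorted_wrt_mono_rel[OF _ xs(2)])
    fix a b assume "a \<in> set xs" "b \<in> set xs" "lless P a b"
    moreover have "set xs \<subseteq> carrier P" using xs(1) by (auto simp: open_interval_def)
    ultimately show "lless P (f a) (f b)" using f_lless by blast
  qed
  then show ?thesis using xs f_open_interval[OF assms(1)] by (auto simp: order_simplices_def sorted_wrt_map)
qed

lemma length_interval_simplex:
  assumes y: "y \<in> carrier P" "y \<noteq> bot" and xs: "xs \<in> order_simplices P (open_interval P bot y)"
  shows "length xs + 1 \<le> rk y"
proof -
  have "bot # xs \<in> order_simplices P ({bot} \<union> open_interval P bot y)"
    using xs by (auto simp: order_simplices_def open_interval_def)
  then have "length (bot # xs) \<le> rk y"
  proof (rule length_simplex_le)
    show "{bot} \<union> open_interval P bot y \<subseteq> carrier P" using bot by (auto simp: open_interval_def)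
    fix u assume "u \<in> {bot} \<union> open_interval P bot y"
    then show "rk u < rk y" using rk_mono[of u y] rk_0_iff[of y] y bot by (auto simp: open_interval_def)
  qed
  then show ?thesis by simp
qed

lemma open_interval_bot: "open_interval P bot bot = {}"
  using antisym bot by (auto simp: open_interval_def lless_iff)

lemma finite_interval_simplices: "finite (order_simplices P (open_interval P bot y))" if "y \<in> carrier P"
proof (rule finite_subset)
  have "length xs \<le> rk y" if "xs \<in> order_simplices P (open_interval P bot y)" for xs
  proof (cases "y = bot")
    case True
    then show ?thesis using that by (simp add: order_simplices_def open_interval_bot)
  next
    case False
    then show ?thesis using length_interval_simplex[OF \<open>y \<in> carrier P\<close> False that] by simp
  qed
  then show "order_simplices P (open_interval P bot y) \<subseteq> {xs. set xs \<subseteq> carrier P \<and> length xs \<le> rk y}"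
    by (auto simp: order_simplices_def open_interval_def)
  show "finite {xs. set xs \<subseteq> carrier P \<and> length xs \<le> rk y}"
    using fin by (rule finite_lists_length_le)
qed

context
  fixes i :: int
begin

definition level :: "'a set" where "level = rank_level P rkq i"

text \<open>The number of vertices of a top-dimensional simplex in the open interval below an
  element of rank \<open>i\<close>. For \<open>i = 0\<close> it is 0 again, in accordance with the
  convention that takes degree -1 of the empty complex.\<close>

definition codeg :: nat where "codeg = (if i \<ge> 1 then nat i - 1 else 0)"

lemma level_iff: "y \<in> level \<longleftrightarrow> y \<in> carrier P \<and> int (rk y) = i"
proof -
  have "(of_nat (rk y) :: rat) = of_int i \<longleftrightarrow> int (rk y) = i"
    by (metis of_int_eq_iff of_int_of_nat_eq)
  then show ?thesis by (cases "y \<in> carrier P") (simp_all add: level_def rank_level_def rkq)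
qed

lemma finite_level: "finite level"
  using fin by (rule finite_subset[rotated]) (auto simp: level_iff)

lemma top_degree_level: "y \<in> level \<Longrightarrow> top_degree P bot y = int codeg - 1"
  using rk_0_iff[of y] bot
  by (auto simp: top_degree_def level_iff interval_length_bot codeg_def)

text \<open>
  All summands of the \<open>i\<close>-th Whitney homology are treated at once: a chain \<open>xs\<close> in the open interval
  below an element \<open>y\<close> of rank \<open>i\<close> is encoded as the list \<open>xs @ [y]\<close>.
\<close>
definition Lset :: "nat \<Rightarrow> 'a list set" where
  "Lset j = {xs @ [y] | xs y. y \<in> level \<and> xs \<in> order_simplices P (open_interval P bot y) \<and> length xs = j}"

lemma finite_Lset: "finite (Lset j)"
proof (rule finite_subset)
  show "Lset j \<subseteq> {xs. set xs \<subseteq> carrier P \<and> length xs = j + 1}"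
    by (auto simp: Lset_def order_simplices_def open_interval_def level_iff)
qed (rule finite_lists_length_eq[OF fin])

lemma f_Lset: "ys \<in> Lset j \<Longrightarrow> map f ys \<in> Lset j"
  unfolding Lset_def using f_order_simplices f_carrier f_rk by (fastforce simp: level_iff)

lemma free_span_Lset:
  "w \<in> free_span (Lset j) \<longleftrightarrow> (\<forall>ys\<in>Poly_Mapping.keys w. \<exists>xs y. ys = xs @ [y] \<and> y \<in> level \<and>
     xs \<in> order_simplices P (open_interval P bot y) \<and> length xs = j)"
  by (auto simp: free_span_def Lset_def)

lemma strip_chains:
  assumes "w \<in> free_span (Lset j)"
  shows "strip_chain y w \<in> chains P (open_interval P bot y) (int j - 1)"
  unfolding strip_chain_def
proof (rule chains_lin)
  fix ys assume "ys \<in> Poly_Mapping.keys w"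
  then obtain xs y' where "ys = xs @ [y']" "xs \<in> order_simplices P (open_interval P bot y')" "length xs = j"
    using assms free_span_Lset by blast
  then show "(if ys \<noteq> [] \<and> last ys = y then Poly_Mapping.single (butlast ys) 1 else 0)
    \<in> chains P (open_interval P bot y) (int j - 1)"
    by (auto simp: chains_iff)
qed

lemma snoc_free_span:
  assumes "y \<in> level" "z \<in> chains P (open_interval P bot y) (int j - 1)"
  shows "snoc_chain y z \<in> free_span (Lset j)"
  using keys_lin[of "\<lambda>xs. Poly_Mapping.single (xs @ [y]) 1" z] assms
  by (fastforce simp: free_span_Lset snoc_chain_def chains_iff)

lemma sum_snoc_strip:
  assumes "w \<in> free_span (Lset j)"
  shows "(\<Sum>y\<in>level. snoc_chain y (strip_chain y w)) = w"
proof -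
  have "(\<Sum>y\<in>level. snoc_chain y (strip_chain y w))
    = lin (\<lambda>ys. \<Sum>y\<in>level. snoc_chain y (if ys \<noteq> [] \<and> last ys = y then Poly_Mapping.single (butlast ys) 1 else 0)) w"
    unfolding lin_sum_fun[symmetric] by (simp add: snoc_chain_def strip_chain_def lin_lin)
  also have "\<dots> = lin (\<lambda>ys. Poly_Mapping.single ys 1) w"
  proof (rule lin_cong)
    fix ys assume "ys \<in> Poly_Mapping.keys w"
    then obtain xs y where ys: "ys = xs @ [y]" "y \<in> level" using assms free_span_Lset by blast
    have "(\<Sum>y'\<in>level. snoc_chain y' (if ys \<noteq> [] \<and> last ys = y' then Poly_Mapping.single (butlast ys) 1 else 0))
      = (\<Sum>y'\<in>level. if y = y' then Poly_Mapping.single ys 1 else 0)"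
      by (intro sum.cong) (auto simp: ys snoc_chain_def)
    also have "\<dots> = Poly_Mapping.single ys 1" using finite_level ys by simp
    finally show "(\<Sum>y'\<in>level. snoc_chain y' (if ys \<noteq> [] \<and> last ys = y' then Poly_Mapping.single (butlast ys) 1 else 0))
      = Poly_Mapping.single ys 1" .
  qed
  finally show ?thesis by (simp add: lin_single_1)
qed

lemma strip_inner_boundary:
  assumes "w \<in> free_span (Lset j)"
  shows "strip_chain y (inner_boundary w) = boundary (strip_chain y w)"
proof -
  have "strip_chain y (inner_boundary w) = (\<Sum>y'\<in>level. strip_chain y (snoc_chain y' (boundary (strip_chain y' w))))"
    by (subst (1) sum_snoc_strip[OF assms, symmetric])
      (simp add: inner_boundary_sum strip_chain_sum inner_boundary_snoc)
  also have "\<dots> = (\<Sum>y'\<in>level. if y = y' then boundary (strip_chain y w) else 0)"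
    by (intro sum.cong) (auto simp: strip_snoc)
  also have "\<dots> = boundary (strip_chain y w)"
  proof (cases "y \<in> level")
    case False
    have "strip_chain y w = lin (\<lambda>_. 0) w"
      unfolding strip_chain_def
    proof (rule lin_cong)
      fix ys assume "ys \<in> Poly_Mapping.keys w"
      then obtain xs y' where "ys = xs @ [y']" "y' \<in> level" using assms free_span_Lset by blast
      then show "(if ys \<noteq> [] \<and> last ys = y then Poly_Mapping.single (butlast ys) 1 else 0) = 0"
        using False by auto
    qed
    then show ?thesis using False finite_level by (simp add: lin_zero_fun)
  qed (use finite_level in simp)
  finally show ?thesis .
qed

lemma inner_boundary_free_span:
  assumes "w \<in> free_span (Lset (Suc j))"
  shows "inner_boundary w \<in> free_span (Lset j)"
proof -
  have "inner_boundary w = (\<Sum>y\<in>level. snoc_chain y (boundary (strip_chain y w)))"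
    by (subst (1) sum_snoc_strip[OF assms, symmetric]) (simp add: inner_boundary_sum inner_boundary_snoc)
  also have "\<dots> \<in> free_span (Lset j)"
  proof (rule Q.subspace_sum[OF subspace_free_span])
    fix y assume "y \<in> level"
    then show "snoc_chain y (boundary (strip_chain y w)) \<in> free_span (Lset j)"
      using chains_boundary[OF strip_chains[OF assms, of y]] by (intro snoc_free_span) simp_all
  qed
  finally show ?thesis .
qed

definition kernel :: "nat \<Rightarrow> ('a list \<Rightarrow>\<^sub>0 rat) set" where
  "kernel j = {w \<in> free_span (Lset j). inner_boundary w = 0}"

lemma kernel_iff:
  "w \<in> kernel j \<longleftrightarrow> w \<in> free_span (Lset j) \<and> (\<forall>y\<in>level. strip_chain y w \<in> cycles P (open_interval P bot y) (int j - 1))"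
proof (cases "w \<in> free_span (Lset j)")
  case True
  have "inner_boundary w = 0 \<longleftrightarrow> (\<forall>y\<in>level. boundary (strip_chain y w) = 0)"
  proof
    assume "inner_boundary w = 0"
    then show "\<forall>y\<in>level. boundary (strip_chain y w) = 0"
      using strip_inner_boundary[OF True] by (simp add: strip_chain_def)
  next
    assume *: "\<forall>y\<in>level. boundary (strip_chain y w) = 0"
    have "inner_boundary w = (\<Sum>y\<in>level. snoc_chain y (boundary (strip_chain y w)))"
      by (subst (1) sum_snoc_strip[OF True, symmetric]) (simp add: inner_boundary_sum inner_boundary_snoc)
    then show "inner_boundary w = 0" using * by (simp add: snoc_chain_def)
  qed
  then show ?thesis using True strip_chains by (auto simp: kernel_def cycles_def)
qed (simp add: kernel_def)

text \<open>Lists with \<open>j\<close> unmarked entries are chains of degree \<open>j - 1\<close>,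
  so acyclicity in each interval is exactness at every position below \<open>codeg\<close>.\<close>

lemma exact:
  assumes j: "j < codeg"
  shows "inner_boundary ` free_span (Lset (Suc j)) = kernel j"
proof
  show "inner_boundary ` free_span (Lset (Suc j)) \<subseteq> kernel j"
  proof
    fix w assume "w \<in> inner_boundary ` free_span (Lset (Suc j))"
    then obtain v where v: "v \<in> free_span (Lset (Suc j))" "w = inner_boundary v" by blast
    have w: "w \<in> free_span (Lset j)" using inner_boundary_free_span v by simp
    moreover have "strip_chain y w \<in> cycles P (open_interval P bot y) (int j - 1)" for y
      using strip_chains[OF w, of y] strip_inner_boundary[OF v(1), of y]
      by (simp add: cycles_def v(2) boundary_boundary)
    ultimately show "w \<in> kernel j" by (simp add: kernel_iff)
  qed
  show "kernel j \<subseteq> inner_boundary ` free_span (Lset (Suc j))"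
  proof
    fix w assume w: "w \<in> kernel j"
    have "\<exists>u. u \<in> chains P (open_interval P bot y) (int j) \<and> boundary u = strip_chain y w" if y: "y \<in> level" for y
    proof -
      \<comment> \<open>\<open>j < codeg\<close> excludes ranks 0 and 1, so \<open>y\<close> is not
        \<open>bot\<close>, and the degree \<open>j - 1\<close> lies below the top degree
        \<open>i - 2\<close>.\<close>
      have i: "i \<ge> 2" "int j < i - 1" using j by (auto simp: codeg_def split: if_splits)
      then have "y \<noteq> bot" using y bot by (auto simp: level_iff)
      then have ac: "acyclic_below P (open_interval P bot y) (i - 2)"
        using acyc[of y] y by (simp add: level_iff)
      have "strip_chain y w \<in> cycles P (open_interval P bot y) (int j - 1)"
        using w y by (simp add: kernel_iff)
      moreover have "int j - 1 < i - 2" using i by simp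
      ultimately have "strip_chain y w \<in> boundaries P (open_interval P bot y) (int j - 1)"
        using ac unfolding acyclic_below_def by blast
      then show ?thesis by (auto simp: boundaries_def)
    qed
    then obtain u where u: "\<And>y. y \<in> level \<Longrightarrow> u y \<in> chains P (open_interval P bot y) (int j) \<and> boundary (u y) = strip_chain y w"
      by metis
    let ?v = "\<Sum>y\<in>level. snoc_chain y (u y)"
    have "?v \<in> free_span (Lset (Suc j))"
      using u by (intro Q.subspace_sum[OF subspace_free_span] snoc_free_span) auto
    moreover have "inner_boundary ?v = (\<Sum>y\<in>level. snoc_chain y (strip_chain y w))"
      unfolding inner_boundary_def lin_sum using u
      by (intro sum.cong) (auto simp: inner_boundary_snoc simp flip: inner_boundary_def)
    ultimately show "w \<in> inner_boundary ` free_span (Lset (Suc j))"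
      using sum_snoc_strip w by (auto simp: kernel_iff)
  qed
qed

lemma push_free_span: "w \<in> free_span (Lset j) \<Longrightarrow> push_chain f w \<in> free_span (Lset j)"
  using keys_lin[of "\<lambda>xs. Poly_Mapping.single (map f xs) 1" w] f_Lset
  by (fastforce simp: free_span_def push_chain_eq_lin)

definition fixed_count :: "nat \<Rightarrow> rat" where
  "fixed_count j = of_nat (card {ys \<in> Lset j. map f ys = ys})"

lemma trace_step:
  "fixed_count j = Q.span_trace (kernel j) (push_chain f)
     + Q.span_trace (inner_boundary ` free_span (Lset j)) (push_chain f)"
proof -
  have "Q.span_trace (free_span (Lset j)) (push_chain f)
    = Q.span_trace {v \<in> free_span (Lset j). inner_boundary v = 0} (push_chain f)
     + Q.span_trace (inner_boundary ` free_span (Lset j)) (push_chain f)"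
  proof (rule Q.span_trace_kernel_image)
    show "finite ((\<lambda>k. Poly_Mapping.single k (1::rat)) ` Lset j)" using finite_Lset by simp
    show "free_span (Lset j) \<subseteq> Q.span ((\<lambda>k. Poly_Mapping.single k 1) ` Lset j)" by (simp add: span_singles)
    show "Vector_Spaces.linear qscale qscale (inner_boundary :: ('a list \<Rightarrow>\<^sub>0 rat) \<Rightarrow> _)"
      unfolding inner_boundary_def by (rule linear_lin)
  qed (simp_all add: subspace_free_span linear_push_chain push_free_span inner_boundary_push)
  then show ?thesis
    by (simp add: span_trace_free_span finite_Lset f_Lset fixed_count_def kernel_def)
qed

text \<open>The Hopf trace formula. Below the top the image arriving from position
  \<open>j + 1\<close> is the kernel at \<open>j\<close>, so the identities
  \<open>trace_step\<close> telescope, and the kernel at \<open>codeg\<close> will be the Whitney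
  homology.\<close>

lemma trace_kernel:
  "j \<le> codeg \<Longrightarrow> Q.span_trace (kernel j) (push_chain f) = (\<Sum>l\<le>j. (-1) ^ (j + l) * fixed_count l)"
proof (induction j)
  case 0
  \<comment> \<open>Position 0 carries the marked empty simplices, whose boundary is 0.\<close>
  have "inner_boundary w = 0" if w: "w \<in> free_span (Lset 0)" for w
  proof -
    have "inner_boundary w = lin (\<lambda>_. 0) w"
      unfolding inner_boundary_def
    proof (rule lin_cong)
      fix ys assume "ys \<in> Poly_Mapping.keys w"
      then obtain xs y where "ys = xs @ [y]" "length xs = 0" using w free_span_Lset by blast
      then have "ys = [y]" by simp
      then show "(if ys = [] then 0 else snoc_chain (last ys) (face_sum (butlast ys))) = 0"
        by (simp add: snoc_chain_def)
    qed
    then show ?thesis by (simp add: lin_zero_fun)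
  qed
  then have "inner_boundary ` free_span (Lset 0) = (\<lambda>_. 0) ` free_span (Lset 0)"
    by (intro image_cong) auto
  moreover have "0 \<in> free_span (Lset 0)" by (simp add: free_span_def)
  ultimately have im: "inner_boundary ` free_span (Lset 0) = {0}" by auto
  have "Q.span_trace {0} (push_chain f) = Q.basis_trace {} (push_chain f)"
    by (rule Q.span_trace_eq) (auto simp: linear_push_chain Q.dependent_explicit)
  then show ?case using trace_step[of 0] by (simp add: im Q.basis_trace_def)
next
  case (Suc j)
  then have "Q.span_trace (kernel (Suc j)) (push_chain f) = fixed_count (Suc j) - (\<Sum>l\<le>j. (-1) ^ (j + l) * fixed_count l)"
    using trace_step[of "Suc j"] exact[of j] by simp
  then show ?case by (simp add: sum_negf)
qed

end

section \<open>Whitney homology as a space of marked top cycles\<close>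

lemma boundaries_level:
  assumes y: "y \<in> level i"
  shows "boundaries P (open_interval P bot y) (int (codeg i) - 1) = {0}"
proof -
  have "z = 0" if z: "z \<in> chains P (open_interval P bot y) (int (codeg i))" for z
  proof -
    have "Poly_Mapping.keys z = {}"
    proof (rule ccontr)
      assume "Poly_Mapping.keys z \<noteq> {}"
      then obtain xs where "xs \<in> Poly_Mapping.keys z" by blast
      then have xs: "xs \<in> order_simplices P (open_interval P bot y)" "length xs = codeg i + 1"
        using z by (auto simp: chains_iff)
      show False
      proof (cases "y = bot")
        case True
        then show False using xs by (simp add: order_simplices_def open_interval_bot)
      next
        case False
        have "y \<in> carrier P" "int (rk y) = i" using y by (auto simp: level_iff)
        then show False using length_interval_simplex[OF _ False xs(1)] xs(2) by (auto simp: codeg_def split: if_splits)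
      qed
    qed
    then show ?thesis by simp
  qed
  then have "chains P (open_interval P bot y) (int (codeg i)) = {0}" by auto
  then show ?thesis by (simp add: boundaries_def)
qed

abbreviation top_cycles :: "int \<Rightarrow> 'a \<Rightarrow> ('a list \<Rightarrow>\<^sub>0 rat) set" where
  "top_cycles i y \<equiv> cycles P (open_interval P bot y) (int (codeg i) - 1)"

text \<open>No simplices exist above the top degree, so the only boundary is 0: a homology class is
  the singleton of a cycle, and the module operations are those of cycles.\<close>

lemma interval_homology_level:
  assumes y: "y \<in> level i"
  shows "carrier (interval_homology P bot y) = (\<lambda>z. {z}) ` top_cycles i y"
    and "\<zero>\<^bsub>interval_homology P bot y\<^esub> = {0}"
    and "A \<oplus>\<^bsub>interval_homology P bot y\<^esub> B = A + B"
    and "r \<odot>\<^bsub>interval_homology P bot y\<^esub> {z} = {qscale r z}"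
  by (simp_all add: interval_homology_def reduced_homology_def top_degree_level[OF y] boundaries_level[OF y]
      elt_plus_zero qscale_def)

text \<open>Gathers a family of singleton classes into one chain. The marks keep the summands apart,
  which makes the map injective, and its image is the kernel treated by
  \<open>trace_kernel\<close>.\<close>

definition embed :: "int \<Rightarrow> ('a \<Rightarrow> ('a list \<Rightarrow>\<^sub>0 rat) set) \<Rightarrow> ('a list \<Rightarrow>\<^sub>0 rat)" where
  "embed i \<phi> = (\<Sum>y\<in>level i. snoc_chain y (the_elem (\<phi> y)))"

lemma whitney_carrier:
  "\<phi> \<in> carrier (whitney_homology P rkq i) \<longleftrightarrow>
    \<phi> \<in> extensional (level i) \<and> (\<forall>y\<in>level i. \<exists>z\<in>top_cycles i y. \<phi> y = {z})"
proof -
  \<comment> \<open>The level is finite, so every family has finite support.\<close>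
  have "finite {y \<in> level i. Q y}" for Q using finite_level by simp
  then show ?thesis
    unfolding whitney_homology_def vs_direct_sum_def bottom_eq level_def[symmetric]
    by (auto simp: PiE_iff interval_homology_level image_iff)
qed

lemma strip_sum_snoc: "y \<in> level i \<Longrightarrow> strip_chain y (\<Sum>y\<in>level i. snoc_chain y (w y)) = w y"
  by (simp add: strip_chain_sum strip_snoc finite_level)

lemma cycles_closed:
  "z \<in> cycles P A d \<Longrightarrow> w \<in> cycles P A d \<Longrightarrow> z + w \<in> cycles P A d"
  "z \<in> cycles P A d \<Longrightarrow> qscale r z \<in> cycles P A d"
  "0 \<in> cycles P A d"
proof -
  show "z \<in> cycles P A d \<Longrightarrow> w \<in> cycles P A d \<Longrightarrow> z + w \<in> cycles P A d"
    by (simp add: cycles_def chains_add boundary_add)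
  have "Poly_Mapping.keys (qscale r z) \<subseteq> Poly_Mapping.keys z" by (auto simp: in_keys_iff)
  then show "z \<in> cycles P A d \<Longrightarrow> qscale r z \<in> cycles P A d"
    by (auto simp: cycles_def boundary_eq_lin lin_qscale chains_iff)
qed (simp add: cycles_def)

lemma snoc_chain_add: "snoc_chain y (z + w) = snoc_chain y z + snoc_chain y w"
  by (simp add: snoc_chain_def lin_add)

lemma snoc_chain_qscale: "snoc_chain y (qscale r z) = qscale r (snoc_chain y z)"
  by (simp add: snoc_chain_def lin_qscale)

lemma snoc_chain_0 [simp]: "snoc_chain y 0 = 0"
  by (simp add: snoc_chain_def)

lemma whitney_embedded: "embedded_space (whitney_homology P rkq i) (embed i)"
proof
  let ?V = "whitney_homology P rkq i"
  have ops: "\<zero>\<^bsub>?V\<^esub> = (\<lambda>y\<in>level i. \<zero>\<^bsub>interval_homology P bot y\<^esub>)"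
    "\<phi> \<oplus>\<^bsub>?V\<^esub> \<psi> = (\<lambda>y\<in>level i. \<phi> y \<oplus>\<^bsub>interval_homology P bot y\<^esub> \<psi> y)"
    "r \<odot>\<^bsub>?V\<^esub> \<phi> = (\<lambda>y\<in>level i. r \<odot>\<^bsub>interval_homology P bot y\<^esub> \<phi> y)" for \<phi> \<psi> r
    unfolding whitney_homology_def vs_direct_sum_def bottom_eq level_def[symmetric] by simp_all
  have add: "(\<phi> \<oplus>\<^bsub>?V\<^esub> \<psi>) y = {z + w}" if "y \<in> level i" "\<phi> y = {z}" "\<psi> y = {w}" for \<phi> \<psi> y z w
    using that by (simp add: ops interval_homology_level set_plus_def)
  have scale: "(r \<odot>\<^bsub>?V\<^esub> \<phi>) y = {qscale r z}" if "y \<in> level i" "\<phi> y = {z}" for \<phi> r y z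
    using that by (simp add: ops interval_homology_level)
  have zero: "\<zero>\<^bsub>?V\<^esub> y = {0}" if "y \<in> level i" for y
    using that by (simp add: ops interval_homology_level)
  have ext: "\<zero>\<^bsub>?V\<^esub> \<in> extensional (level i)" "\<phi> \<oplus>\<^bsub>?V\<^esub> \<psi> \<in> extensional (level i)"
    "r \<odot>\<^bsub>?V\<^esub> \<phi> \<in> extensional (level i)" for \<phi> \<psi> r
    by (simp_all add: ops)
  show "\<zero>\<^bsub>?V\<^esub> \<in> carrier ?V"
    unfolding whitney_carrier using ext zero cycles_closed(3) by blast
  show "embed i \<zero>\<^bsub>?V\<^esub> = 0"
    by (simp add: embed_def zero)
  fix \<phi> assume \<phi>: "\<phi> \<in> carrier ?V"
  then obtain a where a: "\<And>y. y \<in> level i \<Longrightarrow> a y \<in> top_cycles i y \<and> \<phi> y = {a y}"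
    unfolding whitney_carrier by metis
  {
    fix r
    show "r \<odot>\<^bsub>?V\<^esub> \<phi> \<in> carrier ?V"
      unfolding whitney_carrier by (intro conjI ballI ext bexI) (use a scale cycles_closed(2) in auto)
    show "embed i (r \<odot>\<^bsub>?V\<^esub> \<phi>) = qscale r (embed i \<phi>)"
      unfolding embed_def Q.scale_sum_right
      by (intro sum.cong refl) (use a scale in \<open>simp add: snoc_chain_qscale\<close>)
  }
  fix \<psi> assume \<psi>: "\<psi> \<in> carrier ?V"
  then obtain b where b: "\<And>y. y \<in> level i \<Longrightarrow> b y \<in> top_cycles i y \<and> \<psi> y = {b y}"
    unfolding whitney_carrier by metis
  show "\<phi> \<oplus>\<^bsub>?V\<^esub> \<psi> \<in> carrier ?V"
    unfolding whitney_carrier by (intro conjI ballI ext bexI) (use a b add cycles_closed(1) in auto)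
  show "embed i (\<phi> \<oplus>\<^bsub>?V\<^esub> \<psi>) = embed i \<phi> + embed i \<psi>"
    unfolding embed_def sum.distrib[symmetric]
    by (intro sum.cong refl) (use a b add in \<open>simp add: snoc_chain_add\<close>)
next
  let ?V = "whitney_homology P rkq i"
  show "inj_on (embed i) (carrier ?V)"
  proof (rule inj_onI)
    fix \<phi> \<psi> assume \<phi>: "\<phi> \<in> carrier ?V" and \<psi>: "\<psi> \<in> carrier ?V" and eq: "embed i \<phi> = embed i \<psi>"
    show "\<phi> = \<psi>"
    proof (rule extensionalityI)
      show "\<phi> \<in> extensional (level i)" "\<psi> \<in> extensional (level i)"
        using \<phi> \<psi> by (auto simp: whitney_carrier)
      fix y assume y: "y \<in> level i"
      have "the_elem (\<phi> y) = the_elem (\<psi> y)"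
        using eq strip_sum_snoc[OF y, of "\<lambda>y. the_elem (\<phi> y)"] strip_sum_snoc[OF y, of "\<lambda>y. the_elem (\<psi> y)"]
        by (simp add: embed_def)
      moreover obtain z w where "\<phi> y = {z}" "\<psi> y = {w}" using \<phi> \<psi> y unfolding whitney_carrier by blast
      ultimately show "\<phi> y = \<psi> y" by simp
    qed
  qed
qed

lemma embed_image: "embed i ` carrier (whitney_homology P rkq i) = kernel i (codeg i)"
proof (intro subset_antisym subsetI)
  fix w assume "w \<in> embed i ` carrier (whitney_homology P rkq i)"
  then obtain \<phi> where \<phi>: "\<phi> \<in> carrier (whitney_homology P rkq i)" "w = embed i \<phi>" by blast
  have c: "the_elem (\<phi> y) \<in> top_cycles i y" if "y \<in> level i" for y
    using \<phi>(1) that unfolding whitney_carrier by fastforce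
  have "w \<in> free_span (Lset i (codeg i))"
    unfolding \<phi>(2) embed_def using c
    by (intro Q.subspace_sum[OF subspace_free_span] snoc_free_span) (auto simp: cycles_def)
  moreover have "strip_chain y w \<in> top_cycles i y" if y: "y \<in> level i" for y
    using c[OF y] strip_sum_snoc[OF y] by (simp add: \<phi>(2) embed_def)
  ultimately show "w \<in> kernel i (codeg i)" by (simp add: kernel_iff)
next
  fix w assume w: "w \<in> kernel i (codeg i)"
  define \<phi> where "\<phi> = (\<lambda>y\<in>level i. {strip_chain y w})"
  have "\<phi> \<in> carrier (whitney_homology P rkq i)"
    using w by (auto simp: whitney_carrier \<phi>_def kernel_iff)
  moreover have "embed i \<phi> = (\<Sum>y\<in>level i. snoc_chain y (strip_chain y w))"
    unfolding embed_def by (intro sum.cong) (auto simp: \<phi>_def)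
  then have "embed i \<phi> = w" using w sum_snoc_strip[of w i "codeg i"] by (simp add: kernel_iff)
  ultimately show "w \<in> embed i ` carrier (whitney_homology P rkq i)" by blast
qed

lemma f_level: "y \<in> level i \<Longrightarrow> f y \<in> level i"
  by (simp add: level_iff f_carrier f_rk)

lemma f_level_bij: "bij_betw f (level i) (level i)"
proof -
  have "inj_on f (level i)" using f_inj by (auto simp: inj_on_def level_iff)
  then show ?thesis
    using f_level finite_level by (metis bij_betw_def endo_inj_surj image_subsetI)
qed

lemma push_cycles:
  assumes "y \<in> level i" "z \<in> top_cycles i y"
  shows "push_chain f z \<in> top_cycles i (f y)"
proof -
  have y: "y \<in> carrier P" using assms by (simp add: level_iff)
  have "push_chain f z \<in> chains P (open_interval P bot (f y)) (int (codeg i) - 1)"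
    unfolding push_chain_eq_lin using assms f_order_simplices[OF y]
    by (intro chains_lin) (auto simp: cycles_def chains_iff)
  moreover have "boundary (push_chain f z) = push_chain f (boundary z)"
    by (simp add: push_chain_eq_lin boundary_eq_lin lin_lin) (simp add: face_sum_map push_chain_eq_lin)
  ultimately show ?thesis using assms by (simp add: cycles_def)
qed

lemma whitney_action_embed:
  assumes \<phi>: "\<phi> \<in> carrier (whitney_homology P rkq i)"
  shows "whitney_action P rkq i f \<phi> \<in> carrier (whitney_homology P rkq i)"
    and "embed i (whitney_action P rkq i f \<phi>) = push_chain f (embed i \<phi>)"
proof -
  obtain a where a: "\<And>y. y \<in> level i \<Longrightarrow> a y \<in> top_cycles i y \<and> \<phi> y = {a y}"
    using \<phi> unfolding whitney_carrier by metis
  \<comment> \<open>The component at \<open>f y\<close> comes from the one at \<open>y\<close>; as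
    the boundaries are \<open>{0}\<close>, adding them keeps the image a singleton.\<close>
  have val: "whitney_action P rkq i f \<phi> (f y) = {push_chain f (a y)}" if y: "y \<in> level i" for y
  proof -
    have yc: "y \<in> carrier P" using y by (simp add: level_iff)
    have "inv_into (carrier P) f (f y) = y"
      using yc f_bij by (simp add: bij_betw_def)
    then show ?thesis
      using f_level[OF y] a[OF y]
      by (simp add: whitney_action_def level_def[symmetric] induced_map_def bottom_eq top_degree_level boundaries_level)
  qed
  have ext: "whitney_action P rkq i f \<phi> \<in> extensional (level i)"
    by (simp add: whitney_action_def level_def)
  have surj: "\<exists>x\<in>level i. y = f x" if "y \<in> level i" for y
    using f_level_bij that by (metis bij_betw_def imageE)
  show "whitney_action P rkq i f \<phi> \<in> carrier (whitney_homology P rkq i)"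
    unfolding whitney_carrier
  proof (intro conjI ballI ext)
    fix y assume "y \<in> level i"
    then obtain x where "x \<in> level i" "y = f x" using surj by blast
    then show "\<exists>z\<in>top_cycles i y. whitney_action P rkq i f \<phi> y = {z}"
      using val push_cycles a by blast
  qed
  have "embed i (whitney_action P rkq i f \<phi>) = (\<Sum>x\<in>level i. snoc_chain (f x) (the_elem (whitney_action P rkq i f \<phi> (f x))))"
    unfolding embed_def by (rule sum.reindex_bij_betw[OF f_level_bij, symmetric])
  also have "\<dots> = (\<Sum>x\<in>level i. push_chain f (snoc_chain x (the_elem (\<phi> x))))"
    by (intro sum.cong refl) (use a val in \<open>simp add: push_snoc\<close>)
  also have "\<dots> = push_chain f (embed i \<phi>)"
    by (simp add: embed_def push_chain_eq_lin lin_sum)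
  finally show "embed i (whitney_action P rkq i f \<phi>) = push_chain f (embed i \<phi>)" .
qed

lemma whitney_trace:
  "vs_trace (whitney_homology P rkq i) (whitney_action P rkq i f)
    = (\<Sum>l\<le>codeg i. (-1) ^ (codeg i + l) * fixed_count i l)"
proof -
  interpret E: embedded_space "whitney_homology P rkq i" "embed i" by (rule whitney_embedded)
  have "vs_trace (whitney_homology P rkq i) (whitney_action P rkq i f)
    = Q.span_trace (embed i ` carrier (whitney_homology P rkq i)) (push_chain f)"
  proof (rule E.vs_trace_eq_span_trace)
    show "finite ((\<lambda>k. Poly_Mapping.single k (1::rat)) ` Lset i (codeg i))" using finite_Lset by simp
    show "embed i ` carrier (whitney_homology P rkq i) \<subseteq> Q.span ((\<lambda>k. Poly_Mapping.single k 1) ` Lset i (codeg i))"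
      unfolding embed_image span_singles by (auto simp: kernel_def)
  qed (simp_all add: linear_push_chain whitney_action_embed)
  then show ?thesis by (simp add: embed_image trace_kernel)
qed

section \<open>From counts of fixed chains to Moebius numbers\<close>

abbreviation fixed_simplices :: "'a \<Rightarrow> 'a list set" where
  "fixed_simplices y \<equiv> {xs \<in> order_simplices P (open_interval P bot y). map f xs = xs}"

lemma fixed_count_eq:
  "fixed_count i l = (\<Sum>y\<in>{y \<in> level i. f y = y}. of_nat (card {xs \<in> fixed_simplices y. length xs = l}))"
proof -
  let ?A = "\<lambda>y. {xs \<in> fixed_simplices y. length xs = l}"
  have "{ys \<in> Lset i l. map f ys = ys} = (\<Union>y\<in>{y \<in> level i. f y = y}. (\<lambda>xs. xs @ [y]) ` ?A y)"
    by (auto simp: Lset_def)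
  moreover have "card (\<Union>y\<in>{y \<in> level i. f y = y}. (\<lambda>xs. xs @ [y]) ` ?A y)
    = (\<Sum>y\<in>{y \<in> level i. f y = y}. card ((\<lambda>xs. xs @ [y]) ` ?A y))"
  proof (rule card_UN_disjoint)
    show "finite {y \<in> level i. f y = y}" using finite_level by simp
  qed (use finite_interval_simplices in \<open>auto simp: level_iff\<close>)
  moreover have "card ((\<lambda>xs. xs @ [y]) ` ?A y) = card (?A y)" for y
    by (rule card_image) (simp add: inj_on_def)
  ultimately show ?thesis by (simp add: fixed_count_def)
qed

text \<open>The sign is the one carried by the factor \<open>(-t)^i\<close> of the generating
  function. It cancels the dependence on the top degree in the Hopf trace formula, so that each
  fixed chain counts with a sign given by its own length alone.\<close>

theorem whitney_trace_mob:
  "(-1) powi i * vs_trace (whitney_homology P rkq i) (whitney_action P rkq i f)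
    = (\<Sum>y\<in>{y \<in> rank_level P rkq i. f y = y}. mob y)"
proof (cases "i \<ge> 1")
  case True
  then have ci: "i = int (codeg i) + 1" by (simp add: codeg_def)
  \<comment> \<open>Since \<open>i = codeg i + 1\<close>, the total exponent is
    \<open>2 * codeg i + (l + 1)\<close>.\<close>
  have sg: "(-1) powi i * (-1) ^ (codeg i + l) = ((-1) ^ (l + 1) :: rat)" for l
  proof -
    have "(-1 :: rat) powi i = (-1) ^ (codeg i + 1)"
      by (subst ci) (metis of_nat_1 of_nat_add power_int_of_nat)
    then have "(-1) powi i * (-1) ^ (codeg i + l) = (-1 :: rat) ^ (codeg i + 1 + (codeg i + l))"
      by (simp add: power_add)
    also have "codeg i + 1 + (codeg i + l) = 2 * codeg i + (l + 1)" by simp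
    finally show ?thesis by (simp only: power_add power_mult) simp
  qed
  have "(-1) powi i * vs_trace (whitney_homology P rkq i) (whitney_action P rkq i f)
    = (\<Sum>l\<le>codeg i. (-1) ^ (l + 1) * fixed_count i l)"
    unfolding whitney_trace sum_distrib_left mult.assoc[symmetric] sg ..
  also have "\<dots> = (\<Sum>y\<in>{y \<in> level i. f y = y}. \<Sum>l\<le>codeg i. (-1) ^ (l + 1) * of_nat (card {xs \<in> fixed_simplices y. length xs = l}))"
    unfolding fixed_count_eq sum_distrib_left by (rule sum.swap)
  also have "\<dots> = (\<Sum>y\<in>{y \<in> level i. f y = y}. mob y)"
  proof (rule sum.cong[OF refl])
    fix y assume "y \<in> {y \<in> level i. f y = y}"
    then have y: "y \<in> carrier P" "int (rk y) = i" by (auto simp: level_iff)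
    then have yb: "y \<noteq> bot" using bot True by auto
    have fin: "finite (fixed_simplices y)" using finite_interval_simplices[OF y(1)] by simp
    have "mob y = (\<Sum>xs\<in>fixed_simplices y. (-1) ^ (length xs + 1))" by (simp add: mob_def yb)
    also have "\<dots> = (\<Sum>l\<le>codeg i. \<Sum>xs\<in>{xs \<in> fixed_simplices y. length xs = l}. (-1) ^ (length xs + 1))"
    proof (rule sum.group[symmetric, OF fin])
      show "length ` fixed_simplices y \<subseteq> {..codeg i}"
        using length_interval_simplex[OF y(1) yb] y(2) ci by force
    qed simp
    also have "\<dots> = (\<Sum>l\<le>codeg i. (-1) ^ (l + 1) * of_nat (card {xs \<in> fixed_simplices y. length xs = l}))"
      by (intro sum.cong refl) simp
    finally show "(\<Sum>l\<le>codeg i. (-1) ^ (l + 1) * of_nat (card {xs \<in> fixed_simplices y. length xs = l})) = mob y" by simp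
  qed
  finally show ?thesis by (simp add: level_def)
next
  \<comment> \<open>Here \<open>codeg i\<close> is 0 whatever \<open>i\<close> is: rank 0 consists
    of \<open>bot\<close>, with Moebius number 1, and negative ranks are empty.\<close>
  case False
  then have ci: "codeg i = 0" by (simp add: codeg_def)
  have tr: "vs_trace (whitney_homology P rkq i) (whitney_action P rkq i f) = fixed_count i 0"
    by (simp add: whitney_trace ci)
  show ?thesis
  proof (cases "i = 0")
    case True
    have "level i = {bot}" using True rk_0_iff bot by (auto simp: level_iff)
    then have lv: "{y \<in> level i. f y = y} = {bot}" using f_bot by auto
    have "{xs \<in> fixed_simplices bot. length xs = 0} = {[]}"
      by (auto simp: order_simplices_def)
    then have "fixed_count i 0 = 1" by (simp add: fixed_count_eq lv)
    then show ?thesis using lv True tr by (simp add: mob_def level_def)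
  next
    case False
    then have lv: "level i = {}" using \<open>\<not> i \<ge> 1\<close> by (auto simp: level_iff)
    then have "fixed_count i 0 = 0" by (simp add: fixed_count_eq)
    then show ?thesis using lv by (simp add: tr level_def)
  qed
qed

text \<open>The defining recursion of a Moebius function on the subposet of fixed elements. A
  nonempty fixed chain below \<open>y\<close> is a fixed chain below its last element, followed by
  that element; one more entry reverses the sign.\<close>

theorem sum_mob:
  assumes y: "y \<in> carrier P" "f y = y"
  shows "(\<Sum>w\<in>{w \<in> carrier P. f w = w \<and> le P w y}. mob w) = (if y = bot then 1 else 0)"
proof (cases "y = bot")
  case True
  have "{w \<in> carrier P. f w = w \<and> le P w y} = {bot}"
    using antisym bot f_bot le_refl True by auto
  then show ?thesis using True by (simp add: mob_def)
next
  case False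
  let ?I = "{w \<in> open_interval P bot y. f w = w}"
  have fI: "finite ?I" using fin by (rule finite_subset[rotated]) (auto simp: open_interval_def)
  have lb: "lless P bot y" using bot y False by (auto simp: lless_iff)
  have S: "fixed_simplices y = insert [] (\<Union>w\<in>?I. (\<lambda>xs. xs @ [w]) ` fixed_simplices w)"
  proof (intro subset_antisym subsetI)
    fix xs assume xs: "xs \<in> fixed_simplices y"
    show "xs \<in> insert [] (\<Union>w\<in>?I. (\<lambda>xs. xs @ [w]) ` fixed_simplices w)"
    proof (cases xs rule: rev_cases)
      case (snoc ys w)
      have "w \<in> ?I" "ys \<in> fixed_simplices w"
        using xs by (auto simp: snoc order_simplices_def sorted_wrt_append open_interval_def)
      then show ?thesis using snoc by blast
    qed simp
  next
    fix xs assume "xs \<in> insert [] (\<Union>w\<in>?I. (\<lambda>xs. xs @ [w]) ` fixed_simplices w)"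
    then consider "xs = []" | w ys where "w \<in> ?I" "ys \<in> fixed_simplices w" "xs = ys @ [w]" by blast
    then show "xs \<in> fixed_simplices y"
    proof cases
      case 2
      have "lless P z y" if "z \<in> set ys" for z
        using 2 that lless_trans[of z w y] y by (auto simp: order_simplices_def open_interval_def)
      then show ?thesis using 2 by (auto simp: order_simplices_def open_interval_def sorted_wrt_append)
    qed (simp add: order_simplices_def)
  qed
  have fS: "finite (fixed_simplices w)" if "w \<in> carrier P" for w
    using finite_interval_simplices[OF that] by simp
  have IC: "w \<in> carrier P" "w \<noteq> bot" if "w \<in> ?I" for w using that by (auto simp: open_interval_def)
  let ?g = "\<lambda>xs. (-1 :: rat) ^ (length xs + 1)"
  have "mob y = ?g [] + (\<Sum>xs\<in>(\<Union>w\<in>?I. (\<lambda>xs. xs @ [w]) ` fixed_simplices w). ?g xs)"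
    unfolding mob_def S using False fI fS IC by (simp add: image_iff)
  also have "(\<Sum>xs\<in>(\<Union>w\<in>?I. (\<lambda>xs. xs @ [w]) ` fixed_simplices w). ?g xs)
    = (\<Sum>w\<in>?I. \<Sum>xs\<in>(\<lambda>xs. xs @ [w]) ` fixed_simplices w. ?g xs)"
    using fI fS IC by (intro sum.UNION_disjoint) auto
  also have "\<dots> = (\<Sum>w\<in>?I. - mob w)"
  proof (rule sum.cong[OF refl])
    fix w assume w: "w \<in> ?I"
    have "(\<Sum>xs\<in>(\<lambda>xs. xs @ [w]) ` fixed_simplices w. ?g xs) = (\<Sum>xs\<in>fixed_simplices w. ?g (xs @ [w]))"
      by (subst sum.reindex) (auto simp: inj_on_def)
    then show "(\<Sum>xs\<in>(\<lambda>xs. xs @ [w]) ` fixed_simplices w. ?g xs) = - mob w"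
      using IC[OF w] by (simp add: mob_def sum_negf)
  qed
  finally have mob: "mob y = -1 - (\<Sum>w\<in>?I. mob w)" by (simp add: sum_negf)
  have "{w \<in> carrier P. f w = w \<and> le P w y} = insert y (insert bot ?I)"
    using y bot f_bot le_refl lb by (auto simp: open_interval_def lless_iff)
  moreover have "bot \<notin> ?I" "y \<notin> insert bot ?I" using False by (auto simp: open_interval_def)
  ultimately have "(\<Sum>w\<in>{w \<in> carrier P. f w = w \<and> le P w y}. mob w) = mob y + (mob bot + (\<Sum>w\<in>?I. mob w))"
    using fI by simp
  then show ?thesis using mob False by (simp add: mob_def)
qed

end

section \<open>Balanced partitions\<close>

locale dowling = group G for G :: "('g, 'b) monoid_scheme" (structure) +
  fixes n :: nat
  assumes finG: "finite (carrier G)" and n_pos: "n > 0"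
begin

abbreviation X :: "('g \<times> nat) set" where "X \<equiv> points G n"
abbreviation act :: "'g \<Rightarrow> 'g \<times> nat \<Rightarrow> 'g \<times> nat" where "act \<equiv> left_act G"

lemma act_X [simp]: "g \<in> carrier G \<Longrightarrow> p \<in> X \<Longrightarrow> act g p \<in> X"
  by (auto simp: points_def left_act_def)

lemma act_one [simp]: "p \<in> X \<Longrightarrow> act \<one> p = p"
  by (auto simp: points_def left_act_def)

lemma act_mult: "g \<in> carrier G \<Longrightarrow> h \<in> carrier G \<Longrightarrow> p \<in> X \<Longrightarrow> act (g \<otimes> h) p = act g (act h p)"
  by (auto simp: points_def left_act_def m_assoc)

lemma act_inv [simp]: "g \<in> carrier G \<Longrightarrow> p \<in> X \<Longrightarrow> act (inv g) (act g p) = p"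
  "g \<in> carrier G \<Longrightarrow> p \<in> X \<Longrightarrow> act g (act (inv g) p) = p"
  by (simp_all add: act_mult[symmetric])

lemma act_free: "g \<in> carrier G \<Longrightarrow> p \<in> X \<Longrightarrow> act g p = p \<Longrightarrow> g = \<one>"
  by (auto simp: points_def left_act_def)

lemma finite_X: "finite X"
  using finG by (simp add: points_def)

lemma X_nonempty: "(\<one>, 1) \<in> X"
  using n_pos by (auto simp: points_def)

definition balanced :: "('g \<times> nat) set set set" where
  "balanced = {\<pi>. partition_on X \<pi> \<and>
     (\<forall>g\<in>carrier G. \<forall>K\<in>\<pi>. act g ` K \<in> \<pi> \<and> (g \<noteq> \<one> \<longrightarrow> act g ` K \<noteq> K))}"

text \<open>Partitions are handled through their relations: refinement becomes implication, and
  joins are found by asking which pairs have to be related.\<close>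

definition rel :: "('g \<times> nat) set set \<Rightarrow> 'g \<times> nat \<Rightarrow> 'g \<times> nat \<Rightarrow> bool" where
  "rel \<pi> p q \<longleftrightarrow> (\<exists>K\<in>\<pi>. p \<in> K \<and> q \<in> K)"

lemma block_eq: "\<pi> \<in> balanced \<Longrightarrow> K \<in> \<pi> \<Longrightarrow> L \<in> \<pi> \<Longrightarrow> p \<in> K \<Longrightarrow> p \<in> L \<Longrightarrow> K = L"
  using partition_onD2 unfolding balanced_def disjoint_def by blast

lemma block_X: "\<pi> \<in> balanced \<Longrightarrow> K \<in> \<pi> \<Longrightarrow> K \<subseteq> X"
  using partition_onD1 unfolding balanced_def by blast

lemma block_nonempty: "\<pi> \<in> balanced \<Longrightarrow> K \<in> \<pi> \<Longrightarrow> K \<noteq> {}"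
  using partition_onD3 unfolding balanced_def by blast

lemma block_exists: "\<pi> \<in> balanced \<Longrightarrow> p \<in> X \<Longrightarrow> \<exists>K\<in>\<pi>. p \<in> K"
  using partition_onD1 unfolding balanced_def by blast

lemma block_act: "\<pi> \<in> balanced \<Longrightarrow> g \<in> carrier G \<Longrightarrow> K \<in> \<pi> \<Longrightarrow> act g ` K \<in> \<pi>"
  by (simp add: balanced_def)

lemma block_free: "\<pi> \<in> balanced \<Longrightarrow> g \<in> carrier G \<Longrightarrow> K \<in> \<pi> \<Longrightarrow> act g ` K = K \<Longrightarrow> g = \<one>"
  by (auto simp: balanced_def)

lemma finite_balanced: "finite balanced" and finite_blocks: "\<pi> \<in> balanced \<Longrightarrow> finite \<pi>"
proof -
  have sub: "balanced \<subseteq> Pow (Pow X)" using block_X by blast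
  then show "finite balanced" by (rule finite_subset) (simp add: finite_X)
  show "finite \<pi>" if "\<pi> \<in> balanced"
    using sub that finite_X by (meson Pow_iff finite_Pow_iff finite_subset subsetD)
qed

lemma rel_X: "\<pi> \<in> balanced \<Longrightarrow> rel \<pi> p q \<Longrightarrow> p \<in> X \<and> q \<in> X"
  using block_X unfolding rel_def by blast

lemma rel_refl: "\<pi> \<in> balanced \<Longrightarrow> p \<in> X \<Longrightarrow> rel \<pi> p p"
  using block_exists unfolding rel_def by blast

lemma rel_sym: "rel \<pi> p q \<Longrightarrow> rel \<pi> q p"
  unfolding rel_def by blast

lemma rel_trans: "\<pi> \<in> balanced \<Longrightarrow> rel \<pi> p q \<Longrightarrow> rel \<pi> q r \<Longrightarrow> rel \<pi> p r"
  unfolding rel_def using block_eq by metis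

lemma rel_act: "\<pi> \<in> balanced \<Longrightarrow> g \<in> carrier G \<Longrightarrow> rel \<pi> p q \<Longrightarrow> rel \<pi> (act g p) (act g q)"
  unfolding rel_def using block_act by blast

text \<open>A translate of a block that meets the block is the block itself, so freeness on blocks
  says that no point is related to another translate of itself.\<close>

lemma rel_free:
  assumes "\<pi> \<in> balanced" "g \<in> carrier G" "rel \<pi> p (act g p)"
  shows "g = \<one>"
proof -
  obtain K where K: "K \<in> \<pi>" "p \<in> K" "act g p \<in> K" using assms(3) by (auto simp: rel_def)
  have "act g ` K = K" using block_eq[OF assms(1) block_act[OF assms(1,2) K(1)] K(1), of "act g p"] K by blast
  then show ?thesis using block_free assms K by blast
qed

definition refines :: "('g \<times> nat) set set \<Rightarrow> ('g \<times> nat) set set \<Rightarrow> bool" where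
  "refines \<pi> \<rho> \<longleftrightarrow> (\<forall>p q. rel \<pi> p q \<longrightarrow> rel \<rho> p q)"

lemma refines_iff:
  assumes "\<pi> \<in> balanced" "\<rho> \<in> balanced"
  shows "refines \<pi> \<rho> \<longleftrightarrow> (\<forall>K\<in>\<pi>. \<exists>L\<in>\<rho>. K \<subseteq> L)"
proof
  assume *: "refines \<pi> \<rho>"
  show "\<forall>K\<in>\<pi>. \<exists>L\<in>\<rho>. K \<subseteq> L"
  proof
    fix K assume K: "K \<in> \<pi>"
    obtain p where p: "p \<in> K" using block_nonempty assms(1) K by blast
    obtain L where L: "L \<in> \<rho>" "p \<in> L" using block_exists[OF assms(2)] block_X[OF assms(1) K] p by blast
    have "q \<in> L" if "q \<in> K" for q
    proof -
      have "rel \<pi> p q" using K p that unfolding rel_def by blast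
      then have "rel \<rho> p q" using * unfolding refines_def by blast
      then obtain L' where "L' \<in> \<rho>" "p \<in> L'" "q \<in> L'" by (auto simp: rel_def)
      then show ?thesis using block_eq[OF assms(2) L(1)] L(2) by blast
    qed
    then show "\<exists>L\<in>\<rho>. K \<subseteq> L" using L by blast
  qed
next
  assume *: "\<forall>K\<in>\<pi>. \<exists>L\<in>\<rho>. K \<subseteq> L"
  show "refines \<pi> \<rho>"
    unfolding refines_def
  proof (intro allI impI)
    fix p q assume "rel \<pi> p q"
    then obtain K where K: "K \<in> \<pi>" "p \<in> K" "q \<in> K" by (auto simp: rel_def)
    then obtain L where "L \<in> \<rho>" "K \<subseteq> L" using * by blast
    then show "rel \<rho> p q" using K by (auto simp: rel_def)
  qed
qed

lemma refines_refl: "refines \<pi> \<pi>"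
  by (simp add: refines_def)

lemma refines_trans: "refines \<pi> \<rho> \<Longrightarrow> refines \<rho> \<sigma> \<Longrightarrow> refines \<pi> \<sigma>"
  by (simp add: refines_def)

lemma refines_antisym:
  assumes "\<pi> \<in> balanced" "\<rho> \<in> balanced" "refines \<pi> \<rho>" "refines \<rho> \<pi>"
  shows "\<pi> = \<rho>"
proof -
  have "\<pi> \<subseteq> \<rho>" if a: "\<pi> \<in> balanced" "\<rho> \<in> balanced" "refines \<pi> \<rho>" "refines \<rho> \<pi>" for \<pi> \<rho>
  proof
    fix K assume K: "K \<in> \<pi>"
    then obtain L where L: "L \<in> \<rho>" "K \<subseteq> L" using a by (auto simp: refines_iff)
    then obtain K' where K': "K' \<in> \<pi>" "L \<subseteq> K'" using a by (auto simp: refines_iff)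
    have "K \<noteq> {}" using block_nonempty a(1) K by blast
    then have "K = K'" using block_eq[OF a(1) K K'(1)] L K' by blast
    then show "K \<in> \<rho>" using L K' by auto
  qed
  then show ?thesis using assms by (intro subset_antisym) auto
qed

lemma card_refines:
  assumes "\<pi> \<in> balanced" "\<rho> \<in> balanced" "refines \<pi> \<rho>"
  shows "card \<rho> \<le> card \<pi>"
proof -
  have "\<forall>K\<in>\<pi>. \<exists>L. L \<in> \<rho> \<and> K \<subseteq> L" using assms by (auto simp: refines_iff)
  then obtain F where F: "\<And>K. K \<in> \<pi> \<Longrightarrow> F K \<in> \<rho> \<and> K \<subseteq> F K" by metis
  have "\<rho> \<subseteq> F ` \<pi>"
  proof
    fix L assume L: "L \<in> \<rho>"
    then obtain p where p: "p \<in> L" using block_nonempty assms(2) by blast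
    then obtain K where K: "K \<in> \<pi>" "p \<in> K" using block_exists[OF assms(1)] block_X[OF assms(2) L] by blast
    then have "F K = L" using block_eq[OF assms(2) _ L, of "F K" p] F[OF K(1)] p by blast
    then show "L \<in> F ` \<pi>" using K by blast
  qed
  then show ?thesis using finite_blocks[OF assms(1)] surj_card_le by blast
qed

section \<open>Orbits of blocks and the merging of two of them\<close>

lemma image_act_mult:
  "g \<in> carrier G \<Longrightarrow> h \<in> carrier G \<Longrightarrow> K \<subseteq> X \<Longrightarrow> act g ` (act h ` K) = act (g \<otimes> h) ` K"
  by (force simp: act_mult image_iff subset_iff)

lemma image_act_one: "K \<subseteq> X \<Longrightarrow> act \<one> ` K = K"
  by (force simp: image_iff subset_iff)

lemma image_act_eqD:
  assumes "\<pi> \<in> balanced" "K \<in> \<pi>" "g \<in> carrier G" "h \<in> carrier G" "act g ` K = act h ` K"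
  shows "g = h"
proof -
  have KX: "K \<subseteq> X" using block_X assms by blast
  have "act (inv h \<otimes> g) ` K = act (inv h) ` (act g ` K)"
    using KX assms(3,4) by (subst image_act_mult) auto
  also have "\<dots> = act (inv h) ` (act h ` K)" using assms(5) by simp
  also have "\<dots> = act (inv h \<otimes> h) ` K" using KX assms(4) by (subst image_act_mult) auto
  also have "\<dots> = K" using assms KX by (simp add: image_act_one)
  finally have "inv h \<otimes> g = \<one>" using block_free[OF assms(1) _ assms(2)] assms by simp
  then show ?thesis using assms by (metis inv_equality inv_inv inv_closed)
qed

definition orb :: "('g \<times> nat) set \<Rightarrow> ('g \<times> nat) set set" where
  "orb K = (\<lambda>g. act g ` K) ` carrier G"

lemma card_orb: "\<pi> \<in> balanced \<Longrightarrow> K \<in> \<pi> \<Longrightarrow> card (orb K) = Coset.order G"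
  unfolding orb_def Coset.order_def using image_act_eqD by (intro card_image) (auto simp: inj_on_def)

lemma orb_subset: "\<pi> \<in> balanced \<Longrightarrow> K \<in> \<pi> \<Longrightarrow> orb K \<subseteq> \<pi>"
  unfolding orb_def using block_act by blast

lemma orb_act:
  assumes "\<pi> \<in> balanced" "K \<in> \<pi>" "g \<in> carrier G" "L \<in> \<pi>"
  shows "act g ` L \<in> orb K \<longleftrightarrow> L \<in> orb K"
proof
  have X: "K \<subseteq> X" "L \<subseteq> X" using assms block_X by blast+
  assume "act g ` L \<in> orb K"
  then obtain h where h: "h \<in> carrier G" "act g ` L = act h ` K" by (auto simp: orb_def)
  have "L = act (inv g) ` (act g ` L)" using assms X by (simp add: image_act_mult image_act_one)
  also have "\<dots> = act (inv g \<otimes> h) ` K" unfolding h(2) using assms h X by (simp add: image_act_mult)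
  finally show "L \<in> orb K" using assms h by (auto simp: orb_def)
next
  assume "L \<in> orb K"
  then obtain h where h: "h \<in> carrier G" "L = act h ` K" by (auto simp: orb_def)
  then show "act g ` L \<in> orb K" using assms block_X by (auto simp: orb_def image_act_mult)
qed

text \<open>Joining \<open>K\<close> and \<open>K'\<close> forces joining \<open>g K\<close> and
  \<open>g K'\<close> for every \<open>g\<close>. As the two orbits of blocks are different, nothing
  more is forced and the merged blocks are again permuted freely; the result is the least balanced
  coarsening that relates \<open>p\<close> and \<open>q\<close>.\<close>

lemma merge_blocks:
  assumes \<pi>: "\<pi> \<in> balanced" and K: "K \<in> \<pi>" and K': "K' \<in> \<pi>" "K' \<notin> orb K" and pq: "p \<in> K" "q \<in> K'"
  shows "\<exists>\<sigma>\<in>balanced. refines \<pi> \<sigma> \<and> rel \<sigma> p q \<and> card \<sigma> + Coset.order G = card \<pi> \<and>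
    (\<forall>\<rho>\<in>balanced. refines \<pi> \<rho> \<longrightarrow> rel \<rho> p q \<longrightarrow> refines \<sigma> \<rho>)"
proof -
  define N where "N g = act g ` K \<union> act g ` K'" for g
  define \<pi>0 where "\<pi>0 = \<pi> - (orb K \<union> orb K')"
  define \<sigma> where "\<sigma> = \<pi>0 \<union> N ` carrier G"
  have KX: "K \<subseteq> X" "K' \<subseteq> X" using block_X[OF \<pi>] K K' by blast+
  have disj: "orb K \<inter> orb K' = {}"
  proof -
    have "False" if "L \<in> orb K" "L \<in> orb K'" for L
    proof -
      obtain g where "g \<in> carrier G" "L = act g ` K'" using \<open>L \<in> orb K'\<close> by (auto simp: orb_def)
      then show False using orb_act[OF \<pi> K _ K'(1)] that K'(2) by blast
    qed
    then show ?thesis by blast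
  qed
  have Ninj: "g = h" if gh: "g \<in> carrier G" "h \<in> carrier G" and r: "r \<in> N g" "r \<in> N h" for g h r
  proof -
    have mem: "act g ` K \<in> orb K" "act g ` K' \<in> orb K'" "act h ` K \<in> orb K" "act h ` K' \<in> orb K'"
      using gh by (auto simp: orb_def)
    have bl: "act g ` K \<in> \<pi>" "act g ` K' \<in> \<pi>" "act h ` K \<in> \<pi>" "act h ` K' \<in> \<pi>"
      using gh block_act[OF \<pi>] K K' by auto
    consider "r \<in> act g ` K" "r \<in> act h ` K" | "r \<in> act g ` K" "r \<in> act h ` K'"
      | "r \<in> act g ` K'" "r \<in> act h ` K" | "r \<in> act g ` K'" "r \<in> act h ` K'"
      using r by (auto simp: N_def)
    then show ?thesis
    proof cases
      case 1 then show ?thesis using block_eq[OF \<pi> bl(1,3)] image_act_eqD[OF \<pi> K gh] by blast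
    next
      case 2 then show ?thesis using block_eq[OF \<pi> bl(1,4)] mem disj by fastforce
    next
      case 3 then show ?thesis using block_eq[OF \<pi> bl(2,3)] mem disj by fastforce
    next
      case 4 then show ?thesis using block_eq[OF \<pi> bl(2,4)] image_act_eqD[OF \<pi> K'(1) gh] by blast
    qed
  qed
  have Nne: "N g \<noteq> {}" for g using pq by (auto simp: N_def)
  have N0: "L \<inter> N g = {}" if "L \<in> \<pi>0" "g \<in> carrier G" for L g
  proof (rule ccontr)
    assume "L \<inter> N g \<noteq> {}"
    then obtain r where r: "r \<in> L" "r \<in> act g ` K \<or> r \<in> act g ` K'" unfolding N_def by blast
    have L: "L \<in> \<pi>" using that(1) by (simp add: \<pi>0_def)
    have "L = act g ` K \<or> L = act g ` K'"
      using r(2) block_eq[OF \<pi> L block_act[OF \<pi> that(2) K] r(1)]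
        block_eq[OF \<pi> L block_act[OF \<pi> that(2) K'(1)] r(1)] by blast
    then show False using that by (auto simp: \<pi>0_def orb_def)
  qed
  have cover: "\<exists>M\<in>\<sigma>. L \<subseteq> M" if "L \<in> \<pi>" for L
  proof (cases "L \<in> \<pi>0")
    case False
    then have "L \<in> orb K \<or> L \<in> orb K'" using that by (auto simp: \<pi>0_def)
    then show ?thesis by (auto simp: orb_def \<sigma>_def N_def)
  qed (auto simp: \<sigma>_def)
  have part: "partition_on X \<sigma>"
  proof (rule partition_onI)
    have "\<Union>\<pi> = X" using \<pi> partition_onD1 by (auto simp: balanced_def)
    moreover have "\<Union>\<sigma> \<subseteq> X" using block_X[OF \<pi>] KX by (auto simp: \<sigma>_def \<pi>0_def N_def)
    moreover have "\<Union>\<pi> \<subseteq> \<Union>\<sigma>" using cover by blast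
    ultimately show "\<Union>\<sigma> = X" by blast
    fix A B assume AB: "A \<in> \<sigma>" "B \<in> \<sigma>" "A \<noteq> B"
    show "disjnt A B"
    proof (cases "A \<in> \<pi>0")
      case A: True
      show ?thesis
      proof (cases "B \<in> \<pi>0")
        case True
        then show ?thesis using A AB block_eq[OF \<pi>, of A B] by (auto simp: \<pi>0_def disjnt_def)
      next
        case False
        then show ?thesis using A AB N0 by (auto simp: \<sigma>_def disjnt_def)
      qed
    next
      case A: False
      then obtain g where g: "g \<in> carrier G" "A = N g" using AB by (auto simp: \<sigma>_def)
      show ?thesis
      proof (cases "B \<in> \<pi>0")
        case True
        then show ?thesis using g N0 by (auto simp: disjnt_def)
      next
        case False
        then obtain h where "h \<in> carrier G" "B = N h" using AB by (auto simp: \<sigma>_def)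
        then show ?thesis using g AB Ninj unfolding disjnt_def by blast
      qed
    qed
  next
    show "{} \<notin> \<sigma>" using block_nonempty[OF \<pi>] Nne by (auto simp: \<sigma>_def \<pi>0_def)
  qed
  have actN: "act h ` N g = N (h \<otimes> g)" if "g \<in> carrier G" "h \<in> carrier G" for g h
    using that KX by (simp add: N_def image_Un image_act_mult)
  have bal: "\<sigma> \<in> balanced"
    unfolding balanced_def
  proof (intro CollectI conjI part ballI impI)
    fix g L assume g: "g \<in> carrier G" and L: "L \<in> \<sigma>"
    show "act g ` L \<in> \<sigma>"
    proof (cases "L \<in> \<pi>0")
      case True
      then have "act g ` L \<in> \<pi>0"
        using orb_act[OF \<pi> K g, of L] orb_act[OF \<pi> K'(1) g, of L] block_act[OF \<pi> g] by (auto simp: \<pi>0_def)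
      then show ?thesis by (simp add: \<sigma>_def)
    next
      case False
      then show ?thesis using L g actN by (auto simp: \<sigma>_def)
    qed
    assume "g \<noteq> \<one>"
    show "act g ` L \<noteq> L"
    proof (cases "L \<in> \<pi>0")
      case True
      then show ?thesis using block_free[OF \<pi> g, of L] \<open>g \<noteq> \<one>\<close> by (auto simp: \<pi>0_def)
    next
      case False
      then obtain h where h: "h \<in> carrier G" "L = N h" using L by (auto simp: \<sigma>_def)
      have "g \<otimes> h = h" if "act g ` L = L"
        using that Ninj[of "g \<otimes> h" h] actN[OF h(1) g] Nne[of h] g h by auto
      then show ?thesis using \<open>g \<noteq> \<one>\<close> g h by (metis r_cancel_one)
    qed
  qed
  have ref: "refines \<pi> \<sigma>" using cover by (simp add: refines_iff[OF \<pi> bal])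
  have "N \<one> = K \<union> K'" using KX by (simp add: N_def image_act_one)
  then have "rel \<sigma> p q" using pq unfolding rel_def \<sigma>_def by blast
  \<comment> \<open>Two orbits of \<open>|G|\<close> blocks each are replaced by one.\<close>
  moreover have "card \<sigma> + Coset.order G = card \<pi>"
  proof -
    have fin: "finite \<pi>" using finite_blocks \<pi> by blast
    have sub: "orb K \<union> orb K' \<subseteq> \<pi>" using orb_subset[OF \<pi>] K K' by blast
    have "finite (orb K)" "finite (orb K')" using finG by (simp_all add: orb_def)
    then have c2: "card (orb K \<union> orb K') = 2 * Coset.order G"
      using disj card_orb[OF \<pi>] K K' by (simp add: card_Un_disjoint)
    have le: "card (orb K \<union> orb K') \<le> card \<pi>" using sub fin by (rule card_mono[rotated])
    have "card \<pi>0 = card \<pi> - 2 * Coset.order G"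
      unfolding \<pi>0_def c2[symmetric] by (rule card_Diff_subset[OF finite_subset[OF sub fin] sub])
    moreover have "card (N ` carrier G) = Coset.order G"
      unfolding Coset.order_def
    proof (rule card_image, rule inj_onI)
      fix g h assume "g \<in> carrier G" "h \<in> carrier G" "N g = N h"
      then show "g = h" using Ninj[of g h] Nne[of g] by auto
    qed
    moreover have "\<pi>0 \<inter> N ` carrier G = {}"
      using N0 Nne by fastforce
    then have "card \<sigma> = card \<pi>0 + card (N ` carrier G)"
      unfolding \<sigma>_def using fin finG by (intro card_Un_disjoint) (auto simp: \<pi>0_def)
    ultimately show ?thesis using le c2 by simp
  qed
  moreover have "refines \<sigma> \<rho>" if \<rho>: "\<rho> \<in> balanced" "refines \<pi> \<rho>" "rel \<rho> p q" for \<rho>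
    unfolding refines_iff[OF bal \<rho>(1)]
  proof
    fix L assume L: "L \<in> \<sigma>"
    show "\<exists>M\<in>\<rho>. L \<subseteq> M"
    proof (cases "L \<in> \<pi>0")
      case True
      then show ?thesis using \<rho>(2) by (auto simp: refines_iff[OF \<pi> \<rho>(1)] \<pi>0_def)
    next
      case False
      then obtain g where g: "g \<in> carrier G" "L = N g" using L by (auto simp: \<sigma>_def)
      obtain R where R: "R \<in> \<rho>" "p \<in> R" "q \<in> R" using \<rho>(3) by (auto simp: rel_def)
      obtain M where M: "M \<in> \<rho>" "K \<subseteq> M" using \<rho>(2) K by (auto simp: refines_iff[OF \<pi> \<rho>(1)])
      obtain M' where M': "M' \<in> \<rho>" "K' \<subseteq> M'" using \<rho>(2) K' by (auto simp: refines_iff[OF \<pi> \<rho>(1)])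
      have "M = R" "M' = R" using block_eq[OF \<rho>(1)] M M' R pq by blast+
      then have "L \<subseteq> act g ` R" using M M' g by (auto simp: N_def)
      then show ?thesis using block_act[OF \<rho>(1) g(1) R(1)] by blast
    qed
  qed
  ultimately show ?thesis using bal ref by blast
qed

text \<open>The coarsening \<open>\<rho>\<close> witnesses that the two blocks are in different
  orbits: otherwise it would relate \<open>p\<close> to a translate of \<open>p\<close>, which
  forces the translation to be trivial and \<open>p\<close>, \<open>q\<close> to be related
  already.\<close>

lemma join_pair:
  assumes \<pi>: "\<pi> \<in> balanced" and \<rho>: "\<rho> \<in> balanced" "refines \<pi> \<rho>" and pq: "rel \<rho> p q" "\<not> rel \<pi> p q"
  shows "\<exists>\<sigma>\<in>balanced. refines \<pi> \<sigma> \<and> rel \<sigma> p q \<and> card \<sigma> + Coset.order G = card \<pi> \<and>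
    (\<forall>\<rho>\<in>balanced. refines \<pi> \<rho> \<longrightarrow> rel \<rho> p q \<longrightarrow> refines \<sigma> \<rho>)"
proof -
  obtain K where K: "K \<in> \<pi>" "p \<in> K" using block_exists[OF \<pi>] rel_X[OF \<rho>(1) pq(1)] by blast
  obtain K' where K': "K' \<in> \<pi>" "q \<in> K'" using block_exists[OF \<pi>] rel_X[OF \<rho>(1) pq(1)] by blast
  have "K' \<notin> orb K"
  proof
    assume "K' \<in> orb K"
    then obtain g where g: "g \<in> carrier G" "K' = act g ` K" by (auto simp: orb_def)
    then have "act g p \<in> K'" using K by blast
    then have "rel \<pi> q (act g p)" using K' by (auto simp: rel_def)
    then have "rel \<rho> q (act g p)" using \<rho>(2) unfolding refines_def by blast
    then have "rel \<rho> p (act g p)" using rel_trans[OF \<rho>(1) pq(1)] by blast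
    then have "g = \<one>" using rel_free[OF \<rho>(1) g(1)] by blast
    then have "K' = K" using g image_act_one[OF block_X[OF \<pi> K(1)]] by simp
    then show False using pq(2) K K' by (auto simp: rel_def)
  qed
  then show ?thesis using merge_blocks[OF \<pi> K(1) K'(1) _ K(2) K'(2)] by blast
qed

end

section \<open>Free actions and equivariant maps\<close>

locale free_action = group G for G :: "('g, 'b) monoid_scheme" (structure) +
  fixes S :: "'s set" and a :: "'g \<Rightarrow> 's \<Rightarrow> 's"
  assumes a_closed: "g \<in> carrier G \<Longrightarrow> s \<in> S \<Longrightarrow> a g s \<in> S"
    and a_one: "s \<in> S \<Longrightarrow> a \<one> s = s"
    and a_mult: "g \<in> carrier G \<Longrightarrow> h \<in> carrier G \<Longrightarrow> s \<in> S \<Longrightarrow> a (g \<otimes> h) s = a g (a h s)"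
    and a_free: "g \<in> carrier G \<Longrightarrow> s \<in> S \<Longrightarrow> a g s = s \<Longrightarrow> g = \<one>"
begin

lemma a_eqD:
  assumes "g \<in> carrier G" "h \<in> carrier G" "s \<in> S" "a g s = a h s"
  shows "g = h"
proof -
  have "a (inv h \<otimes> g) s = a (inv h) (a h s)" using assms by (simp add: a_mult)
  also have "\<dots> = a (inv h \<otimes> h) s" using assms by (subst a_mult) auto
  also have "\<dots> = s" using assms by (simp add: a_one)
  finally have "inv h \<otimes> g = \<one>" using a_free assms by simp
  then show ?thesis using assms by (metis inv_equality inv_inv inv_closed)
qed

definition a_orbit :: "'s \<Rightarrow> 's set" where
  "a_orbit s = (\<lambda>g. a g s) ` carrier G"

lemma a_orbit_eq:
  assumes s: "s \<in> S" and g: "g \<in> carrier G"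
  shows "a_orbit (a g s) = a_orbit s"
proof
  show "a_orbit (a g s) \<subseteq> a_orbit s"
    using s g by (auto simp: a_orbit_def a_mult[symmetric])
  show "a_orbit s \<subseteq> a_orbit (a g s)"
  proof
    fix t assume "t \<in> a_orbit s"
    then obtain h where h: "h \<in> carrier G" "t = a h s" by (auto simp: a_orbit_def)
    have "h \<otimes> inv g \<otimes> g = h" using h(1) g by (simp add: m_assoc)
    then have "t = a (h \<otimes> inv g) (a g s)"
      unfolding h(2) using h(1) s g by (subst a_mult[symmetric]) auto
    then show "t \<in> a_orbit (a g s)" using h(1) g by (auto simp: a_orbit_def)
  qed
qed

lemma a_orbit_self: "s \<in> S \<Longrightarrow> s \<in> a_orbit s"
  unfolding a_orbit_def using a_one by (metis imageI one_closed)

lemma transversal: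
  obtains T where "T \<subseteq> S" "bij_betw (\<lambda>(g, t). a g t) (carrier G \<times> T) S"
proof
  \<comment> \<open>The choice depends on the orbit only, so \<open>r\<close> selects one
    representative of each orbit.\<close>
  define r where "r s = (SOME t. t \<in> a_orbit s)" for s
  have r: "r s \<in> a_orbit s" if "s \<in> S" for s
    unfolding r_def using a_orbit_self[OF that] by (rule someI)
  have rS: "r s \<in> S" if s: "s \<in> S" for s
    using r[OF s] a_closed s by (auto simp: a_orbit_def)
  have rr: "r (a g (r s)) = r s" if s: "s \<in> S" and g: "g \<in> carrier G" for s g
  proof -
    obtain h where h: "h \<in> carrier G" "r s = a h s" using r[OF s] by (auto simp: a_orbit_def)
    have "a_orbit (a g (r s)) = a_orbit s"
      using a_orbit_eq[OF rS[OF s] g] a_orbit_eq[OF s h(1)] h(2) by simp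
    then show ?thesis by (simp add: r_def)
  qed
  show "r ` S \<subseteq> S" using rS by blast
  show "bij_betw (\<lambda>(g, t). a g t) (carrier G \<times> r ` S) S"
    unfolding bij_betw_def
  proof
    show "inj_on (\<lambda>(g, t). a g t) (carrier G \<times> r ` S)"
    proof (rule inj_onI, clarify)
      fix g h s s'
      assume gh: "g \<in> carrier G" "h \<in> carrier G" and s: "s \<in> S" "s' \<in> S" and eq: "a g (r s) = a h (r s')"
      have "r s = r s'" using rr[OF s(1) gh(1)] rr[OF s(2) gh(2)] eq by simp
      moreover have "g = h" using a_eqD[OF gh rS[OF s(1)]] eq \<open>r s = r s'\<close> by simp
      ultimately show "g = h \<and> r s = r s'" by blast
    qed
    show "(\<lambda>(g, t). a g t) ` (carrier G \<times> r ` S) = S"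
    proof (intro subset_antisym subsetI)
      fix s assume s: "s \<in> S"
      obtain h where h: "h \<in> carrier G" "r s = a h s" using r[OF s] by (auto simp: a_orbit_def)
      have "s = a (inv h) (r s)"
        unfolding h(2) using h(1) s by (subst a_mult[symmetric]) (auto simp: a_one)
      then show "s \<in> (\<lambda>(g, t). a g t) ` (carrier G \<times> r ` S)"
        using h(1) s by (auto intro!: image_eqI[of _ _ "(inv h, r s)"])
    qed (use a_closed rS in auto)
  qed
qed

lemma order_dvd_card: "Coset.order G dvd card S"
proof -
  obtain T where "bij_betw (\<lambda>(g, t). a g t) (carrier G \<times> T) S" by (rule transversal)
  then have "card S = card (carrier G \<times> T)" by (rule bij_betw_same_card[symmetric])
  then show ?thesis by (simp add: card_cartesian_product Coset.order_def)
qed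

text \<open>An equivariant map on a free \<open>G\<close>-set is determined by arbitrary values on a
  transversal, which has \<open>card S div |G|\<close> elements. The target may be any finite
  \<open>G\<close>-set.\<close>

lemma card_equivariant:
  assumes finG: "finite (carrier G)" and finS: "finite S" and finB: "finite B"
    and b_closed: "\<And>g y. g \<in> carrier G \<Longrightarrow> y \<in> B \<Longrightarrow> b g y \<in> B"
    and b_one: "\<And>y. y \<in> B \<Longrightarrow> b \<one> y = y"
    and b_mult: "\<And>g h y. g \<in> carrier G \<Longrightarrow> h \<in> carrier G \<Longrightarrow> y \<in> B \<Longrightarrow> b (g \<otimes> h) y = b g (b h y)"
  shows "card {\<phi> \<in> S \<rightarrow>\<^sub>E B. \<forall>g\<in>carrier G. \<forall>s\<in>S. \<phi> (a g s) = b g (\<phi> s)}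
    = card B ^ (card S div Coset.order G)" (is "card ?E = _")
proof -
  obtain T where T: "T \<subseteq> S" "bij_betw (\<lambda>(g, t). a g t) (carrier G \<times> T) S" by (rule transversal)
  have finT: "finite T" using T(1) finS by (rule finite_subset)
  have "card S = card (carrier G \<times> T)" using T(2) by (rule bij_betw_same_card[symmetric])
  then have cS: "card S div Coset.order G = card T"
    using finG by (simp add: card_cartesian_product Coset.order_def) (metis card_gt_0_iff empty_iff less_numeral_extra(3) nonzero_mult_div_cancel_left one_closed)
  have "bij_betw (\<lambda>\<phi>. restrict \<phi> T) ?E (T \<rightarrow>\<^sub>E B)"
    unfolding bij_betw_def
  proof
    show "inj_on (\<lambda>\<phi>. restrict \<phi> T) ?E"
    proof (rule inj_onI)
      fix \<phi> \<psi> assume \<phi>: "\<phi> \<in> ?E" and \<psi>: "\<psi> \<in> ?E" and eq: "restrict \<phi> T = restrict \<psi> T"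
      show "\<phi> = \<psi>"
      proof (rule PiE_ext)
        show "\<phi> \<in> S \<rightarrow>\<^sub>E B" "\<psi> \<in> S \<rightarrow>\<^sub>E B" using \<phi> \<psi> by auto
        fix s assume "s \<in> S"
        then obtain g t where gt: "g \<in> carrier G" "t \<in> T" "s = a g t"
          using T(2) by (auto simp: bij_betw_def)
        have "\<phi> t = \<psi> t" using fun_cong[OF eq, of t] gt(2) by simp
        then show "\<phi> s = \<psi> s" using \<phi> \<psi> gt T(1) by auto
      qed
    qed
    show "(\<lambda>\<phi>. restrict \<phi> T) ` ?E = T \<rightarrow>\<^sub>E B"
    proof (intro subset_antisym subsetI)
      fix \<psi> assume "\<psi> \<in> (\<lambda>\<phi>. restrict \<phi> T) ` ?E"
      then obtain \<phi> where \<phi>: "\<phi> \<in> S \<rightarrow>\<^sub>E B" "\<psi> = restrict \<phi> T" by blast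
      then show "\<psi> \<in> T \<rightarrow>\<^sub>E B" using T(1) by (auto simp: PiE_iff)
    next
      fix \<psi> assume \<psi>: "\<psi> \<in> T \<rightarrow>\<^sub>E B"
      \<comment> \<open>Every point of \<open>S\<close> is uniquely \<open>a g t\<close> with
        \<open>t\<close> in the transversal; \<open>c\<close> returns this pair and extends
        \<open>\<psi>\<close> by equivariance.\<close>
      define c where "c = inv_into (carrier G \<times> T) (\<lambda>(g, t). a g t)"
      have c: "c (a g t) = (g, t)" if "g \<in> carrier G" "t \<in> T" for g t
      proof -
        have inj: "inj_on (\<lambda>(g, t). a g t) (carrier G \<times> T)" using T(2) by (simp add: bij_betw_def)
        have "(g, t) \<in> carrier G \<times> T" using that by simp
        from inv_into_f_f[OF inj this] show ?thesis by (simp add: c_def)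
      qed
      define \<phi> where "\<phi> = (\<lambda>s\<in>S. b (fst (c s)) (\<psi> (snd (c s))))"
      have val: "\<phi> (a g t) = b g (\<psi> t)" if "g \<in> carrier G" "t \<in> T" for g t
        using that T(1) a_closed by (auto simp: \<phi>_def c)
      have cover: "\<exists>g\<in>carrier G. \<exists>t\<in>T. s = a g t" if "s \<in> S" for s
        using T(2) that by (auto simp: bij_betw_def)
      have \<psi>B: "\<psi> t \<in> B" if "t \<in> T" for t using \<psi> that by auto
      have "\<phi> \<in> S \<rightarrow>\<^sub>E B"
      proof (rule PiE_I)
        fix s assume "s \<in> S"
        then obtain g t where "g \<in> carrier G" "t \<in> T" "s = a g t" using cover by blast
        then show "\<phi> s \<in> B" using val b_closed \<psi>B by simp
      qed (simp add: \<phi>_def)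
      moreover have "\<phi> (a g s) = b g (\<phi> s)" if g: "g \<in> carrier G" and s: "s \<in> S" for g s
      proof -
        obtain h t where ht: "h \<in> carrier G" "t \<in> T" "s = a h t" using cover s by blast
        have "a g s = a (g \<otimes> h) t" using ht g T(1) by (auto simp: a_mult)
        then have "\<phi> (a g s) = b (g \<otimes> h) (\<psi> t)" using val ht g by simp
        also have "\<dots> = b g (\<phi> s)" using ht g val b_mult \<psi>B by simp
        finally show ?thesis .
      qed
      moreover have "restrict \<phi> T = \<psi>"
      proof (rule PiE_ext[of _ T "\<lambda>_. B"])
        fix t assume t: "t \<in> T"
        then have "\<phi> (a \<one> t) = \<psi> t" using val b_one \<psi>B by simp
        then show "restrict \<phi> T t = \<psi> t" using t T(1) a_one by auto
      next
        show "restrict \<phi> T \<in> T \<rightarrow>\<^sub>E B" using \<open>\<phi> \<in> S \<rightarrow>\<^sub>E B\<close> T(1) by (auto simp: PiE_iff)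
      qed (rule \<psi>)
      ultimately show "\<psi> \<in> (\<lambda>\<phi>. restrict \<phi> T) ` ?E" by blast
    qed
  qed
  then have "card ?E = card (T \<rightarrow>\<^sub>E B)" by (rule bij_betw_same_card)
  then show ?thesis using finT by (simp add: card_PiE cS)
qed

end

section \<open>Numbers of orbits of blocks and joins of covers\<close>

context dowling
begin

lemma order_pos: "Coset.order G > 0"
  using finG by (auto simp: Coset.order_def card_gt_0_iff)

lemma free_action_blocks: "\<pi> \<in> balanced \<Longrightarrow> free_action G \<pi> (\<lambda>g K. act g ` K)"
  using block_act block_free image_act_one[OF block_X] image_act_mult[OF _ _ block_X]
  by unfold_locales auto

lemma free_action_points: "free_action G X act"
  using act_free by unfold_locales (auto simp: act_mult)

lemma card_X: "card X = Coset.order G * n"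
  by (simp add: points_def card_cartesian_product Coset.order_def)

text \<open>The number of orbits of blocks; the division is exact because the blocks are permuted
  freely. On the empty partition of the top element it is 0.\<close>

definition nblocks :: "('g \<times> nat) set set \<Rightarrow> nat" where
  "nblocks \<pi> = card \<pi> div Coset.order G"

lemma card_blocks: "\<pi> \<in> balanced \<Longrightarrow> card \<pi> = Coset.order G * nblocks \<pi>"
  using free_action.order_dvd_card[OF free_action_blocks] by (simp add: nblocks_def)

lemma nblocks_pos:
  assumes \<pi>: "\<pi> \<in> balanced"
  shows "nblocks \<pi> > 0"
proof -
  have "\<pi> \<noteq> {}" using block_exists[OF \<pi> X_nonempty] by blast
  then have "card \<pi> > 0" using finite_blocks[OF \<pi>] by (simp add: card_gt_0_iff)
  then show ?thesis using card_blocks[OF \<pi>] by (cases "nblocks \<pi>") auto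
qed

definition singletons :: "('g \<times> nat) set set" where
  "singletons = (\<lambda>p. {p}) ` X"

lemma singletons_balanced: "singletons \<in> balanced"
proof -
  have "partition_on X singletons"
    by (rule partition_onI) (auto simp: singletons_def disjnt_def)
  then show ?thesis
    using act_free by (auto simp: balanced_def singletons_def)
qed

lemma rel_singletons: "rel singletons p q \<longleftrightarrow> p \<in> X \<and> p = q"
  by (auto simp: rel_def singletons_def)

lemma singletons_refines: "\<pi> \<in> balanced \<Longrightarrow> refines singletons \<pi>"
  using rel_refl by (auto simp: refines_def rel_singletons)

lemma nblocks_singletons: "nblocks singletons = n"
proof -
  have "card singletons = card X" unfolding singletons_def by (rule card_image) simp
  then show ?thesis using order_pos by (simp add: nblocks_def card_X)
qed

lemma nblocks_le: "\<pi> \<in> balanced \<Longrightarrow> \<rho> \<in> balanced \<Longrightarrow> refines \<pi> \<rho> \<Longrightarrow> nblocks \<rho> \<le> nblocks \<pi>"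
  unfolding nblocks_def by (intro div_le_mono card_refines)

lemma nblocks_le_n: "\<pi> \<in> balanced \<Longrightarrow> nblocks \<pi> \<le> n"
  using nblocks_le[OF singletons_balanced _ singletons_refines] nblocks_singletons by simp

lemma join_pair':
  assumes \<pi>: "\<pi> \<in> balanced" and \<rho>: "\<rho> \<in> balanced" "refines \<pi> \<rho>" and pq: "rel \<rho> p q" "\<not> rel \<pi> p q"
  shows "\<exists>\<sigma>\<in>balanced. refines \<pi> \<sigma> \<and> rel \<sigma> p q \<and> nblocks \<sigma> + 1 = nblocks \<pi> \<and>
    (\<forall>\<rho>\<in>balanced. refines \<pi> \<rho> \<longrightarrow> rel \<rho> p q \<longrightarrow> refines \<sigma> \<rho>)"
proof -
  obtain \<sigma> where \<sigma>: "\<sigma> \<in> balanced" "refines \<pi> \<sigma>" "rel \<sigma> p q" "card \<sigma> + Coset.order G = card \<pi>"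
    "\<forall>\<rho>\<in>balanced. refines \<pi> \<rho> \<longrightarrow> rel \<rho> p q \<longrightarrow> refines \<sigma> \<rho>"
    using join_pair[OF assms] by blast
  have "Coset.order G * (nblocks \<sigma> + 1) = Coset.order G * nblocks \<pi>"
    using \<sigma>(4) card_blocks \<pi> \<sigma>(1) by simp
  then have "nblocks \<sigma> + 1 = nblocks \<pi>" using order_pos by (metis mult_cancel1 not_gr0)
  then show ?thesis using \<sigma> by blast
qed

lemma refines_neq_pair:
  assumes "\<pi> \<in> balanced" "\<rho> \<in> balanced" "refines \<pi> \<rho>" "\<pi> \<noteq> \<rho>"
  obtains p q where "rel \<rho> p q" "\<not> rel \<pi> p q"
  using assms refines_antisym unfolding refines_def by blast

lemma refines_neq_nblocks:
  assumes "\<pi> \<in> balanced" "\<rho> \<in> balanced" "refines \<pi> \<rho>" "\<pi> \<noteq> \<rho>"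
  shows "nblocks \<rho> < nblocks \<pi>"
proof -
  obtain p q where pq: "rel \<rho> p q" "\<not> rel \<pi> p q" using refines_neq_pair[OF assms] .
  then obtain \<sigma> where "\<sigma> \<in> balanced" "nblocks \<sigma> + 1 = nblocks \<pi>" "refines \<sigma> \<rho>"
    using join_pair'[OF assms(1-3) pq] assms(2,3) pq by blast
  then show ?thesis using nblocks_le[of \<sigma> \<rho>] assms by simp
qed

text \<open>An equivariant map that is constant on blocks is an equivariant map on the set of
  blocks, which is a free \<open>G\<close>-set with \<open>nblocks \<pi>\<close> orbits.\<close>

lemma card_equivariant_const:
  assumes \<pi>: "\<pi> \<in> balanced" and finB: "finite B"
    and b_closed: "\<And>g y. g \<in> carrier G \<Longrightarrow> y \<in> B \<Longrightarrow> b g y \<in> B"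
    and b_one: "\<And>y. y \<in> B \<Longrightarrow> b \<one> y = y"
    and b_mult: "\<And>g h y. g \<in> carrier G \<Longrightarrow> h \<in> carrier G \<Longrightarrow> y \<in> B \<Longrightarrow> b (g \<otimes> h) y = b g (b h y)"
  shows "card {\<phi> \<in> X \<rightarrow>\<^sub>E B. (\<forall>g\<in>carrier G. \<forall>p\<in>X. \<phi> (act g p) = b g (\<phi> p)) \<and> (\<forall>p q. rel \<pi> p q \<longrightarrow> \<phi> p = \<phi> q)}
    = card B ^ nblocks \<pi>" (is "card ?C = _")
proof -
  interpret A: free_action G \<pi> "\<lambda>g K. act g ` K" by (rule free_action_blocks[OF \<pi>])
  let ?E = "{\<psi> \<in> \<pi> \<rightarrow>\<^sub>E B. \<forall>g\<in>carrier G. \<forall>K\<in>\<pi>. \<psi> (act g ` K) = b g (\<psi> K)}"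
  define blk where "blk p = (THE K. K \<in> \<pi> \<and> p \<in> K)" for p
  have blk: "blk p = K" if "K \<in> \<pi>" "p \<in> K" for p K
    unfolding blk_def
  proof (rule the_equality)
    show "L = K" if "L \<in> \<pi> \<and> p \<in> L" for L
      using that \<open>K \<in> \<pi>\<close> \<open>p \<in> K\<close> block_eq[OF \<pi>, of L K p] by blast
  qed (use that in blast)
  have blk_mem: "blk p \<in> \<pi> \<and> p \<in> blk p" if "p \<in> X" for p
    using block_exists[OF \<pi> that] blk by metis
  have "bij_betw (\<lambda>\<psi>. \<lambda>p\<in>X. \<psi> (blk p)) ?E ?C"
    unfolding bij_betw_def
  proof
    show "inj_on (\<lambda>\<psi>. \<lambda>p\<in>X. \<psi> (blk p)) ?E"
    proof (rule inj_onI)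
      fix \<psi> \<psi>' assume \<psi>: "\<psi> \<in> ?E" "\<psi>' \<in> ?E" and eq: "(\<lambda>p\<in>X. \<psi> (blk p)) = (\<lambda>p\<in>X. \<psi>' (blk p))"
      show "\<psi> = \<psi>'"
      proof (rule PiE_ext)
        show "\<psi> \<in> \<pi> \<rightarrow>\<^sub>E B" "\<psi>' \<in> \<pi> \<rightarrow>\<^sub>E B" using \<psi> by auto
        fix K assume K: "K \<in> \<pi>"
        obtain p where p: "p \<in> K" using block_nonempty[OF \<pi> K] by blast
        then have "p \<in> X" using block_X[OF \<pi> K] by blast
        then show "\<psi> K = \<psi>' K" using fun_cong[OF eq, of p] blk[OF K p] by simp
      qed
    qed
    show "(\<lambda>\<psi>. \<lambda>p\<in>X. \<psi> (blk p)) ` ?E = ?C"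
    proof (intro subset_antisym subsetI)
      fix \<phi> assume "\<phi> \<in> (\<lambda>\<psi>. \<lambda>p\<in>X. \<psi> (blk p)) ` ?E"
      then obtain \<psi> where \<psi>: "\<psi> \<in> \<pi> \<rightarrow>\<^sub>E B" "\<And>g K. g \<in> carrier G \<Longrightarrow> K \<in> \<pi> \<Longrightarrow> \<psi> (act g ` K) = b g (\<psi> K)"
        "\<phi> = (\<lambda>p\<in>X. \<psi> (blk p))" by blast
      have "\<phi> \<in> X \<rightarrow>\<^sub>E B" using \<psi>(1) blk_mem by (auto simp: \<psi>(3) PiE_iff)
      moreover have "\<phi> (act g p) = b g (\<phi> p)" if g: "g \<in> carrier G" and p: "p \<in> X" for g p
      proof -
        have "blk (act g p) = act g ` blk p"
          using blk[OF block_act[OF \<pi> g], of "blk p" "act g p"] blk_mem[OF p] by blast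
        then show ?thesis using \<psi>(2)[OF g, of "blk p"] blk_mem[OF p] g p by (simp add: \<psi>(3))
      qed
      moreover have "\<phi> p = \<phi> q" if "rel \<pi> p q" for p q
      proof -
        obtain K where K: "K \<in> \<pi>" "p \<in> K" "q \<in> K" using \<open>rel \<pi> p q\<close> unfolding rel_def by blast
        then show ?thesis using blk[OF K(1,2)] blk[OF K(1,3)] block_X[OF \<pi> K(1)] by (auto simp: \<psi>(3))
      qed
      ultimately show "\<phi> \<in> ?C" by blast
    next
      fix \<phi> assume "\<phi> \<in> ?C"
      then have \<phi>: "\<phi> \<in> X \<rightarrow>\<^sub>E B" "\<And>g p. g \<in> carrier G \<Longrightarrow> p \<in> X \<Longrightarrow> \<phi> (act g p) = b g (\<phi> p)"
        "\<And>p q. rel \<pi> p q \<Longrightarrow> \<phi> p = \<phi> q" by blast+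
      define \<psi> where "\<psi> = (\<lambda>K\<in>\<pi>. \<phi> (SOME p. p \<in> K))"
      have val: "\<psi> K = \<phi> p" if K: "K \<in> \<pi>" "p \<in> K" for K p
      proof -
        have "(SOME p. p \<in> K) \<in> K" using K(2) by (rule someI)
        then have "rel \<pi> (SOME p. p \<in> K) p" using K unfolding rel_def by blast
        then show ?thesis using K(1) \<phi>(3) by (simp add: \<psi>_def)
      qed
      have "\<psi> \<in> \<pi> \<rightarrow>\<^sub>E B"
      proof (rule PiE_I)
        fix K assume K: "K \<in> \<pi>"
        obtain p where p: "p \<in> K" using block_nonempty[OF \<pi> K] by blast
        then show "\<psi> K \<in> B" using val[OF K p] \<phi>(1) block_X[OF \<pi> K] by auto
      qed (simp add: \<psi>_def)
      moreover have "\<psi> (act g ` K) = b g (\<psi> K)" if g: "g \<in> carrier G" and K: "K \<in> \<pi>" for g K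
      proof -
        obtain p where p: "p \<in> K" using block_nonempty[OF \<pi> K] by blast
        then have "\<psi> (act g ` K) = \<phi> (act g p)" using val[OF block_act[OF \<pi> g K]] by blast
        then show ?thesis using val[OF K p] \<phi>(2)[OF g subsetD[OF block_X[OF \<pi> K] p]] by simp
      qed
      moreover have "\<phi> = (\<lambda>p\<in>X. \<psi> (blk p))"
      proof
        fix p
        show "\<phi> p = (\<lambda>p\<in>X. \<psi> (blk p)) p"
          using val[of "blk p" p] blk_mem[of p] PiE_arb[OF \<phi>(1), of p] by (cases "p \<in> X") simp_all
      qed
      ultimately show "\<phi> \<in> (\<lambda>\<psi>. \<lambda>p\<in>X. \<psi> (blk p)) ` ?E" by blast
    qed
  qed
  then have "card ?C = card ?E" by (rule bij_betw_same_card[symmetric])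
  also have "\<dots> = card B ^ nblocks \<pi>"
    unfolding nblocks_def
    by (rule A.card_equivariant[OF finG finite_blocks[OF \<pi>] finB]) (use b_closed b_one b_mult in auto)
  finally show ?thesis .
qed

lemma refines_balanced_rank:
  assumes "\<pi> \<in> balanced" "\<rho> \<in> balanced" "refines \<pi> \<rho>" "nblocks \<rho> = nblocks \<pi>"
  shows "\<pi> = \<rho>"
  using refines_neq_nblocks[of \<pi> \<rho>] assms by auto

text \<open>A cover \<open>\<beta>\<close> of \<open>\<xi>\<close> is the least coarsening relating
  any one of its new pairs. For a pair that \<open>\<alpha>\<close> does not relate, merging it in
  \<open>\<alpha>\<close> gives an element above both that covers them. The common bound
  \<open>\<upsilon>\<close> guarantees that the merging is possible.\<close>

lemma join_covers:
  assumes \<xi>: "\<xi> \<in> balanced" and \<alpha>: "\<alpha> \<in> balanced" "refines \<xi> \<alpha>" "nblocks \<alpha> + 1 = nblocks \<xi>"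
    and \<beta>: "\<beta> \<in> balanced" "refines \<xi> \<beta>" "nblocks \<beta> + 1 = nblocks \<xi>" and ne: "\<alpha> \<noteq> \<beta>"
    and \<upsilon>: "\<upsilon> \<in> balanced" "refines \<alpha> \<upsilon>" "refines \<beta> \<upsilon>"
  shows "\<exists>\<gamma>\<in>balanced. refines \<alpha> \<gamma> \<and> refines \<beta> \<gamma> \<and> nblocks \<gamma> + 1 = nblocks \<alpha> \<and>
    (\<forall>\<upsilon>\<in>balanced. refines \<alpha> \<upsilon> \<longrightarrow> refines \<beta> \<upsilon> \<longrightarrow> refines \<gamma> \<upsilon>)"
proof -
  have "\<not> refines \<beta> \<alpha>" using refines_balanced_rank[of \<beta> \<alpha>] \<alpha> \<beta> ne by auto
  then obtain p q where pq: "rel \<beta> p q" "\<not> rel \<alpha> p q" unfolding refines_def by blast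
  have pq\<xi>: "\<not> rel \<xi> p q" using pq \<alpha>(2) unfolding refines_def by blast
  have pq\<upsilon>: "rel \<upsilon> p q" using pq \<upsilon>(3) unfolding refines_def by blast
  obtain \<gamma> where \<gamma>: "\<gamma> \<in> balanced" "refines \<alpha> \<gamma>" "rel \<gamma> p q" "nblocks \<gamma> + 1 = nblocks \<alpha>"
    "\<And>\<rho>. \<rho> \<in> balanced \<Longrightarrow> refines \<alpha> \<rho> \<Longrightarrow> rel \<rho> p q \<Longrightarrow> refines \<gamma> \<rho>"
    using join_pair'[OF \<alpha>(1) \<upsilon>(1,2) pq\<upsilon> pq(2)] by blast
  obtain \<sigma> where \<sigma>: "\<sigma> \<in> balanced" "nblocks \<sigma> + 1 = nblocks \<xi>"
    "\<And>\<rho>. \<rho> \<in> balanced \<Longrightarrow> refines \<xi> \<rho> \<Longrightarrow> rel \<rho> p q \<Longrightarrow> refines \<sigma> \<rho>"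
    using join_pair'[OF \<xi> \<beta>(1,2) pq(1) pq\<xi>] by blast
  \<comment> \<open>The least coarsening of \<open>\<xi>\<close> relating the pair refines
    \<open>\<beta>\<close> and has the same number of orbits of blocks.\<close>
  have "\<sigma> = \<beta>" using refines_balanced_rank[OF \<sigma>(1) \<beta>(1)] \<sigma> \<beta> pq by auto
  then have "refines \<beta> \<gamma>" using \<sigma>(3)[OF \<gamma>(1) _ \<gamma>(3)] refines_trans[OF \<alpha>(2) \<gamma>(2)] by simp
  moreover have "refines \<gamma> \<upsilon>" if "\<upsilon> \<in> balanced" "refines \<alpha> \<upsilon>" "refines \<beta> \<upsilon>" for \<upsilon>
    using \<gamma>(5)[OF that(1,2)] that(3) pq(1) unfolding refines_def by blast
  ultimately show ?thesis using \<gamma> by blast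
qed

section \<open>Coatoms with labelled blocks\<close>

definition equivariant :: "('g \<times> nat \<Rightarrow> 'g) \<Rightarrow> bool" where
  "equivariant f \<longleftrightarrow> (\<forall>p\<in>X. f p \<in> carrier G) \<and> (\<forall>g\<in>carrier G. \<forall>p\<in>X. f (act g p) = g \<otimes> f p)"

definition const_on :: "('g \<times> nat \<Rightarrow> 'g) \<Rightarrow> ('g \<times> nat) set set \<Rightarrow> bool" where
  "const_on f \<pi> \<longleftrightarrow> (\<forall>p q. rel \<pi> p q \<longrightarrow> f p = f q)"

text \<open>The group permutes the fibres of an equivariant map to \<open>G\<close> simply
  transitively, so they form one orbit of \<open>|G|\<close> blocks, a coatom once the top element
  is added.\<close>

lemma kernel_partition:
  assumes f: "equivariant f"
  shows "\<exists>\<kappa>\<in>balanced. nblocks \<kappa> = 1 \<and> (\<forall>p q. rel \<kappa> p q \<longleftrightarrow> p \<in> X \<and> q \<in> X \<and> f p = f q)"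
proof -
  define F where "F g = {p \<in> X. f p = g}" for g
  let ?\<kappa> = "F ` carrier G"
  have fc: "f p \<in> carrier G" if "p \<in> X" for p using f that by (simp add: equivariant_def)
  have fa: "f (act g p) = g \<otimes> f p" if "g \<in> carrier G" "p \<in> X" for g p using f that by (simp add: equivariant_def)
  have ne: "F g \<noteq> {}" if g: "g \<in> carrier G" for g
  proof -
    let ?p = "act (g \<otimes> inv (f (\<one>, 1))) (\<one>, 1)"
    have "?p \<in> X" using g fc[OF X_nonempty] X_nonempty by simp
    moreover have "f ?p = g" using g fc[OF X_nonempty] X_nonempty by (simp add: fa m_assoc)
    ultimately show ?thesis unfolding F_def by blast
  qed
  have actF: "act h ` F g = F (h \<otimes> g)" if h: "h \<in> carrier G" and g: "g \<in> carrier G" for h g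
  proof
    show "act h ` F g \<subseteq> F (h \<otimes> g)" using h fa by (auto simp: F_def)
    show "F (h \<otimes> g) \<subseteq> act h ` F g"
    proof
      fix p assume p: "p \<in> F (h \<otimes> g)"
      then have pX: "p \<in> X" "f p = h \<otimes> g" by (auto simp: F_def)
      then have "f (act (inv h) p) = g" using h g by (simp add: fa m_assoc[symmetric])
      then have "act (inv h) p \<in> F g" using pX h by (simp add: F_def)
      moreover have "p = act h (act (inv h) p)" using pX h by simp
      ultimately show "p \<in> act h ` F g" by blast
    qed
  qed
  have Finj: "g = h" if "F g = F h" "g \<in> carrier G" for g h
    using ne[OF that(2)] that(1) by (auto simp: F_def)
  have part: "partition_on X ?\<kappa>"
    by (rule partition_onI) (use fc ne in \<open>auto simp: F_def disjnt_def\<close>)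
  have bal: "?\<kappa> \<in> balanced"
    unfolding balanced_def
  proof (intro CollectI conjI part ballI impI)
    fix g K assume g: "g \<in> carrier G" and "K \<in> ?\<kappa>"
    then obtain h where h: "h \<in> carrier G" "K = F h" by blast
    show "act g ` K \<in> ?\<kappa>" using actF g h by auto
    assume "g \<noteq> \<one>"
    then show "act g ` K \<noteq> K" using actF[OF g h(1)] h Finj[of "g \<otimes> h" h] g by (metis m_closed r_cancel_one)
  qed
  have "card ?\<kappa> = Coset.order G"
    unfolding Coset.order_def using Finj by (intro card_image) (auto simp: inj_on_def)
  then have "nblocks ?\<kappa> = 1" using order_pos by (simp add: nblocks_def)
  moreover have "rel ?\<kappa> p q \<longleftrightarrow> p \<in> X \<and> q \<in> X \<and> f p = f q" for p q
    using fc[of p] fc[of q] by (auto simp: rel_def F_def)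
  ultimately show ?thesis using bal by blast
qed

text \<open>Such maps are counted by a power of \<open>|G|\<close>, which is positive.\<close>

lemma equivariant_exists:
  assumes \<pi>: "\<pi> \<in> balanced"
  shows "\<exists>f. equivariant f \<and> const_on f \<pi>"
proof -
  have "card {\<phi> \<in> X \<rightarrow>\<^sub>E carrier G. (\<forall>g\<in>carrier G. \<forall>p\<in>X. \<phi> (act g p) = g \<otimes> \<phi> p) \<and> (\<forall>p q. rel \<pi> p q \<longrightarrow> \<phi> p = \<phi> q)}
    = card (carrier G) ^ nblocks \<pi>"
    by (rule card_equivariant_const[OF \<pi> finG]) (auto simp: m_assoc)
  also have "\<dots> > 0" using order_pos by (simp add: Coset.order_def)
  finally have "{\<phi> \<in> X \<rightarrow>\<^sub>E carrier G. (\<forall>g\<in>carrier G. \<forall>p\<in>X. \<phi> (act g p) = g \<otimes> \<phi> p) \<and> (\<forall>p q. rel \<pi> p q \<longrightarrow> \<phi> p = \<phi> q)} \<noteq> {}"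
    by (metis card.empty less_numeral_extra(3))
  then show ?thesis unfolding equivariant_def const_on_def by blast
qed

text \<open>If the cover \<open>\<alpha>\<close> is not below the coatom of \<open>f\<close>,
  changing the labels on one orbit of blocks gives a coatom above \<open>\<alpha>\<close>. The last
  conclusion is the admissibility of the ordering: what lies strictly above \<open>\<alpha>\<close>
  and below the new coatom also lies above a cover of \<open>\<xi>\<close> below the old one, and
  those covers come earlier.\<close>

lemma exchange:
  assumes \<xi>: "\<xi> \<in> balanced" and f: "equivariant f" "const_on f \<xi>"
    and \<alpha>: "\<alpha> \<in> balanced" "refines \<xi> \<alpha>" "nblocks \<alpha> + 1 = nblocks \<xi>" and nf: "\<not> const_on f \<alpha>"
  shows "\<exists>f'. equivariant f' \<and> const_on f' \<alpha> \<and>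
    (\<forall>\<gamma>\<in>balanced. refines \<alpha> \<gamma> \<longrightarrow> \<gamma> \<noteq> \<alpha> \<longrightarrow> const_on f' \<gamma> \<longrightarrow>
      (\<exists>\<beta>\<in>balanced. refines \<xi> \<beta> \<and> nblocks \<beta> + 1 = nblocks \<xi> \<and> const_on f \<beta> \<and> refines \<beta> \<gamma>))"
proof -
  have fc: "f p \<in> carrier G" if "p \<in> X" for p using f(1) that by (simp add: equivariant_def)
  have fa: "f (act g p) = g \<otimes> f p" if "g \<in> carrier G" "p \<in> X" for g p using f(1) that by (simp add: equivariant_def)
  obtain p q where pq: "rel \<alpha> p q" "f p \<noteq> f q" using nf unfolding const_on_def by blast
  have pqX: "p \<in> X" "q \<in> X" using rel_X[OF \<alpha>(1) pq(1)] by auto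
  have npq: "\<not> rel \<xi> p q" using f(2) pq(2) unfolding const_on_def by blast
  obtain \<sigma> where \<sigma>: "\<sigma> \<in> balanced" "nblocks \<sigma> + 1 = nblocks \<xi>"
    "\<And>\<rho>. \<rho> \<in> balanced \<Longrightarrow> refines \<xi> \<rho> \<Longrightarrow> rel \<rho> p q \<Longrightarrow> refines \<sigma> \<rho>"
    using join_pair'[OF \<xi> \<alpha>(1,2) pq(1) npq] by blast
  have "\<sigma> = \<alpha>" using refines_balanced_rank[OF \<sigma>(1) \<alpha>(1)] \<sigma> \<alpha> pq by auto
  note least = \<sigma>(3)[unfolded this]
  \<comment> \<open>The union of the translates of the \<open>\<xi>\<close>-block of
    \<open>q\<close>, the part on which the labels are changed.\<close>
  define Z where "Z = {u. \<exists>g\<in>carrier G. rel \<xi> (act g q) u}"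
  have ZX: "u \<in> X" if "u \<in> Z" for u using that rel_X[OF \<xi>] unfolding Z_def by blast
  have qZ: "q \<in> Z" unfolding Z_def using rel_refl[OF \<xi> pqX(2)] pqX(2) by (intro CollectI bexI[of _ \<one>]) simp_all
  have Z_rel: "v \<in> Z" if "u \<in> Z" "rel \<xi> u v" for u v
    using that rel_trans[OF \<xi>] unfolding Z_def by blast
  have Z_act: "act h u \<in> Z" if h: "h \<in> carrier G" and u: "u \<in> Z" for h u
  proof -
    obtain g where g: "g \<in> carrier G" "rel \<xi> (act g q) u" using u by (auto simp: Z_def)
    have "rel \<xi> (act (h \<otimes> g) q) (act h u)" using rel_act[OF \<xi> h g(2)] h g pqX by (simp add: act_mult)
    then show ?thesis using h g by (auto simp: Z_def)
  qed
  have Z_act_iff: "act h u \<in> Z \<longleftrightarrow> u \<in> Z" if h: "h \<in> carrier G" and u: "u \<in> X" for h u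
    using Z_act[OF h, of u] Z_act[of "inv h" "act h u"] h u by auto
  have pZ: "p \<notin> Z"
  proof
    assume "p \<in> Z"
    then obtain g where g: "g \<in> carrier G" "rel \<xi> (act g q) p" by (auto simp: Z_def)
    then have "rel \<alpha> (act g q) p" using \<alpha>(2) unfolding refines_def by blast
    then have "rel \<alpha> q (act g q)" using rel_trans[OF \<alpha>(1)] rel_sym pq(1) by blast
    then have "g = \<one>" using rel_free[OF \<alpha>(1) g(1)] by blast
    then show False using g(2) npq rel_sym pqX by auto
  qed
  \<comment> \<open>Right multiplication commutes with the left action, so equivariance is kept; the
    factor is chosen to give \<open>q\<close> the label of \<open>p\<close>.\<close>
  define f' where "f' u = (if u \<in> Z then f u \<otimes> inv (f q) \<otimes> f p else f u)" for u
  have eq': "equivariant f'"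
    unfolding equivariant_def f'_def using fc pqX by (simp add: fa Z_act_iff m_assoc)
  obtain \<kappa> where \<kappa>: "\<kappa> \<in> balanced" "\<And>u v. rel \<kappa> u v \<longleftrightarrow> u \<in> X \<and> v \<in> X \<and> f' u = f' v"
    using kernel_partition[OF eq'] by blast
  have "f' u = f' v" if r: "rel \<xi> u v" for u v
  proof -
    have "u \<in> Z \<longleftrightarrow> v \<in> Z" using Z_rel[OF _ r] Z_rel[OF _ rel_sym[OF r]] by blast
    moreover have "f u = f v" using f(2) r unfolding const_on_def by blast
    ultimately show ?thesis by (simp add: f'_def)
  qed
  then have "refines \<xi> \<kappa>" using rel_X[OF \<xi>] unfolding refines_def \<kappa>(2) by blast
  moreover have "f' p = f' q" using pZ qZ fc pqX by (simp add: f'_def)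
  then have "rel \<kappa> p q" using \<kappa>(2) pqX by simp
  ultimately have "refines \<alpha> \<kappa>" using least[OF \<kappa>(1)] by blast
  then have const': "const_on f' \<alpha>" unfolding refines_def const_on_def \<kappa>(2) by blast
  have ex: "\<exists>\<beta>\<in>balanced. refines \<xi> \<beta> \<and> nblocks \<beta> + 1 = nblocks \<xi> \<and> const_on f \<beta> \<and> refines \<beta> \<gamma>"
    if \<gamma>: "\<gamma> \<in> balanced" "refines \<alpha> \<gamma>" "\<gamma> \<noteq> \<alpha>" "const_on f' \<gamma>" for \<gamma>
  proof -
    obtain u v where uv: "rel \<gamma> u v" "\<not> rel \<alpha> u v"
      using refines_neq_pair[OF \<alpha>(1) \<gamma>(1,2)] \<gamma>(3) by metis
    \<comment> \<open>\<open>\<alpha>\<close> relates \<open>g q\<close> to \<open>g p\<close>, and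
      \<open>p\<close> is outside \<open>Z\<close>. Hence every pair can be moved within
      \<open>\<alpha>\<close>-classes to points where \<open>f'\<close> and \<open>f\<close>
      agree.\<close>
    have out: "\<exists>w. rel \<alpha> u w \<and> w \<notin> Z" if u: "u \<in> X" for u
    proof (cases "u \<in> Z")
      case False
      then show ?thesis using rel_refl[OF \<alpha>(1) u] by blast
    next
      case True
      then obtain g where g: "g \<in> carrier G" "rel \<xi> (act g q) u" by (auto simp: Z_def)
      then have "rel \<alpha> u (act g q)" using \<alpha>(2) rel_sym unfolding refines_def by blast
      moreover have "rel \<alpha> (act g q) (act g p)" using rel_act[OF \<alpha>(1) g(1) rel_sym[OF pq(1)]] .
      ultimately have "rel \<alpha> u (act g p)" using rel_trans[OF \<alpha>(1)] by blast
      moreover have "act g p \<notin> Z" using pZ Z_act_iff[OF g(1) pqX(1)] by simp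
      ultimately show ?thesis by blast
    qed
    have uvX: "u \<in> X" "v \<in> X" using rel_X[OF \<gamma>(1) uv(1)] by auto
    obtain u' v' where u': "rel \<alpha> u u'" "u' \<notin> Z" and v': "rel \<alpha> v v'" "v' \<notin> Z"
      using out[OF uvX(1)] out[OF uvX(2)] by blast
    have r\<gamma>: "rel \<gamma> u' v'"
    proof -
      have "rel \<gamma> u u'" "rel \<gamma> v v'" using u' v' \<gamma>(2) unfolding refines_def by blast+
      then show ?thesis using uv(1) rel_trans[OF \<gamma>(1)] rel_sym by blast
    qed
    have n\<alpha>: "\<not> rel \<alpha> u' v'"
      using u'(1) v'(1) uv(2) rel_trans[OF \<alpha>(1)] rel_sym by blast
    then have n\<xi>: "\<not> rel \<xi> u' v'" using \<alpha>(2) unfolding refines_def by blast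
    have "f' u' = f' v'" using \<gamma>(4) r\<gamma> unfolding const_on_def by blast
    then have fuv: "f u' = f v'" using u'(2) v'(2) by (simp add: f'_def)
    obtain \<kappa>0 where \<kappa>0: "\<kappa>0 \<in> balanced" "\<And>u v. rel \<kappa>0 u v \<longleftrightarrow> u \<in> X \<and> v \<in> X \<and> f u = f v"
      using kernel_partition[OF f(1)] by blast
    have "refines \<xi> \<kappa>0" using f(2) rel_X[OF \<xi>] unfolding refines_def const_on_def \<kappa>0(2) by blast
    moreover have "rel \<kappa>0 u' v'" using fuv rel_X[OF \<gamma>(1) r\<gamma>] by (simp add: \<kappa>0(2))
    ultimately obtain \<beta> where \<beta>: "\<beta> \<in> balanced" "refines \<xi> \<beta>" "nblocks \<beta> + 1 = nblocks \<xi>"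
      "\<And>\<rho>. \<rho> \<in> balanced \<Longrightarrow> refines \<xi> \<rho> \<Longrightarrow> rel \<rho> u' v' \<Longrightarrow> refines \<beta> \<rho>"
      using join_pair'[OF \<xi> \<kappa>0(1) _ _ n\<xi>] by blast
    have "refines \<beta> \<kappa>0" using \<beta>(4) \<kappa>0(1) \<open>refines \<xi> \<kappa>0\<close> \<open>rel \<kappa>0 u' v'\<close> by blast
    then have "const_on f \<beta>" unfolding refines_def const_on_def \<kappa>0(2) by blast
    moreover have "refines \<beta> \<gamma>" using \<beta>(4)[OF \<gamma>(1) refines_trans[OF \<alpha>(2) \<gamma>(2)] r\<gamma>] .
    ultimately show ?thesis using \<beta> by blast
  qed
  then show ?thesis using eq' const' by blast
qed

subsection \<open>The poset of balanced partitions with a top element\<close>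

abbreviation P :: "'g dowling gorder" where "P \<equiv> R_poset G n"

text \<open>The top element has no blocks, so the same formula gives it rank \<open>n\<close>, one
  more than the partitions with a single orbit of blocks.\<close>

definition rrank :: "'g dowling \<Rightarrow> nat" where
  "rrank x = n - nblocks (snd x)"

lemma carrier_P: "carrier P = Pair {} ` balanced \<union> {(X, {})}"
proof -
  have act_Xi: "act g ` X = X" if g: "g \<in> carrier G" for g
  proof
    show "act g ` X \<subseteq> X" using g by auto
    show "X \<subseteq> act g ` X"
    proof
      fix p assume "p \<in> X"
      then show "p \<in> act g ` X" using g act_inv(2)[of g p] act_X[of "inv g" p] by (metis imageI inv_closed)
    qed
  qed
  have "carrier P = {(J, \<pi>) \<in> dowling_elements G n. J = {} \<or> J = X}"
    by (simp add: R_poset_def dowling_lattice_def)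
  also have "\<dots> = Pair {} ` balanced \<union> {(X, {})}"
  proof -
    have "({}, \<pi>) \<in> dowling_elements G n \<longleftrightarrow> \<pi> \<in> balanced" for \<pi>
      by (auto simp: dowling_elements_def balanced_def)
    moreover have "(X, \<pi>) \<in> dowling_elements G n \<longleftrightarrow> \<pi> = {}" for \<pi>
      using act_Xi by (auto simp: dowling_elements_def partition_on_empty)
    ultimately show ?thesis by auto
  qed
  finally show ?thesis .
qed

lemma le_P: "le P = dowling_le" and eq_P: "eq P = (=)"
  by (simp_all add: R_poset_def dowling_lattice_def)

lemma le_balanced:
  assumes "\<pi> \<in> balanced" "\<rho> \<in> balanced"
  shows "le P ({}, \<pi>) ({}, \<rho>) \<longleftrightarrow> refines \<pi> \<rho>"
  using block_nonempty[OF assms(1)] by (auto simp: le_P dowling_le_def refines_iff[OF assms])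

lemma le_top: "x \<in> carrier P \<Longrightarrow> le P x (X, {})"
  using block_X by (auto simp: le_P dowling_le_def carrier_P)

lemma not_top_le: "\<not> le P (X, {}) ({}, \<rho>)"
  using X_nonempty by (auto simp: le_P dowling_le_def)

lemma top_neq: "(X, {}) \<noteq> ({}, \<rho>)" "({}, \<rho>) \<noteq> (X, {})"
  using X_nonempty by auto

lemma rrank_simps: "rrank ({}, \<pi>) = n - nblocks \<pi>" "rrank (X, {}) = n"
  by (simp_all add: rrank_def nblocks_def)

abbreviation botP :: "'g dowling" where "botP \<equiv> ({}, singletons)"

lemma lless_P: "lless P x y \<longleftrightarrow> le P x y \<and> x \<noteq> y"
  by (simp add: lless_def eq_P)

lemma carrier_cases:
  assumes "x \<in> carrier P"
  obtains (bal) \<pi> where "x = ({}, \<pi>)" "\<pi> \<in> balanced" | (top) "x = (X, {})"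
  using assms by (auto simp: carrier_P)

sublocale graded_poset P rrank botP
proof
  show "finite (carrier P)" using finite_balanced by (simp add: carrier_P)
  show "eq P = (=)" by (rule eq_P)
  show "botP \<in> carrier P" using singletons_balanced by (simp add: carrier_P)
  show "rrank botP = 0" by (simp add: rrank_simps nblocks_singletons)
  fix x y z
  assume x: "x \<in> carrier P"
  show "le P x x" using x le_balanced refines_refl le_top[OF x] by (auto elim!: carrier_cases)
  show "le P botP x"
    using x le_balanced[OF singletons_balanced] singletons_refines le_top[of botP] singletons_balanced
    by (auto elim!: carrier_cases simp: carrier_P)
  assume y: "y \<in> carrier P"
  show "rrank x < rrank y" if l: "lless P x y"
    using x
  proof (cases rule: carrier_cases)
    case (bal \<pi>)
    show ?thesis
      using y
    proof (cases rule: carrier_cases)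
      case (bal \<rho>)
      then show ?thesis
        using \<open>x = ({}, \<pi>)\<close> \<open>\<pi> \<in> balanced\<close> l refines_neq_nblocks[of \<pi> \<rho>] nblocks_le_n[of \<pi>]
        by (auto simp: lless_P le_balanced rrank_simps)
    next
      case top
      then show ?thesis using bal nblocks_pos[of \<pi>] n_pos by (simp add: rrank_simps)
    qed
  next
    case top
    then show ?thesis using l y not_top_le by (auto elim!: carrier_cases simp: lless_P)
  qed
  show "\<exists>a\<in>carrier P. lless P x a \<and> rrank a = rrank x + 1 \<and> le P a y" if l: "lless P x y"
    using x
  proof (cases rule: carrier_cases)
    case x: (bal \<pi>)
    note np = nblocks_pos[OF x(2)] nblocks_le_n[OF x(2)]
    have step: ?thesis if \<sigma>: "\<sigma> \<in> balanced" "refines \<pi> \<sigma>" "nblocks \<sigma> + 1 = nblocks \<pi>" "le P ({}, \<sigma>) y" for \<sigma>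
      using \<sigma> x np by (intro bexI[of _ "({}, \<sigma>)"]) (auto simp: carrier_P lless_P le_balanced rrank_simps)
    show ?thesis
      using y
    proof (cases rule: carrier_cases)
      case y: (bal \<rho>)
      have "refines \<pi> \<rho>" "\<pi> \<noteq> \<rho>" using l x y by (auto simp: lless_P le_balanced)
      then obtain p q where "rel \<rho> p q" "\<not> rel \<pi> p q" using refines_neq_pair[OF x(2) y(2)] by blast
      then obtain \<sigma> where "\<sigma> \<in> balanced" "refines \<pi> \<sigma>" "nblocks \<sigma> + 1 = nblocks \<pi>" "refines \<sigma> \<rho>"
        using join_pair'[OF x(2) y(2) \<open>refines \<pi> \<rho>\<close>] \<open>refines \<pi> \<rho>\<close> y(2) by blast
      then show ?thesis using step[of \<sigma>] y by (simp add: le_balanced)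
    next
      case top
      show ?thesis
      \<comment> \<open>With one orbit of blocks left the top itself is the cover; otherwise two
        orbits of blocks can be merged.\<close>
      proof (cases "nblocks \<pi> = 1")
        case True
        then show ?thesis
          using top x np n_pos le_top[of "({}, \<pi>)"] le_top[of "(X, {})"] top_neq
          by (intro bexI[of _ "(X, {})"]) (auto simp: carrier_P lless_P rrank_simps)
      next
        case False
        obtain K where K: "K \<in> \<pi>" using block_exists[OF x(2) X_nonempty] by blast
        have "card (orb K) < card \<pi>"
          using False np order_pos card_orb[OF x(2) K] card_blocks[OF x(2)] by simp
        then have "\<not> \<pi> \<subseteq> orb K" using card_mono[of "orb K" \<pi>] finG by (auto simp: orb_def)
        then obtain K' where K': "K' \<in> \<pi>" "K' \<notin> orb K" by blast
        obtain p q where "p \<in> K" "q \<in> K'" using block_nonempty[OF x(2)] K K' by blast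
        then obtain \<sigma> where \<sigma>: "\<sigma> \<in> balanced" "refines \<pi> \<sigma>" "card \<sigma> + Coset.order G = card \<pi>"
          using merge_blocks[OF x(2) K K'] by blast
        have "Coset.order G * (nblocks \<sigma> + 1) = Coset.order G * nblocks \<pi>"
          using \<sigma> card_blocks x(2) by simp
        then have "nblocks \<sigma> + 1 = nblocks \<pi>" using order_pos by (metis mult_cancel1 not_gr0)
        then show ?thesis using step[OF \<sigma>(1,2)] top le_top[of "({}, \<sigma>)"] \<sigma>(1) by (simp add: carrier_P)
      qed
    qed
  next
    case top
    then show ?thesis using l y not_top_le by (auto elim!: carrier_cases simp: lless_P)
  qed
  assume z: "z \<in> carrier P" "le P x y" "le P y z"
  show "le P x z"
    using z(1)
  proof (cases rule: carrier_cases)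
    case (bal \<sigma>)
    then obtain \<rho> where \<rho>: "y = ({}, \<rho>)" "\<rho> \<in> balanced"
      using y z not_top_le by (auto elim!: carrier_cases)
    then obtain \<pi> where "x = ({}, \<pi>)" "\<pi> \<in> balanced"
      using x z not_top_le by (auto elim!: carrier_cases)
    then show ?thesis using z bal \<rho> refines_trans by (auto simp: le_balanced)
  next
    case top
    then show ?thesis using x le_top by simp
  qed
qed

end

text \<open>Brings the interval into the form treated by \<open>acyclic_filter\<close>, with base
  \<open>bot\<close> and all atoms below \<open>y\<close>: by \<open>cover\<close> every element of
  the interval lies above an atom.\<close>

lemma (in graded_poset) open_interval_filter:
  assumes y: "y \<in> carrier P"
  shows "open_interval P bot y = filter_above {p \<in> carrier P. lless P p y}
    {c \<in> {p \<in> carrier P. lless P p y}. lless P bot c \<and> rk c = rk bot + 1}"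
proof (intro subset_antisym subsetI)
  fix z assume "z \<in> open_interval P bot y"
  then have z: "z \<in> carrier P" "lless P bot z" "lless P z y" by (auto simp: open_interval_def)
  obtain a where a: "a \<in> carrier P" "lless P bot a" "rk a = rk bot + 1" "le P a z"
    using cover[OF bot(1) z(1,2)] by blast
  have "lless P a y" using le_lless_trans[OF a(1) z(1) y a(4) z(3)] .
  then show "z \<in> filter_above {p \<in> carrier P. lless P p y}
    {c \<in> {p \<in> carrier P. lless P p y}. lless P bot c \<and> rk c = rk bot + 1}"
    using a z by (auto simp: filter_above_def)
next
  fix z assume "z \<in> filter_above {p \<in> carrier P. lless P p y}
    {c \<in> {p \<in> carrier P. lless P p y}. lless P bot c \<and> rk c = rk bot + 1}"
  then obtain c where c: "z \<in> carrier P" "lless P z y" "c \<in> carrier P" "lless P bot c" "le P c z"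
    by (auto simp: filter_above_def)
  then have "lless P bot z" using lless_trans[OF bot(1) c(3,1)] by (auto simp: le_iff)
  then show "z \<in> open_interval P bot y" using c by (simp add: open_interval_def)
qed

section \<open>Acyclicity of the lower intervals\<close>

context dowling
begin

lemma lless_balanced:
  "\<pi> \<in> balanced \<Longrightarrow> \<rho> \<in> balanced \<Longrightarrow> lless P ({}, \<pi>) ({}, \<rho>) \<longleftrightarrow> refines \<pi> \<rho> \<and> \<pi> \<noteq> \<rho>"
  by (simp add: lless_P le_balanced)

lemma cover_iff:
  assumes "\<pi> \<in> balanced" "\<rho> \<in> balanced"
  shows "lless P ({}, \<pi>) ({}, \<rho>) \<and> rrank ({}, \<rho>) = rrank ({}, \<pi>) + 1 \<longleftrightarrow> refines \<pi> \<rho> \<and> nblocks \<rho> + 1 = nblocks \<pi>"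
  using assms nblocks_le_n[of \<pi>] nblocks_le_n[of \<rho>] nblocks_pos[of \<pi>]
  by (auto simp: lless_balanced rrank_simps)

definition below :: "'g dowling \<Rightarrow> 'g dowling set" where
  "below y = {p \<in> carrier P. lless P p y}"

lemma below_balanced:
  assumes "y \<in> carrier P" "z \<in> below y"
  obtains \<pi> where "z = ({}, \<pi>)" "\<pi> \<in> balanced"
proof -
  have z: "z \<in> carrier P" "lless P z y" using assms by (auto simp: below_def)
  show ?thesis
    using z(1)
  proof (cases rule: carrier_cases)
    case top
    then have "z = y" using antisym[OF z(1) assms(1)] le_top[OF assms(1)] z by (simp add: lless_P)
    then show ?thesis using z(2) by simp
  qed (use that in blast)
qed

lemma below_down:
  assumes "y \<in> carrier P" "({}, \<rho>) \<in> below y" "\<rho> \<in> balanced" "\<pi> \<in> balanced" "refines \<pi> \<rho>"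
  shows "({}, \<pi>) \<in> below y"
  using le_lless_trans[of "({}, \<pi>)" "({}, \<rho>)" y] assms by (auto simp: below_def carrier_P le_balanced)

text \<open>Supplies the hypothesis \<open>join\<close> of \<open>acyclic_filter\<close>, both for
  balanced \<open>y\<close> and for the top.\<close>

lemma join_below:
  assumes y: "y \<in> carrier P" and M: "a \<in> below y" "b \<in> below y" "x \<in> below y" "u \<in> below y"
    and l: "lless P x a" "lless P x b" "rrank a = rrank x + 1" "rrank b = rrank x + 1" "a \<noteq> b"
    and u: "le P a u" "le P b u"
  shows "\<exists>c\<in>below y. lless P a c \<and> lless P b c \<and> rrank c = rrank a + 1 \<and> le P c u"
proof -
  obtain \<alpha> where \<alpha>: "a = ({}, \<alpha>)" "\<alpha> \<in> balanced" by (rule below_balanced[OF y M(1)])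
  obtain \<beta> where \<beta>: "b = ({}, \<beta>)" "\<beta> \<in> balanced" by (rule below_balanced[OF y M(2)])
  obtain \<xi> where \<xi>: "x = ({}, \<xi>)" "\<xi> \<in> balanced" by (rule below_balanced[OF y M(3)])
  obtain \<upsilon> where \<upsilon>: "u = ({}, \<upsilon>)" "\<upsilon> \<in> balanced" by (rule below_balanced[OF y M(4)])
  have \<xi>\<alpha>: "refines \<xi> \<alpha>" "nblocks \<alpha> + 1 = nblocks \<xi>" using l cover_iff[OF \<xi>(2) \<alpha>(2)] \<alpha> \<xi> by auto
  have \<xi>\<beta>: "refines \<xi> \<beta>" "nblocks \<beta> + 1 = nblocks \<xi>" using l cover_iff[OF \<xi>(2) \<beta>(2)] \<beta> \<xi> by auto
  obtain \<gamma> where \<gamma>: "\<gamma> \<in> balanced" "refines \<alpha> \<gamma>" "refines \<beta> \<gamma>" "nblocks \<gamma> + 1 = nblocks \<alpha>" "refines \<gamma> \<upsilon>"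
    using join_covers[OF \<xi>(2) \<alpha>(2) \<xi>\<alpha> \<beta>(2) \<xi>\<beta> _ \<upsilon>(2)] l(5) u \<alpha> \<beta> \<upsilon> by (auto simp: le_balanced)
  have "({}, \<gamma>) \<in> below y" using below_down[OF y _ \<upsilon>(2) \<gamma>(1,5)] M(4) \<upsilon>(1) by simp
  moreover have "lless P a ({}, \<gamma>) \<and> rrank ({}, \<gamma>) = rrank a + 1"
    using cover_iff[OF \<alpha>(2) \<gamma>(1)] \<gamma> \<alpha> by simp
  moreover have "lless P b ({}, \<gamma>)"
    using cover_iff[OF \<beta>(2) \<gamma>(1)] \<gamma> \<beta> \<xi>\<alpha> \<xi>\<beta> by simp
  ultimately show ?thesis using \<gamma> \<upsilon> by (intro bexI[of _ "({}, \<gamma>)"]) (auto simp: le_balanced)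
qed

abbreviation covers_below :: "'g dowling \<Rightarrow> 'g dowling \<Rightarrow> 'g dowling set" where
  "covers_below y x \<equiv> {c \<in> below y. lless P x c \<and> rrank c = rrank x + 1}"

text \<open>Two covers below \<open>\<rho>\<close> have \<open>\<rho>\<close> as a common balanced
  bound, hence a join, so every nonempty set of covers is admissible and \<open>good\<close> asks
  for no more. Below the top element this bound is missing, which is why \<open>good_top\<close> is
  more elaborate.\<close>

lemma acyclic_balanced:
  assumes \<rho>: "\<rho> \<in> balanced" and r: "rrank ({}, \<rho>) \<ge> 2"
  shows "acyclic_below P (open_interval P botP ({}, \<rho>)) (int (rrank ({}, \<rho>)) - 2)"
proof -
  let ?y = "({}, \<rho>)"
  have y: "?y \<in> carrier P" using \<rho> by (simp add: carrier_P)
  have bb: "botP \<in> below ?y"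
    using \<rho> r singletons_balanced singletons_refines[OF \<rho>]
    by (auto simp: below_def carrier_P lless_balanced rrank_simps nblocks_singletons)
  have ne: "covers_below ?y botP \<noteq> {}"
  proof -
    have "lless P botP ?y" using bb by (simp add: below_def)
    then obtain a where a: "a \<in> carrier P" "lless P botP a" "rrank a = rrank botP + 1" "le P a ?y"
      using cover[OF bot(1) y] by blast
    have "a \<noteq> ?y" using a(3) r by (auto simp: rrank_simps nblocks_singletons)
    then have "a \<in> covers_below ?y botP" using a by (simp add: below_def lless_P)
    then show ?thesis by blast
  qed
  have "acyclic_below P (filter_above (below ?y) (covers_below ?y botP)) (int (rrank ?y) - int (rrank botP) - 2)"
  proof (rule acyclic_filter[where good = "\<lambda>x A. x \<in> below ?y \<and> A \<subseteq> covers_below ?y x \<and> A \<noteq> {}"])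
    show "below ?y \<subseteq> carrier P" by (auto simp: below_def)
    show "botP \<in> below ?y \<and> covers_below ?y botP \<subseteq> covers_below ?y botP \<and> covers_below ?y botP \<noteq> {}"
      using bb ne by simp
    fix x A assume g: "x \<in> below ?y \<and> A \<subseteq> covers_below ?y x \<and> A \<noteq> {}" and "rrank x + 2 \<le> rrank ?y"
    show "(\<exists>a. A = {a}) \<or> (\<exists>a\<in>A. (x \<in> below ?y \<and> A - {a} \<subseteq> covers_below ?y x \<and> A - {a} \<noteq> {}) \<and>
      (rrank a + 2 \<le> rrank ?y \<longrightarrow> a \<in> below ?y \<and>
        {c \<in> below ?y. lless P a c \<and> rrank c = rrank a + 1 \<and> (\<exists>b\<in>A - {a}. lless P b c)} \<subseteq> covers_below ?y a \<and>
        {c \<in> below ?y. lless P a c \<and> rrank c = rrank a + 1 \<and> (\<exists>b\<in>A - {a}. lless P b c)} \<noteq> {}))"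
    proof (cases "\<exists>a. A = {a}")
      case False
      obtain a where a: "a \<in> A" using g by blast
      have A1: "A - {a} \<noteq> {}" using False a by blast
      then obtain b where b: "b \<in> A" "b \<noteq> a" by blast
      have aM: "a \<in> below ?y" "lless P x a" "rrank a = rrank x + 1" using a g by auto
      have bM: "b \<in> below ?y" "lless P x b" "rrank b = rrank x + 1" using b g by auto
      obtain \<alpha> where \<alpha>: "a = ({}, \<alpha>)" "\<alpha> \<in> balanced" by (rule below_balanced[OF y aM(1)])
      obtain \<beta> where \<beta>: "b = ({}, \<beta>)" "\<beta> \<in> balanced" by (rule below_balanced[OF y bM(1)])
      obtain \<xi> where \<xi>: "x = ({}, \<xi>)" "\<xi> \<in> balanced" using g by (auto elim: below_balanced[OF y])
      have \<xi>\<alpha>: "refines \<xi> \<alpha>" "nblocks \<alpha> + 1 = nblocks \<xi>" using aM cover_iff[OF \<xi>(2) \<alpha>(2)] \<alpha> \<xi> by auto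
      have \<xi>\<beta>: "refines \<xi> \<beta>" "nblocks \<beta> + 1 = nblocks \<xi>" using bM cover_iff[OF \<xi>(2) \<beta>(2)] \<beta> \<xi> by auto
      have "refines \<alpha> \<rho>" "refines \<beta> \<rho>" using aM bM \<alpha> \<beta> \<rho> by (auto simp: below_def lless_balanced)
      then obtain \<gamma> where \<gamma>: "\<gamma> \<in> balanced" "refines \<alpha> \<gamma>" "refines \<beta> \<gamma>" "nblocks \<gamma> + 1 = nblocks \<alpha>" "refines \<gamma> \<rho>"
        using join_covers[OF \<xi>(2) \<alpha>(2) \<xi>\<alpha> \<beta>(2) \<xi>\<beta> _ \<rho>] b \<alpha> \<beta> \<rho> by blast
      have "{c \<in> below ?y. lless P a c \<and> rrank c = rrank a + 1 \<and> (\<exists>b\<in>A - {a}. lless P b c)} \<noteq> {}"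
        if "rrank a + 2 \<le> rrank ?y"
      proof -
        have c: "lless P a ({}, \<gamma>) \<and> rrank ({}, \<gamma>) = rrank a + 1"
          using cover_iff[OF \<alpha>(2) \<gamma>(1)] \<gamma> \<alpha> by simp
        have "lless P b ({}, \<gamma>)"
          using cover_iff[OF \<beta>(2) \<gamma>(1)] \<gamma> \<beta> \<xi>\<alpha> \<xi>\<beta> by simp
        \<comment> \<open>The assumed gap of two ranks between \<open>a\<close> and
          \<open>\<rho>\<close> keeps the join inside the open interval.\<close>
        moreover have "\<gamma> \<noteq> \<rho>" using c that by auto
        then have "({}, \<gamma>) \<in> below ?y" using \<gamma> \<rho> by (simp add: below_def carrier_P lless_balanced)
        ultimately show ?thesis using c b by blast
      qed
      then show ?thesis using a A1 g aM(1) by (intro disjI2 bexI[of _ a]) auto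
    qed simp
  qed (use join_below[OF y] in auto)
  then show ?thesis
    unfolding open_interval_filter[OF y] by (simp add: below_def rrank_simps nblocks_singletons)
qed

text \<open>
  An equivariant map \<open>f\<close> to \<open>G\<close> is a coatom with a labelling of its blocks. The admissible orderings of
  the covers of \<open>x\<close> list those below the coatom of some \<open>f\<close> first; the two alternatives say
  whether the segment \<open>A\<close> ends within this first part.
\<close>
definition good_top :: "'g dowling \<Rightarrow> 'g dowling set \<Rightarrow> bool" where
  "good_top x A \<longleftrightarrow> (\<exists>\<xi> f. x = ({}, \<xi>) \<and> \<xi> \<in> balanced \<and> A \<subseteq> covers_below (X, {}) x \<and>
     equivariant f \<and> const_on f \<xi> \<and>
     (A \<noteq> {} \<and> (\<forall>\<alpha>. ({}, \<alpha>) \<in> A \<longrightarrow> const_on f \<alpha>) \<or>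
      (\<forall>\<gamma>\<in>balanced. refines \<xi> \<gamma> \<longrightarrow> nblocks \<gamma> + 1 = nblocks \<xi> \<longrightarrow> const_on f \<gamma> \<longrightarrow> ({}, \<gamma>) \<in> A)))"

lemma below_top: "below (X, {}) = Pair {} ` balanced"
  using le_top top_neq by (auto simp: below_def carrier_P lless_P)

lemma good_topI:
  assumes "\<xi> \<in> balanced" "A \<subseteq> covers_below (X, {}) ({}, \<xi>)" "equivariant f" "const_on f \<xi>"
    and "A \<noteq> {} \<and> (\<forall>\<alpha>. ({}, \<alpha>) \<in> A \<longrightarrow> const_on f \<alpha>) \<or>
      (\<forall>\<gamma>\<in>balanced. refines \<xi> \<gamma> \<longrightarrow> nblocks \<gamma> + 1 = nblocks \<xi> \<longrightarrow> const_on f \<gamma> \<longrightarrow> ({}, \<gamma>) \<in> A)"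
  shows "good_top ({}, \<xi>) A"
  unfolding good_top_def using assms by blast

lemma const_cover_exists:
  assumes \<xi>: "\<xi> \<in> balanced" "nblocks \<xi> \<ge> 2" and f: "equivariant f" "const_on f \<xi>"
  shows "\<exists>\<gamma>\<in>balanced. refines \<xi> \<gamma> \<and> nblocks \<gamma> + 1 = nblocks \<xi> \<and> const_on f \<gamma>"
proof -
  obtain \<kappa> where \<kappa>: "\<kappa> \<in> balanced" "nblocks \<kappa> = 1" "\<And>u v. rel \<kappa> u v \<longleftrightarrow> u \<in> X \<and> v \<in> X \<and> f u = f v"
    using kernel_partition[OF f(1)] by blast
  have r: "refines \<xi> \<kappa>" using f(2) rel_X[OF \<xi>(1)] unfolding refines_def const_on_def \<kappa>(3) by blast
  have "\<xi> \<noteq> \<kappa>" using \<xi>(2) \<kappa>(2) by auto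
  then obtain p q where "rel \<kappa> p q" "\<not> rel \<xi> p q" using refines_neq_pair[OF \<xi>(1) \<kappa>(1) r] by blast
  then obtain \<gamma> where \<gamma>: "\<gamma> \<in> balanced" "refines \<xi> \<gamma>" "nblocks \<gamma> + 1 = nblocks \<xi>" "refines \<gamma> \<kappa>"
    using join_pair'[OF \<xi>(1) \<kappa>(1) r] r \<kappa>(1) by blast
  have "const_on f \<gamma>" using \<gamma>(4) unfolding refines_def const_on_def \<kappa>(3) by blast
  then show ?thesis using \<gamma> by blast
qed

text \<open>Covers below the coatom of \<open>f\<close> have that coatom as a common bound, so their
  join exists and, being least, stays below it.\<close>

lemma join_const:
  assumes \<xi>: "\<xi> \<in> balanced" and \<alpha>: "\<alpha> \<in> balanced" "refines \<xi> \<alpha>" "nblocks \<alpha> + 1 = nblocks \<xi>" "const_on f \<alpha>"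
    and \<beta>: "\<beta> \<in> balanced" "refines \<xi> \<beta>" "nblocks \<beta> + 1 = nblocks \<xi>" "const_on f \<beta>" and ne: "\<alpha> \<noteq> \<beta>"
    and f: "equivariant f"
  shows "\<exists>\<gamma>\<in>balanced. refines \<alpha> \<gamma> \<and> refines \<beta> \<gamma> \<and> nblocks \<gamma> + 1 = nblocks \<alpha>"
    and "\<And>\<gamma>. \<gamma> \<in> balanced \<Longrightarrow> refines \<alpha> \<gamma> \<Longrightarrow> refines \<beta> \<gamma> \<Longrightarrow> nblocks \<gamma> + 1 = nblocks \<alpha> \<Longrightarrow> const_on f \<gamma>"
proof -
  obtain \<kappa> where \<kappa>: "\<kappa> \<in> balanced" "\<And>u v. rel \<kappa> u v \<longleftrightarrow> u \<in> X \<and> v \<in> X \<and> f u = f v"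
    using kernel_partition[OF f] by blast
  have r: "refines \<alpha> \<kappa>" "refines \<beta> \<kappa>"
    using \<alpha>(4) \<beta>(4) rel_X[OF \<alpha>(1)] rel_X[OF \<beta>(1)] unfolding refines_def const_on_def \<kappa>(2) by blast+
  obtain \<gamma>0 where \<gamma>0: "\<gamma>0 \<in> balanced" "refines \<alpha> \<gamma>0" "refines \<beta> \<gamma>0" "nblocks \<gamma>0 + 1 = nblocks \<alpha>"
    "\<And>\<upsilon>. \<upsilon> \<in> balanced \<Longrightarrow> refines \<alpha> \<upsilon> \<Longrightarrow> refines \<beta> \<upsilon> \<Longrightarrow> refines \<gamma>0 \<upsilon>"
    using join_covers[OF \<xi> \<alpha>(1-3) \<beta>(1-3) ne \<kappa>(1) r] by blast
  then show "\<exists>\<gamma>\<in>balanced. refines \<alpha> \<gamma> \<and> refines \<beta> \<gamma> \<and> nblocks \<gamma> + 1 = nblocks \<alpha>" by blast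
  fix \<gamma> assume \<gamma>: "\<gamma> \<in> balanced" "refines \<alpha> \<gamma>" "refines \<beta> \<gamma>" "nblocks \<gamma> + 1 = nblocks \<alpha>"
  have "\<gamma>0 = \<gamma>" using refines_balanced_rank[OF \<gamma>0(1) \<gamma>(1) \<gamma>0(5)[OF \<gamma>(1-3)]] \<gamma> \<gamma>0 by simp
  then show "const_on f \<gamma>" using \<gamma>0(5)[OF \<kappa>(1) r] unfolding refines_def const_on_def \<kappa>(2) by blast
qed

text \<open>If all of \<open>A\<close> lies below the coatom of \<open>f\<close>, joins exist there
  and any element may be taken last, with the same \<open>f\<close> for the next stage. Otherwise an
  element not below that coatom is taken last, and \<open>exchange\<close> provides the map for the
  next stage.\<close>

lemma good_top_step:
  assumes g: "good_top x A" and r: "rrank x + 2 \<le> n"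
  shows "(\<exists>a. A = {a}) \<or> (\<exists>a\<in>A. good_top x (A - {a}) \<and> (rrank a + 2 \<le> n \<longrightarrow>
    good_top a {c \<in> below (X, {}). lless P a c \<and> rrank c = rrank a + 1 \<and> (\<exists>b\<in>A - {a}. lless P b c)}))"
proof -
  obtain \<xi> f where x: "x = ({}, \<xi>)" and \<xi>: "\<xi> \<in> balanced" and A: "A \<subseteq> covers_below (X, {}) x"
    and f: "equivariant f" "const_on f \<xi>"
    and alt: "A \<noteq> {} \<and> (\<forall>\<alpha>. ({}, \<alpha>) \<in> A \<longrightarrow> const_on f \<alpha>) \<or>
      (\<forall>\<gamma>\<in>balanced. refines \<xi> \<gamma> \<longrightarrow> nblocks \<gamma> + 1 = nblocks \<xi> \<longrightarrow> const_on f \<gamma> \<longrightarrow> ({}, \<gamma>) \<in> A)"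
    using g unfolding good_top_def by blast
  have nb: "nblocks \<xi> \<ge> 2" using r nblocks_le_n[OF \<xi>] by (simp add: x rrank_simps)
  have Ael: "\<exists>\<alpha>. a = ({}, \<alpha>) \<and> \<alpha> \<in> balanced \<and> refines \<xi> \<alpha> \<and> nblocks \<alpha> + 1 = nblocks \<xi>" if a: "a \<in> A" for a
  proof -
    obtain \<alpha> where \<alpha>: "a = ({}, \<alpha>)" "\<alpha> \<in> balanced" using a A below_top by auto
    then show ?thesis using a A cover_iff[OF \<xi> \<alpha>(2)] x by auto
  qed
  let ?C = "\<lambda>a. {c \<in> below (X, {}). lless P a c \<and> rrank c = rrank a + 1 \<and> (\<exists>b\<in>A - {a}. lless P b c)}"
  show ?thesis
  proof (cases "A \<noteq> {} \<and> (\<forall>\<alpha>. ({}, \<alpha>) \<in> A \<longrightarrow> const_on f \<alpha>)")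
    case True
    show ?thesis
    proof (cases "\<exists>a. A = {a}")
      case False
      obtain a where a: "a \<in> A" using True by blast
      have A1: "A - {a} \<noteq> {}" using False a by blast
      obtain \<alpha> where \<alpha>: "a = ({}, \<alpha>)" "\<alpha> \<in> balanced" "refines \<xi> \<alpha>" "nblocks \<alpha> + 1 = nblocks \<xi>"
        using Ael[OF a] by blast
      have f\<alpha>: "const_on f \<alpha>" using True a \<alpha>(1) by blast
      have 1: "good_top x (A - {a})"
        unfolding x using A A1 True x by (intro good_topI[OF \<xi> _ f]) auto
      have 2: "good_top a (?C a)"
        unfolding \<alpha>(1)
      proof (rule good_topI[OF \<alpha>(2) _ f(1) f\<alpha>], blast, rule disjI1, rule conjI)
        obtain b where b: "b \<in> A" "b \<noteq> a" using A1 by blast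
        obtain \<beta> where \<beta>: "b = ({}, \<beta>)" "\<beta> \<in> balanced" "refines \<xi> \<beta>" "nblocks \<beta> + 1 = nblocks \<xi>"
          using Ael[OF b(1)] by blast
        have f\<beta>: "const_on f \<beta>" using True b \<beta>(1) by blast
        have ab: "\<alpha> \<noteq> \<beta>" using b \<alpha> \<beta> by auto
        obtain \<gamma> where \<gamma>: "\<gamma> \<in> balanced" "refines \<alpha> \<gamma>" "refines \<beta> \<gamma>" "nblocks \<gamma> + 1 = nblocks \<alpha>"
          using join_const(1)[OF \<xi> \<alpha>(2-4) f\<alpha> \<beta>(2-4) f\<beta> ab f(1)] by blast
        have "lless P b ({}, \<gamma>)" using cover_iff[OF \<beta>(2) \<gamma>(1)] \<gamma> \<beta> \<alpha> by simp
        moreover have "lless P a ({}, \<gamma>) \<and> rrank ({}, \<gamma>) = rrank a + 1"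
          using cover_iff[OF \<alpha>(2) \<gamma>(1)] \<gamma> \<alpha> by simp
        moreover have "({}, \<gamma>) \<in> below (X, {})" using \<gamma> below_top by blast
        ultimately show "?C ({}, \<alpha>) \<noteq> {}" using b \<alpha>(1) by blast
        show "\<forall>\<gamma>. ({}, \<gamma>) \<in> ?C ({}, \<alpha>) \<longrightarrow> const_on f \<gamma>"
        proof (intro allI impI)
          fix \<gamma> assume c: "({}, \<gamma>) \<in> ?C ({}, \<alpha>)"
          then have \<gamma>: "\<gamma> \<in> balanced" using below_top by auto
          obtain b where b: "b \<in> A" "b \<noteq> a" "lless P b ({}, \<gamma>)" using c \<alpha>(1) by blast
          obtain \<beta> where \<beta>: "b = ({}, \<beta>)" "\<beta> \<in> balanced" "refines \<xi> \<beta>" "nblocks \<beta> + 1 = nblocks \<xi>"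
            using Ael[OF b(1)] by blast
          have f\<beta>: "const_on f \<beta>" using True b \<beta>(1) by blast
          have ab: "\<alpha> \<noteq> \<beta>" using b \<alpha> \<beta> by auto
          have "refines \<beta> \<gamma>" using b(3) \<beta> \<gamma> by (simp add: lless_balanced)
          moreover have "refines \<alpha> \<gamma>" "nblocks \<gamma> + 1 = nblocks \<alpha>"
            using c cover_iff[OF \<alpha>(2) \<gamma>] by auto
          ultimately show "const_on f \<gamma>"
            using join_const(2)[OF \<xi> \<alpha>(2-4) f\<alpha> \<beta>(2-4) f\<beta> ab f(1) \<gamma>] by blast
        qed
      qed
      show ?thesis using a 1 2 by blast
    qed simp
  next
    case False
    have all: "({}, \<gamma>) \<in> A" if "\<gamma> \<in> balanced" "refines \<xi> \<gamma>" "nblocks \<gamma> + 1 = nblocks \<xi>" "const_on f \<gamma>" for \<gamma>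
      using alt False that by blast
    have "A \<noteq> {}" using const_cover_exists[OF \<xi> nb f] all by blast
    then obtain \<alpha> where a: "({}, \<alpha>) \<in> A" and nf: "\<not> const_on f \<alpha>" using False by blast
    let ?a = "({}, \<alpha>) :: 'g dowling"
    have \<alpha>: "\<alpha> \<in> balanced" "refines \<xi> \<alpha>" "nblocks \<alpha> + 1 = nblocks \<xi>" using Ael[OF a] by auto
    \<comment> \<open>The removed cover is not below the coatom, so all the covers that are below it
      remain.\<close>
    have 1: "good_top x (A - {?a})"
      unfolding x using A x all nf by (intro good_topI[OF \<xi> _ f]) auto
    obtain f' where f': "equivariant f'" "const_on f' \<alpha>"
      and ex: "\<And>\<gamma>. \<gamma> \<in> balanced \<Longrightarrow> refines \<alpha> \<gamma> \<Longrightarrow> \<gamma> \<noteq> \<alpha> \<Longrightarrow> const_on f' \<gamma> \<Longrightarrow>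
        \<exists>\<beta>\<in>balanced. refines \<xi> \<beta> \<and> nblocks \<beta> + 1 = nblocks \<xi> \<and> const_on f \<beta> \<and> refines \<beta> \<gamma>"
      using exchange[OF \<xi> f \<alpha> nf] by blast
    have 2: "good_top ?a (?C ?a)"
    proof (rule good_topI[OF \<alpha>(1) _ f'], blast, rule disjI2, intro ballI impI)
      fix \<gamma> assume \<gamma>: "\<gamma> \<in> balanced" "refines \<alpha> \<gamma>" "nblocks \<gamma> + 1 = nblocks \<alpha>" "const_on f' \<gamma>"
      then have "\<gamma> \<noteq> \<alpha>" by auto
      then obtain \<beta> where \<beta>: "\<beta> \<in> balanced" "refines \<xi> \<beta>" "nblocks \<beta> + 1 = nblocks \<xi>" "const_on f \<beta>" "refines \<beta> \<gamma>"
        using ex[OF \<gamma>(1,2) _ \<gamma>(4)] by blast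
      have "({}, \<beta>) \<in> A - {?a}" using all[OF \<beta>(1-4)] nf \<beta>(4) by auto
      moreover have "lless P ({}, \<beta>) ({}, \<gamma>)" using cover_iff[OF \<beta>(1) \<gamma>(1)] \<beta> \<gamma> \<alpha> by simp
      moreover have "lless P ?a ({}, \<gamma>) \<and> rrank ({}, \<gamma>) = rrank ?a + 1"
        using cover_iff[OF \<alpha>(1) \<gamma>(1)] \<gamma> by simp
      ultimately show "({}, \<gamma>) \<in> ?C ?a" using \<gamma>(1) below_top by blast
    qed
    show ?thesis using a 1 2 by blast
  qed
qed

lemma acyclic_top: "acyclic_below P (open_interval P botP (X, {})) (int n - 2)"
proof -
  have y: "(X, {}) \<in> carrier P" by (simp add: carrier_P)
  obtain f where f: "equivariant f" "const_on f singletons" using equivariant_exists[OF singletons_balanced] by blast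
  have g: "good_top botP (covers_below (X, {}) botP)"
  \<comment> \<open>All atoms are present, in particular those below the coatom of
    \<open>f\<close>.\<close>
  proof (rule good_topI[OF singletons_balanced order.refl f], rule disjI2, intro ballI impI)
    fix \<gamma> assume \<gamma>: "\<gamma> \<in> balanced" "refines singletons \<gamma>" "nblocks \<gamma> + 1 = nblocks singletons"
    then show "({}, \<gamma>) \<in> covers_below (X, {}) botP"
      using cover_iff[OF singletons_balanced \<gamma>(1)] below_top by auto
  qed
  have "acyclic_below P (filter_above (below (X, {})) (covers_below (X, {}) botP)) (int n - int (rrank botP) - 2)"
  proof (rule acyclic_filter[where good = good_top])
    show "below (X, {}) \<subseteq> carrier P" by (auto simp: below_def)
    show "good_top botP (covers_below (X, {}) botP)" by (rule g)
    show "x \<in> below (X, {}) \<and> A \<subseteq> covers_below (X, {}) x" if "good_top x A" for x A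
      using that below_top unfolding good_top_def by blast
  qed (use join_below[OF y] good_top_step in auto)
  then show ?thesis
    unfolding open_interval_filter[OF y] by (simp add: below_def rrank_simps nblocks_singletons)
qed

lemma acyclic_interval:
  assumes "y \<in> carrier P"
  shows "acyclic_below P (open_interval P botP y) (int (rrank y) - 2)"
  using assms
proof (cases rule: carrier_cases)
  case (bal \<rho>)
  then show ?thesis
    using acyclic_balanced[of \<rho>] acyclic_below_negative[of "int (rrank y) - 2"] by (cases "rrank y \<ge> 2") auto
next
  case top
  then show ?thesis using acyclic_top by (simp add: rrank_simps)
qed

lemma dowling_rank_eq:
  assumes "y \<in> carrier P"
  shows "dowling_rank G n y = of_nat (rrank y)"
  using assms
proof (cases rule: carrier_cases)
  case (bal \<pi>)
  then show ?thesis
    using card_blocks[of \<pi>] nblocks_le_n[of \<pi>] order_pos by (simp add: dowling_rank_def rrank_simps of_nat_diff)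
next
  case top
  then show ?thesis by (simp add: dowling_rank_def rrank_simps)
qed

end

section \<open>The action of the wreath product\<close>

text \<open>Among finitely many permutations two powers coincide. A finite order is what allows a
  step of \<open>x\<close> to be undone by further steps, and it gives every sequence of colours a
  period.\<close>

lemma permutes_finite_order:
  assumes "finite S" "f permutes S"
  obtains N where "N > 0" "f ^^ N = id"
proof -
  have per: "(f ^^ i) permutes S" for i
    using assms(2) by (induction i) (auto simp: permutes_id[unfolded id_def] permutes_compose intro: permutes_compose)
  have "\<not> inj (\<lambda>i. f ^^ i)"
  proof
    assume "inj (\<lambda>i. f ^^ i)"
    then have "infinite (range (\<lambda>i. f ^^ i))" using finite_imageD infinite_UNIV_nat by blast
    moreover have "range (\<lambda>i. f ^^ i) \<subseteq> {p. p permutes S}" using per by blast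
    ultimately show False using finite_permutations[OF assms(1)] finite_subset by blast
  qed
  then obtain i j where ij: "f ^^ i = f ^^ j" "i < j"
    unfolding inj_def by (metis linorder_neqE_nat)
  have "f ^^ (j - i) = id"
  proof
    fix p
    have "(f ^^ i) ((f ^^ (j - i)) p) = (f ^^ i) p"
      using ij by (metis add_diff_inverse_nat comp_apply funpow_add less_imp_not_less)
    then show "(f ^^ (j - i)) p = id p"
      using permutes_inj[OF per[of i]] by (auto dest: injD)
  qed
  then show ?thesis using that[of "j - i"] ij(2) by simp
qed

context dowling
begin

text \<open>By \<open>R_free\<close> a class that is mapped to itself has a trivial translation,
  which is the freeness on blocks.\<close>

lemma balanced_of_rel:
  assumes R: "\<And>p. p \<in> X \<Longrightarrow> R p p" "\<And>p q. R p q \<Longrightarrow> R q p" "\<And>p q r. R p q \<Longrightarrow> R q r \<Longrightarrow> R p r"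
    and R_act: "\<And>g p q. g \<in> carrier G \<Longrightarrow> p \<in> X \<Longrightarrow> q \<in> X \<Longrightarrow> R p q \<Longrightarrow> R (act g p) (act g q)"
    and R_free: "\<And>g p. g \<in> carrier G \<Longrightarrow> p \<in> X \<Longrightarrow> R p (act g p) \<Longrightarrow> g = \<one>"
  shows "\<exists>\<kappa>\<in>balanced. \<forall>p q. rel \<kappa> p q \<longleftrightarrow> p \<in> X \<and> q \<in> X \<and> R p q"
proof -
  define C where "C p = {q \<in> X. R p q}" for p
  let ?\<kappa> = "C ` X"
  have Ceq: "C p = C q" if "R p q" for p q
    using that R(2,3) unfolding C_def by blast
  have actC: "act g ` C p = C (act g p)" if g: "g \<in> carrier G" and p: "p \<in> X" for g p
  proof
    show "act g ` C p \<subseteq> C (act g p)" using R_act[OF g p] g by (auto simp: C_def)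
    show "C (act g p) \<subseteq> act g ` C p"
    proof
      fix q assume q: "q \<in> C (act g p)"
      then have qX: "q \<in> X" by (simp add: C_def)
      have "R p (act (inv g) q)"
        using R_act[of "inv g" "act g p" q] q g p by (auto simp: C_def)
      then have "act (inv g) q \<in> C p" using qX g by (simp add: C_def)
      moreover have "q = act g (act (inv g) q)" using qX g by simp
      ultimately show "q \<in> act g ` C p" by blast
    qed
  qed
  have self: "p \<in> C p" if "p \<in> X" for p using R(1) that by (simp add: C_def)
  have part: "partition_on X ?\<kappa>"
  proof (rule partition_onI)
    show "\<Union>?\<kappa> = X" using self by (auto simp: C_def)
    show "{} \<notin> ?\<kappa>" using self by blast
    fix K L assume "K \<in> ?\<kappa>" "L \<in> ?\<kappa>" "K \<noteq> L"
    then obtain p q where pq: "K = C p" "L = C q" "\<not> R p q" using Ceq by blast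
    then show "disjnt K L" using R(2,3) unfolding disjnt_def C_def by blast
  qed
  have "?\<kappa> \<in> balanced"
    unfolding balanced_def
  proof (intro CollectI conjI part ballI impI)
    fix g K assume g: "g \<in> carrier G" and "K \<in> ?\<kappa>"
    then obtain p where p: "p \<in> X" "K = C p" by blast
    show "act g ` K \<in> ?\<kappa>" using actC[OF g p(1)] g p by auto
    assume "g \<noteq> \<one>"
    then have "\<not> R p (act g p)" using R_free[OF g p(1)] by blast
    then show "act g ` K \<noteq> K" using actC[OF g p(1)] self[of "act g p"] g p by (auto simp: C_def)
  qed
  moreover have "rel ?\<kappa> p q \<longleftrightarrow> p \<in> X \<and> q \<in> X \<and> R p q" for p q
  proof
    assume "rel ?\<kappa> p q"
    then show "p \<in> X \<and> q \<in> X \<and> R p q" unfolding rel_def C_def using R(2,3) by blast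
  next
    assume "p \<in> X \<and> q \<in> X \<and> R p q"
    then show "rel ?\<kappa> p q" unfolding rel_def using self[of p] by (auto simp: C_def)
  qed
  ultimately show ?thesis by blast
qed

section \<open>The wreath product as automorphisms of the poset\<close>

lemma wreath_permutes: "x \<in> wreath G n \<Longrightarrow> x permutes X"
  by (simp add: wreath_def)

lemma wreath_X: "x \<in> wreath G n \<Longrightarrow> x p \<in> X \<longleftrightarrow> p \<in> X"
  by (rule permutes_in_image[OF wreath_permutes])

lemma wreath_act: "x \<in> wreath G n \<Longrightarrow> g \<in> carrier G \<Longrightarrow> p \<in> X \<Longrightarrow> x (act g p) = act g (x p)"
  by (simp add: wreath_def)

lemma wreath_image: "x \<in> wreath G n \<Longrightarrow> x ` X = X"
  using permutes_image wreath_permutes by blast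

abbreviation push :: "('g \<times> nat \<Rightarrow> 'g \<times> nat) \<Rightarrow> ('g \<times> nat) set set \<Rightarrow> ('g \<times> nat) set set" where
  "push x \<pi> \<equiv> (\<lambda>K. x ` K) ` \<pi>"

lemma push_balanced:
  assumes x: "x \<in> wreath G n" and \<pi>: "\<pi> \<in> balanced"
  shows "push x \<pi> \<in> balanced"
proof -
  have inj: "inj x" using permutes_inj[OF wreath_permutes[OF x]] .
  have part: "partition_on X (push x \<pi>)"
  proof (rule partition_onI)
    have "\<Union>\<pi> = X" using \<pi> partition_onD1 by (auto simp: balanced_def)
    moreover have "\<Union>(push x \<pi>) = x ` \<Union>\<pi>" by blast
    ultimately show "\<Union>(push x \<pi>) = X" using wreath_image[OF x] by simp
    show "{} \<notin> push x \<pi>" using block_nonempty[OF \<pi>] by auto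
    fix K L assume "K \<in> push x \<pi>" "L \<in> push x \<pi>" "K \<noteq> L"
    then obtain A B where AB: "K = x ` A" "L = x ` B" "A \<in> \<pi>" "B \<in> \<pi>" "A \<noteq> B" by blast
    then have "A \<inter> B = {}" using block_eq[OF \<pi>] by blast
    then show "disjnt K L" unfolding disjnt_def AB image_Int[OF inj, symmetric] by simp
  qed
  have comm: "act g ` (x ` K) = x ` (act g ` K)" if "g \<in> carrier G" "K \<in> \<pi>" for g K
    using wreath_act[OF x that(1)] block_X[OF \<pi> that(2)] by (force simp: image_iff subset_iff)
  show ?thesis
    unfolding balanced_def
  proof (intro CollectI conjI part ballI impI)
    fix g K assume g: "g \<in> carrier G" and "K \<in> push x \<pi>"
    then obtain A where A: "A \<in> \<pi>" "K = x ` A" by blast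
    show "act g ` K \<in> push x \<pi>" using comm[OF g A(1)] block_act[OF \<pi> g A(1)] A by auto
    assume "g \<noteq> \<one>"
    then have "act g ` A \<noteq> A" using block_free[OF \<pi> g A(1)] by blast
    then show "act g ` K \<noteq> K" using comm[OF g A(1)] A inj_image_eq_iff[OF inj] by simp
  qed
qed

lemma rel_push: "x \<in> wreath G n \<Longrightarrow> rel (push x \<pi>) (x p) (x q) \<longleftrightarrow> rel \<pi> p q"
  by (simp add: rel_def inj_image_mem_iff[OF permutes_inj[OF wreath_permutes]])

lemma refines_push:
  assumes x: "x \<in> wreath G n" and b: "\<pi> \<in> balanced" "\<rho> \<in> balanced"
  shows "refines (push x \<pi>) (push x \<rho>) \<longleftrightarrow> refines \<pi> \<rho>"
proof
  assume *: "refines (push x \<pi>) (push x \<rho>)"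
  show "refines \<pi> \<rho>"
    unfolding refines_def
  proof (intro allI impI)
    fix p q assume "rel \<pi> p q"
    then have "rel (push x \<pi>) (x p) (x q)" by (simp add: rel_push[OF x])
    then have "rel (push x \<rho>) (x p) (x q)" using * unfolding refines_def by blast
    then show "rel \<rho> p q" by (simp add: rel_push[OF x])
  qed
next
  assume *: "refines \<pi> \<rho>"
  show "refines (push x \<pi>) (push x \<rho>)"
    unfolding refines_def
  proof (intro allI impI)
    fix p q assume r: "rel (push x \<pi>) p q"
    have "p \<in> X" "q \<in> X" using rel_X[OF push_balanced[OF x b(1)] r] by auto
    then obtain p' q' where pq: "p = x p'" "q = x q'" using wreath_image[OF x] by blast
    then have "rel \<pi> p' q'" using r by (simp add: rel_push[OF x])
    then have "rel \<rho> p' q'" using * unfolding refines_def by blast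
    then show "rel (push x \<rho>) p q" by (simp add: pq rel_push[OF x])
  qed
qed

lemma inj_image_wreath: "x \<in> wreath G n \<Longrightarrow> inj ((`) x)"
  using inj_image_eq_iff[OF permutes_inj[OF wreath_permutes]] by (simp add: inj_def)

lemma push_inj: "x \<in> wreath G n \<Longrightarrow> push x \<pi> = push x \<rho> \<Longrightarrow> \<pi> = \<rho>"
  by (simp add: inj_image_eq_iff[OF inj_image_wreath])

lemma nblocks_push: "x \<in> wreath G n \<Longrightarrow> nblocks (push x \<pi>) = nblocks \<pi>"
proof -
  assume "x \<in> wreath G n"
  then have "inj_on ((`) x) \<pi>"
    using inj_image_wreath inj_on_subset by blast
  then show ?thesis by (simp add: nblocks_def card_image)
qed

lemma dowling_act_simps:
  "dowling_act x ({}, \<pi>) = ({}, push x \<pi>)"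
  "x \<in> wreath G n \<Longrightarrow> dowling_act x (X, {}) = (X, {})"
  by (simp_all add: dowling_act_def wreath_image)

lemma dowling_automorphism:
  assumes x: "x \<in> wreath G n"
  shows "poset_automorphism P rrank botP (dowling_act x) (dowling_rank G n)"
proof
  have maps: "dowling_act x y \<in> carrier P" if "y \<in> carrier P" for y
    using that by (cases rule: carrier_cases) (auto simp: dowling_act_simps x carrier_P push_balanced)
  have inj: "inj_on (dowling_act x) (carrier P)"
  proof (rule inj_onI)
    fix y z assume y: "y \<in> carrier P" and z: "z \<in> carrier P" and eq: "dowling_act x y = dowling_act x z"
    show "y = z"
      using y
    proof (cases rule: carrier_cases)
      case y: (bal \<pi>)
      show ?thesis
        using z
      proof (cases rule: carrier_cases)
        case z: (bal \<rho>)
        have "push x \<pi> = push x \<rho>" using eq by (simp add: y z dowling_act_simps)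
        then show ?thesis using push_inj[OF x, of \<pi> \<rho>] y z by simp
      next
        case top
        then show ?thesis using eq top_neq by (simp add: y dowling_act_simps x)
      qed
    next
      case y: top
      show ?thesis
        using z by (cases rule: carrier_cases) (use y eq top_neq in \<open>auto simp: dowling_act_simps x\<close>)
    qed
  qed
  show "bij_betw (dowling_act x) (carrier P) (carrier P)"
    unfolding bij_betw_def using inj maps fin by (metis endo_inj_surj image_subsetI)
  show "acyclic_below P (open_interval P botP y) (int (rrank y) - 2)" if "y \<in> carrier P" for y
    by (rule acyclic_interval[OF that])
  show "dowling_rank G n y = of_nat (rrank y)" if "y \<in> carrier P" for y
    by (rule dowling_rank_eq[OF that])
  show "rrank (dowling_act x y) = rrank y" if "y \<in> carrier P" for y
    using that by (cases rule: carrier_cases) (auto simp: dowling_act_simps x rrank_simps nblocks_push)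
  show "le P (dowling_act x y) (dowling_act x z) \<longleftrightarrow> le P y z" if y: "y \<in> carrier P" and z: "z \<in> carrier P" for y z
    using z
  proof (cases rule: carrier_cases)
    case z: (bal \<rho>)
    show ?thesis
      using y by (cases rule: carrier_cases)
        (use z in \<open>auto simp: dowling_act_simps x le_balanced push_balanced refines_push not_top_le\<close>)
  next
    case top
    then show ?thesis using le_top[OF y] le_top[OF maps[OF y]] by (simp add: dowling_act_simps x)
  qed
qed

section \<open>Moebius numbers of fixed partitions and colourings\<close>

definition mobR :: "('g \<times> nat \<Rightarrow> 'g \<times> nat) \<Rightarrow> 'g dowling \<Rightarrow> rat" where
  "mobR x = poset_automorphism.mob P botP (dowling_act x)"

definition Fixp :: "('g \<times> nat \<Rightarrow> 'g \<times> nat) \<Rightarrow> ('g \<times> nat) set set set" where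
  "Fixp x = {\<pi> \<in> balanced. push x \<pi> = \<pi>}"

lemma finite_Fixp: "finite (Fixp x)"
  using finite_balanced by (simp add: Fixp_def)

lemma whitney_trace_R:
  "x \<in> wreath G n \<Longrightarrow> (-1) powi i * vs_trace (whitney_homology P (dowling_rank G n) i)
      (whitney_action P (dowling_rank G n) i (dowling_act x))
    = (\<Sum>y\<in>{y \<in> rank_level P (dowling_rank G n) i. dowling_act x y = y}. mobR x y)"
  unfolding mobR_def by (rule poset_automorphism.whitney_trace_mob[OF dowling_automorphism])

text \<open>Below a balanced partition there are only balanced partitions, so \<open>sum_mob\<close>
  becomes a sum over \<open>Fixp x\<close>.\<close>

lemma sum_mobR_balanced:
  assumes x: "x \<in> wreath G n" and \<rho>: "\<rho> \<in> Fixp x"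
  shows "(\<Sum>\<pi>\<in>{\<pi> \<in> Fixp x. refines \<pi> \<rho>}. mobR x ({}, \<pi>)) = (if \<rho> = singletons then 1 else 0)"
proof -
  have \<rho>b: "\<rho> \<in> balanced" "push x \<rho> = \<rho>" using \<rho> by (auto simp: Fixp_def)
  have "{w \<in> carrier P. dowling_act x w = w \<and> le P w ({}, \<rho>)} = Pair {} ` {\<pi> \<in> Fixp x. refines \<pi> \<rho>}"
    using \<rho>b not_top_le
    by (auto simp: carrier_P Fixp_def dowling_act_simps x le_balanced push_balanced)
  moreover have "(\<Sum>w\<in>{w \<in> carrier P. dowling_act x w = w \<and> le P w ({}, \<rho>)}. mobR x w) = (if \<rho> = singletons then 1 else 0)"
    using poset_automorphism.sum_mob[OF dowling_automorphism[OF x], of "({}, \<rho>)"] \<rho>b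
    by (simp add: mobR_def carrier_P dowling_act_simps)
  moreover have "(\<Sum>w\<in>Pair {} ` {\<pi> \<in> Fixp x. refines \<pi> \<rho>}. mobR x w) = (\<Sum>\<pi>\<in>{\<pi> \<in> Fixp x. refines \<pi> \<rho>}. mobR x ({}, \<pi>))"
    by (subst sum.reindex) (simp_all add: inj_on_def)
  ultimately show ?thesis by simp
qed

text \<open>The Moebius numbers of all fixed elements sum to 0 below the top. This is the origin of
  the subtracted term of the theorem.\<close>

lemma mobR_top:
  assumes x: "x \<in> wreath G n"
  shows "mobR x (X, {}) = - (\<Sum>\<pi>\<in>Fixp x. mobR x ({}, \<pi>))"
proof -
  have T: "(X, {}) \<in> carrier P" by (simp add: carrier_P)
  have "{w \<in> carrier P. dowling_act x w = w \<and> le P w (X, {})} = insert (X, {}) (Pair {} ` Fixp x)"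
    using le_top T by (auto simp: carrier_P Fixp_def dowling_act_simps x)
  moreover have "(\<Sum>w\<in>{w \<in> carrier P. dowling_act x w = w \<and> le P w (X, {})}. mobR x w) = 0"
    using poset_automorphism.sum_mob[OF dowling_automorphism[OF x] T] top_neq
    by (simp add: mobR_def dowling_act_simps x)
  moreover have "(X, {}) \<notin> Pair {} ` Fixp x" using top_neq by auto
  ultimately have "mobR x (X, {}) + (\<Sum>w\<in>Pair {} ` Fixp x. mobR x w) = 0"
    using finite_Fixp[of x] by simp
  then show ?thesis by (simp add: sum.reindex inj_on_def eq_neg_iff_add_eq_0)
qed

lemma funpow_X: "x \<in> wreath G n \<Longrightarrow> (x ^^ k) p \<in> X \<longleftrightarrow> p \<in> X"
  by (induction k) (simp_all add: wreath_X)

lemma funpow_act: "x \<in> wreath G n \<Longrightarrow> g \<in> carrier G \<Longrightarrow> p \<in> X \<Longrightarrow> (x ^^ k) (act g p) = act g ((x ^^ k) p)"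
  by (induction k) (simp_all add: wreath_act funpow_X)

lemma Fixp_rel:
  assumes "x \<in> wreath G n" "\<pi> \<in> Fixp x"
  shows "rel \<pi> (x p) (x q) \<longleftrightarrow> rel \<pi> p q"
  using rel_push[OF assms(1), of \<pi> p q] assms(2) by (simp add: Fixp_def)

lemma Fixp_rel_funpow:
  "x \<in> wreath G n \<Longrightarrow> \<pi> \<in> Fixp x \<Longrightarrow> rel \<pi> ((x ^^ k) p) ((x ^^ k) q) \<longleftrightarrow> rel \<pi> p q"
  by (induction k) (simp_all add: Fixp_rel)

lemma balanced_eqI:
  assumes "\<pi> \<in> balanced" "\<rho> \<in> balanced" "\<And>p q. rel \<pi> p q \<longleftrightarrow> rel \<rho> p q"
  shows "\<pi> = \<rho>"
  using assms by (intro refines_antisym) (auto simp: refines_def)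

lemma Fixp_iff_rel:
  assumes x: "x \<in> wreath G n" and \<pi>: "\<pi> \<in> balanced"
    and inv: "\<And>p q. p \<in> X \<Longrightarrow> q \<in> X \<Longrightarrow> rel \<pi> (x p) (x q) \<longleftrightarrow> rel \<pi> p q"
  shows "\<pi> \<in> Fixp x"
proof -
  have "push x \<pi> = \<pi>"
  proof (rule balanced_eqI[OF push_balanced[OF x \<pi>] \<pi>])
    fix p q
    show "rel (push x \<pi>) p q \<longleftrightarrow> rel \<pi> p q"
    proof (cases "p \<in> X \<and> q \<in> X")
      case True
      then obtain p' q' where pq: "p = x p'" "q = x q'" "p' \<in> X" "q' \<in> X" using wreath_image[OF x] by blast
      then show ?thesis using inv[OF pq(3,4)] by (simp add: rel_push[OF x])
    next
      case False
      then show ?thesis using rel_X[OF \<pi>] rel_X[OF push_balanced[OF x \<pi>]] by blast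
    qed
  qed
  then show ?thesis using \<pi> by (simp add: Fixp_def)
qed

definition separating :: "('g \<times> nat \<Rightarrow> 'g \<times> nat) \<Rightarrow> ('g \<times> nat \<Rightarrow> 'c) \<Rightarrow> bool" where
  "separating x \<phi> \<longleftrightarrow> (\<forall>p\<in>X. \<forall>q\<in>X. (\<forall>k. \<phi> ((x ^^ k) p) = \<phi> ((x ^^ k) q)) \<longrightarrow> p = q)"

text \<open>The power of \<open>card B\<close> counts the equivariant colourings constant on the
  blocks of \<open>\<pi>\<close>, that is, those with \<open>\<pi>\<close> below their kernel
  \<open>\<kappa> \<phi>\<close>. After exchanging the sums, the Moebius numbers below
  \<open>\<kappa> \<phi>\<close> add up to 1 or 0 according to whether this kernel is
  trivial.\<close>

theorem sum_mobR_power: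
  fixes B :: "'c set"
  assumes x: "x \<in> wreath G n" and B: "free_action G B b" and finB: "finite B"
  shows "(\<Sum>\<pi>\<in>Fixp x. mobR x ({}, \<pi>) * of_nat (card B) ^ nblocks \<pi>)
    = of_nat (card {\<phi> \<in> X \<rightarrow>\<^sub>E B. (\<forall>g\<in>carrier G. \<forall>p\<in>X. \<phi> (act g p) = b g (\<phi> p)) \<and> separating x \<phi>})"
proof -
  interpret B: free_action G B b by (rule B)
  let ?\<Phi> = "{\<phi> \<in> X \<rightarrow>\<^sub>E B. \<forall>g\<in>carrier G. \<forall>p\<in>X. \<phi> (act g p) = b g (\<phi> p)}"
  have fin\<Phi>: "finite ?\<Phi>" 
    by (rule finite_subset[of _ "X \<rightarrow>\<^sub>E B"]) (use finite_X finB in \<open>auto intro: finite_PiE\<close>)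
  obtain N where N: "N > 0" "x ^^ N = id"
    by (rule permutes_finite_order[OF finite_X wreath_permutes[OF x]])
  have ex: "\<exists>\<kappa>\<in>Fixp x. (\<forall>p q. rel \<kappa> p q \<longleftrightarrow> p \<in> X \<and> q \<in> X \<and> (\<forall>k. \<phi> ((x ^^ k) p) = \<phi> ((x ^^ k) q)))"
    if \<phi>: "\<phi> \<in> ?\<Phi>" for \<phi>
  proof -
    define R where "R p q \<longleftrightarrow> (\<forall>k. \<phi> ((x ^^ k) p) = \<phi> ((x ^^ k) q))" for p q
    have R_D: "\<phi> ((x ^^ k) p) = \<phi> ((x ^^ k) q)" if "R p q" for p q k using that by (simp add: R_def)
    have R_I: "R p q" if "\<And>k. \<phi> ((x ^^ k) p) = \<phi> ((x ^^ k) q)" for p q using that by (simp add: R_def)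
    have \<phi>B: "\<phi> p \<in> B" if "p \<in> X" for p using \<phi> that by blast
    have \<phi>a: "\<phi> (act g p) = b g (\<phi> p)" if "g \<in> carrier G" "p \<in> X" for g p using \<phi> that by blast
    have R_act: "R (act g p) (act g q)" if "g \<in> carrier G" "p \<in> X" "q \<in> X" "R p q" for g p q
    proof (rule R_I)
      fix k
      show "\<phi> ((x ^^ k) (act g p)) = \<phi> ((x ^^ k) (act g q))"
        using that R_D[OF that(4), of k] by (simp add: funpow_act[OF x] \<phi>a funpow_X[OF x])
    qed
    \<comment> \<open>Freeness of the action on the colours makes the kernel balanced.\<close>
    have R_free: "g = \<one>" if "g \<in> carrier G" "p \<in> X" "R p (act g p)" for g p
    proof -
      have "\<phi> p = b g (\<phi> p)" using R_D[OF that(3), of 0] \<phi>a[OF that(1,2)] by simp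
      then show ?thesis using B.a_free[OF that(1) \<phi>B[OF that(2)]] by simp
    qed
    have R_refl: "R p p" for p by (rule R_I) simp
    have R_sym: "R q p" if "R p q" for p q using R_D[OF that] by (intro R_I) simp
    have R_trans: "R p r" if "R p q" "R q r" for p q r using R_D[OF that(1)] R_D[OF that(2)] by (intro R_I) simp
    have "\<exists>\<kappa>\<in>balanced. \<forall>p q. rel \<kappa> p q \<longleftrightarrow> p \<in> X \<and> q \<in> X \<and> R p q"
      by (rule balanced_of_rel) (erule R_sym R_act R_free R_trans | rule R_refl | assumption)+
    then obtain \<kappa> where \<kappa>: "\<kappa> \<in> balanced" "\<And>p q. rel \<kappa> p q \<longleftrightarrow> p \<in> X \<and> q \<in> X \<and> R p q" by blast
    \<comment> \<open>As \<open>x\<close> has order dividing \<open>N\<close>, a further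
      \<open>N - 1\<close> steps undo one step. This gives the direction from
      \<open>R (x p) (x q)\<close> back to \<open>R p q\<close>.\<close>
    have shift: "(x ^^ (k + N - 1)) (x r) = (x ^^ k) r" for k r
    proof -
      have "(x ^^ (k + N - 1)) (x r) = (x ^^ Suc (k + N - 1)) r" by (simp only: funpow_swap1 funpow.simps o_apply)
      also have "Suc (k + N - 1) = k + N" using N(1) by simp
      also have "(x ^^ (k + N)) r = (x ^^ k) r" by (simp add: funpow_add N(2))
      finally show ?thesis .
    qed
    have "\<kappa> \<in> Fixp x"
    proof (rule Fixp_iff_rel[OF x \<kappa>(1)])
      fix p q assume pq: "p \<in> X" "q \<in> X"
      have "R (x p) (x q) \<longleftrightarrow> R p q"
      proof
        assume r: "R (x p) (x q)"
        show "R p q"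
        proof (rule R_I)
          fix k
          show "\<phi> ((x ^^ k) p) = \<phi> ((x ^^ k) q)" using R_D[OF r, of "k + N - 1"] by (simp only: shift)
        qed
      next
        assume r: "R p q"
        show "R (x p) (x q)"
        proof (rule R_I)
          fix k
          show "\<phi> ((x ^^ k) (x p)) = \<phi> ((x ^^ k) (x q))"
            using R_D[OF r, of "Suc k"] by (simp add: funpow_swap1)
        qed
      qed
      then show "rel \<kappa> (x p) (x q) \<longleftrightarrow> rel \<kappa> p q" using pq by (simp add: \<kappa>(2) wreath_X[OF x])
    qed
    then show ?thesis using \<kappa> unfolding R_def by blast
  qed
  define \<kappa> where "\<kappa> \<phi> = (SOME \<kappa>. \<kappa> \<in> Fixp x \<and>
    (\<forall>p q. rel \<kappa> p q \<longleftrightarrow> p \<in> X \<and> q \<in> X \<and> (\<forall>k. \<phi> ((x ^^ k) p) = \<phi> ((x ^^ k) q))))" for \<phi> :: "'g \<times> nat \<Rightarrow> 'c"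
  have \<kappa>some: "\<kappa> \<phi> \<in> Fixp x \<and>
    (\<forall>p q. rel (\<kappa> \<phi>) p q \<longleftrightarrow> p \<in> X \<and> q \<in> X \<and> (\<forall>k. \<phi> ((x ^^ k) p) = \<phi> ((x ^^ k) q)))"
    if \<phi>: "\<phi> \<in> ?\<Phi>" for \<phi>
    unfolding \<kappa>_def by (rule someI_ex) (use ex[OF \<phi>] in blast)
  have \<kappa>: "\<kappa> \<phi> \<in> Fixp x"
    "rel (\<kappa> \<phi>) p q \<longleftrightarrow> p \<in> X \<and> q \<in> X \<and> (\<forall>k. \<phi> ((x ^^ k) p) = \<phi> ((x ^^ k) q))"
    if \<phi>: "\<phi> \<in> ?\<Phi>" for \<phi> p q
    using \<kappa>some[OF \<phi>] by blast+
  \<comment> \<open>\<open>\<pi>\<close> is fixed by \<open>x\<close>, so constancy of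
    \<open>\<phi>\<close> on its blocks passes to all the functions
    \<open>\<phi> \<circ> x^k\<close>.\<close>
  have const: "refines \<pi> (\<kappa> \<phi>) \<longleftrightarrow> (\<forall>p q. rel \<pi> p q \<longrightarrow> \<phi> p = \<phi> q)" if \<phi>: "\<phi> \<in> ?\<Phi>" and \<pi>: "\<pi> \<in> Fixp x" for \<phi> \<pi>
  proof
    assume r: "refines \<pi> (\<kappa> \<phi>)"
    show "\<forall>p q. rel \<pi> p q \<longrightarrow> \<phi> p = \<phi> q"
    proof (intro allI impI)
      fix p q assume "rel \<pi> p q"
      then have "rel (\<kappa> \<phi>) p q" using r unfolding refines_def by blast
      then have "\<forall>k. \<phi> ((x ^^ k) p) = \<phi> ((x ^^ k) q)" unfolding \<kappa>(2)[OF \<phi>] by blast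
      then show "\<phi> p = \<phi> q" by (metis funpow_0)
    qed
  next
    assume c: "\<forall>p q. rel \<pi> p q \<longrightarrow> \<phi> p = \<phi> q"
    show "refines \<pi> (\<kappa> \<phi>)"
      unfolding refines_def \<kappa>(2)[OF \<phi>]
    proof (intro allI impI)
      fix p q assume r: "rel \<pi> p q"
      have "rel \<pi> ((x ^^ k) p) ((x ^^ k) q)" for k using Fixp_rel_funpow[OF x \<pi>] r by blast
      then show "p \<in> X \<and> q \<in> X \<and> (\<forall>k. \<phi> ((x ^^ k) p) = \<phi> ((x ^^ k) q))"
        using c rel_X[OF _ r] \<pi> unfolding Fixp_def by blast
    qed
  qed
  have sing: "\<kappa> \<phi> = singletons \<longleftrightarrow> separating x \<phi>" if \<phi>: "\<phi> \<in> ?\<Phi>" for \<phi>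
  proof
    assume s: "\<kappa> \<phi> = singletons"
    show "separating x \<phi>"
      using \<kappa>(2)[OF \<phi>] unfolding s rel_singletons separating_def by blast
  next
    assume s: "separating x \<phi>"
    have "\<kappa> \<phi> \<in> balanced" using \<kappa>(1)[OF \<phi>] by (simp add: Fixp_def)
    then show "\<kappa> \<phi> = singletons"
      using s unfolding separating_def
      by (intro balanced_eqI singletons_balanced) (auto simp: \<kappa>(2)[OF \<phi>] rel_singletons)
  qed
  have "(\<Sum>\<pi>\<in>Fixp x. mobR x ({}, \<pi>) * of_nat (card B) ^ nblocks \<pi>)
    = (\<Sum>\<pi>\<in>Fixp x. \<Sum>\<phi>\<in>?\<Phi>. if refines \<pi> (\<kappa> \<phi>) then mobR x ({}, \<pi>) else 0)"
  proof (rule sum.cong[OF refl])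
    fix \<pi> assume \<pi>: "\<pi> \<in> Fixp x"
    then have \<pi>b: "\<pi> \<in> balanced" by (simp add: Fixp_def)
    have "card B ^ nblocks \<pi> = card {\<phi> \<in> X \<rightarrow>\<^sub>E B. (\<forall>g\<in>carrier G. \<forall>p\<in>X. \<phi> (act g p) = b g (\<phi> p)) \<and> (\<forall>p q. rel \<pi> p q \<longrightarrow> \<phi> p = \<phi> q)}"
      by (rule card_equivariant_const[symmetric, OF \<pi>b finB]) (use B.a_closed B.a_one B.a_mult in auto)
    also have "{\<phi> \<in> X \<rightarrow>\<^sub>E B. (\<forall>g\<in>carrier G. \<forall>p\<in>X. \<phi> (act g p) = b g (\<phi> p)) \<and> (\<forall>p q. rel \<pi> p q \<longrightarrow> \<phi> p = \<phi> q)}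
      = {\<phi> \<in> ?\<Phi>. refines \<pi> (\<kappa> \<phi>)}"
      using const[OF _ \<pi>] by blast
    finally have "card B ^ nblocks \<pi> = card {\<phi> \<in> ?\<Phi>. refines \<pi> (\<kappa> \<phi>)}" .
    moreover have "(\<Sum>\<phi>\<in>?\<Phi>. if refines \<pi> (\<kappa> \<phi>) then mobR x ({}, \<pi>) else 0)
      = (\<Sum>\<phi>\<in>{\<phi> \<in> ?\<Phi>. refines \<pi> (\<kappa> \<phi>)}. mobR x ({}, \<pi>))"
      by (rule sum.inter_filter[symmetric, OF fin\<Phi>])
    ultimately show "mobR x ({}, \<pi>) * of_nat (card B) ^ nblocks \<pi> = (\<Sum>\<phi>\<in>?\<Phi>. if refines \<pi> (\<kappa> \<phi>) then mobR x ({}, \<pi>) else 0)"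
      by (simp add: of_nat_power[symmetric] del: of_nat_power)
  qed
  also have "\<dots> = (\<Sum>\<phi>\<in>?\<Phi>. \<Sum>\<pi>\<in>Fixp x. if refines \<pi> (\<kappa> \<phi>) then mobR x ({}, \<pi>) else 0)"
    by (rule sum.swap)
  also have "\<dots> = (\<Sum>\<phi>\<in>?\<Phi>. if separating x \<phi> then 1 else 0)"
  proof (rule sum.cong[OF refl])
    fix \<phi> assume \<phi>: "\<phi> \<in> ?\<Phi>"
    have "(\<Sum>\<pi>\<in>Fixp x. if refines \<pi> (\<kappa> \<phi>) then mobR x ({}, \<pi>) else 0)
      = (\<Sum>\<pi>\<in>{\<pi> \<in> Fixp x. refines \<pi> (\<kappa> \<phi>)}. mobR x ({}, \<pi>))"
      by (rule sum.inter_filter[symmetric, OF finite_Fixp])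
    then show "(\<Sum>\<pi>\<in>Fixp x. if refines \<pi> (\<kappa> \<phi>) then mobR x ({}, \<pi>) else 0) = (if separating x \<phi> then 1 else 0)"
      using sum_mobR_balanced[OF x \<kappa>(1)[OF \<phi>]] sing[OF \<phi>] by simp
  qed
  also have "\<dots> = of_nat (card {\<phi> \<in> ?\<Phi>. separating x \<phi>})"
    by (subst sum.inter_filter[symmetric, OF fin\<Phi>]) simp
  also have "{\<phi> \<in> ?\<Phi>. separating x \<phi>}
    = {\<phi> \<in> X \<rightarrow>\<^sub>E B. (\<forall>g\<in>carrier G. \<forall>p\<in>X. \<phi> (act g p) = b g (\<phi> p)) \<and> separating x \<phi>}" by blast
  finally show ?thesis .
qed

end

section \<open>Moebius inversion over roots of conjugacy classes\<close>

lemma moebius_prime_mult: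
  assumes p: "prime p" "\<not> p dvd d" and d: "squarefree d"
  shows "squarefree (p * d)" "moebius (p * d) = - moebius d"
proof -
  have d0: "d \<noteq> 0" using p(2) by (intro notI) simp
  have cop: "coprime p d" using p prime_imp_coprime by blast
  show sq: "squarefree (p * d)"
    by (rule squarefree_mult_coprime[OF cop squarefree_prime[OF p(1)] d])
  have "prime_factors (p * d) = insert p (prime_factors d)"
    using p(1) d0 by (subst prime_factors_product) (auto simp: prime_prime_factors)
  moreover have "p \<notin> prime_factors d" using p(2) by auto
  ultimately show "moebius (p * d) = - moebius d"
    using sq d by (simp add: moebius_def)
qed

text \<open>For a prime \<open>p\<close> dividing \<open>n\<close>, multiplication by
  \<open>p\<close> pairs the squarefree divisors prime to \<open>p\<close> with the other squarefree
  ones and reverses the sign.\<close>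

lemma sum_moebius_divisors:
  assumes n: "n > 0"
  shows "(\<Sum>d\<in>{d. d dvd n}. moebius d) = (if n = 1 then 1 else 0)"
proof (cases "n = 1")
  case True
  then have "{d. d dvd n} = {1}" by auto
  moreover have "moebius 1 = 1" by (simp add: moebius_def)
  ultimately show ?thesis using True by simp
next
  case False
  then obtain p where p: "prime p" "p dvd n" using prime_factor_nat by blast
  have fin: "finite {d. d dvd n}" using n by simp
  let ?D0 = "{d. d dvd n \<and> squarefree d \<and> \<not> p dvd d}"
  let ?D1 = "{d. d dvd n \<and> squarefree d \<and> p dvd d}"
  have im: "?D1 = (\<lambda>d. p * d) ` ?D0"
  proof (intro subset_antisym subsetI)
    fix d assume d: "d \<in> ?D1"
    then obtain e where e: "d = p * e" by blast
    have "squarefree e" using d e squarefree_multD by blast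
    moreover have "\<not> p dvd e"
    proof
      assume "p dvd e"
      then have "p ^ 2 dvd d" using e by (simp add: power2_eq_square)
      then show False using d p(1) squarefreeD by (metis (mono_tags, lifting) mem_Collect_eq not_prime_unit)
    qed
    moreover have "e dvd n" using d e dvd_mult_right by blast
    ultimately show "d \<in> (\<lambda>d. p * d) ` ?D0" using e by blast
  next
    fix d assume "d \<in> (\<lambda>d. p * d) ` ?D0"
    then obtain e where e: "d = p * e" "e dvd n" "squarefree e" "\<not> p dvd e" by blast
    have "coprime p e" using p e prime_imp_coprime by blast
    then have "p * e dvd n" using p(2) e(2) by (rule divides_mult[rotated 2])
    then show "d \<in> ?D1" using moebius_prime_mult(1)[OF p(1) e(4,3)] e by auto
  qed
  have "(\<Sum>d\<in>{d. d dvd n}. moebius d) = (\<Sum>d\<in>?D0 \<union> ?D1. moebius d)"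
    using fin by (intro sum.mono_neutral_right) (auto simp: moebius_def)
  also have "\<dots> = (\<Sum>d\<in>?D0. moebius d) + (\<Sum>d\<in>?D1. moebius d)"
    using fin by (intro sum.union_disjoint) auto
  also have "(\<Sum>d\<in>?D1. moebius d) = (\<Sum>d\<in>?D0. moebius (p * d))"
    unfolding im using p(1) by (subst sum.reindex) (auto simp: inj_on_def)
  also have "\<dots> = (\<Sum>d\<in>?D0. - moebius d)"
    using moebius_prime_mult(2)[OF p(1)] by (intro sum.cong) auto
  finally show ?thesis using False by (simp add: sum_negf)
qed

context group
begin

lemma class_pow_class_pow:
  assumes "c \<in> conj_classes G"
  shows "class_pow G (class_pow G c d) e = class_pow G c (d * e)"
proof -
  obtain a where "a \<in> carrier G" "c = conj_class G a" using assms by (auto simp: conj_classes_def)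
  then show ?thesis by (simp add: class_pow_conj_class nat_pow_pow)
qed

text \<open>An intermediate variable is determined by its degree, since its class is the
  corresponding power of the class of \<open>w\<close>. Intervals in the order of roots are thus
  divisor lattices, although a class may have several roots of one degree.\<close>

lemma root_vars_between:
  assumes u: "u \<in> cvars G" and w: "w \<in> root_vars G u"
  shows "bij_betw (\<lambda>d. (fst w * d, class_pow G (snd w) d)) {d. d dvd fst u div fst w}
    {v \<in> root_vars G u. w \<in> root_vars G v}"
proof -
  obtain i c where wic: "w = (i, c)" by (cases w)
  obtain N C where uNC: "u = (N, C)" by (cases u)
  have w': "i > 0" "c \<in> conj_classes G" "i dvd N" "C = class_pow G c (N div i)" "N > 0"
    using w by (auto simp: root_vars_def cvars_def wic uNC)
  show ?thesis
    unfolding wic uNC fst_conv snd_conv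
  proof (rule bij_betw_imageI)
    show "inj_on (\<lambda>d. (i * d, class_pow G c d)) {d. d dvd N div i}"
      using w'(1) by (auto simp: inj_on_def)
    show "(\<lambda>d. (i * d, class_pow G c d)) ` {d. d dvd N div i} = {v \<in> root_vars G (N, C). (i, c) \<in> root_vars G v}"
    proof (intro subset_antisym subsetI)
      fix v assume "v \<in> (\<lambda>d. (i * d, class_pow G c d)) ` {d. d dvd N div i}"
      then obtain d where d: "d dvd N div i" "v = (i * d, class_pow G c d)" by blast
      then have N: "N = i * d * (N div i div d)" using w'(3) by (metis dvd_mult_div_cancel mult.assoc)
      have d0: "d > 0" using N w'(5) by (cases d) auto
      have e: "N div (i * d) = N div i div d" by (simp add: div_mult2_eq)
      have "class_pow G (class_pow G c d) (N div (i * d)) = C"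
        unfolding class_pow_class_pow[OF w'(2)] w'(4) e using d(1) by simp
      moreover have "i * d dvd N" using N by (metis dvd_triv_left)
      ultimately show "v \<in> {v \<in> root_vars G (N, C). (i, c) \<in> root_vars G v}"
        using w' d0 class_pow_in_conj_classes[OF w'(2), of d] by (auto simp: d(2) root_vars_def cvars_def)
    next
      fix v assume "v \<in> {v \<in> root_vars G (N, C). (i, c) \<in> root_vars G v}"
      then have v: "fst v > 0" "fst v dvd N" "i dvd fst v" "snd v = class_pow G c (fst v div i)"
        by (auto simp: root_vars_def)
      have "v = (i * (fst v div i), class_pow G c (fst v div i))"
        using v by (simp add: prod_eq_iff)
      moreover have "fst v div i dvd N div i" 
      proof -
        obtain a where a: "fst v = i * a" using v(3) by blast
        obtain b where b: "N = fst v * b" using v(2) by blast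
        show ?thesis using w'(1) by (simp add: a b mult.assoc)
      qed
      ultimately show "v \<in> (\<lambda>d. (i * d, class_pow G c d)) ` {d. d dvd N div i}" by blast
    qed
  qed
qed

lemma root_vars_self: "u \<in> cvars G \<Longrightarrow> u \<in> root_vars G u"
  using class_pow_1[of "snd u"] by (cases u) (auto simp: root_vars_def cvars_def)

lemma root_vars_trans:
  assumes u: "u \<in> cvars G" and v: "v \<in> root_vars G u" and w: "w \<in> root_vars G v"
  shows "w \<in> root_vars G u"
proof -
  obtain i c where wic: "w = (i, c)" by (cases w)
  have v': "fst v dvd fst u" "snd u = class_pow G (snd v) (fst u div fst v)" "fst u > 0" using v by (auto simp: root_vars_def)
  have w': "i > 0" "c \<in> conj_classes G" "i dvd fst v" "snd v = class_pow G c (fst v div i)" "fst v > 0"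
    using w by (auto simp: root_vars_def cvars_def wic)
  have "fst v div i * (fst u div fst v) = fst u div i"
    using v'(1) w'(3,5) by (metis div_mult_swap dvd_div_mult_self dvd_mult_div_cancel mult.commute)
  then have "snd u = class_pow G c (fst u div i)"
    unfolding v'(2) w'(4) class_pow_class_pow[OF w'(2)] by simp
  moreover have "i dvd fst u" using v' w' dvd_trans by blast
  ultimately show ?thesis using w' v' by (auto simp: root_vars_def cvars_def wic)
qed

text \<open>After exchanging the sums, the coefficient of \<open>E w\<close> is a Moebius sum over
  the interval from \<open>w\<close> to \<open>u\<close>, a full set of divisors; it vanishes unless
  \<open>w = u\<close>.\<close>

lemma moebius_inversion:
  fixes E :: "nat \<times> 'a set \<Rightarrow> rat"
  assumes fin: "finite (carrier G)" and u: "u \<in> cvars G"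
  shows "(\<Sum>v\<in>root_vars G u. of_int (moebius (fst u div fst v)) * (\<Sum>w\<in>root_vars G v. E w)) = E u"
proof -
  let ?m = "\<lambda>v. rat_of_int (moebius (fst u div fst v))"
  have fu: "finite (root_vars G u)" by (rule finite_root_vars[OF fin])
  have "(\<Sum>v\<in>root_vars G u. ?m v * (\<Sum>w\<in>root_vars G v. E w))
    = (\<Sum>v\<in>root_vars G u. \<Sum>w\<in>root_vars G u. if w \<in> root_vars G v then ?m v * E w else 0)"
  proof (rule sum.cong[OF refl])
    fix v assume v: "v \<in> root_vars G u"
    have "{w \<in> root_vars G u. w \<in> root_vars G v} = root_vars G v"
      using root_vars_trans[OF u v] by blast
    then show "?m v * (\<Sum>w\<in>root_vars G v. E w) = (\<Sum>w\<in>root_vars G u. if w \<in> root_vars G v then ?m v * E w else 0)"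
      by (simp add: sum.inter_filter[OF fu, symmetric] sum_distrib_left)
  qed
  also have "\<dots> = (\<Sum>w\<in>root_vars G u. \<Sum>v\<in>root_vars G u. if w \<in> root_vars G v then ?m v * E w else 0)"
    by (rule sum.swap)
  also have "\<dots> = (\<Sum>w\<in>root_vars G u. if w = u then E u else 0)"
  proof (rule sum.cong[OF refl])
    fix w assume w: "w \<in> root_vars G u"
    let ?k = "fst u div fst w"
    have w': "fst w > 0" "fst w dvd fst u" "fst u > 0" "snd w \<in> conj_classes G" "snd u = class_pow G (snd w) ?k"
      using w by (auto simp: root_vars_def cvars_def)
    have kpos: "?k > 0" using w' by (simp add: div_greater_zero_iff dvd_imp_le)
    have iff: "?k = 1 \<longleftrightarrow> w = u"
    proof
      assume k: "?k = 1"
      have "fst u = fst w * ?k" using w'(2) by (simp only: dvd_mult_div_cancel)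
      then have "fst w = fst u" using k by (simp only: mult_1_right)
      moreover have "snd w = snd u" using w'(5) class_pow_1[OF w'(4)] unfolding k by simp
      ultimately show "w = u" by (rule prod_eqI)
    next
      assume "w = u"
      then show "?k = 1" using w'(1) by simp
    qed
    have "(\<Sum>v\<in>root_vars G u. if w \<in> root_vars G v then ?m v * E w else 0)
      = (\<Sum>v\<in>{v \<in> root_vars G u. w \<in> root_vars G v}. ?m v * E w)"
      by (rule sum.inter_filter[OF fu, symmetric])
    also have "\<dots> = (\<Sum>d\<in>{d. d dvd ?k}. ?m (fst w * d, class_pow G (snd w) d) * E w)"
      by (rule sum.reindex_bij_betw[OF root_vars_between[OF u w], symmetric])
    also have "\<dots> = (\<Sum>d\<in>{d. d dvd ?k}. rat_of_int (moebius (?k div d)) * E w)"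
      by (simp add: div_mult2_eq)
    also have "\<dots> = rat_of_int (\<Sum>d\<in>{d. d dvd ?k}. moebius (?k div d)) * E w"
      by (simp add: sum_distrib_right)
    also have "(\<Sum>d\<in>{d. d dvd ?k}. moebius (?k div d)) = (\<Sum>d\<in>{d. d dvd ?k}. moebius d)"
      by (rule sum.reindex_bij_witness[of _ "\<lambda>d. ?k div d" "\<lambda>d. ?k div d"]) (use kpos in auto)
    also have "\<dots> = (if ?k = 1 then 1 else 0)" by (rule sum_moebius_divisors[OF kpos])
    also have "\<dots> = (if w = u then 1 else 0)" using iff by (simp only:)
    finally show "(\<Sum>v\<in>root_vars G u. if w \<in> root_vars G v then ?m v * E w else 0) = (if w = u then E u else 0)"
      by auto
  qed
  also have "\<dots> = E u" using fu root_vars_self[OF u] by simp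
  finally show ?thesis .
qed

text \<open>\<open>E\<close> is meant to count sequences of exact type, and the hypothesis counts
  those whose type is any root. In \<open>cweight G v * moeb_coeff v u\<close> the degrees multiply
  to \<open>fst u\<close>, so the same denominator comes out of every term and Moebius inversion
  applies to the rest.\<close>

lemma poly_orbit_poly:
  fixes E :: "nat \<times> 'a set \<Rightarrow> rat"
  assumes fin: "finite (carrier G)" and u: "u \<in> cvars G"
    and E: "\<And>v. v \<in> cvars G \<Longrightarrow> (\<Sum>w\<in>root_vars G v. E w) = of_nat (card (snd v)) * q ^ fst v"
  shows "poly (orbit_poly G u) q = E u / (of_nat (fst u) * of_nat (Coset.order G))"
proof -
  have u1: "fst u > 0" using u by (auto simp: cvars_def)
  have "poly (orbit_poly G u) q = (\<Sum>v\<in>root_vars G u. cweight G v * moeb_coeff v u * q ^ fst v)"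
    by (simp add: orbit_poly_def poly_sum poly_monom)
  also have "\<dots> = (\<Sum>v\<in>root_vars G u. of_int (moebius (fst u div fst v)) * (of_nat (card (snd v)) * q ^ fst v)
      / (of_nat (fst u) * of_nat (Coset.order G)))"
  proof (rule sum.cong[OF refl])
    fix v assume v: "v \<in> root_vars G u"
    then obtain k where k: "fst u = fst v * k" by (auto simp: root_vars_def)
    then have "fst v > 0" "k > 0" using u1 by auto
    then show "cweight G v * moeb_coeff v u * q ^ fst v = of_int (moebius (fst u div fst v)) * (of_nat (card (snd v)) * q ^ fst v)
      / (of_nat (fst u) * of_nat (Coset.order G))"
      by (simp add: cweight_def moeb_coeff_def k ac_simps)
  qed
  also have "\<dots> = (\<Sum>v\<in>root_vars G u. of_int (moebius (fst u div fst v)) * (\<Sum>w\<in>root_vars G v. E w))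
      / (of_nat (fst u) * of_nat (Coset.order G))"
    unfolding sum_divide_distrib using E by (intro sum.cong) (auto simp: root_vars_def)
  finally show ?thesis by (simp add: moebius_inversion[OF fin u])
qed

end

section \<open>Periodic sequences\<close>

locale sequences = free_action G B b
  for G :: "('g, 'm) monoid_scheme" (structure) and B :: "'s set" and b +
  assumes finG: "finite (carrier G)" and finB: "finite B"
begin

definition seqs :: "(nat \<Rightarrow> 's) set" where
  "seqs = {y. \<forall>k. y k \<in> B}"

definition sact :: "'g \<Rightarrow> (nat \<Rightarrow> 's) \<Rightarrow> nat \<Rightarrow> 's" where
  "sact g y = (\<lambda>k. b g (y k))"

definition shift :: "nat \<Rightarrow> (nat \<Rightarrow> 's) \<Rightarrow> nat \<Rightarrow> 's" where
  "shift k y = (\<lambda>j. y (j + k))"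

lemma seqs_closed [simp]: "g \<in> carrier G \<Longrightarrow> y \<in> seqs \<Longrightarrow> sact g y \<in> seqs" "y \<in> seqs \<Longrightarrow> shift k y \<in> seqs"
  by (auto simp: seqs_def sact_def shift_def a_closed)

lemma shift_sact: "shift k (sact g y) = sact g (shift k y)"
  by (simp add: shift_def sact_def)

lemma shift_shift: "shift k (shift l y) = shift (k + l) y"
  by (simp add: shift_def ac_simps)

lemma shift_0 [simp]: "shift 0 y = y"
  by (simp add: shift_def)

lemma free_action_seqs: "free_action G seqs sact"
proof unfold_locales
  fix g y assume g: "g \<in> carrier G" and y: "y \<in> seqs" and eq: "sact g y = y"
  have "b g (y 0) = y 0" using fun_cong[OF eq, of 0] by (simp add: sact_def)
  then show "g = \<one>" using a_free[OF g, of "y 0"] y by (simp add: seqs_def)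
next
  fix y assume "y \<in> seqs" then show "sact \<one> y = y"
    by (simp add: sact_def seqs_def a_one)
next
  fix g h y assume "g \<in> carrier G" "h \<in> carrier G" "y \<in> seqs"
  then show "sact (g \<otimes> h) y = sact g (sact h y)"
    by (simp add: sact_def seqs_def a_mult)
qed simp

sublocale S: free_action G seqs sact
  by (rule free_action_seqs)

lemma sact_inv: 
  "g \<in> carrier G \<Longrightarrow> y \<in> seqs \<Longrightarrow> sact (inv g) (sact g y) = y"
  "g \<in> carrier G \<Longrightarrow> y \<in> seqs \<Longrightarrow> sact g (sact (inv g) y) = y"
  by (simp_all add: S.a_mult[symmetric] S.a_one)

section \<open>Periods and twists\<close>

definition per :: "(nat \<Rightarrow> 's) \<Rightarrow> nat \<Rightarrow> 'g \<Rightarrow> bool" where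
  "per y N h \<longleftrightarrow> N > 0 \<and> h \<in> carrier G \<and> shift N y = sact h y"

definition Y :: "(nat \<Rightarrow> 's) set" where
  "Y = {y \<in> seqs. \<exists>N h. per y N h}"

definition period :: "(nat \<Rightarrow> 's) \<Rightarrow> nat" where
  "period y = (LEAST N. \<exists>h. per y N h)"

text \<open>Unique by freeness once the period is fixed. Translating \<open>y\<close> by
  \<open>g\<close> conjugates the twist, so only its class enters the type.\<close>

definition twist :: "(nat \<Rightarrow> 's) \<Rightarrow> 'g" where
  "twist y = (SOME h. per y (period y) h)"

lemma Y_seqs: "y \<in> Y \<Longrightarrow> y \<in> seqs"
  by (simp add: Y_def)

lemma per_period: "y \<in> Y \<Longrightarrow> per y (period y) (twist y)"
proof -
  assume "y \<in> Y"
  then have "\<exists>N h. per y N h" by (simp add: Y_def)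
  then have "\<exists>h. per y (period y) h" unfolding period_def by (rule LeastI_ex)
  then show ?thesis unfolding twist_def by (rule someI_ex)
qed

lemma period_le: "per y N h \<Longrightarrow> period y \<le> N"
  unfolding period_def by (rule Least_le) blast

lemma period_pos: "y \<in> Y \<Longrightarrow> period y > 0"
  and twist_carrier: "y \<in> Y \<Longrightarrow> twist y \<in> carrier G"
  and shift_period: "y \<in> Y \<Longrightarrow> shift (period y) y = sact (twist y) y"
  using per_period by (auto simp: per_def)

lemma period_twist_unique:
  assumes "y \<in> seqs" "per y N h" "\<And>N' h'. per y N' h' \<Longrightarrow> N \<le> N'"
  shows "period y = N" "twist y = h"
proof -
  have y: "y \<in> Y" using assms(1,2) by (auto simp: Y_def)
  show N: "period y = N" using period_le[OF assms(2)] assms(3)[OF per_period[OF y]] by simp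
  have "sact (twist y) y = sact h y" using shift_period[OF y] assms(2) by (simp add: N per_def)
  then show "twist y = h" using S.a_eqD[OF twist_carrier[OF y] _ assms(1)] assms(2) by (simp add: per_def)
qed

lemma shift_mult:
  assumes "y \<in> seqs" "g \<in> carrier G" "shift K y = sact g y"
  shows "shift (K * j) y = sact (g [^] j) y"
proof (induction j)
  case 0
  then show ?case using assms(1) by (simp add: S.a_one)
next
  case (Suc j)
  have "shift (K * Suc j) y = shift K (shift (K * j) y)" by (simp add: shift_shift)
  also have "\<dots> = sact (g [^] j) (sact g y)" by (simp add: Suc shift_sact assms(3))
  also have "\<dots> = sact (g [^] Suc j) y" using assms by (simp add: S.a_mult)
  finally show ?case .
qed

text \<open>Division with remainder: the remainder would be a smaller period up to \<open>G\<close>,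
  so it is 0, and freeness identifies the group element with a power of the twist.\<close>

lemma period_dvd:
  assumes y: "y \<in> Y" and g: "g \<in> carrier G" and eq: "shift K y = sact g y"
  shows "period y dvd K" "g = twist y [^] (K div period y)"
proof -
  let ?N = "period y" and ?j = "K div period y" and ?r = "K mod period y"
  have ys: "y \<in> seqs" and t: "twist y \<in> carrier G" using y by (simp_all add: Y_seqs twist_carrier)
  have "sact g y = shift ?r (shift (?N * ?j) y)" by (simp add: eq[symmetric] shift_shift)
  also have "\<dots> = sact (twist y [^] ?j) (shift ?r y)"
    by (simp add: shift_mult[OF ys t shift_period[OF y]] shift_sact)
  finally have *: "sact g y = sact (twist y [^] ?j) (shift ?r y)" .
  have "shift ?r y = sact (inv (twist y [^] ?j)) (sact g y)"
    unfolding * using t ys by (simp add: sact_inv)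
  also have "\<dots> = sact (inv (twist y [^] ?j) \<otimes> g) y" using t g ys by (simp add: S.a_mult)
  finally have r: "shift ?r y = sact (inv (twist y [^] ?j) \<otimes> g) y" .
  have r0: "?r = 0"
  proof (rule ccontr)
    assume "?r \<noteq> 0"
    then have "per y ?r (inv (twist y [^] ?j) \<otimes> g)" using r t g by (simp add: per_def)
    from period_le[OF this] show False using mod_less_divisor[OF period_pos[OF y], of K] by simp
  qed
  then show "?N dvd K" by auto
  have "sact g y = sact (twist y [^] ?j) y" using * r0 by simp
  then show "g = twist y [^] ?j" using S.a_eqD[OF g _ ys] t by simp
qed

text \<open>Further shifting brings both sequences back up to group elements, so \<open>y\<close> is
  a translate of \<open>z\<close>; comparing the two after the shift by \<open>k\<close>, freeness
  makes the translation trivial.\<close>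

lemma shift_inj:
  assumes y: "y \<in> Y" and z: "z \<in> Y" and eq: "shift k y = shift k z"
  shows "y = z"
proof -
  \<comment> \<open>A common multiple of both periods that is at least \<open>k\<close>, so that the
    shift by it factors through the shift by \<open>k\<close>.\<close>
  let ?M = "period y * period z * k"
  have s: "y \<in> seqs" "z \<in> seqs" using y z by (simp_all add: Y_seqs)
  have M: "k \<le> ?M" using period_pos[OF y] period_pos[OF z] by simp
  let ?g = "twist y [^] (period z * k)" and ?h = "twist z [^] (period y * k)"
  have g: "?g \<in> carrier G" "?h \<in> carrier G" using twist_carrier y z by simp_all
  have "shift ?M y = shift (?M - k) (shift k y)" using M by (simp add: shift_shift)
  also have "\<dots> = shift ?M z" using M by (simp add: shift_shift eq)
  finally have "sact ?g y = sact ?h z"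
    using shift_mult[OF s(1) twist_carrier[OF y] shift_period[OF y], of "period z * k"]
      shift_mult[OF s(2) twist_carrier[OF z] shift_period[OF z], of "period y * k"]
    by (simp add: ac_simps)
  then have u: "y = sact (inv ?g \<otimes> ?h) z" using g s by (metis S.a_mult inv_closed sact_inv(1))
  have "shift k z = sact (inv ?g \<otimes> ?h) (shift k z)"
    using arg_cong[OF u, of "shift k"] by (simp add: shift_sact eq)
  then have "inv ?g \<otimes> ?h = \<one>" using S.a_free[of "inv ?g \<otimes> ?h" "shift k z"] g s by simp
  then show ?thesis using u s by (simp add: S.a_one)
qed

lemma per_shift: "y \<in> Y \<Longrightarrow> per y N h \<Longrightarrow> per (shift k y) N h"
  by (auto simp: per_def shift_shift shift_sact[symmetric]) (metis add.commute shift_shift)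

lemma per_sact: "y \<in> Y \<Longrightarrow> g \<in> carrier G \<Longrightarrow> per y N h \<Longrightarrow> per (sact g y) N (g \<otimes> h \<otimes> inv g)"
proof -
  assume y: "y \<in> Y" and g: "g \<in> carrier G" and p: "per y N h"
  have h: "h \<in> carrier G" using p by (simp add: per_def)
  have "sact (g \<otimes> h \<otimes> inv g) (sact g y) = sact (g \<otimes> h) (sact (inv g) (sact g y))"
    using g h Y_seqs[OF y] by (intro S.a_mult) auto
  also have "\<dots> = sact g (sact h y)" using g h Y_seqs[OF y] by (simp add: sact_inv S.a_mult)
  also have "\<dots> = shift N (sact g y)" using p by (simp add: per_def shift_sact)
  finally show ?thesis using p g h by (simp add: per_def)
qed

lemma Y_closed:
  assumes "y \<in> Y" shows "shift k y \<in> Y" "g \<in> carrier G \<Longrightarrow> sact g y \<in> Y"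
  using per_shift[OF assms per_period[OF assms]] per_sact[OF assms _ per_period[OF assms]] Y_seqs[OF assms]
  by (auto simp: Y_def)

lemma period_shift: "y \<in> Y \<Longrightarrow> period (shift k y) = period y" "y \<in> Y \<Longrightarrow> twist (shift k y) = twist y"
proof -
  assume y: "y \<in> Y"
  have "period y \<le> N'" if p: "per (shift k y) N' h'" for N' h'
  proof -
    have h': "h' \<in> carrier G" using p by (simp add: per_def)
    have "shift k (shift N' y) = shift N' (shift k y)" by (simp add: shift_shift add.commute)
    also have "\<dots> = shift k (sact h' y)" using p by (simp add: per_def shift_sact)
    finally have "shift N' y = sact h' y"
      by (rule shift_inj[OF Y_closed(1)[OF y] Y_closed(2)[OF y h']])
    then have "per y N' h'" using p by (simp add: per_def)
    then show ?thesis by (rule period_le)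
  qed
  then show "period (shift k y) = period y" "twist (shift k y) = twist y"
    using period_twist_unique[OF _ per_shift[OF y per_period[OF y]]] Y_seqs[OF y] by auto
qed

lemma period_sact:
  assumes y: "y \<in> Y" and g: "g \<in> carrier G"
  shows "period (sact g y) = period y" "twist (sact g y) = g \<otimes> twist y \<otimes> inv g"
proof -
  have "period y \<le> N'" if p: "per (sact g y) N' h'" for N' h'
  proof -
    have "sact (inv g) (sact g y) = y" using g Y_seqs[OF y] by (rule sact_inv)
    then have "per y N' (inv g \<otimes> h' \<otimes> inv (inv g))"
      using per_sact[OF Y_closed(2)[OF y g] inv_closed[OF g] p] by (simp only:)
    then show ?thesis by (rule period_le)
  qed
  then show "period (sact g y) = period y" "twist (sact g y) = g \<otimes> twist y \<otimes> inv g"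
    using period_twist_unique[OF _ per_sact[OF y g per_period[OF y]]] Y_seqs[OF y] g by auto
qed

section \<open>Types of sequences and orbits under the group and the shift\<close>

definition seq_type :: "(nat \<Rightarrow> 's) \<Rightarrow> nat \<times> 'g set" where
  "seq_type y = (period y, conj_class G (twist y))"

lemma conj_class_conj:
  assumes "a \<in> carrier G" "g \<in> carrier G"
  shows "conj_class G (g \<otimes> a \<otimes> inv g) = conj_class G a"
proof -
  have sub: "conj_class G (g \<otimes> a \<otimes> inv g) \<subseteq> conj_class G a" if "a \<in> carrier G" "g \<in> carrier G" for a g
  proof
    fix c assume "c \<in> conj_class G (g \<otimes> a \<otimes> inv g)"
    then obtain h where h: "h \<in> carrier G" "c = h \<otimes> (g \<otimes> a \<otimes> inv g) \<otimes> inv h" by (auto simp: conj_class_def)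
    then have "c = (h \<otimes> g) \<otimes> a \<otimes> inv (h \<otimes> g)" using that by (simp add: m_assoc inv_mult_group)
    then show "c \<in> conj_class G a" using h that by (auto simp: conj_class_def)
  qed
  have "inv g \<otimes> (g \<otimes> a \<otimes> inv g) \<otimes> inv (inv g) = (inv g \<otimes> g) \<otimes> a \<otimes> (inv g \<otimes> g)"
    using assms by (simp only: m_assoc inv_inv inv_closed m_closed)
  then have "inv g \<otimes> (g \<otimes> a \<otimes> inv g) \<otimes> inv (inv g) = a" using assms by simp
  then have "conj_class G a \<subseteq> conj_class G (g \<otimes> a \<otimes> inv g)"
    using sub[of "g \<otimes> a \<otimes> inv g" "inv g"] assms by simp
  then show ?thesis using sub[OF assms] by blast
qed

lemma seq_type_shift: "y \<in> Y \<Longrightarrow> seq_type (shift k y) = seq_type y"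
  by (simp add: seq_type_def period_shift)

lemma seq_type_sact: "y \<in> Y \<Longrightarrow> g \<in> carrier G \<Longrightarrow> seq_type (sact g y) = seq_type y"
  by (simp add: seq_type_def period_sact conj_class_conj twist_carrier)

lemma seq_type_cvars: "y \<in> Y \<Longrightarrow> seq_type y \<in> cvars G"
  using period_pos twist_carrier by (fastforce simp: seq_type_def cvars_def conj_classes_def)

text \<open>The orbit under the group together with the shifts. Only forward shifts are available;
  that these sets are still equivalence classes rests on periodicity, see
  \<open>big_sym\<close>.\<close>

definition big :: "(nat \<Rightarrow> 's) \<Rightarrow> (nat \<Rightarrow> 's) set" where
  "big y = {sact g (shift k y) | g k. g \<in> carrier G}"

lemma bigI: "g \<in> carrier G \<Longrightarrow> sact g (shift k y) \<in> big y"
  by (auto simp: big_def)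

lemma big_subset: "y \<in> Y \<Longrightarrow> big y \<subseteq> Y"
  by (auto simp: big_def intro: Y_closed)

lemma big_self: "y \<in> Y \<Longrightarrow> y \<in> big y"
  using bigI[of \<one> 0 y] Y_seqs[of y] by (simp add: S.a_one)

lemma big_type: "y \<in> Y \<Longrightarrow> z \<in> big y \<Longrightarrow> seq_type z = seq_type y"
  by (auto simp: big_def seq_type_shift seq_type_sact Y_closed)

lemma big_closed:
  assumes y: "y \<in> Y" and z: "z \<in> big y"
  shows "shift k z \<in> big y" "g \<in> carrier G \<Longrightarrow> sact g z \<in> big y"
proof -
  obtain h l where h: "h \<in> carrier G" "z = sact h (shift l y)" using z by (auto simp: big_def)
  show "shift k z \<in> big y" using bigI[OF h(1), of "k + l" y] by (simp add: h(2) shift_sact shift_shift)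
  assume g: "g \<in> carrier G"
  show "sact g z \<in> big y" using bigI[of "g \<otimes> h" l y] g h Y_seqs[OF y] by (simp add: S.a_mult)
qed

text \<open>A shift by \<open>k\<close> is completed to a multiple of the period, after which a
  group element leads back to \<open>y\<close>.\<close>

lemma big_sym:
  assumes y: "y \<in> Y" and z: "z \<in> big y"
  shows "y \<in> big z"
proof -
  obtain g k where g: "g \<in> carrier G" "z = sact g (shift k y)" using z by (auto simp: big_def)
  let ?M = "period y * k" and ?t = "twist y [^] k"
  have ys: "y \<in> seqs" by (rule Y_seqs[OF y])
  have t: "?t \<in> carrier G" using twist_carrier[OF y] by simp
  have M: "k \<le> ?M" using period_pos[OF y] by simp
  have "shift (?M - k) z = sact g (shift ?M y)" using M by (simp add: g(2) shift_sact shift_shift)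
  also have "\<dots> = sact (g \<otimes> ?t) y"
    using g(1) t ys by (simp add: shift_mult[OF ys twist_carrier[OF y] shift_period[OF y]] S.a_mult)
  finally have "sact (inv (g \<otimes> ?t)) (shift (?M - k) z) = y" using g(1) t ys by (simp add: sact_inv)
  then show ?thesis using bigI[of "inv (g \<otimes> ?t)" "?M - k" z] g(1) t by simp
qed

lemma big_trans: "y \<in> Y \<Longrightarrow> z \<in> big y \<Longrightarrow> big z \<subseteq> big y"
  using big_closed by (auto simp: big_def[of z])

lemma big_eq: "y \<in> Y \<Longrightarrow> z \<in> big y \<Longrightarrow> big z = big y"
  using big_trans big_trans[of z y] big_sym big_subset by blast

text \<open>A shift by the period can be traded for the twist, so group elements and shifts below
  the period exhaust the orbit. Minimality of the period and freeness exclude repetitions.\<close>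

lemma card_big:
  assumes y: "y \<in> Y"
  shows "card (big y) = period y * Coset.order G"
proof -
  have ys: "y \<in> seqs" by (rule Y_seqs[OF y])
  have t: "twist y \<in> carrier G" by (rule twist_carrier[OF y])
  have le: "k = k' \<and> g = g'" if g: "g \<in> carrier G" "g' \<in> carrier G" and k: "k < period y" "k' < period y" "k \<le> k'"
    and eq: "sact g (shift k y) = sact g' (shift k' y)" for g g' k k'
  proof -
    have "sact g (shift k y) = shift k (sact g y)" by (simp add: shift_sact)
    moreover have "sact g' (shift k' y) = shift k (sact g' (shift (k' - k) y))" using k by (simp add: shift_sact shift_shift)
    ultimately have "sact g y = sact g' (shift (k' - k) y)"
      using eq shift_inj[of "sact g y" "sact g' (shift (k' - k) y)" k] Y_closed y g by simp
    then have "shift (k' - k) y = sact (inv g') (sact g y)" using g ys by (simp add: sact_inv)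
    also have "\<dots> = sact (inv g' \<otimes> g) y" using g ys by (simp add: S.a_mult)
    finally have "period y dvd k' - k" by (rule period_dvd(1)[OF y m_closed[OF inv_closed[OF g(2)] g(1)]])
    moreover have "k' - k < period y" using k by simp
    ultimately have "k' - k = 0" using nat_dvd_not_less by blast
    then have kk: "k = k'" using k(3) by simp
    then show ?thesis using S.a_eqD[OF g, of "shift k y"] eq ys by simp
  qed
  have inj: "inj_on (\<lambda>(g, k). sact g (shift k y)) (carrier G \<times> {..<period y})"
  proof (rule inj_onI)
    fix p q assume p: "p \<in> carrier G \<times> {..<period y}" and q: "q \<in> carrier G \<times> {..<period y}"
      and eq: "(case p of (g, k) \<Rightarrow> sact g (shift k y)) = (case q of (g, k) \<Rightarrow> sact g (shift k y))"
    show "p = q"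
      using le[of "fst p" "fst q" "snd p" "snd q"] le[of "fst q" "fst p" "snd q" "snd p"] p q eq
      by (cases "snd p \<le> snd q") (auto simp: prod_eq_iff)
  qed
  have "big y = (\<lambda>(g, k). sact g (shift k y)) ` (carrier G \<times> {..<period y})"
  proof (intro subset_antisym subsetI)
    fix z assume "z \<in> big y"
    then obtain g k where g: "g \<in> carrier G" "z = sact g (shift k y)" by (auto simp: big_def)
    let ?r = "k mod period y" and ?t = "twist y [^] (k div period y)"
    have "shift k y = shift ?r (shift (period y * (k div period y)) y)" by (simp add: shift_shift)
    also have "\<dots> = sact ?t (shift ?r y)" by (simp add: shift_mult[OF ys t shift_period[OF y]] shift_sact)
    finally have "z = sact (g \<otimes> ?t) (shift ?r y)" using g t ys by (simp add: S.a_mult)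
    moreover have "?r < period y" using period_pos[OF y] by simp
    ultimately show "z \<in> (\<lambda>(g, k). sact g (shift k y)) ` (carrier G \<times> {..<period y})"
      using g t by (intro image_eqI[of _ _ "(g \<otimes> ?t, ?r)"]) auto
  qed (auto intro: bigI)
  then show ?thesis by (simp add: card_image[OF inj] card_cartesian_product Coset.order_def)
qed

text \<open>A sequence with \<open>shift N y = sact h y\<close> is determined by \<open>h\<close>
  and its first \<open>N\<close> entries, which are arbitrary. By freeness \<open>h\<close> is
  determined by \<open>y\<close>, so no sequence is counted for two elements of
  \<open>C\<close>.\<close>

lemma card_per:
  assumes C: "C \<subseteq> carrier G" and N: "N > 0"
  shows "card {y \<in> Y. \<exists>h\<in>C. shift N y = sact h y} = card C * card B ^ N"
    "finite {y \<in> Y. \<exists>h\<in>C. shift N y = sact h y}"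
proof -
  \<comment> \<open>Writing \<open>k = N q + r\<close>, the entry at \<open>k\<close> is the entry
    at \<open>r\<close> moved by the \<open>q\<close>-th power of \<open>h\<close>.\<close>
  let ?f = "\<lambda>(h, w) k. b (h [^] (k div N)) (w (k mod N))"
  let ?A = "C \<times> ({..<N} \<rightarrow>\<^sub>E B)" and ?Q = "{y \<in> Y. \<exists>h\<in>C. shift N y = sact h y}"
  have wB: "w (k mod N) \<in> B" if "w \<in> {..<N} \<rightarrow>\<^sub>E B" for w k
    using PiE_mem[OF that, of "k mod N"] N by simp
  have fs: "?f (h, w) \<in> seqs" "shift N (?f (h, w)) = sact h (?f (h, w))" if hw: "h \<in> C" "w \<in> {..<N} \<rightarrow>\<^sub>E B" for h w
  proof -
    have h: "h \<in> carrier G" using hw C by blast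
    show "?f (h, w) \<in> seqs" using h wB[OF hw(2)] by (simp add: seqs_def a_closed)
    show "shift N (?f (h, w)) = sact h (?f (h, w))"
    proof
      fix k
      have "h [^] Suc (k div N) = h \<otimes> h [^] (k div N)" using nat_pow_Suc2[OF h] by simp
      then show "shift N (?f (h, w)) k = sact h (?f (h, w)) k"
        using N h wB[OF hw(2)] by (simp add: shift_def sact_def a_mult[symmetric] del: nat_pow_Suc)
    qed
  qed
  have fY: "?f (h, w) \<in> Y" if hw: "h \<in> C" "w \<in> {..<N} \<rightarrow>\<^sub>E B" for h w
    using fs[OF hw] N hw C unfolding Y_def per_def by blast
  have fw: "?f (h, w) k = w k" if "h \<in> C" "w \<in> {..<N} \<rightarrow>\<^sub>E B" "k < N" for h w k
    using that PiE_mem[of w "{..<N}" "\<lambda>_. B" k] by (simp add: a_one)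
  have bij: "bij_betw ?f ?A ?Q"
  proof (rule bij_betw_imageI)
    show "inj_on ?f ?A"
    proof (rule inj_onI)
      fix p q assume p: "p \<in> ?A" and q: "q \<in> ?A" and eq: "?f p = ?f q"
      obtain h w where hw: "p = (h, w)" "h \<in> C" "w \<in> {..<N} \<rightarrow>\<^sub>E B" using p by blast
      obtain h' w' where hw': "q = (h', w')" "h' \<in> C" "w' \<in> {..<N} \<rightarrow>\<^sub>E B" using q by blast
      have "w = w'"
      proof (rule PiE_ext[OF hw(3) hw'(3)])
        fix k assume "k \<in> {..<N}"
        then have "?f (h, w) k = w k" "?f (h', w') k = w' k" using fw hw(2,3) hw'(2,3) by blast+
        then show "w k = w' k" using eq unfolding hw(1) hw'(1) by (simp only:)
      qed
      moreover have "sact h (?f (h, w)) = sact h' (?f (h, w))"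
        using fs(2)[OF hw(2,3)] fs(2)[OF hw'(2,3)] eq unfolding hw(1) hw'(1) by (simp only:)
      then have "h = h'" using S.a_eqD[OF _ _ fs(1)[OF hw(2,3)]] hw hw' C by blast
      ultimately show "p = q" using hw hw' by simp
    qed
    show "?f ` ?A = ?Q"
    proof (intro subset_antisym subsetI)
      fix y assume "y \<in> ?f ` ?A"
      then obtain h w where "y = ?f (h, w)" "h \<in> C" "w \<in> {..<N} \<rightarrow>\<^sub>E B" by blast
      then show "y \<in> ?Q" using fs fY by blast
    next
      fix y assume "y \<in> ?Q"
      then obtain h where h: "y \<in> seqs" "h \<in> C" "shift N y = sact h y" using Y_seqs by blast
      have hG: "h \<in> carrier G" using h(2) C by blast
      let ?w = "restrict y {..<N}"
      have w: "?w \<in> {..<N} \<rightarrow>\<^sub>E B" using h(1) by (auto simp: seqs_def)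
      have "y k = ?f (h, ?w) k" for k
      proof -
        have "y k = shift (N * (k div N)) y (k mod N)" by (simp add: shift_def)
        also have "\<dots> = b (h [^] (k div N)) (y (k mod N))"
          unfolding shift_mult[OF h(1) hG h(3)] by (simp add: sact_def)
        finally show ?thesis using N by simp
      qed
      then have "y = ?f (h, ?w)" by blast
      then show "y \<in> ?f ` ?A" using h(2) w by blast
    qed
  qed
  have "card ?Q = card ?A" using bij_betw_same_card[OF bij] by simp
  then show "card ?Q = card C * card B ^ N" by (simp add: card_cartesian_product card_PiE)
  have "finite ?A" using finite_subset[OF C finG] finB by (auto intro: finite_PiE)
  then show "finite ?Q" using bij_betw_finite[OF bij] by blast
qed

definition bigs :: "nat \<times> 'g set \<Rightarrow> (nat \<Rightarrow> 's) set set" where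
  "bigs u = big ` {y \<in> Y. seq_type y = u}"

text \<open>By \<open>period_dvd\<close>, \<open>N\<close> is a multiple of the exact period and
  \<open>h\<close> the corresponding power of the twist; on classes this is the relation of
  \<open>root_vars\<close>.\<close>

lemma seq_type_root_vars:
  assumes u: "u \<in> cvars G"
  shows "{y \<in> Y. \<exists>h\<in>snd u. shift (fst u) y = sact h y} = {y \<in> Y. seq_type y \<in> root_vars G u}"
proof -
  have N: "fst u > 0" and C: "snd u \<in> conj_classes G" using u by (auto simp: cvars_def)
  have CG: "snd u \<subseteq> carrier G" by (rule conj_class_subset[OF C])
  have self: "a \<in> conj_class G a" if "a \<in> carrier G" for a
    unfolding conj_class_def using that by (intro CollectI exI[of _ \<one>]) simp
  have cls: "conj_class G h = snd u" if "h \<in> snd u" for h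
  proof -
    obtain a where a: "a \<in> carrier G" "snd u = conj_class G a" using C by (auto simp: conj_classes_def)
    have "h \<in> conj_class G a" using that a(2) by (simp only:)
    then obtain g where g: "g \<in> carrier G" "h = g \<otimes> a \<otimes> inv g" unfolding conj_class_def by blast
    show ?thesis unfolding g(2) a(2) by (rule conj_class_conj[OF a(1) g(1)])
  qed
  have "(\<exists>h\<in>snd u. shift (fst u) y = sact h y) \<longleftrightarrow> seq_type y \<in> root_vars G u" if y: "y \<in> Y" for y
  proof
    assume "\<exists>h\<in>snd u. shift (fst u) y = sact h y"
    then obtain h where h: "h \<in> snd u" "shift (fst u) y = sact h y" by blast
    have hG: "h \<in> carrier G" using h CG by blast
    have "snd u = class_pow G (snd (seq_type y)) (fst u div fst (seq_type y))"
      using cls[OF h(1)] period_dvd(2)[OF y hG h(2)] twist_carrier[OF y]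
      by (simp add: seq_type_def class_pow_conj_class)
    then show "seq_type y \<in> root_vars G u"
      using seq_type_cvars[OF y] period_dvd(1)[OF y hG h(2)] N
      by (simp add: root_vars_def seq_type_def)
  next
    assume *: "seq_type y \<in> root_vars G u"
    let ?h = "twist y [^] (fst u div period y)"
    have d: "period y dvd fst u" "snd u = conj_class G ?h"
      using * twist_carrier[OF y] by (auto simp: root_vars_def seq_type_def class_pow_conj_class)
    have "shift (period y * (fst u div period y)) y = sact ?h y"
      by (rule shift_mult[OF Y_seqs[OF y] twist_carrier[OF y] shift_period[OF y]])
    then have "shift (fst u) y = sact ?h y" using d(1) by simp
    moreover have "?h \<in> snd u" unfolding d(2) using self twist_carrier[OF y] by simp
    ultimately show "\<exists>h\<in>snd u. shift (fst u) y = sact h y" by blast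
  qed
  then show ?thesis by blast
qed

lemma finite_type: "finite {y \<in> Y. seq_type y = u}"
proof (cases "u \<in> cvars G")
  case True
  have "{y \<in> Y. seq_type y = u} \<subseteq> {y \<in> Y. seq_type y \<in> root_vars G u}"
    using root_vars_self[OF True] by blast
  moreover have "finite {y \<in> Y. seq_type y \<in> root_vars G u}"
    using card_per(2)[of "snd u" "fst u"] True conj_class_subset seq_type_root_vars[OF True]
    by (auto simp: cvars_def)
  ultimately show ?thesis by (rule finite_subset)
next
  case False
  then have "{y \<in> Y. seq_type y = u} = {}" using seq_type_cvars by blast
  then show ?thesis by (simp only: finite.emptyI)
qed

lemma finite_bigs: "finite (bigs u)"
  unfolding bigs_def using finite_type by simp

lemma card_type: "card {y \<in> Y. seq_type y = u} = card (bigs u) * (fst u * Coset.order G)"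
proof -
  have U: "\<Union> (bigs u) = {y \<in> Y. seq_type y = u}"
  proof (intro subset_antisym subsetI)
    fix z assume "z \<in> \<Union> (bigs u)"
    then obtain y where y: "y \<in> Y" "seq_type y = u" "z \<in> big y" by (auto simp: bigs_def)
    then show "z \<in> {y \<in> Y. seq_type y = u}" using big_type big_subset by blast
  qed (use big_self in \<open>auto simp: bigs_def\<close>)
  have "(fst u * Coset.order G) * card (bigs u) = card (\<Union> (bigs u))"
  proof (rule card_partition[OF finite_bigs])
    show "finite (\<Union> (bigs u))" unfolding U by (rule finite_type)
    show "\<And>c. c \<in> bigs u \<Longrightarrow> card c = fst u * Coset.order G"
      by (auto simp: bigs_def card_big seq_type_def)
    show "\<And>c d. c \<in> bigs u \<Longrightarrow> d \<in> bigs u \<Longrightarrow> c \<noteq> d \<Longrightarrow> c \<inter> d = {}"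
      unfolding bigs_def using big_eq by blast
  qed
  then show ?thesis unfolding U by (simp add: mult.commute)
qed

text \<open>Summing over the roots of \<open>v\<close> gives the count of \<open>card_per\<close>,
  which Moebius inversion turns into the number of sequences of exact type \<open>u\<close>. Each
  orbit of type \<open>u\<close> has \<open>fst u * |G|\<close> of them.\<close>

theorem poly_orbit_poly_bigs:
  assumes u: "u \<in> cvars G"
  shows "poly (orbit_poly G u) (of_nat (card B)) = of_nat (card (bigs u))"
proof -
  have "poly (orbit_poly G u) (of_nat (card B))
    = of_nat (card {y \<in> Y. seq_type y = u}) / (of_nat (fst u) * of_nat (Coset.order G))"
  proof (rule poly_orbit_poly[OF finG u])
    fix v assume v: "v \<in> cvars G"
    then have v': "snd v \<subseteq> carrier G" "fst v > 0" using conj_class_subset[of "snd v"] by (auto simp: cvars_def)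
    have "(\<Sum>w\<in>root_vars G v. card {y \<in> Y. seq_type y = w}) = card (\<Union>w\<in>root_vars G v. {y \<in> Y. seq_type y = w})"
      using finite_type finite_root_vars[OF finG] by (intro card_UN_disjoint[symmetric]) auto
    also have "(\<Union>w\<in>root_vars G v. {y \<in> Y. seq_type y = w}) = {y \<in> Y. seq_type y \<in> root_vars G v}" by blast
    also have "card \<dots> = card (snd v) * card B ^ fst v"
      unfolding seq_type_root_vars[OF v, symmetric] by (rule card_per(1)[OF v'])
    finally show "(\<Sum>w\<in>root_vars G v. rat_of_nat (card {y \<in> Y. seq_type y = w})) = of_nat (card (snd v)) * of_nat (card B) ^ fst v"
      by (simp flip: of_nat_sum of_nat_mult of_nat_power)
  qed
  moreover have "fst u > 0" "Coset.order G > 0" using u order_gt_0_iff_finite finG by (auto simp: cvars_def)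
  ultimately show ?thesis by (simp add: card_type)
qed

end

lemma card_subsets_of_types:
  assumes fin: "finite K" "\<And>u. u \<in> K \<Longrightarrow> finite (S u)"
    and disj: "\<And>u v. u \<in> K \<Longrightarrow> v \<in> K \<Longrightarrow> u \<noteq> v \<Longrightarrow> S u \<inter> S v = {}"
  shows "card {\<Omega>. \<Omega> \<subseteq> (\<Union>u\<in>K. S u) \<and> (\<forall>u\<in>K. card (\<Omega> \<inter> S u) = d u)} = (\<Prod>u\<in>K. card (S u) choose d u)"
    "finite {\<Omega>. \<Omega> \<subseteq> (\<Union>u\<in>K. S u) \<and> (\<forall>u\<in>K. card (\<Omega> \<inter> S u) = d u)}"
proof -
  let ?A = "{\<Omega>. \<Omega> \<subseteq> (\<Union>u\<in>K. S u) \<and> (\<forall>u\<in>K. card (\<Omega> \<inter> S u) = d u)}"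
  let ?T = "\<lambda>u. {T. T \<subseteq> S u \<and> card T = d u}"
  have "bij_betw (\<lambda>f. \<Union>u\<in>K. f u) (\<Pi>\<^sub>E u\<in>K. ?T u) ?A"
  proof (rule bij_betw_byWitness[where f' = "\<lambda>\<Omega>. \<lambda>u\<in>K. \<Omega> \<inter> S u"])
    have int: "(\<Union>v\<in>K. f v) \<inter> S u = f u" if f: "f \<in> (\<Pi>\<^sub>E u\<in>K. ?T u)" and u: "u \<in> K" for f u
    proof (intro subset_antisym subsetI)
      fix s assume "s \<in> (\<Union>v\<in>K. f v) \<inter> S u"
      then obtain v where v: "v \<in> K" "s \<in> f v" "s \<in> S u" by blast
      have "f v \<subseteq> S v" using PiE_mem[OF f v(1)] by blast
      then have "v = u" using disj[OF v(1) u] v by blast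
      then show "s \<in> f u" using v by simp
    next
      fix s assume "s \<in> f u"
      then show "s \<in> (\<Union>v\<in>K. f v) \<inter> S u" using PiE_mem[OF f u] u by blast
    qed
    show "\<forall>f\<in>\<Pi>\<^sub>E u\<in>K. ?T u. (\<lambda>u\<in>K. (\<Union>u\<in>K. f u) \<inter> S u) = f"
    proof
      fix f assume f: "f \<in> (\<Pi>\<^sub>E u\<in>K. ?T u)"
      show "(\<lambda>u\<in>K. (\<Union>u\<in>K. f u) \<inter> S u) = f"
        using int[OF f] PiE_arb[OF f] by (intro ext) (simp add: restrict_def)
    qed
    show "(\<lambda>f. \<Union>u\<in>K. f u) ` (\<Pi>\<^sub>E u\<in>K. ?T u) \<subseteq> ?A"
    proof
      fix \<Omega> assume "\<Omega> \<in> (\<lambda>f. \<Union>u\<in>K. f u) ` (\<Pi>\<^sub>E u\<in>K. ?T u)"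
      then obtain f where f: "f \<in> (\<Pi>\<^sub>E u\<in>K. ?T u)" "\<Omega> = (\<Union>u\<in>K. f u)" by blast
      have "f u \<subseteq> S u \<and> card (f u) = d u" if "u \<in> K" for u using PiE_mem[OF f(1) that] by blast
      then show "\<Omega> \<in> ?A" using int[OF f(1)] unfolding f(2) by auto
    qed
  qed auto
  then have c: "card ?A = card (\<Pi>\<^sub>E u\<in>K. ?T u)" and f: "finite ?A \<longleftrightarrow> finite (\<Pi>\<^sub>E u\<in>K. ?T u)"
    by (rule bij_betw_same_card[symmetric], rule bij_betw_finite[symmetric])
  show "card ?A = (\<Prod>u\<in>K. card (S u) choose d u)"
    unfolding c card_PiE[OF fin(1)] using fin(2) by (intro prod.cong) (auto simp: n_subsets)
  show "finite ?A" unfolding f using fin by (auto intro!: finite_PiE)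
qed

section \<open>Counting equivariant bijections\<close>

context dowling
begin

lemma points_unit: "m \<in> {1..n} \<Longrightarrow> (\<one>, m) \<in> X"
  by (simp add: points_def)

lemma act_unit: "g \<in> carrier G \<Longrightarrow> act g (\<one>, m) = (g, m)"
  by (simp add: left_act_def)

text \<open>The image of \<open>(\<one>, m)\<close> is a translate by \<open>\<gamma> m\<close> of
  an element \<open>\<tau> m\<close> of a transversal. The labels \<open>\<gamma>\<close> are
  arbitrary, which gives \<open>|G|^n\<close>, and \<open>\<tau>\<close> is injective into
  \<open>n\<close> representatives, which gives \<open>n!\<close>.\<close>

lemma card_equivariant_bij:
  assumes Z: "free_action G Z z" and finZ: "finite Z" and cZ: "card Z = n * Coset.order G"
  shows "card {f \<in> X \<rightarrow>\<^sub>E Z. (\<forall>g\<in>carrier G. \<forall>p\<in>X. f (act g p) = z g (f p)) \<and> bij_betw f X Z}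
    = Coset.order G ^ n * fact n"
proof -
  interpret Z: free_action G Z z by (rule Z)
  let ?F = "{f \<in> X \<rightarrow>\<^sub>E Z. (\<forall>g\<in>carrier G. \<forall>p\<in>X. f (act g p) = z g (f p)) \<and> bij_betw f X Z}"
  obtain T where T: "T \<subseteq> Z" "bij_betw (\<lambda>(g, t). z g t) (carrier G \<times> T) Z" by (rule Z.transversal)
  have finT: "finite T" using T(1) finZ by (rule finite_subset)
  have "card (carrier G \<times> T) = n * Coset.order G"
    using bij_betw_same_card[OF T(2)] cZ by simp
  then have cT: "card T = n" using order_pos by (simp add: card_cartesian_product Coset.order_def)
  have T_eq: "g = h \<and> t = u" if "g \<in> carrier G" "h \<in> carrier G" "t \<in> T" "u \<in> T" "z g t = z h u" for g h t u
    using inj_onD[OF bij_betw_imp_inj_on[OF T(2)], of "(g, t)" "(h, u)"] that by simp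
  have T_ex: "\<exists>g\<in>carrier G. \<exists>t\<in>T. s = z g t" if "s \<in> Z" for s
  proof -
    have "s \<in> (\<lambda>(g, t). z g t) ` (carrier G \<times> T)" using that bij_betw_imp_surj_on[OF T(2)] by simp
    then obtain q where "q \<in> carrier G \<times> T" "s = (\<lambda>(g, t). z g t) q" by (rule imageE)
    then show ?thesis by (cases q) auto
  qed
  let ?S = "{\<tau> \<in> {1..n} \<rightarrow>\<^sub>E T. inj_on \<tau> {1..n}}"
  let ?C = "({1..n} \<rightarrow>\<^sub>E carrier G) \<times> ?S"
  let ?h = "\<lambda>(\<gamma>, \<tau>). \<lambda>p\<in>X. z (fst p \<otimes> \<gamma> (snd p)) (\<tau> (snd p))"
  have XE: "fst p \<in> carrier G \<and> snd p \<in> {1..n}" if "p \<in> X" for p using that by (auto simp: points_def)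
  have pact: "p = act (fst p) (\<one>, snd p)" if "p \<in> X" for p using XE[OF that] by (simp add: act_unit)
  have h_F: "?h (\<gamma>, \<tau>) \<in> ?F" if \<gamma>: "\<gamma> \<in> {1..n} \<rightarrow>\<^sub>E carrier G" and \<tau>: "\<tau> \<in> ?S" for \<gamma> \<tau>
  proof -
    let ?f = "?h (\<gamma>, \<tau>)"
    have \<tau>': "\<tau> \<in> {1..n} \<rightarrow>\<^sub>E T" "inj_on \<tau> {1..n}" using \<tau> by auto
    have mem: "\<gamma> m \<in> carrier G" "\<tau> m \<in> T" "\<tau> m \<in> Z" if "m \<in> {1..n}" for m
      using PiE_mem[OF \<gamma> that] PiE_mem[OF \<tau>'(1) that] T(1) by auto
    have fE: "?f \<in> X \<rightarrow>\<^sub>E Z"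
      using mem XE unfolding prod.case by (intro PiE_I) (simp_all add: Z.a_closed)
    have eqv: "?f (act g p) = z g (?f p)" if g: "g \<in> carrier G" and p: "p \<in> X" for g p
    proof -
      have "act g p = (g \<otimes> fst p, snd p)" by (simp add: left_act_def split: prod.split)
      then show ?thesis using g p XE[OF p] mem[of "snd p"]
        by (simp add: Z.a_mult[symmetric] m_assoc) (metis act_X g p)
    qed
    have inj: "inj_on ?f X"
    proof (rule inj_onI)
      fix p q assume p: "p \<in> X" and q: "q \<in> X" and eq: "?f p = ?f q"
      have "fst p \<otimes> \<gamma> (snd p) = fst q \<otimes> \<gamma> (snd q) \<and> \<tau> (snd p) = \<tau> (snd q)"
        using eq p q XE[OF p] XE[OF q] mem by (intro T_eq) auto
      moreover from this have "snd p = snd q" using inj_onD[OF \<tau>'(2)] XE[OF p] XE[OF q] by blast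
      ultimately show "p = q" using XE[OF p] XE[OF q] mem by (simp add: prod_eq_iff)
    qed
    \<comment> \<open>Injectivity and equal cardinalities give surjectivity.\<close>
    have "card (?f ` X) = card Z" using card_image[OF inj] cZ by (simp add: card_X mult.commute)
    moreover have "?f ` X \<subseteq> Z" using fE by blast
    ultimately have "?f ` X = Z" using finZ by (intro card_subset_eq)
    then show ?thesis using fE eqv inj by (simp add: bij_betw_def)
  qed
  have "bij_betw ?h ?C ?F"
  proof (rule bij_betw_imageI)
    show "inj_on ?h ?C"
    proof (rule inj_onI)
      fix c c' assume c: "c \<in> ?C" and c': "c' \<in> ?C" and eq: "?h c = ?h c'"
      obtain \<gamma> \<tau> where gt: "c = (\<gamma>, \<tau>)" "\<gamma> \<in> {1..n} \<rightarrow>\<^sub>E carrier G" "\<tau> \<in> {1..n} \<rightarrow>\<^sub>E T" using c by blast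
      obtain \<gamma>' \<tau>' where gt': "c' = (\<gamma>', \<tau>')" "\<gamma>' \<in> {1..n} \<rightarrow>\<^sub>E carrier G" "\<tau>' \<in> {1..n} \<rightarrow>\<^sub>E T" using c' by blast
      have *: "\<gamma> m = \<gamma>' m \<and> \<tau> m = \<tau>' m" if m: "m \<in> {1..n}" for m
      proof (rule T_eq)
        show mem: "\<gamma> m \<in> carrier G" "\<gamma>' m \<in> carrier G" "\<tau> m \<in> T" "\<tau>' m \<in> T"
          using PiE_mem[OF gt(2) m] PiE_mem[OF gt'(2) m] PiE_mem[OF gt(3) m] PiE_mem[OF gt'(3) m] by simp_all
        show "z (\<gamma> m) (\<tau> m) = z (\<gamma>' m) (\<tau>' m)"
          using fun_cong[OF eq, of "(\<one>, m)"] mem points_unit[OF m] unfolding gt(1) gt'(1) by simp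
      qed
      show "c = c'" unfolding gt(1) gt'(1)
        using PiE_ext[OF gt(2) gt'(2)] PiE_ext[OF gt(3) gt'(3)] * by blast
    qed
    show "?h ` ?C = ?F"
    proof (intro subset_antisym subsetI)
      fix f assume "f \<in> ?h ` ?C"
      then obtain \<gamma> \<tau> where "f = ?h (\<gamma>, \<tau>)" "\<gamma> \<in> {1..n} \<rightarrow>\<^sub>E carrier G" "\<tau> \<in> ?S" by blast
      then show "f \<in> ?F" using h_F by blast
    next
      fix f assume f: "f \<in> ?F"
      have fZ: "f p \<in> Z" if "p \<in> X" for p using f that by blast
      have "\<forall>m\<in>{1..n}. \<exists>gt. fst gt \<in> carrier G \<and> snd gt \<in> T \<and> f (\<one>, m) = z (fst gt) (snd gt)"
        using T_ex[OF fZ[OF points_unit]] by fastforce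
      then obtain c where c: "\<And>m. m \<in> {1..n} \<Longrightarrow> fst (c m) \<in> carrier G \<and> snd (c m) \<in> T \<and> f (\<one>, m) = z (fst (c m)) (snd (c m))"
        by metis
      let ?\<gamma> = "\<lambda>m\<in>{1..n}. fst (c m)" and ?\<tau> = "\<lambda>m\<in>{1..n}. snd (c m)"
      have "inj_on ?\<tau> {1..n}"
      proof (rule inj_onI)
        fix m m' assume m: "m \<in> {1..n}" and m': "m' \<in> {1..n}" and eq: "?\<tau> m = ?\<tau> m'"
        let ?g = "fst (c m)" and ?g' = "fst (c m')"
        have cc: "?g \<in> carrier G" "?g' \<in> carrier G" "snd (c m') \<in> Z" using c[OF m] c[OF m'] T(1) by auto
        have "f (act (inv ?g) (\<one>, m)) = z (inv ?g) (z ?g (snd (c m)))"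
          using f cc c[OF m] points_unit[OF m] by simp
        also have "\<dots> = z (inv ?g) (z ?g (snd (c m')))" using eq m m' by simp
        also have "\<dots> = snd (c m')" using cc by (simp add: Z.a_mult[symmetric] Z.a_one)
        also have "\<dots> = z (inv ?g') (z ?g' (snd (c m')))" using cc by (simp add: Z.a_mult[symmetric] Z.a_one)
        also have "\<dots> = f (act (inv ?g') (\<one>, m'))"
          using f cc c[OF m'] points_unit[OF m'] by simp
        finally have "act (inv ?g) (\<one>, m) = act (inv ?g') (\<one>, m')"
          using f cc points_unit[OF m] points_unit[OF m'] by (intro inj_onD[OF bij_betw_imp_inj_on, of f X Z]) simp_all
        then show "m = m'" using cc by (simp add: act_unit)
      qed
      then have \<tau>: "?\<tau> \<in> ?S" using c by auto
      have \<gamma>: "?\<gamma> \<in> {1..n} \<rightarrow>\<^sub>E carrier G" using c by auto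
      have "f = ?h (?\<gamma>, ?\<tau>)"
      proof
        fix p
        show "f p = ?h (?\<gamma>, ?\<tau>) p"
        proof (cases "p \<in> X")
          case True
          have "f p = f (act (fst p) (\<one>, snd p))" using pact[OF True] by simp
          also have "\<dots> = z (fst p) (f (\<one>, snd p))" using f XE[OF True] points_unit by blast
          also have "\<dots> = z (fst p \<otimes> fst (c (snd p))) (snd (c (snd p)))"
            using c[of "snd p"] XE[OF True] T(1) by (auto simp: Z.a_mult)
          finally show ?thesis using True XE[OF True] by simp
        next
          case False
          then show ?thesis using PiE_arb[of f X "\<lambda>_. Z" p] f by simp
        qed
      qed
      then show "f \<in> ?h ` ?C" using \<tau> \<gamma> by blast
    qed
  qed
  then have "card ?F = card ?C" by (rule bij_betw_same_card[symmetric])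
  also have "card ?S = fact n"
    unfolding card_inj_on_subset_funcset[OF finite_atLeastAtMost finT order.refl] by (simp add: cT fact_prod_rev)
  then have "card ?C = Coset.order G ^ n * fact n"
    by (simp add: card_cartesian_product card_PiE Coset.order_def)
  finally show ?thesis .
qed

end

section \<open>Separating colourings and orbits of sequences\<close>

context dowling
begin

text \<open>The exponent vector of the monomial \<open>\<Psi>(x)\<close>.\<close>

definition cmon :: "('g \<times> nat \<Rightarrow> 'g \<times> nat) \<Rightarrow> (nat \<times> 'g set \<Rightarrow>\<^sub>0 nat)" where
  "cmon x = (\<Sum>u\<in>{1..n} \<times> conj_classes G. Poly_Mapping.single u (cycle_count G n x (fst u) (snd u)))"

lemma lookup_cmon:
  "Poly_Mapping.lookup (cmon x) u = (if u \<in> {1..n} \<times> conj_classes G then cycle_count G n x (fst u) (snd u) else 0)"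
proof -
  have fin: "finite ({1..n} \<times> conj_classes G)" using finite_conj_classes[OF finG] by simp
  have "Poly_Mapping.lookup (cmon x) u
      = (\<Sum>v\<in>{1..n} \<times> conj_classes G. if v = u then cycle_count G n x (fst u) (snd u) else 0)"
    unfolding cmon_def lookup_sum by (intro sum.cong) (auto simp: lookup_single when_def)
  then show ?thesis using fin by simp
qed

lemma cmon_keys: "Poly_Mapping.keys (cmon x) \<subseteq> cvars G"
  using lookup_cmon[of x] by (auto simp: in_keys_iff cvars_def split: if_splits)

lemma cycle_monomial_cmon: "cycle_monomial G n x = mmon (cmon x) 1"
  unfolding cycle_monomial_def cmon_def
  by (simp add: mvar_power mmon_prod case_prod_unfold del: One_nat_def)

lemma snd_act: "snd (act g p) = snd p"
  by (simp add: left_act_def split_beta)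

lemma funpow_snd:
  assumes x: "x \<in> wreath G n" and p: "p \<in> X"
  shows "snd ((x ^^ k) p) = (base_perm G x ^^ k) (snd p)"
proof (induction k)
  case (Suc k)
  have step: "snd (x q) = base_perm G x (snd q)" if q: "q \<in> X" for q
  proof -
    have g: "fst q \<in> carrier G" "(\<one>, snd q) \<in> X" using q by (auto simp: points_def)
    have "x q = act (fst q) (x (\<one>, snd q))"
      using wreath_act[OF x g] by (simp add: act_unit g(1))
    then show ?thesis by (simp add: base_perm_def left_act_def split: prod.split)
  qed
  show ?case using step[of "(x ^^ k) p"] funpow_X[OF x] p Suc by simp
qed simp

end

section \<open>Embeddings into periodic sequences\<close>

locale dowling_sequences = dowling G n + Q: sequences G B b
  for G :: "('g, 'm) monoid_scheme" (structure) and n :: nat and B :: "'s set" and b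
begin

text \<open>Such a map turns \<open>x\<close> into the shift, hence cycles of \<open>x\<close> into
  orbits of sequences and the types of the former into the types of the latter.\<close>

definition embedding :: "('g \<times> nat \<Rightarrow> 'g \<times> nat) \<Rightarrow> ('g \<times> nat \<Rightarrow> nat \<Rightarrow> 's) \<Rightarrow> bool" where
  "embedding x f \<longleftrightarrow> x \<in> wreath G n \<and> f \<in> X \<rightarrow>\<^sub>E Q.Y \<and> inj_on f X \<and>
     (\<forall>g\<in>carrier G. \<forall>p\<in>X. f (act g p) = Q.sact g (f p)) \<and> (\<forall>p\<in>X. f (x p) = Q.shift 1 (f p))"

context
  fixes x f assumes e: "embedding x f"
begin

lemma emb_x: "x \<in> wreath G n"
  and emb_Y: "p \<in> X \<Longrightarrow> f p \<in> Q.Y"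
  and emb_inj: "p \<in> X \<Longrightarrow> q \<in> X \<Longrightarrow> f p = f q \<Longrightarrow> p = q"
  and emb_act: "g \<in> carrier G \<Longrightarrow> p \<in> X \<Longrightarrow> f (act g p) = Q.sact g (f p)"
  and emb_step: "p \<in> X \<Longrightarrow> f (x p) = Q.shift 1 (f p)"
  using e unfolding embedding_def by (blast dest: inj_onD)+

lemma emb_shift: "p \<in> X \<Longrightarrow> f ((x ^^ k) p) = Q.shift k (f p)"
proof (induction k)
  case (Suc k)
  have "f ((x ^^ Suc k) p) = Q.shift 1 (f ((x ^^ k) p))" using emb_step funpow_X[OF emb_x] Suc.prems by simp
  then show ?case using Suc by (simp add: Q.shift_shift)
qed simp

abbreviation "y m \<equiv> f (\<one>, m)"

lemma emb_sact_shift: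
  assumes p: "p \<in> X" and g: "g \<in> carrier G"
  shows "Q.sact g (Q.shift k (f p)) = f (act g ((x ^^ k) p))"
  using emb_act[OF g] emb_shift[OF p] funpow_X[OF emb_x] p by simp

lemma emb_big_subset: "p \<in> X \<Longrightarrow> Q.big (f p) \<subseteq> f ` X"
proof
  fix z assume p: "p \<in> X" and "z \<in> Q.big (f p)"
  then obtain g k where g: "g \<in> carrier G" "z = Q.sact g (Q.shift k (f p))" by (auto simp: Q.big_def)
  have "act g ((x ^^ k) p) \<in> X" using g(1) funpow_X[OF emb_x] p by simp
  then show "z \<in> f ` X" unfolding g(2) emb_sact_shift[OF p g(1)] by (rule imageI)
qed

lemma emb_Union_big: "\<Union> (Q.big ` f ` X) = f ` X"
  using emb_big_subset Q.big_self emb_Y by blast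

lemma emb_eq_unit:
  assumes m: "m \<in> {1..n}"
  shows "f ((x ^^ period) (\<one>, m)) = Q.sact h (y m) \<Longrightarrow> h \<in> carrier G \<Longrightarrow> (x ^^ period) (\<one>, m) = (h, m)"
proof -
  assume *: "f ((x ^^ period) (\<one>, m)) = Q.sact h (y m)" and h: "h \<in> carrier G"
  have "f ((x ^^ period) (\<one>, m)) = f (act h (\<one>, m))" using * emb_act[OF h points_unit[OF m]] by simp
  then have "(x ^^ period) (\<one>, m) = act h (\<one>, m)"
    using emb_inj[of "(x ^^ period) (\<one>, m)" "act h (\<one>, m)"] funpow_X[OF emb_x] points_unit[OF m] h by simp
  then show ?thesis by (simp add: act_unit h)
qed

text \<open>The relation between shift and twist is read back through the injective
  \<open>f\<close>: the return of \<open>(\<one>, m)\<close> to the fibre over \<open>m\<close>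
  shows the group element that defines the type of the cycle.\<close>

lemma emb_period: "m \<in> {1..n} \<Longrightarrow> (x ^^ Q.period (y m)) (\<one>, m) = (Q.twist (y m), m)"
  using emb_eq_unit emb_shift[OF points_unit] Q.shift_period[OF emb_Y[OF points_unit]] Q.twist_carrier[OF emb_Y[OF points_unit]]
  by simp

text \<open>\<open>orbit\<close> collects positive iterates only; since \<open>m\<close> returns to
  itself, the iterate \<open>k = 0\<close> may be included.\<close>

lemma mem_orbit_iff:
  assumes m: "m \<in> {1..n}"
  shows "m' \<in> orbit (base_perm G x) m \<longleftrightarrow> (\<exists>k. (base_perm G x ^^ k) m = m')"
proof -
  have "(base_perm G x ^^ Q.period (y m)) m = m"
    using funpow_snd[OF emb_x points_unit[OF m], of "Q.period (y m)"] emb_period[OF m] by simp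
  then have "m \<in> orbit (base_perm G x) m"
    using Q.period_pos[OF emb_Y[OF points_unit[OF m]]] unfolding orbit_altdef by (metis (mono_tags, lifting) mem_Collect_eq)
  then show ?thesis by (subst orbit_altdef_self_in) auto
qed

lemma orbit_eq_big:
  assumes m: "m \<in> {1..n}"
  shows "orbit (base_perm G x) m = {m' \<in> {1..n}. y m' \<in> Q.big (y m)}"
proof (intro subset_antisym subsetI)
  have p: "(\<one>, m) \<in> X" by (rule points_unit[OF m])
  {
    fix m' assume "m' \<in> orbit (base_perm G x) m"
    then obtain k where k: "(base_perm G x ^^ k) m = m'" using mem_orbit_iff[OF m] by blast
    let ?q = "(x ^^ k) (\<one>, m)"
    have q: "?q \<in> X" "snd ?q = m'" using funpow_X[OF emb_x] p funpow_snd[OF emb_x p] k by simp_all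
    then have g: "fst ?q \<in> carrier G" "m' \<in> {1..n}" by (auto simp: points_def)
    have "?q = act (fst ?q) (\<one>, m')" using act_unit[OF g(1), of m'] q(2) by (simp add: prod_eq_iff)
    then have "(\<one>, m') = act (inv (fst ?q)) ?q" using act_inv(1)[OF g(1) points_unit[OF g(2)]] by simp
    then have "y m' = Q.sact (inv (fst ?q)) (Q.shift k (y m))" using emb_sact_shift[OF p, of "inv (fst ?q)" k] g by simp
    then have "y m' \<in> Q.big (y m)" using Q.bigI[of "inv (fst ?q)"] g by simp
    then show "m' \<in> {m' \<in> {1..n}. y m' \<in> Q.big (y m)}" using g by blast
  next
    fix m' assume "m' \<in> {m' \<in> {1..n}. y m' \<in> Q.big (y m)}"
    then obtain g k where g: "m' \<in> {1..n}" "g \<in> carrier G" "y m' = Q.sact g (Q.shift k (y m))"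
      by (auto simp: Q.big_def)
    have "(\<one>, m') = act g ((x ^^ k) (\<one>, m))"
      using g(3) unfolding emb_sact_shift[OF p g(2)]
      by (intro emb_inj points_unit g(1) act_X g(2)) (simp_all add: funpow_X[OF emb_x] p)
    then have "snd (\<one>, m') = snd ((x ^^ k) (\<one>, m))" by (simp only: snd_act)
    then have "(base_perm G x ^^ k) m = m'" using funpow_snd[OF emb_x p, of k] by simp
    then show "m' \<in> orbit (base_perm G x) m" using mem_orbit_iff[OF m] by blast
  }
qed

text \<open>\<open>f\<close> maps \<open>G\<close> times the cycle bijectively onto an orbit of
  sequences, whose size is known from \<open>card_big\<close>.\<close>

lemma card_orbit_base_perm:
  assumes m: "m \<in> {1..n}"
  shows "card (orbit (base_perm G x) m) = Q.period (y m)"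
proof -
  let ?O = "orbit (base_perm G x) m"
  have p: "(\<one>, m) \<in> X" by (rule points_unit[OF m])
  have O: "?O \<subseteq> {1..n}" using orbit_eq_big[OF m] by blast
  have sub: "carrier G \<times> ?O \<subseteq> X" using O by (auto simp: points_def)
  have "f ` (carrier G \<times> ?O) = Q.big (y m)"
  proof (intro subset_antisym subsetI)
    fix z assume "z \<in> f ` (carrier G \<times> ?O)"
    then obtain g m' where g: "z = f (g, m')" "g \<in> carrier G" "m' \<in> ?O" by blast
    have m': "m' \<in> {1..n}" "y m' \<in> Q.big (y m)" using g(3) orbit_eq_big[OF m] by blast+
    have "z = Q.sact g (y m')" using emb_act[OF g(2) points_unit[OF m'(1)]] g(1) act_unit[OF g(2)] by simp
    then show "z \<in> Q.big (y m)" using Q.big_closed(2)[OF emb_Y[OF p] m'(2) g(2)] by simp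
  next
    fix z assume "z \<in> Q.big (y m)"
    then obtain g k where g: "g \<in> carrier G" "z = Q.sact g (Q.shift k (y m))" by (auto simp: Q.big_def)
    let ?q = "act g ((x ^^ k) (\<one>, m))"
    have q: "?q \<in> X" using g(1) funpow_X[OF emb_x] p by simp
    have "snd ?q = (base_perm G x ^^ k) m"
      using funpow_snd[OF emb_x p, of k] by (simp add: snd_act)
    then have "snd ?q \<in> ?O" unfolding mem_orbit_iff[OF m] by (intro exI[of _ k]) (rule sym)
    moreover have "fst ?q \<in> carrier G" using q by (auto simp: points_def)
    ultimately have "?q \<in> carrier G \<times> ?O" by (simp add: mem_Times_iff)
    then show "z \<in> f ` (carrier G \<times> ?O)" using g(2) emb_sact_shift[OF p g(1)] by auto
  qed
  moreover have "inj_on f (carrier G \<times> ?O)" using emb_inj sub by (meson inj_onI subsetD)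
  ultimately have "card (carrier G \<times> ?O) = Q.period (y m) * Coset.order G"
    using card_image Q.card_big[OF emb_Y[OF p]] by metis
  then show ?thesis using order_pos by (simp add: card_cartesian_product Coset.order_def)
qed

text \<open>All points of a cycle belong to the same orbit of sequences, so they have the same
  period and conjugate twists; any \<open>m'\<close> on the cycle shows the same type.\<close>

lemma cycle_type_iff:
  assumes m: "m \<in> {1..n}"
  shows "card (orbit (base_perm G x) m) = i \<and> (\<exists>m'\<in>orbit (base_perm G x) m. \<exists>h. (x ^^ i) (\<one>, m') = (h, m') \<and> conj_class G h = c)
    \<longleftrightarrow> Q.seq_type (y m) = (i, c)"
proof -
  have ty: "Q.seq_type (y m') = Q.seq_type (y m) \<and> m' \<in> {1..n}" if "m' \<in> orbit (base_perm G x) m" for m'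
    using that Q.big_type[OF emb_Y[OF points_unit[OF m]]] unfolding orbit_eq_big[OF m] by blast
  have self: "m \<in> orbit (base_perm G x) m"
    using mem_orbit_iff[OF m] by (metis funpow_0)
  show ?thesis
  proof
    assume "card (orbit (base_perm G x) m) = i \<and> (\<exists>m'\<in>orbit (base_perm G x) m. \<exists>h. (x ^^ i) (\<one>, m') = (h, m') \<and> conj_class G h = c)"
    then obtain m' h where *: "Q.period (y m) = i" "m' \<in> orbit (base_perm G x) m"
      "(x ^^ i) (\<one>, m') = (h, m')" "conj_class G h = c" using card_orbit_base_perm[OF m] by auto
    have t: "Q.seq_type (y m') = Q.seq_type (y m)" "m' \<in> {1..n}" using ty[OF *(2)] by auto
    then have "Q.period (y m') = i" using *(1) by (simp add: Q.seq_type_def)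
    then have "h = Q.twist (y m')" using emb_period[OF t(2)] *(3) by simp
    then show "Q.seq_type (y m) = (i, c)" using t(1) *(4) \<open>Q.period (y m') = i\<close> by (simp add: Q.seq_type_def)
  next
    assume t: "Q.seq_type (y m) = (i, c)"
    then have "Q.period (y m) = i" "conj_class G (Q.twist (y m)) = c" by (simp_all add: Q.seq_type_def)
    then show "card (orbit (base_perm G x) m) = i \<and> (\<exists>m'\<in>orbit (base_perm G x) m. \<exists>h. (x ^^ i) (\<one>, m') = (h, m') \<and> conj_class G h = c)"
      using card_orbit_base_perm[OF m] emb_period[OF m] self by blast
  qed
qed

lemma big_image: "Q.big ` f ` X = (\<lambda>m. Q.big (y m)) ` {1..n}"
proof (intro subset_antisym subsetI)
  fix Z assume "Z \<in> Q.big ` f ` X"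
  then obtain g m where g: "Z = Q.big (f (g, m))" "g \<in> carrier G" "m \<in> {1..n}" by (auto simp: points_def)
  have "f (g, m) = Q.sact g (Q.shift 0 (y m))" using emb_act[OF g(2) points_unit[OF g(3)]] act_unit[OF g(2)] by simp
  then have "f (g, m) \<in> Q.big (y m)" using Q.bigI[OF g(2), of 0 "y m"] by simp
  then have "Z = Q.big (y m)" unfolding g(1) by (rule Q.big_eq[OF emb_Y[OF points_unit[OF g(3)]]])
  then show "Z \<in> (\<lambda>m. Q.big (y m)) ` {1..n}" using g(3) by blast
qed (use points_unit in blast)

lemma cycle_count_eq: "cycle_count G n x i c = card (Q.big ` f ` X \<inter> Q.bigs (i, c))"
proof -
  let ?M = "{m \<in> {1..n}. Q.seq_type (y m) = (i, c)}"
  \<comment> \<open>Recovers the cycle from its orbit of sequences; it is injective on the orbits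
    that occur, so cycles and orbits are equally numerous.\<close>
  let ?H = "\<lambda>Z. {m' \<in> {1..n}. y m' \<in> Z}"
  have 1: "{C \<in> orbit (base_perm G x) ` {1..n}. card C = i \<and>
       (\<exists>m\<in>C. \<exists>h. (x ^^ i) (\<one>, m) = (h, m) \<and> conj_class G h = c)} = orbit (base_perm G x) ` ?M"
    using cycle_type_iff by blast
  have 2: "Q.big ` f ` X \<inter> Q.bigs (i, c) = (\<lambda>m. Q.big (y m)) ` ?M"
  proof (intro subset_antisym subsetI)
    fix Z assume Z: "Z \<in> Q.big ` f ` X \<inter> Q.bigs (i, c)"
    then obtain m where m: "m \<in> {1..n}" "Z = Q.big (y m)" unfolding big_image by blast
    obtain w where w: "w \<in> Q.Y" "Q.seq_type w = (i, c)" "Z = Q.big w" using Z by (auto simp: Q.bigs_def)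
    have "y m \<in> Q.big w" using Q.big_self[OF emb_Y[OF points_unit[OF m(1)]]] m(2) w(3) by simp
    then have "Q.seq_type (y m) = (i, c)" using Q.big_type[OF w(1)] w(2) by simp
    then show "Z \<in> (\<lambda>m. Q.big (y m)) ` ?M" using m by blast
  next
    fix Z assume "Z \<in> (\<lambda>m. Q.big (y m)) ` ?M"
    then obtain m where m: "m \<in> {1..n}" "Q.seq_type (y m) = (i, c)" "Z = Q.big (y m)" by blast
    then show "Z \<in> Q.big ` f ` X \<inter> Q.bigs (i, c)"
      using points_unit emb_Y[OF points_unit[OF m(1)]] unfolding Q.bigs_def by blast
  qed
  have "orbit (base_perm G x) ` ?M = ?H ` (\<lambda>m. Q.big (y m)) ` ?M"
    unfolding image_image using orbit_eq_big by (intro image_cong) auto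
  moreover have "inj_on ?H ((\<lambda>m. Q.big (y m)) ` ?M)"
  proof (rule inj_onI)
    fix Z W assume Z: "Z \<in> (\<lambda>m. Q.big (y m)) ` ?M" and W: "W \<in> (\<lambda>m. Q.big (y m)) ` ?M" and eq: "?H Z = ?H W"
    obtain m where m: "m \<in> {1..n}" "Z = Q.big (y m)" using Z by blast
    obtain l where l: "l \<in> {1..n}" "W = Q.big (y l)" using W by blast
    have "y m \<in> Z" using Q.big_self[OF emb_Y[OF points_unit[OF m(1)]]] m(2) by simp
    then have "y m \<in> W" using eq m(1) by blast
    then show "Z = W" unfolding m(2) l(2) by (rule Q.big_eq[OF emb_Y[OF points_unit[OF l(1)]]])
  qed
  ultimately show ?thesis unfolding cycle_count_def 1 2 by (simp only: card_image)
qed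

lemma lookup_cmon_emb: "Poly_Mapping.lookup (cmon x) u = card (Q.big ` f ` X \<inter> Q.bigs u)"
proof (cases "Q.big ` f ` X \<inter> Q.bigs u = {}")
  case True
  then show ?thesis using cycle_count_eq[of "fst u" "snd u"] unfolding lookup_cmon by simp
next
  case False
  then obtain m where m: "m \<in> {1..n}" "Q.big (y m) \<in> Q.bigs u" unfolding big_image by blast
  then obtain w where w: "w \<in> Q.Y" "Q.seq_type w = u" "Q.big (y m) = Q.big w" by (auto simp: Q.bigs_def)
  have ym: "y m \<in> Q.Y" by (rule emb_Y[OF points_unit[OF m(1)]])
  have "y m \<in> Q.big w" using Q.big_self[OF ym] w(3) by simp
  then have t: "Q.seq_type (y m) = u" using Q.big_type[OF w(1)] w(2) by simp
  have "orbit (base_perm G x) m \<subseteq> {1..n}" using orbit_eq_big[OF m(1)] by blast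
  then have "card (orbit (base_perm G x) m) \<le> card {1..n}" by (intro card_mono) auto
  then have "fst u \<le> n" using card_orbit_base_perm[OF m(1)] t by (auto simp: Q.seq_type_def)
  moreover have "u \<in> cvars G" using Q.seq_type_cvars[OF ym] t by simp
  ultimately have "u \<in> {1..n} \<times> conj_classes G" by (auto simp: cvars_def)
  then show ?thesis using cycle_count_eq[of "fst u" "snd u"] unfolding lookup_cmon by simp
qed

end

section \<open>Sets of orbits of prescribed types\<close>

definition orbit_sets :: "(nat \<times> 'g set \<Rightarrow>\<^sub>0 nat) \<Rightarrow> (nat \<Rightarrow> 's) set set set" where
  "orbit_sets m = {\<Omega>. \<Omega> \<subseteq> (\<Union>u\<in>Poly_Mapping.keys m. Q.bigs u)
     \<and> (\<forall>u\<in>Poly_Mapping.keys m. card (\<Omega> \<inter> Q.bigs u) = Poly_Mapping.lookup m u)}"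

lemma bigs_disjoint: "u \<noteq> v \<Longrightarrow> Q.bigs u \<inter> Q.bigs v = {}"
proof (rule ccontr)
  assume uv: "u \<noteq> v" and "Q.bigs u \<inter> Q.bigs v \<noteq> {}"
  then obtain w z where wz: "w \<in> Q.Y" "Q.seq_type w = u" "z \<in> Q.Y" "Q.seq_type z = v" "Q.big w = Q.big z"
    by (auto simp: Q.bigs_def)
  then have "z \<in> Q.big w" using Q.big_self by blast
  then show False using Q.big_type[OF wz(1)] wz(2,4) uv by simp
qed

text \<open>The orbits of different types are chosen independently, whence the product of binomial
  coefficients.\<close>

lemma card_orbit_sets:
  "card (orbit_sets m) = (\<Prod>u\<in>Poly_Mapping.keys m. card (Q.bigs u) choose Poly_Mapping.lookup m u)"
  "finite (orbit_sets m)"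
  unfolding orbit_sets_def using Q.finite_bigs bigs_disjoint
  by (intro card_subsets_of_types finite_keys; blast)+

lemma orbit_setsD:
  assumes \<Omega>: "\<Omega> \<in> orbit_sets m" and Z: "Z \<in> \<Omega>"
  obtains w where "w \<in> Q.Y" "Z = Q.big w"
  using assms unfolding orbit_sets_def Q.bigs_def by blast

lemma big_Union:
  assumes \<Omega>: "\<Omega> \<in> orbit_sets m"
  shows "\<Union> \<Omega> \<subseteq> Q.Y" "Q.big ` \<Union> \<Omega> = \<Omega>"
proof -
  show "\<Union> \<Omega> \<subseteq> Q.Y"
  proof
    fix z assume "z \<in> \<Union> \<Omega>"
    then obtain Z where Z: "Z \<in> \<Omega>" "z \<in> Z" by blast
    obtain w where "w \<in> Q.Y" "Z = Q.big w" by (rule orbit_setsD[OF \<Omega> Z(1)])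
    then show "z \<in> Q.Y" using Q.big_subset Z(2) by blast
  qed
  show "Q.big ` \<Union> \<Omega> = \<Omega>"
  proof (intro subset_antisym subsetI)
    fix W assume "W \<in> Q.big ` \<Union> \<Omega>"
    then obtain Z z where Z: "Z \<in> \<Omega>" "z \<in> Z" "W = Q.big z" by blast
    obtain w where "w \<in> Q.Y" "Z = Q.big w" by (rule orbit_setsD[OF \<Omega> Z(1)])
    then show "W \<in> \<Omega>" using Q.big_eq[of w z] Z by simp
  next
    fix Z assume Z: "Z \<in> \<Omega>"
    obtain w where "w \<in> Q.Y" "Z = Q.big w" by (rule orbit_setsD[OF \<Omega> Z])
    then show "Z \<in> Q.big ` \<Union> \<Omega>" using Q.big_self[of w] Z by blast
  qed
qed

text \<open>An orbit of type \<open>u\<close> has \<open>fst u * |G|\<close> elements. The union of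
  the orbits thus has the size of \<open>X\<close> exactly when \<open>wt m = n\<close>.\<close>

lemma card_Union_orbits:
  assumes \<Omega>: "\<Omega> \<in> orbit_sets m"
  shows "card (\<Union> \<Omega>) = wt m * Coset.order G" "finite (\<Union> \<Omega>)"
proof -
  let ?K = "Poly_Mapping.keys m"
  have sub: "\<Omega> \<subseteq> (\<Union>u\<in>?K. Q.bigs u)" and c: "\<And>u. u \<in> ?K \<Longrightarrow> card (\<Omega> \<inter> Q.bigs u) = Poly_Mapping.lookup m u"
    using \<Omega> by (auto simp: orbit_sets_def)
  have fin: "finite (\<Union>u\<in>?K. Q.bigs u)" using Q.finite_bigs by simp
  have fin\<Omega>: "finite \<Omega>" using sub fin by (rule finite_subset)
  have cu: "card Z = fst u * Coset.order G" if "Z \<in> Q.bigs u" for Z u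
    using that by (auto simp: Q.bigs_def Q.card_big Q.seq_type_def)
  have finZ: "finite Z" if Z: "Z \<in> \<Omega>" for Z
  proof -
    obtain w where w: "w \<in> Q.Y" "Z = Q.big w" by (rule orbit_setsD[OF \<Omega> Z])
    have "Z \<subseteq> {y \<in> Q.Y. Q.seq_type y = Q.seq_type w}"
      using Q.big_type[OF w(1)] Q.big_subset[OF w(1)] w(2) by blast
    then show ?thesis using Q.finite_type by (rule finite_subset)
  qed
  show "finite (\<Union> \<Omega>)" using fin\<Omega> finZ by blast
  have disj: "Z \<inter> W = {}" if ZW: "Z \<in> \<Omega>" "W \<in> \<Omega>" "Z \<noteq> W" for Z W
  proof (rule ccontr)
    obtain w where w: "w \<in> Q.Y" "Z = Q.big w" by (rule orbit_setsD[OF \<Omega> ZW(1)])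
    obtain v where v: "v \<in> Q.Y" "W = Q.big v" by (rule orbit_setsD[OF \<Omega> ZW(2)])
    assume "Z \<inter> W \<noteq> {}"
    then obtain z where "z \<in> Q.big w" "z \<in> Q.big v" using w v by blast
    then show False using Q.big_eq w v ZW(3) by metis
  qed
  have "card (\<Union> \<Omega>) = (\<Sum>Z\<in>\<Omega>. card Z)"
    using fin\<Omega> finZ disj card_UN_disjoint[of \<Omega> "\<lambda>Z. Z"] by simp
  also have "\<dots> = (\<Sum>Z\<in>(\<Union>u\<in>?K. \<Omega> \<inter> Q.bigs u). card Z)"
    using sub by (intro sum.cong) auto
  also have "\<dots> = (\<Sum>u\<in>?K. \<Sum>Z\<in>\<Omega> \<inter> Q.bigs u. card Z)"
  proof -
    have "\<Omega> \<inter> Q.bigs u \<inter> (\<Omega> \<inter> Q.bigs v) = {}" if "u \<noteq> v" for u v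
      using bigs_disjoint[OF that] by blast
    then show ?thesis using fin\<Omega> by (intro sum.UNION_disjoint) simp_all
  qed
  also have "\<dots> = (\<Sum>u\<in>?K. fst u * Poly_Mapping.lookup m u * Coset.order G)"
  proof (rule sum.cong[OF refl])
    fix u assume u: "u \<in> ?K"
    have "(\<Sum>Z\<in>\<Omega> \<inter> Q.bigs u. card Z) = (\<Sum>Z\<in>\<Omega> \<inter> Q.bigs u. fst u * Coset.order G)"
      by (rule sum.cong[OF refl]) (use cu in blast)
    then show "(\<Sum>Z\<in>\<Omega> \<inter> Q.bigs u. card Z) = fst u * Poly_Mapping.lookup m u * Coset.order G"
      by (simp add: c[OF u])
  qed
  finally show "card (\<Union> \<Omega>) = wt m * Coset.order G" by (simp add: weight_def sum_distrib_right)
qed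

lemma embedding_orbit_set:
  assumes e: "embedding x f"
  shows "Q.big ` f ` X \<in> orbit_sets (cmon x)"
proof -
  have "Q.big (f p) \<in> (\<Union>u\<in>Poly_Mapping.keys (cmon x). Q.bigs u)" if p: "p \<in> X" for p
  proof -
    let ?u = "Q.seq_type (f p)"
    have b: "Q.big (f p) \<in> Q.bigs ?u" using emb_Y[OF e p] by (auto simp: Q.bigs_def)
    then have "Q.big ` f ` X \<inter> Q.bigs ?u \<noteq> {}" using p by blast
    then have "?u \<in> Poly_Mapping.keys (cmon x)"
      using finite_X by (simp add: in_keys_iff lookup_cmon_emb[OF e])
    then show ?thesis using b by blast
  qed
  then show ?thesis unfolding orbit_sets_def using lookup_cmon_emb[OF e] by auto
qed

lemma embedding_wt:
  assumes e: "embedding x f"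
  shows "wt (cmon x) = n"
proof -
  have "inj_on f X" using e by (simp add: embedding_def)
  then have "card (f ` X) = card X" by (rule card_image)
  then have "wt (cmon x) * Coset.order G = n * Coset.order G"
    using card_Union_orbits(1)[OF embedding_orbit_set[OF e]] unfolding emb_Union_big[OF e] by (simp add: card_X mult.commute)
  then show ?thesis using order_pos by simp
qed

section \<open>Separating colourings as embeddings\<close>

definition colourings :: "('g \<times> nat \<Rightarrow> 'g \<times> nat) \<Rightarrow> ('g \<times> nat \<Rightarrow> 's) set" where
  "colourings x = {\<phi> \<in> X \<rightarrow>\<^sub>E B. (\<forall>g\<in>carrier G. \<forall>p\<in>X. \<phi> (act g p) = b g (\<phi> p)) \<and> separating x \<phi>}"

text \<open>The itinerary of a point: the colours met along its iterates. That \<open>\<phi>\<close>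
  separates points for \<open>x\<close> is injectivity of this map.\<close>

definition emb :: "('g \<times> nat \<Rightarrow> 'g \<times> nat) \<Rightarrow> ('g \<times> nat \<Rightarrow> 's) \<Rightarrow> 'g \<times> nat \<Rightarrow> nat \<Rightarrow> 's" where
  "emb x \<phi> = (\<lambda>p\<in>X. \<lambda>k. \<phi> ((x ^^ k) p))"

lemma embedding_emb:
  assumes x: "x \<in> wreath G n" and \<phi>: "\<phi> \<in> colourings x"
  shows "embedding x (emb x \<phi>)"
proof -
  have \<phi>': "\<phi> \<in> X \<rightarrow>\<^sub>E B" "\<And>g p. g \<in> carrier G \<Longrightarrow> p \<in> X \<Longrightarrow> \<phi> (act g p) = b g (\<phi> p)" "separating x \<phi>"
    using \<phi> by (auto simp: colourings_def)
  obtain N where N: "N > 0" "x ^^ N = id"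
    using permutes_finite_order[OF finite_X wreath_permutes[OF x]] .
  have Y: "emb x \<phi> p \<in> Q.Y" if p: "p \<in> X" for p
  proof -
    have s: "emb x \<phi> p \<in> Q.seqs"
      unfolding Q.seqs_def using PiE_mem[OF \<phi>'(1)] funpow_X[OF x] p by (simp add: emb_def)
    \<comment> \<open>The finite order of \<open>x\<close> gives a genuine period, with trivial
      group element.\<close>
    have "Q.shift N (emb x \<phi> p) = emb x \<phi> p"
      using p N(2) by (simp add: emb_def Q.shift_def funpow_add)
    then have "Q.per (emb x \<phi> p) N \<one>" using N(1) Q.S.a_one[OF s] by (simp add: Q.per_def)
    then show ?thesis using s unfolding Q.Y_def by blast
  qed
  have "emb x \<phi> \<in> X \<rightarrow>\<^sub>E Q.Y" using Y by (auto simp: emb_def)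
  moreover have "inj_on (emb x \<phi>) X"
  proof (rule inj_onI)
    fix p q assume p: "p \<in> X" and q: "q \<in> X" and eq: "emb x \<phi> p = emb x \<phi> q"
    have "\<phi> ((x ^^ k) p) = \<phi> ((x ^^ k) q)" for k using fun_cong[OF eq, of k] p q by (simp add: emb_def)
    then show "p = q" using \<phi>'(3) p q unfolding separating_def by blast
  qed
  moreover have "emb x \<phi> (act g p) = Q.sact g (emb x \<phi> p)" if "g \<in> carrier G" "p \<in> X" for g p
    using that by (simp add: emb_def Q.sact_def funpow_act[OF x] funpow_X[OF x] \<phi>'(2))
  moreover have "emb x \<phi> (x p) = Q.shift 1 (emb x \<phi> p)" if "p \<in> X" for p
    using that by (simp add: emb_def Q.shift_def wreath_X[OF x] funpow_swap1)
  ultimately show ?thesis using x by (simp add: embedding_def)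
qed

definition equivariant_bijections :: "(nat \<Rightarrow> 's) set \<Rightarrow> ('g \<times> nat \<Rightarrow> nat \<Rightarrow> 's) set" where
  "equivariant_bijections Z = {f \<in> X \<rightarrow>\<^sub>E Z. (\<forall>g\<in>carrier G. \<forall>p\<in>X. f (act g p) = Q.sact g (f p)) \<and> bij_betw f X Z}"

lemma card_equivariant_bijections:
  assumes \<Omega>: "\<Omega> \<in> orbit_sets m" and m: "wt m = n"
  shows "card (equivariant_bijections (\<Union> \<Omega>)) = Coset.order G ^ n * fact n"
  unfolding equivariant_bijections_def
proof (rule card_equivariant_bij)
  show "finite (\<Union> \<Omega>)" "card (\<Union> \<Omega>) = n * Coset.order G" using card_Union_orbits[OF \<Omega>] m by simp_all
  have s: "\<Union> \<Omega> \<subseteq> Q.seqs" using big_Union(1)[OF \<Omega>] Q.Y_seqs by blast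
  show "free_action G (\<Union> \<Omega>) Q.sact"
  proof unfold_locales
    fix g z assume g: "g \<in> carrier G" and "z \<in> \<Union> \<Omega>"
    then obtain Z where Z: "Z \<in> \<Omega>" "z \<in> Z" by blast
    obtain w where "w \<in> Q.Y" "Z = Q.big w" by (rule orbit_setsD[OF \<Omega> Z(1)])
    then have "Q.sact g z \<in> Z" using Q.big_closed(2) Z(2) g by blast
    then show "Q.sact g z \<in> \<Union> \<Omega>" using Z(1) by blast
  qed (use s Q.S.a_one Q.S.a_mult Q.S.a_free in blast)+
qed

text \<open>A bijection onto a shift-stable set carries its own permutation and colouring:
  \<open>x\<close> is the shift pulled back through \<open>f\<close>, and \<open>\<phi>\<close> is
  the entry at position 0. Injectivity of the shift on periodic sequences makes \<open>x\<close> a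
  permutation.\<close>

lemma bijection_embedding:
  assumes \<Omega>: "\<Omega> \<in> orbit_sets m" and f: "f \<in> equivariant_bijections (\<Union> \<Omega>)"
  obtains x \<phi> where "embedding x f" "\<phi> \<in> colourings x" "f = emb x \<phi>" "cmon x = m"
proof -
  have f': "f \<in> X \<rightarrow>\<^sub>E \<Union> \<Omega>" "\<And>g p. g \<in> carrier G \<Longrightarrow> p \<in> X \<Longrightarrow> f (act g p) = Q.sact g (f p)"
    "inj_on f X" "f ` X = \<Union> \<Omega>"
    using f by (auto simp: equivariant_bijections_def bij_betw_def)
  have fY: "f p \<in> Q.Y" if "p \<in> X" for p using f'(4) big_Union(1)[OF \<Omega>] that by blast
  define x where "x p = (if p \<in> X then inv_into X f (Q.shift 1 (f p)) else p)" for p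
  have sh: "Q.shift 1 (f p) \<in> f ` X" if p: "p \<in> X" for p
  proof -
    have "f p \<in> \<Union> \<Omega>" using f'(4) p by blast
    then obtain Z where Z: "Z \<in> \<Omega>" "f p \<in> Z" by blast
    obtain w where "w \<in> Q.Y" "Z = Q.big w" by (rule orbit_setsD[OF \<Omega> Z(1)])
    then have "Q.shift 1 (f p) \<in> Z" using Q.big_closed(1) Z(2) by blast
    then show ?thesis unfolding f'(4) using Z(1) by blast
  qed
  have xX: "x p \<in> X" and fx: "f (x p) = Q.shift 1 (f p)" if "p \<in> X" for p
    using inv_into_into[OF sh[OF that]] f_inv_into_f[OF sh[OF that]] that by (simp_all add: x_def)
  have inj: "inj_on x X"
  proof (rule inj_onI)
    fix p q assume p: "p \<in> X" and q: "q \<in> X" and eq: "x p = x q"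
    have "Q.shift 1 (f p) = Q.shift 1 (f q)" using fx[OF p] fx[OF q] eq by simp
    then have "f p = f q" by (rule Q.shift_inj[OF fY[OF p] fY[OF q]])
    then show "p = q" using f'(3) p q by (auto dest: inj_onD)
  qed
  have "x ` X \<subseteq> X" using xX by blast
  then have "x ` X = X" using inj finite_X by (simp add: endo_inj_surj)
  then have perm: "x permutes X" using inj by (intro bij_imp_permutes) (auto simp: bij_betw_def x_def)
  have eqv: "x (act g p) = act g (x p)" if g: "g \<in> carrier G" and p: "p \<in> X" for g p
  proof (rule inj_onD[OF f'(3)])
    have "f (x (act g p)) = Q.shift 1 (Q.sact g (f p))" using fx[of "act g p"] f'(2)[OF g p] g p by simp
    also have "\<dots> = f (act g (x p))" using f'(2)[OF g xX[OF p]] fx[OF p] by (simp add: Q.shift_sact)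
    finally show "f (x (act g p)) = f (act g (x p))" .
  qed (use g p xX in simp_all)
  have x: "x \<in> wreath G n" using perm eqv by (simp add: wreath_def)
  have fE: "f \<in> X \<rightarrow>\<^sub>E Q.Y" using f'(1) fY by (auto simp: PiE_def)
  have e: "embedding x f" unfolding embedding_def using x fE f'(2,3) fx by blast
  define \<phi> where "\<phi> = (\<lambda>p\<in>X. f p 0)"
  have step: "f p k = \<phi> ((x ^^ k) p)" if p: "p \<in> X" for p k
    using fun_cong[OF emb_shift[OF e p, of k], of 0] funpow_X[OF x] p by (simp add: \<phi>_def Q.shift_def)
  have femb: "f = emb x \<phi>"
  proof
    fix p show "f p = emb x \<phi> p"
      using step[of p] PiE_arb[OF f'(1), of p] by (cases "p \<in> X") (simp_all add: emb_def fun_eq_iff)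
  qed
  have "\<phi> \<in> colourings x"
  proof -
    have "f p 0 \<in> B" if "p \<in> X" for p using Q.Y_seqs[OF fY[OF that]] by (simp add: Q.seqs_def)
    then have "\<phi> \<in> X \<rightarrow>\<^sub>E B" by (auto simp: \<phi>_def)
    moreover have "\<phi> (act g p) = b g (\<phi> p)" if "g \<in> carrier G" "p \<in> X" for g p
      using f'(2)[OF that] that by (simp add: \<phi>_def Q.sact_def)
    moreover have "separating x \<phi>"
      unfolding separating_def
    proof (intro ballI impI)
      fix p q assume p: "p \<in> X" and q: "q \<in> X" and "\<forall>k. \<phi> ((x ^^ k) p) = \<phi> ((x ^^ k) q)"
      then have "f p = f q" using step[OF p] step[OF q] by (simp add: fun_eq_iff)
      then show "p = q" by (rule inj_onD[OF f'(3) _ p q])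
    qed
    ultimately show ?thesis unfolding colourings_def by blast
  qed
  moreover have "cmon x = m"
  proof (rule poly_mapping_eqI)
    fix u
    have big: "Q.big ` f ` X = \<Omega>" unfolding f'(4) by (rule big_Union(2)[OF \<Omega>])
    have l: "Poly_Mapping.lookup (cmon x) u = card (\<Omega> \<inter> Q.bigs u)" unfolding lookup_cmon_emb[OF e] big ..
    show "Poly_Mapping.lookup (cmon x) u = Poly_Mapping.lookup m u"
    proof (cases "u \<in> Poly_Mapping.keys m")
      case True
      then show ?thesis using \<Omega> by (simp add: l orbit_sets_def)
    next
      case False
      have "Z \<notin> Q.bigs u" if Z\<Omega>: "Z \<in> \<Omega>" for Z
      proof
        assume Z: "Z \<in> Q.bigs u"
        have "\<Omega> \<subseteq> (\<Union>u\<in>Poly_Mapping.keys m. Q.bigs u)" using \<Omega> by (simp add: orbit_sets_def)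
        then obtain v where v: "v \<in> Poly_Mapping.keys m" "Z \<in> Q.bigs v" using Z\<Omega> by blast
        then have "u \<noteq> v" using False by blast
        then show False using bigs_disjoint[of u v] Z v(2) by blast
      qed
      then have "\<Omega> \<inter> Q.bigs u = {}" by blast
      then show ?thesis using False by (simp add: l in_keys_iff)
    qed
  qed
  ultimately show thesis using that e femb by blast
qed

text \<open>Double counting of embeddings: by the pairs \<open>(x, \<phi>)\<close> they come from,
  and by the set of orbits that is their image. Every set of orbits of type \<open>m\<close> admits
  the same number \<open>|G|^n n!\<close> of equivariant bijections.\<close>

theorem sum_card_colourings:
  assumes m: "wt m = n"
  shows "(\<Sum>x\<in>{x \<in> wreath G n. cmon x = m}. card (colourings x))
    = Coset.order G ^ n * fact n * (\<Prod>u\<in>Poly_Mapping.keys m. card (Q.bigs u) choose Poly_Mapping.lookup m u)"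
proof -
  let ?W = "{x \<in> wreath G n. cmon x = m}" and ?U = "\<Union>\<Omega>\<in>orbit_sets m. equivariant_bijections (\<Union> \<Omega>)"
  have finW: "finite ?W"
    by (rule finite_subset[OF _ finite_permutations[OF finite_X]]) (use wreath_permutes in blast)
  have finC: "finite (colourings x)" for x
    by (rule finite_subset[of _ "X \<rightarrow>\<^sub>E B"]) (auto simp: colourings_def finite_X Q.finB intro!: finite_PiE)
  have "bij_betw (\<lambda>(x, \<phi>). emb x \<phi>) (Sigma ?W colourings) ?U"
  proof (rule bij_betw_imageI)
    show "inj_on (\<lambda>(x, \<phi>). emb x \<phi>) (Sigma ?W colourings)"
    proof (rule inj_onI)
      fix c c' assume c: "c \<in> Sigma ?W colourings" and c': "c' \<in> Sigma ?W colourings"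
        and eq: "(case c of (x, \<phi>) \<Rightarrow> emb x \<phi>) = (case c' of (x, \<phi>) \<Rightarrow> emb x \<phi>)"
      obtain x \<phi> where x: "c = (x, \<phi>)" "x \<in> wreath G n" "\<phi> \<in> colourings x" using c by blast
      obtain x' \<phi>' where x': "c' = (x', \<phi>')" "x' \<in> wreath G n" "\<phi>' \<in> colourings x'" using c' by blast
      have eq: "emb x \<phi> = emb x' \<phi>'" using eq x(1) x'(1) by simp
      \<comment> \<open>One embedding for both permutations: the image of \<open>x p\<close> is the
        shift of the image of \<open>p\<close>, so the embedding determines
        \<open>x\<close>.\<close>
      have e: "embedding x (emb x \<phi>)" "embedding x' (emb x \<phi>)"
        using embedding_emb[OF x(2,3)] embedding_emb[OF x'(2,3)] eq by simp_all
      have "x p = x' p" for p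
      proof (cases "p \<in> X")
        case True
        then show ?thesis
          using emb_step[OF e(1) True] emb_step[OF e(2) True] wreath_X x(2) x'(2)
          by (intro emb_inj[OF e(1)]) simp_all
      next
        case False
        then show ?thesis using wreath_permutes[OF x(2)] wreath_permutes[OF x'(2)] by (simp add: permutes_not_in)
      qed
      moreover have "\<phi> = \<phi>'"
      proof (rule PiE_ext[of _ X "\<lambda>_. B"])
        show "\<phi> \<in> X \<rightarrow>\<^sub>E B" "\<phi>' \<in> X \<rightarrow>\<^sub>E B" using x(3) x'(3) by (simp_all add: colourings_def)
        fix p assume p: "p \<in> X"
        have "emb x \<phi> p 0 = emb x' \<phi>' p 0" unfolding eq ..
        then show "\<phi> p = \<phi>' p" using p by (simp add: emb_def)
      qed
      ultimately show "c = c'" using x(1) x'(1) by auto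
    qed
    show "(\<lambda>(x, \<phi>). emb x \<phi>) ` Sigma ?W colourings = ?U"
    proof (intro subset_antisym subsetI)
      fix f assume "f \<in> (\<lambda>(x, \<phi>). emb x \<phi>) ` Sigma ?W colourings"
      then obtain c where c: "f = (\<lambda>(x, \<phi>). emb x \<phi>) c" "c \<in> Sigma ?W colourings" by (rule imageE)
      obtain x \<phi> where "c = (x, \<phi>)" by (cases c)
      with c have x: "x \<in> wreath G n" "cmon x = m" "\<phi> \<in> colourings x" "f = emb x \<phi>" by simp_all
      have e: "embedding x f" using embedding_emb[OF x(1,3)] x(4) by simp
      have "f \<in> equivariant_bijections (\<Union> (Q.big ` f ` X))"
        using e unfolding emb_Union_big[OF e] equivariant_bijections_def embedding_def bij_betw_def
        by (blast intro: PiE_I dest: PiE_arb)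
      then show "f \<in> ?U" using embedding_orbit_set[OF e] x(2) by blast
    next
      fix f assume "f \<in> ?U"
      then obtain \<Omega> where \<Omega>: "\<Omega> \<in> orbit_sets m" "f \<in> equivariant_bijections (\<Union> \<Omega>)" by blast
      obtain x \<phi> where x: "embedding x f" "\<phi> \<in> colourings x" "f = emb x \<phi>" "cmon x = m"
        by (rule bijection_embedding[OF \<Omega>])
      have "(x, \<phi>) \<in> Sigma ?W colourings" using emb_x[OF x(1)] x by simp
      then show "f \<in> (\<lambda>(x, \<phi>). emb x \<phi>) ` Sigma ?W colourings" using x(3) by (intro image_eqI[of _ _ "(x, \<phi>)"]) auto
    qed
  qed
  then have "card (Sigma ?W colourings) = card ?U" by (rule bij_betw_same_card)
  also have "\<dots> = (\<Sum>\<Omega>\<in>orbit_sets m. card (equivariant_bijections (\<Union> \<Omega>)))"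
  proof (rule card_UN_disjoint[OF card_orbit_sets(2)]; intro ballI impI)
    fix \<Omega> assume \<Omega>: "\<Omega> \<in> orbit_sets m"
    have "card (equivariant_bijections (\<Union> \<Omega>)) > 0"
      unfolding card_equivariant_bijections[OF \<Omega> m] using order_pos by simp
    then show "finite (equivariant_bijections (\<Union> \<Omega>))" by (rule card_ge_0_finite)
    fix \<Omega>' assume \<Omega>': "\<Omega>' \<in> orbit_sets m" and ne: "\<Omega> \<noteq> \<Omega>'"
    \<comment> \<open>A set of orbits is recovered from its union, so different sets give disjoint
      families of bijections.\<close>
    have "\<Union> \<Omega> \<noteq> \<Union> \<Omega>'" using big_Union(2)[OF \<Omega>] big_Union(2)[OF \<Omega>'] ne by metis
    then show "equivariant_bijections (\<Union> \<Omega>) \<inter> equivariant_bijections (\<Union> \<Omega>') = {}"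
      by (auto simp: equivariant_bijections_def bij_betw_def)
  qed
  also have "\<dots> = card (orbit_sets m) * (Coset.order G ^ n * fact n)"
    using card_equivariant_bijections[OF _ m] by simp
  finally show ?thesis using finW finC by (simp add: card_orbit_sets(1) mult.commute)
qed

end

section \<open>Comparison of coefficients\<close>

lemma cancel_left_inverse:
  fixes c d u v w :: "'r :: comm_ring_1"
  assumes "c * d = 1"
  shows "c * (u * (d * v - d * w)) = u * (v - w)"
proof -
  have "c * (u * (d * v - d * w)) = (c * d) * (u * (v - w))" by (simp add: algebra_simps)
  then show ?thesis by (simp add: assms)
qed

context dowling
begin

text \<open>
  The identity colouring of \<open>G \<times> [n]\<close> by itself separates points for every \<open>x\<close>.
\<close>
lemma wt_cmon:
  assumes x: "x \<in> wreath G n"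
  shows "wt (cmon x) = n"
proof -
  interpret dowling_sequences G n X act
    by (intro dowling_sequences.intro sequences.intro dowling_axioms free_action_points sequences_axioms.intro
        finG finite_X)
  have "(\<lambda>p\<in>X. p) \<in> colourings x"
    unfolding colourings_def separating_def by (auto simp: funpow_X[OF x] dest: spec[of _ 0])
  then show ?thesis by (rule embedding_wt[OF embedding_emb[OF x]])
qed

text \<open>Summed over \<open>wreath_type m\<close>, this is the polynomial \<open>K_m\<close> of
  the overview.\<close>

definition fixed_poly :: "('g \<times> nat \<Rightarrow> 'g \<times> nat) \<Rightarrow> rat poly" where
  "fixed_poly x = (\<Sum>\<pi>\<in>Fixp x. monom (mobR x ({}, \<pi>)) (nblocks \<pi>))"

abbreviation wreath_type :: "(nat \<times> 'g set \<Rightarrow>\<^sub>0 nat) \<Rightarrow> ('g \<times> nat \<Rightarrow> 'g \<times> nat) set" where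
  "wreath_type m \<equiv> {x \<in> wreath G n. cmon x = m}"

lemma sum_fixed_poly:
  assumes m: "wt m = n"
  shows "(\<Sum>x\<in>wreath_type m. fixed_poly x) = Polynomial.smult (of_nat (Coset.order G ^ n * fact n)) (choose_poly G m)"
proof (cases "Poly_Mapping.keys m \<subseteq> cvars G")
  case False
  then have "wreath_type m = {}" using cmon_keys by blast
  then show ?thesis unfolding choose_poly_zero[OF False] by (simp only: sum.empty smult_0_right)
next
  case True
  let ?p = "\<Sum>x\<in>wreath_type m. fixed_poly x"
  let ?q = "Polynomial.smult (of_nat (Coset.order G ^ n * fact n)) (choose_poly G m) :: rat poly"
  let ?s = "\<lambda>r. of_nat (Coset.order G * Suc r) :: rat"
  have eq: "poly ?p (?s r) = poly ?q (?s r)" for r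
  proof -
    \<comment> \<open>The points of \<open>G \<times> [r + 1]\<close> serve as the free
      \<open>G\<close>-set with \<open>|G| (r + 1)\<close> colours.\<close>
    interpret D: dowling G "Suc r" by unfold_locales (use finG in simp_all)
    interpret dowling_sequences G n "points G (Suc r)" act
      by (intro dowling_sequences.intro sequences.intro dowling_axioms D.free_action_points
          sequences_axioms.intro finG D.finite_X)
    have "poly ?p (?s r) = (\<Sum>x\<in>wreath_type m. \<Sum>\<pi>\<in>Fixp x. mobR x ({}, \<pi>) * of_nat (card (points G (Suc r))) ^ nblocks \<pi>)"
      unfolding D.card_X by (simp only: fixed_poly_def poly_sum poly_monom)
    also have "\<dots> = (\<Sum>x\<in>wreath_type m. of_nat (card (colourings x)))"
      unfolding colourings_def
      by (intro sum.cong refl sum_mobR_power D.free_action_points D.finite_X) simp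
    also have "\<dots> = of_nat (\<Sum>x\<in>wreath_type m. card (colourings x))" by simp
    also have "\<dots> = of_nat (Coset.order G ^ n * fact n)
        * of_nat (\<Prod>u\<in>Poly_Mapping.keys m. card (Q.bigs u) choose Poly_Mapping.lookup m u)"
      unfolding sum_card_colourings[OF m] by (rule of_nat_mult)
    also have "of_nat (\<Prod>u\<in>Poly_Mapping.keys m. card (Q.bigs u) choose Poly_Mapping.lookup m u) = poly (choose_poly G m) (?s r)"
      unfolding D.card_X[symmetric]
      by (rule poly_choose_poly[symmetric], rule Q.poly_orbit_poly_bigs) (use True in blast)
    finally show ?thesis by simp
  qed
  have "range ?s \<subseteq> {s. poly (?p - ?q) s = 0}" using eq by auto
  moreover have "inj ?s" using order_pos by (auto simp: inj_def simp del: of_nat_Suc of_nat_mult)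
  then have "infinite (range ?s)" by (rule range_inj_infinite)
  ultimately have "infinite {s. poly (?p - ?q) s = 0}" using finite_subset by blast
  then have "?p - ?q = 0" using poly_roots_finite by blast
  then show ?thesis by simp
qed

text \<open>The rank \<open>n - nblocks \<pi>\<close> splits off \<open>t^n\<close> and leaves the
  polynomial at \<open>1/t\<close>; the top contributes \<open>mobR_top\<close> at rank
  \<open>n\<close>, which is minus the polynomial at 1.\<close>

lemma laurent_subst_fixed_poly:
  assumes x: "x \<in> wreath G n"
  shows "(\<Sum>y\<in>{y \<in> carrier P. dowling_act x y = y}. Poly_Mapping.single (int (rrank y)) (mobR x y))
    = Poly_Mapping.single (int n) 1 * (laurent_subst (-1) (fixed_poly x) - laurent_subst 0 (fixed_poly x))"
proof -
  have F: "{y \<in> carrier P. dowling_act x y = y} = insert (X, {}) (Pair {} ` Fixp x)"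
  proof (intro subset_antisym subsetI)
    fix y assume "y \<in> {y \<in> carrier P. dowling_act x y = y}"
    then have "y \<in> carrier P" "dowling_act x y = y" by simp_all
    then show "y \<in> insert (X, {}) (Pair {} ` Fixp x)"
      by (cases rule: carrier_cases) (simp_all add: Fixp_def dowling_act_simps)
  next
    fix y assume "y \<in> insert (X, {}) (Pair {} ` Fixp x)"
    then consider "y = (X, {})" | \<pi> where "y = ({}, \<pi>)" "\<pi> \<in> Fixp x" by blast
    then show "y \<in> {y \<in> carrier P. dowling_act x y = y}"
      by cases (simp_all add: carrier_P Fixp_def dowling_act_simps x)
  qed
  have top: "(X, {}) \<notin> Pair {} ` Fixp x" using X_nonempty by auto
  have sub: "laurent_subst a (fixed_poly x) = (\<Sum>\<pi>\<in>Fixp x. Poly_Mapping.single (int (nblocks \<pi>) * a) (mobR x ({}, \<pi>)))" for a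
    by (simp add: fixed_poly_def laurent_subst_sum laurent_subst_monom)
  have single_sum: "Poly_Mapping.single k (sum h A) = (\<Sum>i\<in>A. Poly_Mapping.single k (h i))"
    for k :: int and h :: "('g \<times> nat) set set \<Rightarrow> rat" and A
    by (induction A rule: infinite_finite_induct) (simp_all add: single_add)
  have "(\<Sum>y\<in>{y \<in> carrier P. dowling_act x y = y}. Poly_Mapping.single (int (rrank y)) (mobR x y))
    = Poly_Mapping.single (int n) (mobR x (X, {})) + (\<Sum>\<pi>\<in>Fixp x. Poly_Mapping.single (int (n - nblocks \<pi>)) (mobR x ({}, \<pi>)))"
    unfolding F using top finite_Fixp by (simp add: sum.reindex inj_on_def rrank_simps)
  also have "Poly_Mapping.single (int n) (mobR x (X, {})) = - (\<Sum>\<pi>\<in>Fixp x. Poly_Mapping.single (int n) (mobR x ({}, \<pi>)))"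
    unfolding mobR_top[OF x] by (simp only: single_uminus single_sum)
  also have "(\<Sum>\<pi>\<in>Fixp x. Poly_Mapping.single (int (n - nblocks \<pi>)) (mobR x ({}, \<pi>)))
    = (\<Sum>\<pi>\<in>Fixp x. Poly_Mapping.single (int n + int (nblocks \<pi>) * (-1)) (mobR x ({}, \<pi>)))"
    using nblocks_le_n by (intro sum.cong) (auto simp: Fixp_def of_nat_diff)
  finally show ?thesis
    unfolding sub by (simp only: right_diff_distrib sum_distrib_left mult_single mult_1_left mult_zero_right add_0_right uminus_add_conv_diff)
qed

text \<open>The sign of \<open>neg_t_pow i\<close> is the one absorbed by
  \<open>whitney_trace_mob\<close>, and \<open>t^i\<close> becomes the rank of the fixed element, so
  the summand no longer mentions \<open>i\<close> and the sum over \<open>i\<close> can be carried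
  out.\<close>

lemma mcoeff_ch:
  "mcoeff (ch_WH_R G n i * neg_t_pow i) m = (\<Sum>x\<in>wreath_type m.
     \<Sum>y\<in>{y \<in> {y \<in> carrier P. dowling_act x y = y}. int (rrank y) = i}.
       Poly_Mapping.single 0 (1 / of_nat (Coset.order G ^ n * fact n)) * Poly_Mapping.single (int (rrank y)) (mobR x y))"
proof -
  let ?tr = "\<lambda>x. vs_trace (whitney_homology P (dowling_rank G n) i) (whitney_action P (dowling_rank G n) i (dowling_act x))"
  let ?c = "Poly_Mapping.single 0 (1 / of_nat (Coset.order G ^ n * fact n)) :: laurent"
  have fin: "finite (wreath G n)"
    by (rule finite_subset[OF _ finite_permutations[OF finite_X]]) (use wreath_permutes in blast)
  have "mcoeff (ch_WH_R G n i * neg_t_pow i) m = Poly_Mapping.single i ((-1) powi i) *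
      (?c * (\<Sum>x\<in>wreath G n. Poly_Mapping.single 0 (?tr x) * (1 when m = cmon x)))"
    by (simp add: ch_WH_R_def wreath_ch_def neg_t_pow_def rat_const_def cycle_monomial_cmon mcoeff_mmon)
  also have "(\<Sum>x\<in>wreath G n. Poly_Mapping.single 0 (?tr x) * (1 when m = cmon x))
      = (\<Sum>x\<in>wreath G n. if cmon x = m then Poly_Mapping.single 0 (?tr x) else 0)"
    by (intro sum.cong) (auto simp: when_def)
  also have "\<dots> = (\<Sum>x\<in>wreath_type m. Poly_Mapping.single 0 (?tr x))"
    by (rule sum.inter_filter[OF fin, symmetric])
  also have "Poly_Mapping.single i ((-1) powi i) * (?c * \<dots>)
      = (\<Sum>x\<in>wreath_type m. ?c * Poly_Mapping.single i ((-1) powi i * ?tr x))"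
    by (simp add: sum_distrib_left mult_single mult.left_commute)
  also have "\<dots> = (\<Sum>x\<in>wreath_type m.
     \<Sum>y\<in>{y \<in> {y \<in> carrier P. dowling_act x y = y}. int (rrank y) = i}.
       ?c * Poly_Mapping.single (int (rrank y)) (mobR x y))"
  proof (rule sum.cong[OF refl])
    fix x assume "x \<in> wreath_type m"
    then have x: "x \<in> wreath G n" by simp
    have S: "{y \<in> rank_level P (dowling_rank G n) i. dowling_act x y = y}
        = {y \<in> {y \<in> carrier P. dowling_act x y = y}. int (rrank y) = i}"
    proof -
      have "dowling_rank G n y = of_int i \<longleftrightarrow> int (rrank y) = i" if "y \<in> carrier P" for y
        unfolding dowling_rank_eq[OF that] by (metis of_int_eq_iff of_int_of_nat_eq)
      then show ?thesis by (auto simp: rank_level_def)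
    qed
    have single_sum: "Poly_Mapping.single i (sum h A) = (\<Sum>y\<in>A. Poly_Mapping.single i (h y))"
      for h :: "'g dowling \<Rightarrow> rat" and A
      by (induction A rule: infinite_finite_induct) (simp_all add: single_add)
    show "?c * Poly_Mapping.single i ((-1) powi i * ?tr x)
      = (\<Sum>y\<in>{y \<in> {y \<in> carrier P. dowling_act x y = y}. int (rrank y) = i}.
       ?c * Poly_Mapping.single (int (rrank y)) (mobR x y))"
      unfolding whitney_trace_R[OF x] S single_sum sum_distrib_left by (rule sum.cong) auto
  qed
  finally show ?thesis .
qed

lemma finite_carrier_P: "finite (carrier P)"
  using finite_balanced by (simp add: carrier_P)

lemma mcoeff_msum_ch:
  "mcoeff (msum (\<lambda>i. ch_WH_R G n i * neg_t_pow i) UNIV) m =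
    (if wt m = n then Poly_Mapping.single (int n) 1 * (laurent_subst (-1) (choose_poly G m) - laurent_subst 0 (choose_poly G m)) else 0)"
proof -
  let ?N = "of_nat (Coset.order G ^ n * fact n) :: rat"
  let ?c = "Poly_Mapping.single 0 (1 / ?N) :: laurent"
  let ?F = "\<lambda>x. {y \<in> carrier P. dowling_act x y = y}"
  let ?t = "\<lambda>x y. ?c * Poly_Mapping.single (int (rrank y)) (mobR x y)"
  have fin: "finite (?F x)" for x using finite_carrier_P by simp
  have le: "rrank y \<le> n" for y by (simp add: rrank_def)
  have "mcoeff (msum (\<lambda>i. ch_WH_R G n i * neg_t_pow i) UNIV) m
    = Sum_any (\<lambda>i. \<Sum>x\<in>wreath_type m. \<Sum>y\<in>{y \<in> ?F x. int (rrank y) = i}. ?t x y)"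
    by (simp only: msum_def mcoeff_Mfps mcoeff_ch UNIV_I when_def if_True)
  \<comment> \<open>Ranks lie between 0 and \<open>n\<close>, so the sum over all integers is
    finite.\<close>
  also have "\<dots> = (\<Sum>i\<in>int ` {..n}. \<Sum>x\<in>wreath_type m. \<Sum>y\<in>{y \<in> ?F x. int (rrank y) = i}. ?t x y)"
  proof (rule Sum_any.expand_superset)
    have "(\<Sum>x\<in>wreath_type m. \<Sum>y\<in>{y \<in> ?F x. int (rrank y) = i}. ?t x y) = 0" if "i \<notin> int ` {..n}" for i
    proof -
      have "{y \<in> ?F x. int (rrank y) = i} = {}" for x using le that by auto
      then show ?thesis by (simp only: sum.empty sum.neutral_const)
    qed
    then show "{i. (\<Sum>x\<in>wreath_type m. \<Sum>y\<in>{y \<in> ?F x. int (rrank y) = i}. ?t x y) \<noteq> 0} \<subseteq> int ` {..n}" by blast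
  qed simp
  also have "\<dots> = (\<Sum>x\<in>wreath_type m. \<Sum>i\<in>int ` {..n}. \<Sum>y\<in>{y \<in> ?F x. int (rrank y) = i}. ?t x y)"
    by (rule sum.swap)
  also have "\<dots> = (\<Sum>x\<in>wreath_type m. \<Sum>y\<in>?F x. ?t x y)"
    by (intro sum.cong refl sum.group fin) (use le in auto)
  also have "\<dots> = (\<Sum>x\<in>wreath_type m. ?c * (Poly_Mapping.single (int n) 1
      * (laurent_subst (-1) (fixed_poly x) - laurent_subst 0 (fixed_poly x))))"
  proof (rule sum.cong[OF refl])
    fix x assume "x \<in> wreath_type m"
    then have "x \<in> wreath G n" by simp
    from laurent_subst_fixed_poly[OF this]
    show "(\<Sum>y\<in>?F x. ?t x y) = ?c * (Poly_Mapping.single (int n) 1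
      * (laurent_subst (-1) (fixed_poly x) - laurent_subst 0 (fixed_poly x)))"
      by (simp only: sum_distrib_left[symmetric])
  qed
  also have "\<dots> = ?c * (Poly_Mapping.single (int n) 1
      * (laurent_subst (-1) (\<Sum>x\<in>wreath_type m. fixed_poly x) - laurent_subst 0 (\<Sum>x\<in>wreath_type m. fixed_poly x)))"
    by (simp only: laurent_subst_sum sum_distrib_left[symmetric] sum_subtractf)
  also have "\<dots> = (if wt m = n then Poly_Mapping.single (int n) 1 * (laurent_subst (-1) (choose_poly G m) - laurent_subst 0 (choose_poly G m)) else 0)"
  proof (cases "wt m = n")
    case True
    have "?N \<noteq> 0" using order_pos by simp
    then have c: "?c * Poly_Mapping.single 0 ?N = 1" by (simp only: mult_single) simp
    have k: "?c * (u * (Poly_Mapping.single 0 ?N * v - Poly_Mapping.single 0 ?N * w)) = u * (v - w)" for u v w :: laurent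
      by (rule cancel_left_inverse[OF c])
    show ?thesis unfolding if_P[OF True] sum_fixed_poly[OF True] laurent_subst_smult by (rule k)
  next
    \<comment> \<open>Every element of the wreath product has a cycle type of weight
      \<open>n\<close>, so the sum is empty.\<close>
    case False
    then have "wreath_type m = {}" using wt_cmon by blast
    then show ?thesis using False by (simp only: sum.empty laurent_subst_0 diff_self mult_zero_right if_False)
  qed
  finally show ?thesis .
qed

end

theorem theorem5p3:
  fixes G :: "('g, 'b) monoid_scheme"
  assumes "group G" and "finite (carrier G)"
  shows "msum (\<lambda>n. msum (\<lambda>i. ch_WH_R G n i * neg_t_pow i) (UNIV :: int set)) {1..} =
    plethysm G (plethysm G (Exp_series G) (t_pow (-1) * L_series)) (t_pow 1 * mvar 1)
    - plethysm G (plethysm G (Exp_series G) L_series) (t_pow 1 * mvar 1)"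
proof (rule mfps_eqI)
  fix m
  interpret group G by (rule assms(1))
  let ?R = "\<lambda>k. Poly_Mapping.single (int k) 1 * (laurent_subst (-1) (choose_poly G m) - laurent_subst 0 (choose_poly G m))"
  have L: "mcoeff (msum (\<lambda>i. ch_WH_R G n i * neg_t_pow i) UNIV) m = (if wt m = n then ?R n else 0)" if "n \<ge> 1" for n
  proof -
    interpret dowling G n by unfold_locales (use assms(2) that in simp_all)
    show ?thesis by (rule mcoeff_msum_ch)
  qed
  have "mcoeff (msum (\<lambda>n. msum (\<lambda>i. ch_WH_R G n i * neg_t_pow i) (UNIV :: int set)) {1..}) m
    = Sum_any (\<lambda>n. mcoeff (msum (\<lambda>i. ch_WH_R G n i * neg_t_pow i) (UNIV :: int set)) m when n \<in> {1..})"
    by (subst msum_def) simp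
  \<comment> \<open>By \<open>L\<close> only \<open>n = wt m\<close> contributes to the coefficient
    at \<open>m\<close>.\<close>
  also have "\<dots> = (mcoeff (msum (\<lambda>i. ch_WH_R G (wt m) i * neg_t_pow i) (UNIV :: int set)) m when wt m \<in> {1..})"
    by (rule Sum_any_single) (use L in \<open>simp add: when_def\<close>)
  also have "\<dots> = ?R (wt m)"
  \<comment> \<open>The outer sum starts at 1, so weight 0 is treated apart. Either \<open>m\<close>
    is 0, where both substitutions give 1 and cancel, or \<open>m\<close> contains a variable of
    index 0, where \<open>choose_poly\<close> vanishes.\<close>
  proof (cases "wt m = 0")
    case True
    have "laurent_subst (-1) (choose_poly G m) = laurent_subst 0 (choose_poly G m)"
    proof (cases "Poly_Mapping.keys m \<subseteq> cvars G")
      case True': True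
      have "Poly_Mapping.keys m = {}"
      proof (rule equals0I)
        fix v assume v: "v \<in> Poly_Mapping.keys m"
        then have "fst v * Poly_Mapping.lookup m v = 0" using True by (simp add: weight_def)
        moreover have "v \<in> cvars G" using v True' by blast
        ultimately show False using v by (auto simp: in_keys_iff cvars_def)
      qed
      then show ?thesis by (simp add: choose_poly_def laurent_subst_1)
    qed (simp add: choose_poly_zero)
    then show ?thesis using True by simp
  next
    case False
    then show ?thesis using L[of "wt m"] by simp
  qed
  finally show "mcoeff (msum (\<lambda>n. msum (\<lambda>i. ch_WH_R G n i * neg_t_pow i) (UNIV :: int set)) {1..}) m =
    mcoeff (plethysm G (plethysm G (Exp_series G) (t_pow (-1) * L_series)) (t_pow 1 * mvar 1)
    - plethysm G (plethysm G (Exp_series G) L_series) (t_pow 1 * mvar 1)) m"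
    by (simp only: mcoeff_rhs[OF assms(2)])
qed

end
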